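(* Let $\alpha\in(0,1)$, $\theta<1$, $0\le a<T<\infty$. Let the following conditions be fulfilled: 1. $1<\beta<2$; 2. $\varphi\in L^2(0,1)$; 3. $f(\cdot,a)\in L^2(0,1)$ and $f\in C^1([a,T],L^2(0,1))$. Then there exists a unique weak solution of the problem $$\mathcal{D}^{\alpha}_t u(x,t)-\frac{\partial}{\partial x}\Big(x^{\beta}\frac{\partial u(x,t)}{\partial x}\Big)=f(x,t)\quad (0<x<1,\ a<t\le T),$$ $$u(x,a+)=\varphi(x)\quad (0\le x\le 1),\qquad u(1,t)=0\quad (a\le t\le T),$$ where $\mathcal{D}^{\alpha}_t$ is the regularized Caputo-like counterpart of the hyper-Bessel fractional derivative with starting point $a$.
   Context: All functions are real-valued. Fractional derivative. For $\theta<1$, $p=1-\theta$, $0<\alpha<1$, $t>a\ge0$, and a function $g$ of $t$, define the Erdélyi–Kober integral $I^{\gamma,\delta}_{p;a+}g(t)=\frac{t^{-p(\gamma+\delta)}}{\Gamma(\delta)}\int_a^t(t^p-\tau^p)^{\delta-1}\tau^{p\gamma}g(\tau)\,d(\tau^p)$ ($\delta>0$, $d(\tau^p)=p\tau^{p-1}d\tau$), and for negative order $$I^{0,-\alpha}_{p;a+}g(t):=D^{-\alpha,\alpha}_{p;a+}g(t)=\Big(1-\alpha+\frac{t}{p}\frac{d}{dt}\Big)I^{0,1-\alpha}_{p;a+}g(t).$$ The hyper-Bessel derivative is $p^{\alpha}t^{-p\alpha}I^{0,-\alpha}_{p;a+}g(t)$, and its regularized Caputo-like counterpart is $$\mathcal{D}^{\alpha}_t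 g(t)=p^{\alpha}t^{-p\alpha}I^{0,-\alpha}_{p;a+}g(t)-\frac{p^{\alpha}g(a)\,(t^{p}-a^{p})^{-\alpha}}{\Gamma(1-\alpha)}.$$ Operator $A$ and spaces, for $1<\beta<2$. $Av=-(x^{\beta}v')'$, with initial domain $D(A)$ consisting of the $v\in C[0,1]$ with $x^{\beta}v'\in C[0,1]$, $(x^{\beta}v')'\in AC[0,1]$, $Av\in L^2(0,1)$, $v(1)=0$. This operator is symmetric and positive definite in $L^2(0,1)$, and its Friedrichs extension is again denoted by $A$. $\dot W^1_{2,\beta}(0,1)$ is the closure of $D(A)$ in the norm $\|v\|^2=\int_0^1[v^2+x^{\beta}(v')^2]\,dx$. $A$ acts on functions of $(x,t)$ in the variable $x$. $C(J,V)$ denotes continuous functions from the interval $J$ to the Banach space $V$, and $C^1([a,T],V)$ those whose derivative in $t$ exists and belongs to $C([a,T],V)$. Weak solution: a function $u\in C([a,T],L^2(0,1))\cap C((a,T],\dot W^1_{2,\beta}(0,1))$ with $Au\in C((a,T],L^2(0,1))$ which satisfies, for all $\omega\in\dot W^1_{2,\beta}(0,1)$ (and $t\in(a,T]$), $$\mathcal{D}^{\alpha}_t(u(\cdot,t),\omega)_{L^2(0,1)}+\Big(x^{\beta/2}\frac{\partial u}{\partial x},\,x^{\beta/2}\frac{\partial\omega}{\partial x}\Big)_{L^2(0,1)}=(f(\cdot,t),\omega)_{L^2(0,1)},$$ and the initial condition $u(\cdot,a+)=\varphi$. *)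

theory Defs
  imports "HOL-Analysis.Analysis"
begin

section \<open>The real Hilbert space \<open>L\<^sup>2(0,1)\<close>\<close>

abbreviation unit_leb :: "real measure" where
  "unit_leb \<equiv> lebesgue_on {0<..<1}"

definition square_integrable :: "(real \<Rightarrow> real) \<Rightarrow> bool" where
  "square_integrable f \<longleftrightarrow>
     f \<in> borel_measurable unit_leb \<and> integrable unit_leb (\<lambda>x. (f x)\<^sup>2)"

definition L2rel :: "(real \<Rightarrow> real) \<Rightarrow> (real \<Rightarrow> real) \<Rightarrow> bool" where
  "L2rel f g \<longleftrightarrow>
     square_integrable f \<and> square_integrable g \<and> (AE x in unit_leb. f x = g x)"

lemma square_integrable_zero: "square_integrable (\<lambda>x. 0)"
  by (simp add: square_integrable_def)

lemma square_integrable_mult: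
  assumes "square_integrable f" "square_integrable g"
  shows "integrable unit_leb (\<lambda>x. f x * g x)"
proof (rule Bochner_Integration.integrable_bound)
  show "integrable unit_leb (\<lambda>x. (f x)\<^sup>2 + (g x)\<^sup>2)"
    using assms by (simp add: square_integrable_def)
  show "(\<lambda>x. f x * g x) \<in> borel_measurable unit_leb"
    using assms by (simp add: square_integrable_def borel_measurable_times)
  have "\<bar>u * v\<bar> \<le> u\<^sup>2 + v\<^sup>2" for u v :: real
  proof -
    have "0 \<le> (\<bar>u\<bar> - \<bar>v\<bar>)\<^sup>2" by simp
    then have "2 * (\<bar>u\<bar> * \<bar>v\<bar>) \<le> u\<^sup>2 + v\<^sup>2" by (simp add: power2_diff)
    moreover have "0 \<le> \<bar>u\<bar> * \<bar>v\<bar>" by simp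
    ultimately show ?thesis unfolding abs_mult by linarith
  qed
  then show "AE x in unit_leb. norm (f x * g x) \<le> norm ((f x)\<^sup>2 + (g x)\<^sup>2)"
    by auto
qed

lemma square_integrable_add:
  assumes "square_integrable f" "square_integrable g"
  shows "square_integrable (\<lambda>x. f x + g x)"
  using assms square_integrable_mult[OF assms]
  by (auto simp: square_integrable_def power2_sum mult.assoc intro!: borel_measurable_add)

lemma square_integrable_cmult:
  assumes "square_integrable f"
  shows "square_integrable (\<lambda>x. c * f x)"
  using assms by (auto simp: square_integrable_def power_mult_distrib)

quotient_type L2 = "real \<Rightarrow> real" / partial: L2rel
  morphisms rep_L2 abs_L2
proof (rule part_equivpI)
  show "\<exists>x. L2rel x x"
    using square_integrable_zero by (auto simp: L2rel_def)
  show "symp L2rel"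
    by (auto simp: symp_def L2rel_def)
  show "transp L2rel"
    by (auto simp: transp_def L2rel_def elim: AE_mp)
qed

instantiation L2 :: real_inner
begin

lift_definition zero_L2 :: L2 is "\<lambda>x. 0"
  by (simp add: L2rel_def square_integrable_zero)

lift_definition plus_L2 :: "L2 \<Rightarrow> L2 \<Rightarrow> L2" is "\<lambda>f g x. f x + g x"
  by (auto simp: L2rel_def square_integrable_add)

lift_definition uminus_L2 :: "L2 \<Rightarrow> L2" is "\<lambda>f x. - f x"
  by (auto simp: L2rel_def square_integrable_def)

definition minus_L2 :: "L2 \<Rightarrow> L2 \<Rightarrow> L2" where
  "minus_L2 u v = u + (- v)"

lift_definition scaleR_L2 :: "real \<Rightarrow> L2 \<Rightarrow> L2" is "\<lambda>c f x. c * f x"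
  by (auto simp: L2rel_def square_integrable_cmult)

lift_definition inner_L2 :: "L2 \<Rightarrow> L2 \<Rightarrow> real" is
  "\<lambda>f g. \<integral>x. f x * g x \<partial>unit_leb"
proof -
  fix f f' g g' assume *: "L2rel f f'" "L2rel g g'"
  show "(\<integral>x. f x * g x \<partial>unit_leb) = (\<integral>x. f' x * g' x \<partial>unit_leb)"
  proof (rule integral_cong_AE)
    show "(\<lambda>x. f x * g x) \<in> borel_measurable unit_leb"
      "(\<lambda>x. f' x * g' x) \<in> borel_measurable unit_leb"
      using * by (auto simp: L2rel_def square_integrable_def)
    show "AE x in unit_leb. f x * g x = f' x * g' x"
      using * by (auto simp: L2rel_def)
  qed
qed

definition norm_L2 :: "L2 \<Rightarrow> real" where "norm_L2 u = sqrt (inner u u)"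
definition sgn_L2 :: "L2 \<Rightarrow> L2" where "sgn_L2 u = inverse (norm u) *\<^sub>R u"
definition dist_L2 :: "L2 \<Rightarrow> L2 \<Rightarrow> real" where "dist_L2 u v = norm (u - v)"
definition uniformity_L2 :: "(L2 \<times> L2) filter" where
  "uniformity_L2 = (INF e\<in>{0<..}. principal {(x, y). dist x y < e})"
definition open_L2 :: "L2 set \<Rightarrow> bool" where
  "open_L2 U \<longleftrightarrow> (\<forall>x\<in>U. \<forall>\<^sub>F (x', y) in uniformity. x' = x \<longrightarrow> y \<in> U)"

instance
proof
  fix u v w :: L2 and c d :: real and U :: "L2 set"
  show "u + v + w = u + (v + w)"
    by transfer (auto simp: L2rel_def algebra_simps intro!: square_integrable_add)
  show "u + v = v + u"
    by transfer (auto simp: L2rel_def algebra_simps intro!: square_integrable_add)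
  show "0 + u = u"
    by transfer (auto simp: L2rel_def)
  show "- u + u = 0"
    by transfer (auto simp: L2rel_def square_integrable_zero)
  show "u - v = u + - v"
    by (fact minus_L2_def)
  show "c *\<^sub>R (u + v) = c *\<^sub>R u + c *\<^sub>R v"
    by transfer (auto simp: L2rel_def distrib_left
        intro!: square_integrable_add square_integrable_cmult)
  show "(c + d) *\<^sub>R u = c *\<^sub>R u + d *\<^sub>R u"
    by transfer (auto simp: L2rel_def distrib_right
        intro!: square_integrable_add square_integrable_cmult)
  show "c *\<^sub>R d *\<^sub>R u = (c * d) *\<^sub>R u"
    by transfer (auto simp: L2rel_def mult.assoc intro!: square_integrable_cmult)
  show "1 *\<^sub>R u = u"
    by transfer (auto simp: L2rel_def)
  show "dist u v = norm (u - v)" by (fact dist_L2_def)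
  show "sgn u = inverse (norm u) *\<^sub>R u" by (fact sgn_L2_def)
  show "uniformity = (INF e\<in>{0<..}. principal {(x :: L2, y). dist x y < e})"
    by (fact uniformity_L2_def)
  show "open U \<longleftrightarrow> (\<forall>x\<in>U. \<forall>\<^sub>F (x', y) in uniformity. x' = x \<longrightarrow> y \<in> U)"
    by (fact open_L2_def)
  show "inner u v = inner v u"
    by transfer (simp add: mult.commute)
  show "inner (u + v) w = inner u w + inner v w"
    by transfer (simp add: L2rel_def distrib_right square_integrable_mult)
  show "inner (c *\<^sub>R u) v = c * inner u v"
    by transfer (simp add: mult.assoc)
  show "0 \<le> inner u u"
    by transfer simp
  show "inner u u = 0 \<longleftrightarrow> u = 0"
  proof transfer
    fix f assume f: "L2rel f f"
    then have "integrable unit_leb (\<lambda>x. f x * f x)"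
      by (auto simp: L2rel_def square_integrable_mult)
    then have "(\<integral>x. f x * f x \<partial>unit_leb) = 0 \<longleftrightarrow> (AE x in unit_leb. f x * f x = 0)"
      by (subst integral_nonneg_eq_0_iff_AE) auto
    then show "(\<integral>x. f x * f x \<partial>unit_leb) = 0 \<longleftrightarrow> L2rel f (\<lambda>x. 0)"
      using f by (auto simp: L2rel_def square_integrable_zero)
  qed
  show "norm u = sqrt (inner u u)" by (fact norm_L2_def)
qed

end


section \<open>The fractional derivative\<close>

text \<open>
  The Erdelyi--Kober integral of order \<open>\<delta> > 0\<close>, with \<open>d(\<tau>\<^sup>p) = p \<tau>\<^bsup>p-1\<^esup> d\<tau>\<close> written out.
  The value \<open>0 powr _ = 0\<close> only matters at the end points of the interval of integration.
\<close>

definition EK_integral ::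
    "real \<Rightarrow> real \<Rightarrow> real \<Rightarrow> real \<Rightarrow> (real \<Rightarrow> real) \<Rightarrow> real \<Rightarrow> real" where
  "EK_integral p a \<gamma> \<delta> g t =
     t powr (- p * (\<gamma> + \<delta>)) / Gamma \<delta> *
     (LBINT \<tau>:{a..t}. (t powr p - \<tau> powr p) powr (\<delta> - 1) * \<tau> powr (p * \<gamma>) * g \<tau>
                          * (p * \<tau> powr (p - 1)))"

text \<open>
  \<open>has_EK_derivative p a T \<alpha> g E t\<close>: the expression \<open>I\<^bsup>0,-\<alpha>\<^esup> g\<close> of negative order exists at \<open>t\<close>
  and equals \<open>E\<close>.  Functions live on \<open>[a,T]\<close>, so the derivative is one-sided at \<open>t = T\<close>.
\<close>

definition has_EK_derivative ::
    "real \<Rightarrow> real \<Rightarrow> real \<Rightarrow> real \<Rightarrow> (real \<Rightarrow> real) \<Rightarrow> real \<Rightarrow> real \<Rightarrow> bool" where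
  "has_EK_derivative p a T \<alpha> g E t \<longleftrightarrow>
     (\<exists>D. (EK_integral p a 0 (1 - \<alpha>) g has_real_derivative D) (at t within {a<..T}) \<and>
          E = (1 - \<alpha>) * EK_integral p a 0 (1 - \<alpha>) g t + t / p * D)"

text \<open>
  The regularized Caputo-like hyper-Bessel derivative of \<open>g\<close> exists at \<open>t\<close> and equals \<open>d\<close>.
\<close>

definition has_caputo_hyper_bessel_derivative ::
    "real \<Rightarrow> real \<Rightarrow> real \<Rightarrow> real \<Rightarrow> (real \<Rightarrow> real) \<Rightarrow> real \<Rightarrow> real \<Rightarrow> bool" where
  "has_caputo_hyper_bessel_derivative \<theta> \<alpha> a T g d t \<longleftrightarrow>
     (let p = 1 - \<theta> in
      \<exists>E. has_EK_derivative p a T \<alpha> g E t \<and>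
          d = p powr \<alpha> * t powr (- p * \<alpha>) * E
              - p powr \<alpha> * g a * (t powr p - a powr p) powr (- \<alpha>) / Gamma (1 - \<alpha>))"


section \<open>The operator \<open>A\<close> and its Friedrichs extension\<close>

definition absolutely_continuous_on :: "real \<Rightarrow> real \<Rightarrow> (real \<Rightarrow> real) \<Rightarrow> bool" where
  "absolutely_continuous_on a b f \<longleftrightarrow>
     (\<forall>e>0. \<exists>d>0. \<forall>P :: (real \<times> real) set.
        finite P \<and> (\<forall>(x, y)\<in>P. a \<le> x \<and> x < y \<and> y \<le> b) \<and>
        disjoint_family_on (\<lambda>(x, y). {x<..<y}) P \<and> (\<Sum>(x, y)\<in>P. y - x) < d
        \<longrightarrow> (\<Sum>(x, y)\<in>P. \<bar>f y - f x\<bar>) < e)"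

text \<open>
  The graph of \<open>Av = -(x\<^sup>\<beta> v')'\<close> on its initial domain.  Here \<open>w\<close> and \<open>z\<close> are the extensions to
  \<open>[0,1]\<close> of \<open>x\<^sup>\<beta> v'\<close> and \<open>(x\<^sup>\<beta> v')'\<close>, whose derivatives are taken in \<open>(0,1)\<close>; \<open>v\<close> itself
  need not be differentiable at \<open>0\<close>.
\<close>

definition A_init :: "real \<Rightarrow> (L2 \<times> L2) set" where
  "A_init \<beta> = {(abs_L2 v, abs_L2 (\<lambda>x. - z x)) | v z.
     continuous_on {0..1} v \<and>
     (\<exists>v' w. (\<forall>x\<in>{0<..<1}. (v has_real_derivative v' x) (at x) \<and>
                            w x = x powr \<beta> * v' x \<and>
                            (w has_real_derivative z x) (at x)) \<and>
             continuous_on {0..1} w) \<and>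
     absolutely_continuous_on 0 1 z \<and>
     square_integrable (\<lambda>x. - z x) \<and>
     v 1 = 0}"

text \<open>
  Friedrichs extension of a positive definite symmetric operator, given by its graph \<open>S\<close>:
  the restriction of the adjoint of \<open>S\<close> to the energy space, i.e. to the completion of the domain
  of \<open>S\<close> in the norm \<open>(Sv, v)\<^bsup>1/2\<^esup>\<close>, realized inside the ambient space.
\<close>

definition energy_space :: "('h::real_inner \<times> 'h) set \<Rightarrow> 'h set" where
  "energy_space S = {u. \<exists>X Y. (\<forall>n::nat. (X n, Y n) \<in> S) \<and> X \<longlonglongrightarrow> u \<and>
     (\<forall>e>0. \<exists>N. \<forall>m\<ge>N. \<forall>n\<ge>N. inner (Y m - Y n) (X m - X n) < e)}"

definition friedrichs :: "('h::real_inner \<times> 'h) set \<Rightarrow> ('h \<times> 'h) set" where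
  "friedrichs S = {(u, g). u \<in> energy_space S \<and> (\<forall>(v, h)\<in>S. inner u h = inner g v)}"


section \<open>The weighted Sobolev space\<close>

definition has_weak_derivative :: "(real \<Rightarrow> real) \<Rightarrow> (real \<Rightarrow> real) \<Rightarrow> bool" where
  "has_weak_derivative v g \<longleftrightarrow>
     (\<forall>K\<subseteq>{0<..<1}. compact K \<longrightarrow> set_integrable lebesgue K v \<and> set_integrable lebesgue K g) \<and>
     (\<forall>\<psi> \<psi>'. (\<forall>x. (\<psi> has_real_derivative \<psi>' x) (at x)) \<and> continuous_on UNIV \<psi>' \<and>
             (\<exists>K\<subseteq>{0<..<1}. compact K \<and> (\<forall>x. x \<notin> K \<longrightarrow> \<psi> x = 0))
        \<longrightarrow> (\<integral>x. v x * \<psi>' x \<partial>unit_leb) = - (\<integral>x. g x * \<psi> x \<partial>unit_leb))"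

text \<open>\<open>has_wgrad \<beta> v q\<close>: the weak derivative \<open>v'\<close> exists and \<open>q = x\<^bsup>\<beta>/2\<^esup> v'\<close> is in \<open>L\<^sup>2(0,1)\<close>.\<close>

definition has_wgrad :: "real \<Rightarrow> L2 \<Rightarrow> L2 \<Rightarrow> bool" where
  "has_wgrad \<beta> v q \<longleftrightarrow>
     (\<exists>g. has_weak_derivative (rep_L2 v) g \<and>
          square_integrable (\<lambda>x. x powr (\<beta> / 2) * g x) \<and>
          q = abs_L2 (\<lambda>x. x powr (\<beta> / 2) * g x))"

definition wgrad :: "real \<Rightarrow> L2 \<Rightarrow> L2" where
  "wgrad \<beta> v = (THE q. has_wgrad \<beta> v q)"

definition Wnorm :: "real \<Rightarrow> L2 \<Rightarrow> real" where
  "Wnorm \<beta> v = sqrt ((norm v)\<^sup>2 + (norm (wgrad \<beta> v))\<^sup>2)"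

definition Wspace :: "real \<Rightarrow> L2 set" where
  "Wspace \<beta> = {v. (\<exists>q. has_wgrad \<beta> v q) \<and>
     (\<exists>X. (\<forall>n::nat. X n \<in> Domain (A_init \<beta>)) \<and> (\<lambda>n. Wnorm \<beta> (X n - v)) \<longlonglongrightarrow> 0)}"


section \<open>Function spaces in time and weak solutions\<close>

definition W_continuous_on :: "real \<Rightarrow> real set \<Rightarrow> (real \<Rightarrow> L2) \<Rightarrow> bool" where
  "W_continuous_on \<beta> J u \<longleftrightarrow>
     (\<forall>t\<in>J. u t \<in> Wspace \<beta> \<and> ((\<lambda>s. Wnorm \<beta> (u s - u t)) \<longlongrightarrow> 0) (at t within J))"

definition C1_on :: "real set \<Rightarrow> (real \<Rightarrow> 'b::real_normed_vector) \<Rightarrow> bool" where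
  "C1_on J f \<longleftrightarrow>
     (\<exists>f'. (\<forall>t\<in>J. (f has_vector_derivative f' t) (at t within J)) \<and> continuous_on J f')"

definition weak_solution ::
    "real \<Rightarrow> real \<Rightarrow> real \<Rightarrow> real \<Rightarrow> real \<Rightarrow> L2 \<Rightarrow> (real \<Rightarrow> L2) \<Rightarrow> (real \<Rightarrow> L2) \<Rightarrow> bool" where
  "weak_solution \<alpha> \<theta> \<beta> a T \<phi> f u \<longleftrightarrow>
     continuous_on {a..T} u \<and>
     W_continuous_on \<beta> {a<..T} u \<and>
     (\<exists>Au. (\<forall>t\<in>{a<..T}. (u t, Au t) \<in> friedrichs (A_init \<beta>)) \<and> continuous_on {a<..T} Au) \<and>
     (\<forall>\<omega>\<in>Wspace \<beta>. \<forall>t\<in>{a<..T}. \<exists>d.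
        has_caputo_hyper_bessel_derivative \<theta> \<alpha> a T (\<lambda>s. inner (u s) \<omega>) d t \<and>
        d + inner (wgrad \<beta> (u t)) (wgrad \<beta> \<omega>) = inner (f t) \<omega>) \<and>
     (u \<longlongrightarrow> \<phi>) (at_right a)"

end

theory Submission
  imports Defs "HOL-Computational_Algebra.Polynomial"
begin

text \<open>
  Why there is exactly one weak solution.  A change of time and the inversion of the elliptic
  operator turn the problem into an abstract fractional evolution equation, which is then solved by
  functional calculus.

  \<^item> \<^emph>\<open>Change of time.\<close>  In the clock \<open>s = (t\<^sup>p - a\<^sup>p) / p\<close> with \<open>p = 1 - \<theta>\<close> the Erdelyi--Kober
  integral of order \<open>1 - \<alpha>\<close> is, up to a constant and a power of \<open>t\<close>, the Riemann--Liouville integral \<open>rl (1 - \<alpha>)\<close>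
  started at \<open>0\<close>.  The power of \<open>t\<close> is exactly what the factor \<open>1 - \<alpha> + (t/p) d/dt\<close> compensates, so the
  regularized hyper-Bessel derivative of \<open>g\<close> is \<open>d/ds rl (1 - \<alpha>) (g - g 0)\<close>, the Caputo derivative
  (lemma \<open>caputo_hyper_bessel_iff_rl\<close>).

  \<^item> \<^emph>\<open>Inversion of \<open>A\<close>.\<close>  The inverse of \<open>A\<close> is explicit: \<open>A_inv = T\<^sup>* T\<close>, where
  \<open>T f y = y\<^bsup>-\<beta>/2\<^esup> \<integral>\<^bsub>0\<^esub>\<^bsup>y\<^esup> f\<close>.  Since \<open>\<beta> < 2\<close>, the operator \<open>T\<close> is bounded on \<open>L\<^sup>2(0,1)\<close>.  The condition
  \<open>\<beta> > 1\<close> enters at the degenerate end: a function that is continuous at \<open>0\<close> has no flux there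
  (lemma \<open>no_positive_flux_at_0\<close>), hence the initial domain carries no freedom that \<open>A_inv\<close> misses.
  Polynomials are dense and \<open>A_inv\<close> maps them into the initial domain, so the Friedrichs extension is
  the inverse of \<open>A_inv\<close> (lemma \<open>friedrichs_eq_graph\<close>).  Because the weighted gradient of \<open>A_inv g\<close> is
  \<open>- T g\<close>, the bilinear form of the weak formulation is \<open>inner g \<omega>\<close> (lemma \<open>wgrad_inner\<close>).

  \<^item> \<^emph>\<open>The abstract equation.\<close>  It remains to solve \<open>D\<^sup>\<alpha> u + A u = F\<close> in a Hilbert space, where
  \<open>R = A\<^sup>-\<^sup>1\<close> is bounded, symmetric, nonnegative and injective.

  Existence.  A continuous functional calculus for positive contractions defines the relaxation
  operators \<open>S s = E\<^sub>\<alpha>(- s\<^sup>\<alpha> A)\<close>.  It rests on two facts: a polynomial that is positive on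
  \<open>[0,1]\<close> has nonnegative Bernstein coefficients in some degree (lemma \<open>positive_poly_bernstein_form\<close>), and the
  Mittag-Leffler relaxation function is positive, decreasing and decays like \<open>s\<^sup>-\<^sup>\<alpha>\<close>
  (lemmas \<open>ml_pos\<close>, \<open>ml_antimono\<close>, \<open>ml_decay\<close>), three consequences of one positivity principle for Volterra
  equations (lemma \<open>volterra_positive\<close>).  The decay makes \<open>A S s\<close> bounded by a multiple of \<open>s\<^sup>-\<^sup>\<alpha>\<close>, which
  is integrable against the Abel kernel: rough initial values are smoothed at once.
  Duhamel's formula, integrated by parts so that only the derivative of the source appears, then
  gives the solution (lemma \<open>U_equation\<close>).

  Uniqueness.  The primitive \<open>V\<close> of the difference of two solutions satisfies
  \<open>R V = - rl \<alpha> V\<close>.  Iterating, \<open>R\<^sup>k V\<close> is bounded by \<open>C s\<^bsup>k\<alpha>\<^esup> / \<Gamma>(k \<alpha> + 1)\<close>, which tends to zero faster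
  than any geometric sequence; but a nonzero vector decays at most geometrically under the powers of an
  injective symmetric operator (lemma \<open>R_power_lower\<close>).  Hence \<open>V = 0\<close>.
\<close>

section \<open>Abel integrals\<close>

lemma Gamma_plus1_pos: "0 < a \<Longrightarrow> Gamma (a + 1) = a * Gamma (a :: real)"
  using nonpos_Ints_nonpos[of a] by (intro Gamma_plus1) auto

lemma Gamma_nonzero_pos [simp]: "0 < a \<Longrightarrow> Gamma (a :: real) \<noteq> 0"
  using Gamma_real_pos[of a] by linarith

lemma lborel_set_integral_of_has_integral:
  fixes f :: "real \<Rightarrow> real"
  assumes "(f has_integral I) A" "\<And>x. x \<in> A \<Longrightarrow> 0 \<le> f x"
    and "A \<in> sets borel" "f \<in> borel_measurable borel"
  shows "set_integrable lborel A f" "(LBINT x:A. f x) = I"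
proof -
  have "f absolutely_integrable_on A"
    using assms by (intro nonnegative_absolutely_integrable_1) auto
  moreover have "(\<lambda>x. indicator A x *\<^sub>R f x) \<in> borel_measurable lborel"
    using assms(3,4) by (intro borel_measurable_scaleR borel_measurable_indicator) auto
  ultimately show *: "set_integrable lborel A f"
    unfolding set_integrable_def by (simp add: integrable_completion)
  show "(LBINT x:A. f x) = I"
    using set_borel_integral_eq_integral(2)[OF *] integral_unique[OF assms(1)] by simp
qed

text \<open>
  Euler's Beta integral after the substitution \<open>t = r + (s - r) x\<close>.
\<close>

lemma has_integral_abel_beta:
  fixes a b r s :: real
  assumes "0 < a" "0 < b" "r \<le> s"
  shows "((\<lambda>t. (s - t) powr (a - 1) * (t - r) powr (b - 1)) has_integral
           (s - r) powr (a + b - 1) * Beta a b) {r..s}"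
proof (cases "r = s")
  case True
  then show ?thesis using has_integral_refl(2) by simp
next
  case False
  with assms have rs: "r < s" by simp
  define d where "d = s - r"
  have d: "d > 0" using rs by (simp add: d_def)
  have d': "1 / d * t + - r / d = (t - r) / d" "1 - (t - r) / d = (s - t) / d" for t
  proof -
    have "(s - t) / d = (d - (t - r)) / d" by (simp add: d_def)
    also have "\<dots> = d / d - (t - r) / d" by (rule diff_divide_distrib)
    finally show "1 - (t - r) / d = (s - t) / d" using d by simp
  qed (simp add: diff_divide_distrib)
  have box: "cbox ((0 - (- r / d)) /\<^sub>R (1/d)) ((1 - (- r / d)) /\<^sub>R (1/d)) = {r..s}"
    using d by (simp add: field_simps d_def)
  have "((\<lambda>t. (\<lambda>u. u powr (b - 1) * (1 - u) powr (a - 1)) ((1/d) *\<^sub>R t + (- r / d))) has_integral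
           (Beta b a /\<^sub>R (1/d) ^ DIM(real))) (cbox ((0 - (- r / d)) /\<^sub>R (1/d)) ((1 - (- r / d)) /\<^sub>R (1/d)))"
    using has_integral_Beta_real[OF assms(2,1)] d by (intro has_integral_affinity') auto
  then have "((\<lambda>t. ((t - r) / d) powr (b - 1) * ((s - t) / d) powr (a - 1)) has_integral
           (Beta b a /\<^sub>R (1/d) ^ DIM(real))) {r..s}"
    unfolding box unfolding real_scaleR_def d' .
  moreover have "Beta b a /\<^sub>R (1/d) ^ DIM(real) = d * Beta a b"
    by (simp add: Beta_commute)
  ultimately have "((\<lambda>t. ((t - r) / d) powr (b - 1) * ((s - t) / d) powr (a - 1)) has_integral
           (d * Beta a b)) {r..s}"
    by metis
  then have "((\<lambda>t. d powr (a + b - 2) * (((t - r) / d) powr (b - 1) * ((s - t) / d) powr (a - 1)))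
       has_integral d powr (a + b - 2) * (d * Beta a b)) {r..s}"
    by (rule has_integral_mult_right)
  moreover have "d powr (a + b - 2) * (((t - r) / d) powr (b - 1) * ((s - t) / d) powr (a - 1)) =
      (s - t) powr (a - 1) * (t - r) powr (b - 1)" if "t \<in> {r..s}" for t
  proof -
    have "d powr (a + b - 2) = d powr (a - 1) * d powr (b - 1)"
      by (simp flip: powr_add)
    then show ?thesis using that d by (simp add: powr_divide)
  qed
  moreover have "d powr (a + b - 2) * (d * Beta a b) = d powr (a + b - 1) * Beta a b"
    using d powr_add[of d "a + b - 2" 1] by simp
  ultimately show ?thesis
    unfolding d_def[symmetric]
    by (subst has_integral_cong[where g = "\<lambda>t. d powr (a + b - 2) * (((t - r) / d) powr (b - 1) * ((s - t) / d) powr (a - 1))"]) auto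
qed

lemma has_integral_abel_kernel:
  fixes a r s :: real
  assumes "0 < a" "r \<le> s"
  shows "((\<lambda>t. (s - t) powr (a - 1)) has_integral (s - r) powr a / a) {r..s}"
proof -
  have "Beta a 1 = 1 / a"
    using Gamma_plus1_pos[OF assms(1)] Gamma_real_pos[OF assms(1)] assms by (simp add: Beta_def)
  then have "((\<lambda>t. (s - t) powr (a - 1) * (t - r) powr 0) has_integral (s - r) powr a / a) {r..s}"
    using has_integral_abel_beta[of a 1 r s] assms by simp
  then show ?thesis
    by (rule has_integral_spike_finite[rotated 2, where S = "{r}"]) auto
qed

lemma abel_kernel_set_integral:
  fixes a r s :: real
  assumes "0 < a" "r \<le> s"
  shows "set_integrable lborel {r..s} (\<lambda>t. (s - t) powr (a - 1))"
    and "(LBINT t:{r..s}. (s - t) powr (a - 1)) = (s - r) powr a / a"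
  using lborel_set_integral_of_has_integral[OF has_integral_abel_kernel[OF assms]] by auto

text \<open>
  The Riemann--Liouville integral of order \<open>a\<close> with base point \<open>0\<close>.
\<close>

definition rl :: "real \<Rightarrow> (real \<Rightarrow> real) \<Rightarrow> real \<Rightarrow> real" where
  "rl a g s = (LBINT t:{0..s}. (s - t) powr (a - 1) * g t) / Gamma a"

lemma set_borel_measurable_lborelI [intro]:
  "f \<in> borel_measurable borel \<Longrightarrow> A \<in> sets borel \<Longrightarrow> set_borel_measurable lborel A (f :: real \<Rightarrow> real)"
  by (simp add: set_borel_measurable_def)

lemma abel_integrand_integrable:
  fixes a C :: real
  assumes "0 < a" "g \<in> borel_measurable borel" "r \<le> s" "s \<le> s'"
    and "\<And>t. r \<le> t \<Longrightarrow> t \<le> s \<Longrightarrow> \<bar>g t\<bar> \<le> C"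
  shows "set_integrable lborel {r..s} (\<lambda>t. (s' - t) powr (a - 1) * g t)"
proof (rule set_integrable_bound)
  have "set_integrable lborel {r..s'} (\<lambda>t. (s' - t) powr (a - 1))"
    using assms by (intro abel_kernel_set_integral) auto
  then have "set_integrable lborel {r..s} (\<lambda>t. (s' - t) powr (a - 1))"
    by (rule set_integrable_subset) (use assms in auto)
  then show "set_integrable lborel {r..s} (\<lambda>t. C * (s' - t) powr (a - 1))"
    by simp
  show "set_borel_measurable lborel {r..s} (\<lambda>t. (s' - t) powr (a - 1) * g t)"
    using assms(2) by (intro set_borel_measurable_lborelI) auto
  show "AE x in lborel. x \<in> {r..s} \<longrightarrow>
      norm ((s' - x) powr (a - 1) * g x) \<le> norm (C * (s' - x) powr (a - 1))"
  proof (intro AE_I2 impI)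
    fix x assume "x \<in> {r..s}"
    then have "\<bar>g x\<bar> \<le> \<bar>C\<bar>" using assms(5)[of x] by auto
    then have "\<bar>(s' - x) powr (a - 1)\<bar> * \<bar>g x\<bar> \<le> \<bar>(s' - x) powr (a - 1)\<bar> * \<bar>C\<bar>"
      by (rule mult_left_mono) simp
    then show "norm ((s' - x) powr (a - 1) * g x) \<le> norm (C * (s' - x) powr (a - 1))"
      by (simp add: abs_mult mult.commute)
  qed
qed

lemma abel_integral_bound:
  fixes a C :: real
  assumes "0 < a" "g \<in> borel_measurable borel" "r \<le> s"
    and "\<And>t. r \<le> t \<Longrightarrow> t \<le> s \<Longrightarrow> \<bar>g t\<bar> \<le> C"
  shows "\<bar>LBINT t:{r..s}. (s - t) powr (a - 1) * g t\<bar> \<le> C * ((s - r) powr a / a)"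
proof -
  have int: "set_integrable lborel {r..s} (\<lambda>t. (s - t) powr (a - 1) * g t)"
    using assms by (intro abel_integrand_integrable[where C = C]) auto
  have "\<bar>LBINT t:{r..s}. (s - t) powr (a - 1) * g t\<bar> \<le> (LBINT t:{r..s}. \<bar>(s - t) powr (a - 1) * g t\<bar>)"
    using integral_norm_bound[of lborel "\<lambda>t. indicator {r..s} t *\<^sub>R ((s - t) powr (a - 1) * g t)"]
    by (simp add: set_lebesgue_integral_def abs_mult)
  also have "\<dots> \<le> (LBINT t:{r..s}. C * (s - t) powr (a - 1))"
  proof (rule set_integral_mono)
    show "set_integrable lborel {r..s} (\<lambda>t. \<bar>(s - t) powr (a - 1) * g t\<bar>)"
      using int by (rule set_integrable_abs)
    show "set_integrable lborel {r..s} (\<lambda>t. C * (s - t) powr (a - 1))"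
      using abel_kernel_set_integral(1)[OF assms(1,3)] by simp
    fix x assume "x \<in> {r..s}"
    then have "\<bar>g x\<bar> * (s - x) powr (a - 1) \<le> C * (s - x) powr (a - 1)"
      using assms(4)[of x] by (intro mult_right_mono) auto
    then show "\<bar>(s - x) powr (a - 1) * g x\<bar> \<le> C * (s - x) powr (a - 1)"
      by (simp add: abs_mult mult.commute)
  qed
  also have "\<dots> = C * ((s - r) powr a / a)"
    using abel_kernel_set_integral(2)[OF assms(1,3)] by simp
  finally show ?thesis .
qed

lemma rl_bound:
  fixes a C :: real
  assumes "0 < a" "g \<in> borel_measurable borel" "0 \<le> s"
    and "\<And>t. 0 \<le> t \<Longrightarrow> t \<le> s \<Longrightarrow> \<bar>g t\<bar> \<le> C"
  shows "\<bar>rl a g s\<bar> \<le> C * s powr a / Gamma (a + 1)"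
proof -
  have "\<bar>rl a g s\<bar> = \<bar>LBINT t:{0..s}. (s - t) powr (a - 1) * g t\<bar> / Gamma a"
    using assms(1) by (simp add: rl_def abs_divide)
  also have "\<dots> \<le> C * (s powr a / a) / Gamma a"
    using abel_integral_bound[OF assms] Gamma_real_pos[OF assms(1)] by (intro divide_right_mono) auto
  finally show ?thesis using Gamma_plus1_pos[OF assms(1)] by simp
qed

text \<open>
  The kernel is integrable and decreasing in the upper limit: on \<open>[0,s]\<close> the two kernels differ by a
  function of one sign whose integral is explicit, and on \<open>[s,s']\<close> the kernel itself contributes \<open>(s' - s)\<^sup>a / a\<close>.
\<close>

lemma rl_holder:
  fixes a C :: real
  assumes a: "0 < a" "a \<le> 1" and g: "g \<in> borel_measurable borel" and s: "0 \<le> s" "s \<le> s'"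
    and C: "\<And>t. 0 \<le> t \<Longrightarrow> t \<le> s' \<Longrightarrow> \<bar>g t\<bar> \<le> C"
  shows "\<bar>rl a g s' - rl a g s\<bar> \<le> 2 * C * (s' - s) powr a / Gamma (a + 1)"
proof -
  have C0: "0 \<le> C" using C[of 0] s by auto
  let ?k = "\<lambda>u t. (u - t) powr (a - 1)"
  have i1: "set_integrable lborel {0..s} (\<lambda>t. ?k s' t * g t)"
    using assms by (intro abel_integrand_integrable[where C = C]) auto
  have i2: "set_integrable lborel {s..s'} (\<lambda>t. ?k s' t * g t)"
    using assms by (intro abel_integrand_integrable[where C = C]) auto
  have i3: "set_integrable lborel {0..s} (\<lambda>t. ?k s t * g t)"
    using assms by (intro abel_integrand_integrable[where C = C]) auto
  have k1: "set_integrable lborel {0..s} (?k s')"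
    by (rule set_integrable_subset[OF abel_kernel_set_integral(1)[of a 0 s']]) (use a s in auto)
  have k2: "set_integrable lborel {0..s} (?k s)"
    using a s by (intro abel_kernel_set_integral) auto
  have k3: "set_integrable lborel {s..s'} (?k s')"
    using a s by (intro abel_kernel_set_integral) auto
  have split: "(LBINT t:{0..s'}. f t) = (LBINT t:{0..s}. f t) + (LBINT t:{s..s'}. f t)"
    if f: "set_integrable lborel {0..s} f" "set_integrable lborel {s..s'} f" for f :: "real \<Rightarrow> real"
  proof -
    have "{0..s'} = {0..s} \<union> {s..s'}" using s by auto
    moreover have "AE x in lborel. \<not> (x \<in> {0..s} \<and> x \<in> {s..s'})"
      using AE_lborel_singleton[of s] by eventually_elim auto
    ultimately show ?thesis
      using f by (simp add: set_integral_Un_AE)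
  qed
  have "(LBINT t:{0..s'}. ?k s' t * g t) - (LBINT t:{0..s}. ?k s t * g t)
      = (LBINT t:{0..s}. ?k s' t * g t - ?k s t * g t) + (LBINT t:{s..s'}. ?k s' t * g t)"
    using split[OF i1 i2] set_integral_diff(2)[OF i1 i3] by simp
  moreover have "\<bar>LBINT t:{0..s}. ?k s' t * g t - ?k s t * g t\<bar> \<le> (LBINT t:{0..s}. C * (?k s t - ?k s' t))"
  proof -
    have "\<bar>LBINT t:{0..s}. ?k s' t * g t - ?k s t * g t\<bar> \<le> (LBINT t:{0..s}. \<bar>?k s' t * g t - ?k s t * g t\<bar>)"
      using integral_norm_bound[of lborel "\<lambda>t. indicator {0..s} t *\<^sub>R (?k s' t * g t - ?k s t * g t)"]
      by (simp add: set_lebesgue_integral_def abs_mult)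
    also have "\<dots> \<le> (LBINT t:{0..s}. C * (?k s t - ?k s' t))"
    proof (rule set_integral_mono_AE)
      show "set_integrable lborel {0..s} (\<lambda>t. \<bar>?k s' t * g t - ?k s t * g t\<bar>)"
        by (rule set_integrable_abs) (rule set_integral_diff(1)[OF i1 i3])
      show "set_integrable lborel {0..s} (\<lambda>t. C * (?k s t - ?k s' t))"
        using set_integral_diff(1)[OF k2 k1] by simp
      show "AE x\<in>{0..s} in lborel. \<bar>?k s' x * g x - ?k s x * g x\<bar> \<le> C * (?k s x - ?k s' x)"
        using AE_lborel_singleton[of s]
      proof eventually_elim
        case (elim x)
        show ?case
        proof
          assume x: "x \<in> {0..s}"
          then have "?k s' x \<le> ?k s x"
            using a s elim by (intro powr_mono2') auto
          moreover have "\<bar>g x\<bar> \<le> C" using x C[of x] s by auto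
          ultimately have "\<bar>g x\<bar> * (?k s x - ?k s' x) \<le> C * (?k s x - ?k s' x)"
            by (intro mult_right_mono) auto
          moreover have "\<bar>?k s' x * g x - ?k s x * g x\<bar> = \<bar>g x\<bar> * (?k s x - ?k s' x)"
          proof -
            have "?k s' x * g x - ?k s x * g x = - (g x * (?k s x - ?k s' x))" by (simp add: algebra_simps)
            then show ?thesis using \<open>?k s' x \<le> ?k s x\<close> by (simp add: abs_mult)
          qed
          ultimately show "\<bar>?k s' x * g x - ?k s x * g x\<bar> \<le> C * (?k s x - ?k s' x)"
            by simp
        qed
      qed
    qed
    finally show ?thesis .
  qed
  moreover have "(LBINT t:{0..s}. C * (?k s t - ?k s' t)) \<le> C * ((s' - s) powr a / a)"
  proof -
    have "(LBINT t:{0..s}. ?k s' t) = s' powr a / a - (s' - s) powr a / a"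
      using split[OF k1 k3] abel_kernel_set_integral(2)[of a 0 s'] abel_kernel_set_integral(2)[of a s s'] a s
      by simp
    then have "(LBINT t:{0..s}. ?k s t - ?k s' t) = s powr a / a - (s' powr a / a - (s' - s) powr a / a)"
      using set_integral_diff(2)[OF k2 k1] abel_kernel_set_integral(2)[of a 0 s] a s by simp
    also have "\<dots> \<le> (s' - s) powr a / a"
      using powr_mono2[of a s s'] a s by (simp add: divide_right_mono)
    finally have "C * (LBINT t:{0..s}. ?k s t - ?k s' t) \<le> C * ((s' - s) powr a / a)"
      using C0 by (rule mult_left_mono)
    then show ?thesis by simp
  qed
  moreover have "\<bar>LBINT t:{s..s'}. ?k s' t * g t\<bar> \<le> C * ((s' - s) powr a / a)"
    using assms by (intro abel_integral_bound) auto
  ultimately have "\<bar>(LBINT t:{0..s'}. ?k s' t * g t) - (LBINT t:{0..s}. ?k s t * g t)\<bar>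
      \<le> 2 * (C * ((s' - s) powr a / a))"
    by linarith
  moreover have "\<bar>rl a g s' - rl a g s\<bar> =
     \<bar>(LBINT t:{0..s'}. ?k s' t * g t) - (LBINT t:{0..s}. ?k s t * g t)\<bar> / Gamma a"
    using a by (simp add: rl_def abs_divide flip: diff_divide_distrib)
  ultimately have "\<bar>rl a g s' - rl a g s\<bar> \<le> 2 * (C * ((s' - s) powr a / a)) / Gamma a"
    using a divide_right_mono[of "\<bar>(LBINT t:{0..s'}. ?k s' t * g t) - (LBINT t:{0..s}. ?k s t * g t)\<bar>"
      "2 * (C * ((s' - s) powr a / a))" "Gamma a"] by simp
  then show ?thesis using Gamma_plus1_pos[OF a(1)] by simp
qed

lemma rl_continuous_on:
  assumes a: "0 < a" "a \<le> 1" and g: "g \<in> borel_measurable borel"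
    and C: "\<And>t. 0 \<le> t \<Longrightarrow> t \<le> S \<Longrightarrow> \<bar>g t\<bar> \<le> C"
  shows "continuous_on {0..S} (rl a g)"
  unfolding continuous_on_def
proof
  fix s assume s: "s \<in> {0..S}"
  have H: "\<bar>rl a g u - rl a g s\<bar> \<le> 2 * C * \<bar>u - s\<bar> powr a / Gamma (a + 1)" if "u \<in> {0..S}" for u
    using rl_holder[OF a g, of s u C] rl_holder[OF a g, of u s C] C that s
    by (cases "s \<le> u") (auto simp: abs_minus_commute)
  have "((\<lambda>u. 2 * C * \<bar>u - s\<bar> powr a / Gamma (a + 1)) \<longlongrightarrow> 2 * C * 0 / Gamma (a + 1)) (at s within {0..S})"
  proof (intro tendsto_intros)
    have "((\<lambda>u. \<bar>u - s\<bar>) \<longlongrightarrow> \<bar>s - s\<bar>) (at s within {0..S})"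
      by (intro tendsto_intros)
    then show "((\<lambda>u. \<bar>u - s\<bar> powr a) \<longlongrightarrow> 0) (at s within {0..S})"
      using a tendsto_powr2[of "\<lambda>u. \<bar>u - s\<bar>" 0 "at s within {0..S}" "\<lambda>_. a" a] by simp
  qed (use a Gamma_real_pos[of "a + 1"] in auto)
  then have "((\<lambda>u. 2 * C * \<bar>u - s\<bar> powr a / Gamma (a + 1)) \<longlongrightarrow> 0) (at s within {0..S})"
    by simp
  then have "((\<lambda>u. rl a g u - rl a g s) \<longlongrightarrow> 0) (at s within {0..S})"
    by (rule Lim_null_comparison[rotated])
       (use H in \<open>auto simp: eventually_at intro!: exI[of _ 1]\<close>)
  then show "(rl a g \<longlongrightarrow> rl a g s) (at s within {0..S})"
    by (rule LIM_zero_cancel)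
qed


lemma rl_diff:
  assumes "set_integrable lborel {0..s} (\<lambda>t. (s - t) powr (a - 1) * f t)"
    and "set_integrable lborel {0..s} (\<lambda>t. (s - t) powr (a - 1) * g t)"
  shows "rl a (\<lambda>t. f t - g t) s = rl a f s - rl a g s"
  using set_integral_diff(2)[OF assms] by (simp add: rl_def right_diff_distrib diff_divide_distrib)

lemma rl_add:
  assumes "set_integrable lborel {0..s} (\<lambda>t. (s - t) powr (a - 1) * f t)"
    and "set_integrable lborel {0..s} (\<lambda>t. (s - t) powr (a - 1) * g t)"
  shows "rl a (\<lambda>t. f t + g t) s = rl a f s + rl a g s"
  using set_integral_add(2)[OF assms] by (simp add: rl_def distrib_left add_divide_distrib)

lemma rl_cmult: "rl a (\<lambda>t. c * f t) s = c * rl a f s"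
  by (simp add: rl_def mult.left_commute[of _ c])

lemma rl_cong:
  "(\<And>t. 0 \<le> t \<Longrightarrow> t \<le> s \<Longrightarrow> f t = g t) \<Longrightarrow> rl a f s = rl a g s"
  unfolding rl_def by (intro arg_cong2[where f = "(/)"] set_lebesgue_integral_cong) auto

text \<open>
  A Stirling-type bound without asymptotics: it turns the terms of the Mittag-Leffler series into a
  geometric sequence of any prescribed ratio (lemma \<open>ml_term_le\<close>).
\<close>

lemma powr_le_Gamma_exp:
  fixes s x :: real
  assumes "0 \<le> s" "0 \<le> x"
  shows "s powr x \<le> Gamma (x + 1) * exp s"
proof -
  have 1: "((\<lambda>t. t powr x / exp t) has_integral Gamma (x + 1)) {0..}"
    using Gamma_integral_real[of "x + 1"] assms by simp
  have "((\<lambda>t. exp (- t)) has_integral exp (- s)) {s..}"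
    using has_integral_exp_minus_to_infinity[of 1 s] by simp
  then have "((\<lambda>t. s powr x * exp (- t)) has_integral s powr x * exp (- s)) {s..}"
    by (rule has_integral_mult_right)
  then have 2: "((\<lambda>t. if t \<in> {s..} then s powr x * exp (- t) else 0) has_integral s powr x * exp (- s)) {0..}"
    using assms by (subst has_integral_restrict) auto
  have "s powr x * exp (- s) \<le> Gamma (x + 1)"
  proof (rule has_integral_le[OF 2 1])
    fix t :: real assume "t \<in> {0..}"
    then show "(if t \<in> {s..} then s powr x * exp (- t) else 0) \<le> t powr x / exp t"
      using assms by (auto simp: exp_minus divide_simps intro!: powr_mono2)
  qed
  then show ?thesis by (simp add: exp_minus field_simps)
qed


text \<open>
  By Fubini the inner integral over \<open>t\<close> is a Beta integral; for \<open>a + b = 1\<close> the power of \<open>s - r\<close> that it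
  produces has exponent \<open>0\<close>.
\<close>

lemma rl_semigroup:
  fixes a b s :: real and g :: "real \<Rightarrow> real"
  assumes a: "0 < a" and b: "0 < b" and ab: "a + b = 1" and s: "0 \<le> s"
    and gm: "g \<in> borel_measurable borel" and gi: "set_integrable lborel {0..s} g"
  shows "rl a (rl b g) s = (LBINT t:{0..s}. g t)"
proof -
  \<comment> \<open>the integrand of the double integral on the triangle \<open>0 \<le> r \<le> t \<le> s\<close>\<close>
  define F where "F r t = indicator {0..s} t * indicator {0..t} r * ((s - t) powr (a - 1) * ((t - r) powr (b - 1) * g r))"
    for r t :: real
  have ind: "indicator {0..s} t * indicator {0..t} r = (indicator {0..s} r * indicator {r..s} t :: real)" for r t
    by (auto split: split_indicator)
  have F': "F r t = indicator {0..s} r * g r * (indicator {r..s} t * ((s - t) powr (a - 1) * (t - r) powr (b - 1)))" for r t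
    unfolding F_def ind by (simp add: mult_ac)
  have gG: "Gamma a > 0" "Gamma b > 0" using a b by auto
  have Bab: "Beta a b = Gamma a * Gamma b" using ab by (simp add: Beta_def)
  note K = lborel_set_integral_of_has_integral[OF has_integral_abel_beta[OF a b]]
  have Kint: "integrable lborel (\<lambda>t. indicator {r..s} t * ((s - t) powr (a - 1) * (t - r) powr (b - 1)))"
    and Kval: "r < s \<Longrightarrow> (\<integral>t. indicator {r..s} t * ((s - t) powr (a - 1) * (t - r) powr (b - 1)) \<partial>lborel) = Gamma a * Gamma b"
    if "r \<le> s" for r
  proof -
    have 1: "set_integrable lborel {r..s} (\<lambda>t. (s - t) powr (a - 1) * (t - r) powr (b - 1))"
      by (rule K(1)[OF that]) (simp_all)
    have 2: "(LBINT t:{r..s}. (s - t) powr (a - 1) * (t - r) powr (b - 1)) = (s - r) powr (a + b - 1) * Beta a b"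
      by (rule K(2)[OF that]) (simp_all)
    show "integrable lborel (\<lambda>t. indicator {r..s} t * ((s - t) powr (a - 1) * (t - r) powr (b - 1)))"
      using 1 by (simp add: set_integrable_def)
    show "(\<integral>t. indicator {r..s} t * ((s - t) powr (a - 1) * (t - r) powr (b - 1)) \<partial>lborel) = Gamma a * Gamma b" if "r < s"
      using 2 that by (simp add: set_lebesgue_integral_def Bab ab)
  qed
  have meas: "case_prod F \<in> borel_measurable (lborel \<Otimes>\<^sub>M lborel)"
  proof -
    have eq: "case_prod F = (\<lambda>p. indicator {0..s} (snd p) * (if 0 \<le> fst p \<and> fst p \<le> snd p then 1 else 0) *
       ((s - snd p) powr (a - 1) * ((snd p - fst p) powr (b - 1) * g (fst p))))"
      by (rule ext) (simp add: F_def split_beta indicator_def)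
    moreover have "\<dots> \<in> borel_measurable borel"
    proof -
      have f: "fst \<in> borel_measurable (borel :: (real \<times> real) measure)" "snd \<in> borel_measurable (borel :: (real \<times> real) measure)"
        by (intro borel_measurable_continuous_onI continuous_intros)+
      have c: "closed {p :: real \<times> real. 0 \<le> fst p \<and> fst p \<le> snd p}"
        by (intro closed_Collect_conj closed_Collect_le continuous_intros)
      have 1: "(\<lambda>p :: real \<times> real. if 0 \<le> fst p \<and> fst p \<le> snd p then 1 else 0 :: real) \<in> borel_measurable borel"
        by (rule measurable_If[OF borel_measurable_const borel_measurable_const]) (simp only: space_borel UNIV_I simp_thms borel_closed[OF c])
      have 2: "(\<lambda>p. indicator {0..s} (snd p) :: real) \<in> borel_measurable (borel :: (real \<times> real) measure)"
        by (rule measurable_compose[OF f(2) borel_measurable_indicator]) (rule atLeastAtMost_borel)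
      have 3: "(\<lambda>p. g (fst p)) \<in> borel_measurable (borel :: (real \<times> real) measure)"
        by (rule measurable_compose[OF f(1) gm])
      have 4: "(\<lambda>p. (snd p - fst p) powr (b - 1)) \<in> borel_measurable (borel :: (real \<times> real) measure)"
        by (intro powr_real_measurable borel_measurable_diff f borel_measurable_const)
      have 5: "(\<lambda>p. (s - snd p) powr (a - 1)) \<in> borel_measurable (borel :: (real \<times> real) measure)"
        by (intro powr_real_measurable borel_measurable_diff f borel_measurable_const)
      show ?thesis
        by (intro borel_measurable_times 1 2 3 4 5)
    qed
    ultimately have "case_prod F \<in> borel_measurable borel"
      by (simp only:)
    then show ?thesis
      unfolding lborel_prod by (subst measurable_cong_sets[OF sets_lborel refl])
  qed
  have int: "integrable (lborel \<Otimes>\<^sub>M lborel) (case_prod F)"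
  proof (rule lborel_pair.Fubini_integrable[OF meas])
    have "integrable lborel (\<lambda>r. indicator {0..s} r * \<bar>g r\<bar>)"
      using set_integrable_abs[OF gi] unfolding set_integrable_def real_scaleR_def .
    then have "integrable lborel (\<lambda>r. indicator {0..s} r * \<bar>g r\<bar> * (Gamma a * Gamma b))"
      by (rule integrable_mult_left)
    then show "integrable lborel (\<lambda>r. \<integral>t. norm (case_prod F (r, t)) \<partial>lborel)"
    proof (rule integrable_cong_AE_imp)
      show "(\<lambda>r. \<integral>t. norm (case_prod F (r, t)) \<partial>lborel) \<in> borel_measurable lborel"
        using meas by measurable
      show "AE r in lborel. indicator {0..s} r * \<bar>g r\<bar> * (Gamma a * Gamma b) = (\<integral>t. norm (case_prod F (r, t)) \<partial>lborel)"
        using AE_lborel_singleton[of s]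
      proof eventually_elim
        case (elim r)
        have "norm (case_prod F (r, t)) = indicator {0..s} r * \<bar>g r\<bar> * (indicator {r..s} t * ((s - t) powr (a - 1) * (t - r) powr (b - 1)))" for t
          by (simp add: F' abs_mult)
        then have "(\<integral>t. norm (case_prod F (r, t)) \<partial>lborel) = indicator {0..s} r * \<bar>g r\<bar> *
            (\<integral>t. indicator {r..s} t * ((s - t) powr (a - 1) * (t - r) powr (b - 1)) \<partial>lborel)"
          by (simp only: integral_mult_right_zero)
        moreover have "r \<in> {0..s} \<Longrightarrow> r < s" using elim by auto
        ultimately show ?case using Kval[of r] by (cases "r \<in> {0..s}") simp_all
      qed
    qed
    show "AE r in lborel. integrable lborel (\<lambda>t. case_prod F (r, t))"
    proof (rule AE_I2)
      fix r show "integrable lborel (\<lambda>t. case_prod F (r, t))"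
      proof (cases "r \<in> {0..s}")
        case True
        then have "integrable lborel (\<lambda>t. indicator {0..s} r * g r * (indicator {r..s} t * ((s - t) powr (a - 1) * (t - r) powr (b - 1))))"
          by (intro integrable_mult_right Kint) simp
        then show ?thesis by (simp only: F' prod.case)
      qed (simp add: F')
    qed
  qed
  have "(\<integral>t. \<integral>r. F r t \<partial>lborel \<partial>lborel) = (\<integral>r. \<integral>t. F r t \<partial>lborel \<partial>lborel)"
    by (rule lborel_pair.Fubini_integral[OF int])
  also have "\<dots> = (\<integral>r. indicator {0..s} r * g r * (Gamma a * Gamma b) \<partial>lborel)"
  proof (rule integral_cong_AE)
    show "(\<lambda>r. \<integral>t. F r t \<partial>lborel) \<in> borel_measurable lborel"
      using meas by measurable
    show "(\<lambda>r. indicator {0..s} r * g r * (Gamma a * Gamma b)) \<in> borel_measurable lborel"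
      using gm by measurable
    show "AE r in lborel. (\<integral>t. F r t \<partial>lborel) = indicator {0..s} r * g r * (Gamma a * Gamma b)"
      using AE_lborel_singleton[of s]
    proof eventually_elim
      case (elim r)
      have "(\<integral>t. F r t \<partial>lborel) = indicator {0..s} r * g r *
            (\<integral>t. indicator {r..s} t * ((s - t) powr (a - 1) * (t - r) powr (b - 1)) \<partial>lborel)"
        by (simp only: F' integral_mult_right_zero)
      moreover have "r \<in> {0..s} \<Longrightarrow> r < s" using elim by auto
      ultimately show ?case using Kval[of r] by (cases "r \<in> {0..s}") simp_all
    qed
  qed
  also have "\<dots> = (LBINT t:{0..s}. g t) * (Gamma a * Gamma b)"
    by (simp add: set_lebesgue_integral_def)
  finally have 1: "(\<integral>t. \<integral>r. F r t \<partial>lborel \<partial>lborel) = (LBINT t:{0..s}. g t) * (Gamma a * Gamma b)" .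
  have "(\<integral>r. F r t \<partial>lborel) = indicator {0..s} t * ((s - t) powr (a - 1) * (rl b g t * Gamma b))" for t
  proof -
    have "(\<integral>r. F r t \<partial>lborel) = (\<integral>r. (indicator {0..s} t * (s - t) powr (a - 1)) * (indicator {0..t} r * ((t - r) powr (b - 1) * g r)) \<partial>lborel)"
      by (intro Bochner_Integration.integral_cong) (auto simp: F_def)
    then show ?thesis using gG by (simp add: rl_def set_lebesgue_integral_def)
  qed
  then have "(\<integral>t. \<integral>r. F r t \<partial>lborel \<partial>lborel) = (\<integral>t. (indicator {0..s} t * ((s - t) powr (a - 1) * rl b g t)) * Gamma b \<partial>lborel)"
    by (simp add: mult_ac)
  also have "\<dots> = rl a (rl b g) s * (Gamma a * Gamma b)"
    using gG by (simp add: rl_def set_lebesgue_integral_def)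
  finally show ?thesis using 1 gG by simp
qed




lemma rl_zero_at_0 [simp]: "rl a g 0 = 0"
proof -
  have "(\<lambda>t. indicator {0..0} t *\<^sub>R ((0 - t) powr (a - 1) * g t)) = (\<lambda>t. 0 :: real)"
    by (rule ext) (simp split: split_indicator)
  then show ?thesis unfolding rl_def set_lebesgue_integral_def by (simp only:) simp
qed

lemma continuous_bounded_Icc:
  fixes g :: "real \<Rightarrow> real"
  assumes "continuous_on {0..y} g"
  obtains C where "\<And>t. 0 \<le> t \<Longrightarrow> t \<le> y \<Longrightarrow> \<bar>g t\<bar> \<le> C"
proof -
  have "bounded (g ` {0..y})"
    by (intro compact_imp_bounded compact_continuous_image assms compact_Icc)
  then obtain C where "\<forall>x\<in>g ` {0..y}. norm x \<le> C" unfolding bounded_iff by blast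
  then show ?thesis using that[of C] by force
qed

section \<open>The Mittag-Leffler relaxation function\<close>

text \<open>
  A solution of \<open>w + rl a w = F\<close> with \<open>F > 0\<close> can only become negative if \<open>F\<close> drops faster than the kernel,
  which \<open>ratio\<close> excludes.  Let \<open>s1\<close> be the first point where \<open>w \<le> 0\<close> and let \<open>x\<close> be a maximum point of \<open>w\<close> on a
  short interval to the left of \<open>s1\<close>.  With \<open>\<rho> = F s1 / F x\<close>, the assumption bounds the part of
  \<open>rl a w s1\<close> over \<open>[0,x]\<close> by \<open>\<rho>\<close> times \<open>rl a w x\<close>, and the part over \<open>[x,s1]\<close> is at most
  \<open>w x (s1 - x)\<^sup>a / \<Gamma>(a + 1)\<close>.  Hence \<open>w s1 \<ge> w x (\<rho> - small)\<close>, and \<open>\<rho>\<close> is close to \<open>1\<close>.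
\<close>

lemma volterra_positive:
  fixes w :: "real \<Rightarrow> real"
  assumes a: "0 < a" "a \<le> 1" and wm: "w \<in> borel_measurable borel" and wc: "continuous_on {0..} w"
    and F: "\<And>s. 0 \<le> s \<Longrightarrow> F s = w s + rl a w s" and Fpos: "\<And>s. 0 \<le> s \<Longrightarrow> 0 < F s"
    and ratio: "\<And>s s1 t. \<lbrakk>0 \<le> t; t < s; s < s1\<rbrakk> \<Longrightarrow> F s * (s1 - t) powr (a - 1) \<le> F s1 * (s - t) powr (a - 1)"
    and s: "0 \<le> s"
  shows "0 < w s"
proof (rule ccontr)
  assume "\<not> 0 < w s"
  have wcI: "continuous_on {x..y} w" if "0 \<le> x" for x y
    using wc by (rule continuous_on_subset) (use that in auto)
  define Z where "Z = {x\<in>{0..s}. w x \<le> 0}"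
  have Zc: "closed Z"
    using continuous_closed_preimage[OF wcI[of 0 s], of "{..0}"] by (simp add: Z_def vimage_def Int_def conj_commute)
  have Zne: "Z \<noteq> {}" using \<open>\<not> 0 < w s\<close> s by (auto simp: Z_def)
  have Zb: "bdd_below Z" by (rule bdd_belowI[of _ 0]) (auto simp: Z_def)
  define s1 where "s1 = Inf Z"
  have s1Z: "s1 \<in> Z" unfolding s1_def by (rule closed_contains_Inf[OF Zne Zb Zc])
  have before: "0 < w x" if "0 \<le> x" "x < s1" for x
  proof (rule ccontr)
    assume "\<not> 0 < w x"
    then have "x \<in> Z" using that s1Z by (auto simp: Z_def)
    then have "s1 \<le> x" unfolding s1_def by (rule cInf_lower[OF _ Zb])
    then show False using that by simp
  qed
  have w0: "w 0 = F 0" using F[of 0] by simp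
  have s1: "0 \<le> s1" "w s1 \<le> 0" using s1Z by (auto simp: Z_def)
  then have "s1 \<noteq> 0" using w0 Fpos[of 0] by auto
  with s1 have s1pos: "0 < s1" by simp
  obtain C where C: "\<And>t. t \<in> {0..s1} \<Longrightarrow> \<bar>w t\<bar> \<le> C"
    using continuous_bounded_Icc[OF wcI[of 0 s1]] by (metis atLeastAtMost_iff order_refl)
  have Fc: "continuous_on {0..s1} F"
  proof -
    have "continuous_on {0..s1} (\<lambda>x. w x + rl a w x)"
      using rl_continuous_on[OF a wm, of s1 C] C wcI[of 0 s1] by (intro continuous_intros) auto
    then show ?thesis using F by (subst continuous_on_cong[OF refl]) auto
  qed
  have Ft: "((\<lambda>x. F s1 / F x) \<longlongrightarrow> F s1 / F s1) (at_left s1)"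
    and Kt: "((\<lambda>x. (s1 - x) powr a / Gamma (a + 1)) \<longlongrightarrow> (s1 - s1) powr a / Gamma (a + 1)) (at_left s1)"
  proof -
    have *: "at_left s1 = at s1 within {0..<s1}"
      using s1pos by (intro at_within_nhd[of _ "{0<..}"]) auto
    have "(F \<longlongrightarrow> F s1) (at s1 within {0..s1})"
      using Fc s1 by (simp add: continuous_on_def)
    then have "(F \<longlongrightarrow> F s1) (at_left s1)"
      unfolding * by (rule tendsto_within_subset) auto
    then show "((\<lambda>x. F s1 / F x) \<longlongrightarrow> F s1 / F s1) (at_left s1)"
      using Fpos[of s1] s1 by (intro tendsto_intros) auto
    have "((\<lambda>x. s1 - x) \<longlongrightarrow> s1 - s1) (at_left s1)"
      by (intro tendsto_intros)
    moreover have "eventually (\<lambda>x. 0 \<le> s1 - x) (at_left s1)"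
      by (auto simp: eventually_at_filter)
    ultimately have "((\<lambda>x. (s1 - x) powr a) \<longlongrightarrow> (s1 - s1) powr a) (at_left s1)"
      using a by (intro tendsto_powr2 tendsto_const) auto
    then show "((\<lambda>x. (s1 - x) powr a / Gamma (a + 1)) \<longlongrightarrow> (s1 - s1) powr a / Gamma (a + 1)) (at_left s1)"
      using a by (intro tendsto_divide tendsto_const) auto
  qed
  \<comment> \<open>any number strictly between \<open>0\<close> and \<open>1\<close> would do in place of \<open>1 / 2\<close>\<close>
  have "eventually (\<lambda>x. F s1 / F x > 1 / 2 \<and> (s1 - x) powr a / Gamma (a + 1) < 1 / 2 \<and> x > 0) (at_left s1)"
  proof (intro eventually_conj)
    show "eventually (\<lambda>x. F s1 / F x > 1 / 2) (at_left s1)"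
      using Fpos[of s1] s1 by (intro order_tendstoD(1)[OF Ft]) auto
    show "eventually (\<lambda>x. (s1 - x) powr a / Gamma (a + 1) < 1 / 2) (at_left s1)"
      by (intro order_tendstoD(2)[OF Kt]) simp
    show "eventually (\<lambda>x. x > 0) (at_left s1)"
      using s1pos eventually_at_left[of 0 s1] by auto
  qed
  then obtain b where b: "b < s1" and bH: "\<And>x. b < x \<Longrightarrow> x < s1 \<Longrightarrow> F s1 / F x > 1 / 2 \<and> (s1 - x) powr a / Gamma (a + 1) < 1 / 2 \<and> x > 0"
    unfolding eventually_at_left[OF s1pos] by auto
  define x0 where "x0 = (max b 0 + s1) / 2"
  have x0: "b < x0" "x0 < s1" "0 < x0" using b s1pos by (auto simp: x0_def)
  obtain x where x: "x \<in> {x0..s1}" and xmax: "\<And>y. y \<in> {x0..s1} \<Longrightarrow> w y \<le> w x"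
    using continuous_attains_sup[of "{x0..s1}" w] wcI[of x0 s1] x0 by auto
  have wx: "0 < w x" using xmax[of x0] before[of x0] x0 by auto
  then have xs: "x < s1" using s1 x by (cases "x = s1") auto
  have xpos: "0 < x" "b < x" using x x0 by auto
  define \<rho> where "\<rho> = F s1 / F x"
  have rho: "\<rho> > 1 / 2" and ks: "(s1 - x) powr a / Gamma (a + 1) < 1 / 2"
    using bH[of x] xpos xs by (auto simp: \<rho>_def)
  have i1: "set_integrable lborel {0..x} (\<lambda>t. (s1 - t) powr (a - 1) * w t)"
    using a wm xpos xs C by (intro abel_integrand_integrable[where C = C]) auto
  have i2: "set_integrable lborel {x..s1} (\<lambda>t. (s1 - t) powr (a - 1) * w t)"
    using a wm xpos xs C by (intro abel_integrand_integrable[where C = C]) auto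
  have i3: "set_integrable lborel {0..x} (\<lambda>t. (x - t) powr (a - 1) * w t)"
    using a wm xpos xs C by (intro abel_integrand_integrable[where C = C]) auto
  have "(LBINT t:{0..s1}. (s1 - t) powr (a - 1) * w t) =
     (LBINT t:{0..x}. (s1 - t) powr (a - 1) * w t) + (LBINT t:{x..s1}. (s1 - t) powr (a - 1) * w t)"
  proof -
    have "{0..s1} = {0..x} \<union> {x..s1}" using xpos xs by auto
    moreover have "AE y in lborel. \<not> (y \<in> {0..x} \<and> y \<in> {x..s1})"
      using AE_lborel_singleton[of x] by eventually_elim auto
    ultimately show ?thesis using i1 i2 by (simp add: set_integral_Un_AE)
  qed
  also have "(LBINT t:{0..x}. (s1 - t) powr (a - 1) * w t) \<le> (LBINT t:{0..x}. \<rho> * ((x - t) powr (a - 1) * w t))"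
  proof (rule set_integral_mono_AE)
    show "set_integrable lborel {0..x} (\<lambda>t. \<rho> * ((x - t) powr (a - 1) * w t))"
      by (rule set_integrable_mult_right) (rule i3)
    show "AE t\<in>{0..x} in lborel. (s1 - t) powr (a - 1) * w t \<le> \<rho> * ((x - t) powr (a - 1) * w t)"
      using AE_lborel_singleton[of x]
    proof eventually_elim
      case (elim t)
      show ?case
      proof
        assume t: "t \<in> {0..x}"
        then have "F x * (s1 - t) powr (a - 1) \<le> F s1 * (x - t) powr (a - 1)"
          using elim xs by (intro ratio) auto
        then have "(s1 - t) powr (a - 1) \<le> \<rho> * (x - t) powr (a - 1)"
          using Fpos[of x] xpos by (simp add: \<rho>_def field_simps)
        moreover have "0 \<le> w t" using before[of t] t xs by auto
        ultimately have "(s1 - t) powr (a - 1) * w t \<le> \<rho> * (x - t) powr (a - 1) * w t"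
          by (rule mult_right_mono)
        then show "(s1 - t) powr (a - 1) * w t \<le> \<rho> * ((x - t) powr (a - 1) * w t)"
          by (simp only: mult.assoc)
      qed
    qed
  qed (rule i1)
  also have "(LBINT t:{0..x}. \<rho> * ((x - t) powr (a - 1) * w t)) = \<rho> * (rl a w x * Gamma a)"
    using a by (simp add: rl_def)
  also have "(LBINT t:{x..s1}. (s1 - t) powr (a - 1) * w t) \<le> w x * ((s1 - x) powr a / a)"
  proof -
    have "(LBINT t:{x..s1}. (s1 - t) powr (a - 1) * w t) \<le> \<bar>LBINT t:{x..s1}. (s1 - t) powr (a - 1) * w t\<bar>"
      by simp
    also have "\<dots> = \<bar>LBINT t:{x..s1}. (s1 - t) powr (a - 1) * max 0 (w t)\<bar>"
    proof (intro arg_cong[where f = abs] set_lebesgue_integral_cong allI impI)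
      fix t assume t: "t \<in> {x..s1}"
      show "(s1 - t) powr (a - 1) * w t = (s1 - t) powr (a - 1) * max 0 (w t)"
      proof (cases "t = s1")
        case False
        then show ?thesis using before[of t] t xpos by auto
      qed simp
    qed simp
    also have "\<dots> \<le> w x * ((s1 - x) powr a / a)"
      using a wm xs xmax wx x by (intro abel_integral_bound) auto
    finally show ?thesis .
  qed
  finally have "(LBINT t:{0..s1}. (s1 - t) powr (a - 1) * w t) \<le> \<rho> * (rl a w x * Gamma a) + w x * ((s1 - x) powr a / a)"
    by simp
  then have "rl a w s1 \<le> (\<rho> * (rl a w x * Gamma a) + w x * ((s1 - x) powr a / a)) / Gamma a"
    unfolding rl_def[of a w s1] using a by (intro divide_right_mono) auto
  also have "\<dots> = \<rho> * rl a w x + w x * ((s1 - x) powr a / Gamma (a + 1))"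
    using a Gamma_plus1_pos[OF a(1)] by (simp add: add_divide_distrib)
  finally have "rl a w s1 \<le> \<rho> * rl a w x + w x * ((s1 - x) powr a / Gamma (a + 1))" .
  moreover have "F s1 = \<rho> * (w x + rl a w x)"
    using Fpos[of x] F[of x] xpos by (simp add: \<rho>_def)
  ultimately have "w s1 \<ge> \<rho> * w x - w x * ((s1 - x) powr a / Gamma (a + 1))"
    using F[of s1] s1 by (simp add: algebra_simps)
  moreover have "w x * ((s1 - x) powr a / Gamma (a + 1)) < w x * \<rho>"
    using rho ks wx by (intro mult_strict_left_mono) linarith+
  ultimately show False using s1 by (simp add: mult.commute)
qed


definition ml_term :: "real \<Rightarrow> nat \<Rightarrow> real \<Rightarrow> real" where
  "ml_term a k s = (s powr a) ^ k / Gamma (real k * a + 1)"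

lemma ml_term_0 [simp]: "ml_term a 0 s = 1"
  by (simp add: ml_term_def)

lemma rl_ml_term:
  assumes a: "0 < a" and s: "0 \<le> s"
  shows "rl a (ml_term a k) s = ml_term a (Suc k) s"
proof -
  let ?b = "real k * a + 1"
  have b1: "0 < ?b" using a by (auto intro: add_nonneg_pos)
  note b = b1 add_pos_pos[OF a b1]
  have "((\<lambda>t. (s - t) powr (a - 1) * (t - 0) powr (?b - 1)) has_integral (s - 0) powr (a + ?b - 1) * Beta a ?b) {0..s}"
    using a b s by (intro has_integral_abel_beta) auto
  then have "((\<lambda>t. (s - t) powr (a - 1) * (t powr a) ^ k) has_integral (s - 0) powr (a + ?b - 1) * Beta a ?b) {0..s}"
  proof (rule has_integral_spike_finite[rotated 2, where S = "{0}"])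
    fix t assume "t \<in> {0..s} - {0}"
    then show "(s - t) powr (a - 1) * (t powr a) ^ k = (s - t) powr (a - 1) * (t - 0) powr (?b - 1)"
      by (simp add: powr_powr mult.commute flip: powr_realpow)
  qed simp
  moreover have "(s - 0) powr (a + ?b - 1) = (s powr a) ^ Suc k"
  proof (cases "s = 0")
    case False
    then have "(s powr a) ^ Suc k = (s powr a) powr real (Suc k)"
      using s by (subst powr_realpow) auto
    then show ?thesis by (simp add: powr_powr algebra_simps)
  qed simp
  ultimately have I: "((\<lambda>t. (s - t) powr (a - 1) * (t powr a) ^ k) has_integral (s powr a) ^ Suc k * Beta a ?b) {0..s}"
    by simp
  have "(LBINT t:{0..s}. (s - t) powr (a - 1) * (t powr a) ^ k) = (s powr a) ^ Suc k * Beta a ?b"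
    by (rule lborel_set_integral_of_has_integral(2)[OF I]) simp_all
  moreover have "rl a (ml_term a k) s = (LBINT t:{0..s}. (s - t) powr (a - 1) * (t powr a) ^ k) / Gamma ?b / Gamma a"
    by (simp add: rl_def ml_term_def)
  ultimately have "rl a (ml_term a k) s = (s powr a) ^ Suc k * Beta a ?b / Gamma ?b / Gamma a"
    by simp
  also have "\<dots> = (s powr a) ^ Suc k / Gamma (a + ?b)"
    using a b by (simp add: Beta_def)
  also have "a + ?b = real (Suc k) * a + 1" by (simp add: algebra_simps)
  finally show ?thesis unfolding ml_term_def[of a "Suc k"] .
qed

text \<open>
  The factor \<open>q\<close> is arbitrary: the terms of the series decay faster than every geometric sequence.
\<close>

lemma ml_term_le:
  assumes a: "0 < a" and s: "0 \<le> s" and q: "0 < q"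
  shows "ml_term a k s \<le> (1 / q) ^ k * exp (q powr (1 / a) * s)"
proof -
  define R where "R = q powr (1 / a)"
  have R: "0 < R" "R powr a = q" using a q by (auto simp: R_def powr_powr)
  have G: "0 < Gamma (real k * a + 1)" using a by (intro Gamma_real_pos) (auto intro: add_nonneg_pos)
  have "q ^ k * (s powr a) ^ k = ((R * s) powr a) ^ k"
    using R s by (simp add: powr_mult power_mult_distrib)
  also have "\<dots> \<le> Gamma (real k * a + 1) * exp (R * s)"
  proof (cases "s = 0 \<or> k = 0")
    case True
    then show ?thesis using G R s by (cases "k = 0") (auto simp: power_0_left)
  next
    case False
    then have "((R * s) powr a) ^ k = (R * s) powr (real k * a)"
      using R s by (simp add: powr_powr mult.commute flip: powr_realpow)
    then show ?thesis using powr_le_Gamma_exp[of "R * s" "real k * a"] R s a by simp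
  qed
  finally have "q ^ k * (s powr a) ^ k \<le> Gamma (real k * a + 1) * exp (R * s)" .
  then have "(s powr a) ^ k / Gamma (real k * a + 1) \<le> exp (R * s) / q ^ k"
    using G q by (simp add: field_simps)
  then show ?thesis by (simp add: ml_term_def R_def power_one_over field_simps)
qed

lemma ml_term_nonneg: "0 < a \<Longrightarrow> 0 \<le> ml_term a k s"
  using Gamma_real_pos[of "real k * a + 1"] by (auto simp: ml_term_def intro!: divide_nonneg_pos add_nonneg_pos)

text \<open>
  The relaxation function \<open>s \<mapsto> E\<^sub>a(- s\<^sup>a)\<close>.  Arguments below \<open>0\<close> are cut off, which makes it continuous on
  the whole line.
\<close>

definition ml :: "real \<Rightarrow> real \<Rightarrow> real" where
  "ml a s = (\<Sum>k. (-1) ^ k * ml_term a k (max 0 s))"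

lemma ml_uniform_limit:
  assumes a: "0 < a"
  shows "uniform_limit {..S} (\<lambda>n s. \<Sum>k<n. (-1) ^ k * ml_term a k (max 0 s)) (ml a) sequentially"
  unfolding ml_def
proof (rule Weierstrass_m_test)
  fix k s assume s: "s \<in> {..S}"
  have "norm ((-1) ^ k * ml_term a k (max 0 s)) = ml_term a k (max 0 s)"
    using ml_term_nonneg[OF a] by (simp add: abs_mult power_abs)
  also have "\<dots> \<le> (1 / 2) ^ k * exp (2 powr (1 / a) * max 0 s)"
    by (rule ml_term_le[OF a]) simp_all
  also have "\<dots> \<le> (1 / 2) ^ k * exp (2 powr (1 / a) * max 0 S)"
    using s by (intro mult_left_mono) auto
  finally show "norm ((-1) ^ k * ml_term a k (max 0 s)) \<le> (1 / 2) ^ k * exp (2 powr (1 / a) * max 0 S)" .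
next
  show "summable (\<lambda>k. (1 / 2) ^ k * exp (2 powr (1 / a) * max 0 S))"
    by (intro summable_mult2 summable_geometric) simp
qed

lemma ml_term_continuous [continuous_intros]:
  assumes "0 < a" shows "continuous_on A (\<lambda>s. ml_term a k (max 0 s))"
proof -
  have "continuous_on A (\<lambda>s. max 0 s powr a)"
    using assms by (intro continuous_on_powr' continuous_intros) auto
  then show ?thesis unfolding ml_term_def
    by (intro continuous_on_divide continuous_on_power continuous_on_const) (use assms add_nonneg_pos[of "real k * a" 1] in auto)
qed

lemma ml_continuous:
  assumes a: "0 < a" shows "continuous_on A (ml a)"
proof -
  have "continuous_on {..S} (ml a)" for S
    using ml_uniform_limit[OF a]
    by (rule uniform_limit_theorem[rotated]) (auto intro!: always_eventually continuous_intros a)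
  then have "isCont (ml a) s" for s
    by (rule continuous_on_interior[where S = "{..s + 1}"]) simp
  then show ?thesis by (simp add: continuous_at_imp_continuous_on)
qed

lemma ml_measurable [measurable]: "0 < a \<Longrightarrow> ml a \<in> borel_measurable borel"
  by (intro borel_measurable_continuous_onI ml_continuous)

lemma ml_0: assumes "0 < a" shows "ml a 0 = 1"
proof -
  have "(\<lambda>k. (-1) ^ k * ml_term a k (max 0 0)) = (\<lambda>k. if k = 0 then 1 else 0)"
    by (rule ext) (simp add: ml_term_def power_0_left)
  then show ?thesis unfolding ml_def by (simp only:) (simp add: suminf_finite[where N = "{0}"] sums_unique[OF sums_single, symmetric])
qed

text \<open>
  The Abel integral shifts the terms of the alternating series by one, so the two sums telescope.
\<close>

lemma ml_volterra:
  assumes a: "0 < a" and s: "0 \<le> s"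
  shows "ml a s + rl a (ml a) s = 1"
proof -
  define P where "P n t = (\<Sum>k<n. (-1) ^ k * ml_term a k (max 0 t))" for n t
  have Pc: "continuous_on A (P n)" for A n
    unfolding P_def by (intro continuous_intros a)
  have Pm: "P n \<in> borel_measurable borel" for n
    by (intro borel_measurable_continuous_onI Pc)
  have int: "set_integrable lborel {0..s} (\<lambda>t. (s - t) powr (a - 1) * g t)" if "continuous_on UNIV g" for g
    using continuous_bounded_Icc[OF continuous_on_subset[OF that subset_UNIV]]
      abel_integrand_integrable[OF a borel_measurable_continuous_onI[OF that], of 0 s s] s by (metis order_refl)
  have trm: "rl a (\<lambda>t. ml_term a k (max 0 t)) s = ml_term a (Suc k) s" for k
  proof -
    have "rl a (\<lambda>t. ml_term a k (max 0 t)) s = rl a (ml_term a k) s"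
      by (rule rl_cong) simp
    then show ?thesis using rl_ml_term[OF a s] by simp
  qed
  have PP: "rl a (P n) s = 1 - P (Suc n) s" for n
  proof (induction n)
    case 0
    show ?case by (simp add: P_def rl_def)
  next
    case (Suc n)
    have "P (Suc n) = (\<lambda>t. P n t + (-1) ^ n * ml_term a n (max 0 t))"
      by (rule ext) (simp add: P_def)
    then have "rl a (P (Suc n)) s = rl a (\<lambda>t. P n t + (-1) ^ n * ml_term a n (max 0 t)) s"
      by (simp only:)
    also have "\<dots> = rl a (P n) s + rl a (\<lambda>t. (-1) ^ n * ml_term a n (max 0 t)) s"
      by (intro rl_add int continuous_intros a Pc)
    also have "\<dots> = 1 - P (Suc n) s + (-1) ^ n * ml_term a (Suc n) s"
      by (simp only: Suc.IH rl_cmult trm)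
    also have "\<dots> = 1 - P (Suc (Suc n)) s"
      using s by (simp add: P_def)
    finally show ?case .
  qed
  have ul: "uniform_limit {0..s} P (ml a) sequentially"
    unfolding P_def by (rule uniform_limit_on_subset[OF ml_uniform_limit[OF a]]) auto
  have lim: "(\<lambda>n. P (Suc n) s) \<longlonglongrightarrow> ml a s"
    by (rule LIMSEQ_Suc[OF tendsto_uniform_limitI[OF ul]]) (use s in simp)
  have "(\<lambda>n. rl a (P n) s) \<longlonglongrightarrow> rl a (ml a) s"
  proof (rule metric_LIMSEQ_I)
    fix e :: real assume e: "0 < e"
    define K where "K = s powr a / Gamma (a + 1)"
    have K0: "0 \<le> K" using a by (simp add: K_def less_imp_le)
    then have "0 < e / (K + 1)" using e by simp
    from uniform_limitD[OF ul this] obtain N where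
      N: "\<And>n t. n \<ge> N \<Longrightarrow> t \<in> {0..s} \<Longrightarrow> dist (P n t) (ml a t) < e / (K + 1)"
      unfolding eventually_sequentially by blast
    show "\<exists>N. \<forall>n\<ge>N. dist (rl a (P n) s) (rl a (ml a) s) < e"
    proof (intro exI allI impI)
      fix n assume n: "N \<le> n"
      have "rl a (P n) s - rl a (ml a) s = rl a (\<lambda>t. P n t - ml a t) s"
        by (rule rl_diff[symmetric]) (intro int Pc ml_continuous a)+
      moreover have "\<bar>rl a (\<lambda>t. P n t - ml a t) s\<bar> \<le> e / (K + 1) * s powr a / Gamma (a + 1)"
        using N[OF n] by (intro rl_bound[OF a _ s] borel_measurable_diff Pm ml_measurable[OF a]) (auto simp: dist_real_def less_imp_le)
      moreover have "e / (K + 1) * s powr a / Gamma (a + 1) = e * (K / (K + 1))"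
        by (simp add: K_def)
      moreover have "e * (K / (K + 1)) < e" using e K0 by (simp add: field_simps)
      ultimately show "dist (rl a (P n) s) (rl a (ml a) s) < e"
        by (simp add: dist_real_def)
    qed
  qed
  moreover have "(\<lambda>n. rl a (P n) s) \<longlonglongrightarrow> 1 - ml a s"
    unfolding PP by (intro tendsto_intros lim)
  ultimately show ?thesis using LIMSEQ_unique by fastforce
qed

lemma ml_pos:
  assumes a: "0 < a" "a \<le> 1" and s: "0 \<le> s"
  shows "0 < ml a s"
proof (rule volterra_positive[OF a ml_measurable[OF a(1)] ml_continuous[OF a(1)], where F = "\<lambda>_. 1"])
  fix s s1 t :: real assume "0 \<le> t" "t < s" "s < s1"
  then show "1 * (s1 - t) powr (a - 1) \<le> 1 * (s - t) powr (a - 1)"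
    using a by (simp add: powr_mono2')
qed (use ml_volterra[OF a(1)] s in auto)

text \<open>
  The difference \<open>w s = ml a s - ml a (s + h)\<close> solves a Volterra equation whose right-hand side is the
  integral over \<open>[0,h]\<close> that the shift cuts off.  This is a positive combination of the kernels \<open>(s + h - t)\<^bsup>a-1\<^esup>\<close>, so it is
  positive and satisfies the ratio condition, because
  \<open>(s + h - r) (s1 - t) \<ge> (s1 + h - r) (s - t)\<close> for \<open>r \<le> h\<close>.
\<close>

lemma ml_shift_less:
  assumes a: "0 < a" "a \<le> 1" and s: "0 \<le> s" and h: "0 < h"
  shows "ml a (s + h) < ml a s"
proof -
  let ?w = "\<lambda>t. ml a t - ml a (t + h)"
  define G where "G s = (LBINT t:{0..h}. (s + h - t) powr (a - 1) * ml a t)" for s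
  have c: "continuous_on A ?w" for A
    by (intro continuous_intros ml_continuous[OF a(1)] continuous_on_compose2[OF ml_continuous[OF a(1), of UNIV]]) auto
  have c2: "continuous_on A (\<lambda>t. ml a (t + h))" for A
    by (intro continuous_intros continuous_on_compose2[OF ml_continuous[OF a(1), of UNIV]]) auto
  have int: "set_integrable lborel {r..u} (\<lambda>t. (v - t) powr (a - 1) * g t)"
    if "continuous_on UNIV g" "0 \<le> r" "r \<le> u" "u \<le> v" for g r u v
  proof -
    have "continuous_on {0..u} g" using that(1) by (rule continuous_on_subset) simp
    then obtain C where "\<And>t. 0 \<le> t \<Longrightarrow> t \<le> u \<Longrightarrow> \<bar>g t\<bar> \<le> C"
      by (rule continuous_bounded_Icc) blast
    then show ?thesis using that a
      by (intro abel_integrand_integrable[where C = C] borel_measurable_continuous_onI) auto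
  qed
  have G: "?w s + rl a ?w s = G s / Gamma a" if s: "0 \<le> s" for s
  proof -
    have "{0..s + h} = {0..h} \<union> {h..s + h}" using s h by auto
    moreover have "AE y in lborel. \<not> (y \<in> {0..h} \<and> y \<in> {h..s + h})"
      using AE_lborel_singleton[of h] by eventually_elim auto
    ultimately have "(LBINT t:{0..s + h}. (s + h - t) powr (a - 1) * ml a t) =
        G s + (LBINT t:{h..s + h}. (s + h - t) powr (a - 1) * ml a t)"
      unfolding G_def using s h a
      by (simp add: set_integral_Un_AE int ml_continuous)
    moreover have "(LBINT t:{h..s + h}. (s + h - t) powr (a - 1) * ml a t) = (LBINT t:{0..s}. (s - t) powr (a - 1) * ml a (t + h))"
    proof -
      have "(\<integral>x. indicator {h..s + h} x *\<^sub>R ((s + h - x) powr (a - 1) * ml a x) \<partial>lborel)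
         = \<bar>1\<bar> *\<^sub>R (\<integral>x. indicator {h..s + h} (h + 1 * x) *\<^sub>R ((s + h - (h + 1 * x)) powr (a - 1) * ml a (h + 1 * x)) \<partial>lborel)"
        by (rule lborel_integral_real_affine) simp
      also have "\<dots> = (\<integral>x. indicator {0..s} x *\<^sub>R ((s - x) powr (a - 1) * ml a (x + h)) \<partial>lborel)"
        by (simp add: indicator_def add.commute)
      finally show ?thesis by (simp only: set_lebesgue_integral_def)
    qed
    ultimately have "rl a (ml a) (s + h) = G s / Gamma a + rl a (\<lambda>t. ml a (t + h)) s"
      by (simp add: rl_def add_divide_distrib)
    moreover have "rl a ?w s = rl a (ml a) s - rl a (\<lambda>t. ml a (t + h)) s"
      using s a by (intro rl_diff int c2 ml_continuous) auto
    ultimately show ?thesis using ml_volterra[OF a(1) s] ml_volterra[OF a(1), of "s + h"] s h by simp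
  qed
  have Gpos: "0 < G s" if s: "0 \<le> s" for s
  proof -
    have "compact {0..h}" by simp
    from continuous_attains_inf[OF this _ ml_continuous[OF a(1)]] h obtain x where
      x: "x \<in> {0..h}" "\<And>y. y \<in> {0..h} \<Longrightarrow> ml a x \<le> ml a y" by auto
    have "0 < ml a x * ((s + h) powr (a - 1) * h)" using ml_pos[OF a, of x] x s h by simp
    also have "\<dots> = (LBINT t:{0..h}. ml a x * (s + h) powr (a - 1))"
      using h by (simp add: set_integral_const set_lebesgue_integral_def mult_ac)
    also have "\<dots> \<le> G s" unfolding G_def
    proof (rule set_integral_mono_AE)
      show "set_integrable lborel {0..h} (\<lambda>t. ml a x * (s + h) powr (a - 1))"
        using h by (simp add: set_integrable_def)
      show "set_integrable lborel {0..h} (\<lambda>t. (s + h - t) powr (a - 1) * ml a t)"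
        using s h a by (intro int ml_continuous) auto
      show "AE t\<in>{0..h} in lborel. ml a x * (s + h) powr (a - 1) \<le> (s + h - t) powr (a - 1) * ml a t"
        using AE_lborel_singleton[of h]
      proof eventually_elim
        case (elim t)
        show ?case
        proof
          assume t: "t \<in> {0..h}"
          then have "ml a x \<le> ml a t" "(s + h) powr (a - 1) \<le> (s + h - t) powr (a - 1)"
            using x elim s a by (auto intro!: powr_mono2')
          moreover have "0 \<le> ml a t" using ml_pos[OF a, of t] t by auto
          ultimately have "ml a x * (s + h) powr (a - 1) \<le> ml a t * (s + h - t) powr (a - 1)"
            by (intro mult_mono) auto
          then show "ml a x * (s + h) powr (a - 1) \<le> (s + h - t) powr (a - 1) * ml a t"
            by (simp only: mult.commute)
        qed
      qed
    qed
    finally show ?thesis .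
  qed
  have "0 < ?w s"
  proof (rule volterra_positive[OF a _ c, where F = "\<lambda>s. G s / Gamma a"])
    show "?w \<in> borel_measurable borel" by (intro borel_measurable_continuous_onI c)
    fix s :: real assume "0 \<le> s"
    then show "G s / Gamma a = ?w s + rl a ?w s" "0 < G s / Gamma a"
      using G Gpos a by simp_all
  next
    fix s s1 t :: real assume t: "0 \<le> t" "t < s" "s < s1"
    have "(s1 - t) powr (a - 1) * G s = (LBINT r:{0..h}. (s1 - t) powr (a - 1) * ((s + h - r) powr (a - 1) * ml a r))"
      by (simp add: G_def)
    also have "\<dots> \<le> (LBINT r:{0..h}. (s - t) powr (a - 1) * ((s1 + h - r) powr (a - 1) * ml a r))"
    proof (rule set_integral_mono)
      show "set_integrable lborel {0..h} (\<lambda>r. (s1 - t) powr (a - 1) * ((s + h - r) powr (a - 1) * ml a r))"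
        "set_integrable lborel {0..h} (\<lambda>r. (s - t) powr (a - 1) * ((s1 + h - r) powr (a - 1) * ml a r))"
        using t h a by (intro set_integrable_mult_right int ml_continuous; simp)+
      fix r assume r: "r \<in> {0..h}"
      have "((s1 - t) * (s + h - r)) powr (a - 1) \<le> ((s - t) * (s1 + h - r)) powr (a - 1)"
      proof (rule powr_mono2')
        have "(s1 - t) * (s + h - r) - (s - t) * (s1 + h - r) = (s1 - s) * (h - r + t)"
          by (simp add: algebra_simps)
        also have "\<dots> \<ge> 0" using t r by (intro mult_nonneg_nonneg) auto
        finally show "(s - t) * (s1 + h - r) \<le> (s1 - t) * (s + h - r)" by simp
        show "0 < (s - t) * (s1 + h - r)" using t r by auto
      qed (use a in auto)
      then have "(s1 - t) powr (a - 1) * (s + h - r) powr (a - 1) \<le> (s - t) powr (a - 1) * (s1 + h - r) powr (a - 1)"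
        using t r by (simp add: powr_mult)
      then have "(s1 - t) powr (a - 1) * (s + h - r) powr (a - 1) * ml a r \<le> (s - t) powr (a - 1) * (s1 + h - r) powr (a - 1) * ml a r"
        using ml_pos[OF a, of r] r by (intro mult_right_mono) auto
      then show "(s1 - t) powr (a - 1) * ((s + h - r) powr (a - 1) * ml a r) \<le> (s - t) powr (a - 1) * ((s1 + h - r) powr (a - 1) * ml a r)"
        by (simp only: mult.assoc)
    qed
    also have "\<dots> = (s - t) powr (a - 1) * G s1" by (simp add: G_def)
    finally show "G s / Gamma a * (s1 - t) powr (a - 1) \<le> G s1 / Gamma a * (s - t) powr (a - 1)"
      using a by (simp add: divide_right_mono mult.commute)
  qed (rule s)
  then show ?thesis by simp
qed

lemma ml_antimono:
  assumes a: "0 < a" "a \<le> 1" and "0 \<le> s" "s \<le> t"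
  shows "ml a t \<le> ml a s"
  using ml_shift_less[OF a assms(3), of "t - s"] assms(4) by (cases "s = t") auto

lemma ml_le_1: "0 < a \<Longrightarrow> a \<le> 1 \<Longrightarrow> 0 \<le> s \<Longrightarrow> ml a s \<le> 1"
  using ml_antimono[of a 0 s] ml_0[of a] by simp

text \<open>
  By monotonicity \<open>rl a (ml a) s \<ge> ml a s \<cdot> s\<^sup>a / \<Gamma>(a + 1)\<close>, and the Volterra equation bounds the left-hand side
  by \<open>1\<close>.
\<close>

lemma ml_decay:
  assumes a: "0 < a" "a \<le> 1" and s: "0 \<le> s"
  shows "s powr a * ml a s \<le> Gamma (a + 1)"
proof -
  have "(LBINT t:{0..s}. (s - t) powr (a - 1) * ml a s) \<le> (LBINT t:{0..s}. (s - t) powr (a - 1) * ml a t)"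
  proof (rule set_integral_mono)
    show "set_integrable lborel {0..s} (\<lambda>t. (s - t) powr (a - 1) * ml a s)"
      using abel_kernel_set_integral(1)[OF a(1) s] by simp
    show "set_integrable lborel {0..s} (\<lambda>t. (s - t) powr (a - 1) * ml a t)"
    proof (rule abel_integrand_integrable[where C = 1])
      fix t :: real assume "0 \<le> t"
      then show "\<bar>ml a t\<bar> \<le> 1" using ml_le_1[OF a, of t] ml_pos[OF a, of t] by simp
    qed (use a s ml_measurable in auto)
    fix t assume "t \<in> {0..s}"
    then show "(s - t) powr (a - 1) * ml a s \<le> (s - t) powr (a - 1) * ml a t"
      using ml_antimono[OF a, of t s] by (intro mult_left_mono) auto
  qed
  then have "ml a s * (s powr a / a) \<le> Gamma a * rl a (ml a) s"
    using abel_kernel_set_integral(2)[OF a(1) s] a by (simp add: rl_def mult.commute)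
  also have "\<dots> \<le> Gamma a * 1"
    using ml_volterra[OF a(1) s] ml_pos[OF a s] a by (intro mult_left_mono) auto
  finally have "ml a s * s powr a \<le> a * Gamma a" using a by (simp add: field_simps)
  then show ?thesis using Gamma_plus1_pos[OF a(1)] by (simp add: mult.commute)
qed

section \<open>Bernstein form of positive polynomials\<close>

definition bernstein_poly :: "nat \<Rightarrow> nat \<Rightarrow> real poly" where
  "bernstein_poly n k = smult (real (n choose k)) ([:0, 1:] ^ k * [:1, -1:] ^ (n - k))"

lemma poly_bernstein_poly: "poly (bernstein_poly n k) x = Bernstein n k x"
  by (simp add: bernstein_poly_def Bernstein_def)

text \<open>
  Both quantities are the probability of drawing \<open>i\<close> marked balls out of \<open>n\<close> of which \<open>k\<close> are marked, without and with
  replacement; the induction adds one draw.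
\<close>

lemma choose_ratio_limit:
  fixes i :: nat and e :: real
  assumes "0 < e"
  shows "\<exists>N. \<forall>n\<ge>N. \<forall>k\<le>n. \<bar>real (k choose i) / real (n choose i) - (real k / real n) ^ i\<bar> < e"
  using assms
proof (induction i arbitrary: e)
  case 0
  then show ?case by (intro exI[of _ 0]) simp
next
  case (Suc i)
  from Suc.IH[of "e / 2"] Suc.prems obtain N where
    N: "\<And>n k. \<lbrakk>n \<ge> N; k \<le> n\<rbrakk> \<Longrightarrow> \<bar>real (k choose i) / real (n choose i) - (real k / real n) ^ i\<bar> < e / 2"
    by auto
  obtain N' where N': "2 * real i / e < real N'" using reals_Archimedean2 by blast
  show ?case
  proof (intro exI allI impI)
    fix n k assume n: "max N (N' + i + 1) \<le> n" and k: "k \<le> n"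
    define r where "r = real (k choose i) / real (n choose i)"
    have ni: "i < n" using n by simp
    have r01: "0 \<le> r" "r \<le> 1"
      using binomial_right_mono[OF k, of i] ni by (auto simp: r_def divide_le_eq_1)
    have "real (Suc i) * real (m choose Suc i) = (real m - real i) * real (m choose i)" for m
    proof (cases "i \<le> m")
      case True
      have "Suc i * (m choose Suc i) = (m - i) * (m choose i)"
        by (metis binomial_absorb_comp binomial_absorption mult.commute)
      then show ?thesis using True by (metis of_nat_diff of_nat_mult)
    qed (simp add: binomial_eq_0 not_le)
    then have suc: "real (m choose Suc i) = (real m - real i) * real (m choose i) / real (Suc i)" for m
      by (metis nonzero_mult_div_cancel_left of_nat_neq_0)
    have "real (k choose Suc i) / real (n choose Suc i) = (real k - real i) / (real n - real i) * r"
      unfolding suc r_def using ni by simp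
    moreover have "(real k - real i) / (real n - real i) - real k / real n
        = - (real i / (real n - real i) * (1 - real k / real n))"
      using ni by (simp add: field_simps)
    moreover have kn: "0 \<le> real k / real n" "real k / real n \<le> 1" using k by (auto simp: divide_le_eq_1)
    moreover have "\<bar>real i / (real n - real i) * (1 - real k / real n)\<bar> \<le> e / 2"
    proof -
      have "real i / (real n - real i) \<le> e / 2"
      proof -
        have "2 * real i < e * real N'" using N' Suc.prems by (simp add: field_simps)
        also have "\<dots> \<le> e * (real n - real i)" using n Suc.prems by (intro mult_left_mono) auto
        finally show ?thesis using ni by (simp add: field_simps)
      qed
      moreover have "\<bar>real i / (real n - real i) * (1 - real k / real n)\<bar> \<le> real i / (real n - real i) * 1"
        unfolding abs_mult using kn ni by (intro mult_mono) auto
      ultimately show ?thesis by linarith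
    qed
    ultimately have d: "\<bar>(real k - real i) / (real n - real i) - real k / real n\<bar> \<le> e / 2"
      by simp
    have "\<bar>real (k choose Suc i) / real (n choose Suc i) - (real k / real n) ^ Suc i\<bar>
      = \<bar>((real k - real i) / (real n - real i) - real k / real n) * r + real k / real n * (r - (real k / real n) ^ i)\<bar>"
      using \<open>real (k choose Suc i) / real (n choose Suc i) = (real k - real i) / (real n - real i) * r\<close>
      by (simp only: power_Suc) (simp only: algebra_simps)
    also have "\<dots> \<le> \<bar>(real k - real i) / (real n - real i) - real k / real n\<bar> * \<bar>r\<bar> + \<bar>real k / real n\<bar> * \<bar>r - (real k / real n) ^ i\<bar>"
      by (metis abs_mult abs_triangle_ineq)
    also have "\<bar>(real k - real i) / (real n - real i) - real k / real n\<bar> * \<bar>r\<bar> \<le> e / 2 * 1"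
      using d r01 Suc.prems by (intro mult_mono) auto
    also have "\<bar>real k / real n\<bar> * \<bar>r - (real k / real n) ^ i\<bar> \<le> 1 * \<bar>r - (real k / real n) ^ i\<bar>"
      using kn by (intro mult_right_mono) auto
    also have "\<bar>r - (real k / real n) ^ i\<bar> < e / 2" using N[of n k] n k by (simp add: r_def)
    finally show "\<bar>real (k choose Suc i) / real (n choose Suc i) - (real k / real n) ^ Suc i\<bar> < e"
      by simp
  qed
qed

lemma smult_sum_right: "smult a (\<Sum>i\<in>I. f i) = (\<Sum>i\<in>I. smult a (f i))"
  by (induction I rule: infinite_finite_induct) (auto simp: smult_add_right)

text \<open>
  Multiply \<open>X\<^sup>i\<close> by \<open>1 = (X + (1 - X))\<^bsup>n-i\<^esup>\<close> and expand.
\<close>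

lemma monomial_bernstein_form:
  assumes "i \<le> n"
  shows "[:0, 1:] ^ i = (\<Sum>k\<le>n. smult (real (k choose i) / real (n choose i)) (bernstein_poly n k))"
proof -
  let ?X = "[:0, 1:] :: real poly" and ?Y = "[:1, -1:] :: real poly"
  have XY: "?X + ?Y = 1" by (simp add: one_pCons)
  have "?X ^ i = ?X ^ i * (?X + ?Y) ^ (n - i)" by (simp only: XY power_one mult_1_right)
  also have "\<dots> = (\<Sum>j\<le>n - i. ?X ^ i * (of_nat ((n - i) choose j) * ?X ^ j * ?Y ^ (n - i - j)))"
    by (simp only: binomial_ring sum_distrib_left)
  also have "\<dots> = (\<Sum>k\<in>{i..n}. of_nat ((n - i) choose (k - i)) * (?X ^ k * ?Y ^ (n - k)))"
    using assms
    by (intro sum.reindex_bij_witness[of _ "\<lambda>k. k - i" "\<lambda>j. j + i"])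
       (auto simp: power_add mult_ac diff_commute add.commute)
  also have "\<dots> = (\<Sum>k\<in>{i..n}. smult (real (k choose i) / real (n choose i)) (bernstein_poly n k))"
  proof (intro sum.cong refl)
    fix k assume k: "k \<in> {i..n}"
    have "(n choose k) * (k choose i) = (n choose i) * ((n - i) choose (k - i))"
      using k by (intro choose_mult) auto
    then have "real (n choose k) * real (k choose i) = real (n choose i) * real ((n - i) choose (k - i))"
      by (metis of_nat_mult)
    then have "real ((n - i) choose (k - i)) = real (k choose i) / real (n choose i) * real (n choose k)"
      using assms by (simp add: field_simps)
    then show "of_nat ((n - i) choose (k - i)) * (?X ^ k * ?Y ^ (n - k)) = smult (real (k choose i) / real (n choose i)) (bernstein_poly n k)"
      by (simp only: bernstein_poly_def smult_smult of_nat_poly[where 'a = real]) simp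
  qed
  also have "\<dots> = (\<Sum>k\<le>n. smult (real (k choose i) / real (n choose i)) (bernstein_poly n k))"
    by (intro sum.mono_neutral_left) auto
  finally show ?thesis .
qed

text \<open>
  Bernstein's theorem.  In degree \<open>n\<close> the coefficients of \<open>p\<close> tend to the values of \<open>p\<close> at the points
  \<open>k / n\<close>, uniformly in \<open>k\<close>, and these values are bounded away from zero.
\<close>

lemma positive_poly_bernstein_form:
  fixes p :: "real poly"
  assumes pos: "\<And>x. x \<in> {0..1} \<Longrightarrow> 0 < poly p x"
  obtains n c where "\<And>k. k \<le> n \<Longrightarrow> 0 \<le> c k" "p = (\<Sum>k\<le>n. smult (c k) (bernstein_poly n k))"
proof -
  have "\<exists>x\<in>{0..1}. \<forall>y\<in>{0..1}. poly p x \<le> poly p y"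
    by (intro continuous_attains_inf continuous_intros) auto
  then obtain x0 where x0: "x0 \<in> {0..1::real}" "\<And>y. y \<in> {0..1} \<Longrightarrow> poly p x0 \<le> poly p y"
    by blast
  define d where "d = poly p x0"
  have d: "0 < d" "\<And>y. y \<in> {0..1} \<Longrightarrow> d \<le> poly p y" using x0 pos[of x0] by (auto simp: d_def)
  define m where "m = degree p"
  define L where "L = (\<Sum>i\<le>m. \<bar>coeff p i\<bar>) + 1"
  have L: "0 < L" by (auto simp: L_def intro: add_nonneg_pos sum_nonneg)
  have "\<exists>N. \<forall>n\<ge>N. \<forall>k\<le>n. \<bar>real (k choose i) / real (n choose i) - (real k / real n) ^ i\<bar> < d / L" for i
    using d L by (intro choose_ratio_limit) simp
  then obtain N where N: "\<And>i n k. \<lbrakk>N i \<le> n; k \<le> n\<rbrakk> \<Longrightarrow> \<bar>real (k choose i) / real (n choose i) - (real k / real n) ^ i\<bar> < d / L"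
    by metis
  define n where "n = Max (N ` {..m}) + m"
  have n: "N i \<le> n" if "i \<le> m" for i
    using that unfolding n_def by (intro trans_le_add1 Max_ge) auto
  define c where "c k = (\<Sum>i\<le>m. coeff p i * (real (k choose i) / real (n choose i)))" for k
  have "0 \<le> c k" if k: "k \<le> n" for k
  proof -
    have "c k - poly p (real k / real n) = (\<Sum>i\<le>m. coeff p i * (real (k choose i) / real (n choose i) - (real k / real n) ^ i))"
      by (simp add: c_def poly_altdef m_def sum_subtractf right_diff_distrib)
    also have "\<bar>\<dots>\<bar> \<le> (\<Sum>i\<le>m. \<bar>coeff p i\<bar> * (d / L))"
    proof (intro order_trans[OF sum_abs] sum_mono)
      fix i assume "i \<in> {..m}"
      then have "\<bar>real (k choose i) / real (n choose i) - (real k / real n) ^ i\<bar> \<le> d / L"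
        using N[OF n k, of i] by simp
      then show "\<bar>coeff p i * (real (k choose i) / real (n choose i) - (real k / real n) ^ i)\<bar> \<le> \<bar>coeff p i\<bar> * (d / L)"
        unfolding abs_mult by (rule mult_left_mono) simp
    qed
    also have "\<dots> = (\<Sum>i\<le>m. \<bar>coeff p i\<bar>) * (d / L)" by (rule sum_distrib_right[symmetric])
    also have "\<dots> = (L - 1) * (d / L)" by (simp add: L_def)
    also have "\<dots> \<le> d" using L d by (simp add: field_simps)
    finally have "poly p (real k / real n) - c k \<le> d" by simp
    moreover have "d \<le> poly p (real k / real n)" using k by (intro d) (auto simp: divide_le_eq_1)
    ultimately show ?thesis by simp
  qed
  moreover have "p = (\<Sum>k\<le>n. smult (c k) (bernstein_poly n k))"
  proof -
    have "p = (\<Sum>i\<le>m. smult (coeff p i) ([:0, 1:] ^ i))"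
      unfolding m_def by (subst poly_as_sum_of_monoms[symmetric]) (simp add: monom_altdef)
    also have "\<dots> = (\<Sum>i\<le>m. \<Sum>k\<le>n. smult (coeff p i * (real (k choose i) / real (n choose i))) (bernstein_poly n k))"
    proof (intro sum.cong refl)
      fix i assume "i \<in> {..m}"
      then have "i \<le> n" by (simp add: n_def)
      then show "smult (coeff p i) ([:0, 1:] ^ i) = (\<Sum>k\<le>n. smult (coeff p i * (real (k choose i) / real (n choose i))) (bernstein_poly n k))"
        by (simp only: monomial_bernstein_form[of i n] smult_sum_right smult_smult)
    qed
    also have "\<dots> = (\<Sum>k\<le>n. \<Sum>i\<le>m. smult (coeff p i * (real (k choose i) / real (n choose i))) (bernstein_poly n k))"
      by (rule sum.swap)
    finally show ?thesis by (simp only: c_def smult_sum)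
  qed
  ultimately show ?thesis by (rule that)
qed

section \<open>Functional calculus for positive contractions\<close>

text \<open>
  Horner's scheme for \<open>p(B) x\<close>.
\<close>

definition poly_op :: "('h::real_normed_vector \<Rightarrow> 'h) \<Rightarrow> real poly \<Rightarrow> 'h \<Rightarrow> 'h" where
  "poly_op B p = fold_coeffs (\<lambda>a g x. a *\<^sub>R x + B (g x)) p (\<lambda>_. 0)"

definition bernstein_approx :: "(real \<Rightarrow> real) \<Rightarrow> nat \<Rightarrow> real poly" where
  "bernstein_approx f n = (\<Sum>k\<le>n. smult (f (real k / real n)) (bernstein_poly n k))"

text \<open>
  The definition picks the Bernstein polynomials; any uniform approximation by polynomials has the same limit
  (lemma \<open>fun_op_limit\<close>).
\<close>

definition fun_op :: "('h::real_normed_vector \<Rightarrow> 'h) \<Rightarrow> (real \<Rightarrow> real) \<Rightarrow> 'h \<Rightarrow> 'h" where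
  "fun_op B f x = lim (\<lambda>n. poly_op B (bernstein_approx f n) x)"

lemma bernstein_approx_uniform:
  assumes "continuous_on {0..1} f"
  shows "uniform_limit {0..1} (\<lambda>n. poly (bernstein_approx f n)) f sequentially"
proof (rule uniform_limitI)
  fix e :: real assume "0 < e"
  from Bernstein_Weierstrass[OF assms this] show "\<forall>\<^sub>F n in sequentially. \<forall>x\<in>{0..1}. dist (poly (bernstein_approx f n) x) (f x) < e"
    unfolding eventually_sequentially dist_real_def bernstein_approx_def poly_sum poly_bernstein_poly poly_smult
    by (subst abs_minus_commute) blast
qed

locale positive_contraction =
  fixes B :: "'h::{real_inner,banach} \<Rightarrow> 'h"
  assumes lin: "linear B" and sym: "inner (B x) y = inner x (B y)"
    and pos: "0 \<le> inner (B x) x" and contr: "norm (B x) \<le> norm x"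
begin

lemmas B_simps = linear_add[OF lin] linear_diff[OF lin] linear_0[OF lin] linear_scale[OF lin] linear_neg[OF lin]

lemma poly_op_0 [simp]: "poly_op B 0 x = 0"
  by (simp add: poly_op_def)

lemma poly_op_pCons [simp]: "poly_op B (pCons a p) x = a *\<^sub>R x + B (poly_op B p x)"
  by (cases "a = 0 \<and> p = 0") (auto simp: poly_op_def B_simps cCons_def fold_coeffs_def)

lemma poly_op_1 [simp]: "poly_op B 1 x = x"
  by (simp add: one_pCons B_simps)

lemma poly_op_linear: "linear (poly_op B p)"
proof (rule linearI)
  show "poly_op B p (x + y) = poly_op B p x + poly_op B p y" for x y
    by (induction p) (auto simp: B_simps algebra_simps)
  show "poly_op B p (c *\<^sub>R x) = c *\<^sub>R poly_op B p x" for x c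
    by (induction p) (auto simp: B_simps algebra_simps)
qed

lemma poly_op_add: "poly_op B (p + q) x = poly_op B p x + poly_op B q x"
  by (induction p q rule: poly_induct2) (auto simp: B_simps algebra_simps)

lemma poly_op_smult: "poly_op B (smult c p) x = c *\<^sub>R poly_op B p x"
  by (induction p) (auto simp: B_simps algebra_simps)

lemma poly_op_diff: "poly_op B (p - q) x = poly_op B p x - poly_op B q x"
  using poly_op_add[of "p - q" q x] by simp

lemma poly_op_sum: "poly_op B (\<Sum>i\<in>I. f i) x = (\<Sum>i\<in>I. poly_op B (f i) x)"
  by (induction I rule: infinite_finite_induct) (auto simp: poly_op_add)

lemma poly_op_mult: "poly_op B (p * q) x = poly_op B p (poly_op B q x)"
  by (induction p) (auto simp: poly_op_add poly_op_smult B_simps)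

lemma poly_op_sym: "inner (poly_op B p x) y = inner x (poly_op B p y)"
proof (induction p arbitrary: x y)
  case (pCons a p)
  have "B (poly_op B p y) = poly_op B p (B y)"
    using poly_op_mult[of "[:0, 1:]" p y] poly_op_mult[of p "[:0, 1:]" y]
    by (simp add: B_simps mult.commute)
  then show ?case using pCons.IH by (simp add: inner_add_left inner_add_right sym)
qed simp

text \<open>
  \<open>q(B) r(B) q(B)\<close> is a congruence of the nonnegative operator \<open>r(B)\<close>.
\<close>

lemma poly_op_square_nonneg:
  assumes "\<And>x. 0 \<le> inner (poly_op B r x) x"
  shows "0 \<le> inner (poly_op B (q * q * r) x) x"
proof -
  have "poly_op B (q * q * r) x = poly_op B q (poly_op B r (poly_op B q x))"
    by (metis poly_op_mult mult.commute mult.assoc)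
  then show ?thesis using assms[of "poly_op B q x"] by (simp only: poly_op_sym[of q])
qed

text \<open>
  Write the polynomial as \<open>q\<^sup>2 r\<close> where \<open>r\<close> is one of \<open>1\<close>, \<open>X\<close>, \<open>1 - X\<close>, \<open>X (1 - X)\<close>.  The last one is
  nonnegative at \<open>B\<close> because \<open>X (1 - X) = X\<^sup>2 (1 - X) + (1 - X)\<^sup>2 X\<close>.
\<close>

lemma bernstein_op_nonneg: "0 \<le> inner (poly_op B ([:0, 1:] ^ k * [:1, -1:] ^ m) x) x"
proof -
  let ?X = "[:0, 1:] :: real poly" and ?Y = "[:1, -1:] :: real poly"
  define q r where "q = ?X ^ (k div 2) * ?Y ^ (m div 2)" and "r = ?X ^ (k mod 2) * ?Y ^ (m mod 2)"
  have X: "0 \<le> inner (poly_op B ?X x) x" for x using pos[of x] by (simp add: B_simps)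
  have Y: "0 \<le> inner (poly_op B ?Y x) x" for x
  proof -
    have "inner (B x) x \<le> norm (B x) * norm x" by (rule norm_cauchy_schwarz)
    also have "\<dots> \<le> norm x * norm x" using contr by (intro mult_right_mono) auto
    finally show ?thesis by (simp add: B_simps inner_diff_left inner_add_left dot_square_norm power2_eq_square)
  qed
  have XY: "0 \<le> inner (poly_op B (?X * ?Y) x) x" for x
  proof -
    have "?X * ?Y = ?X * ?X * ?Y + ?Y * ?Y * ?X" by simp
    then have "poly_op B (?X * ?Y) x = poly_op B (?X * ?X * ?Y) x + poly_op B (?Y * ?Y * ?X) x"
      by (metis poly_op_add)
    then show ?thesis using poly_op_square_nonneg[OF Y, of ?X x] poly_op_square_nonneg[OF X, of ?Y x]
      by (simp only: inner_add_left)
  qed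
  have r: "0 \<le> inner (poly_op B r x) x" for x
  proof -
    have "k mod 2 = 0 \<or> k mod 2 = 1" "m mod 2 = 0 \<or> m mod 2 = 1" by auto
    then show ?thesis using X Y XY unfolding r_def by (elim disjE) (simp_all only: power_0 power_one_right mult_1_left mult_1_right poly_op_1 inner_ge_zero)
  qed
  have "?X ^ k = ?X ^ (k div 2) * ?X ^ (k div 2) * ?X ^ (k mod 2)"
    by (metis mult_2 power_add mult_div_mod_eq)
  moreover have "?Y ^ m = ?Y ^ (m div 2) * ?Y ^ (m div 2) * ?Y ^ (m mod 2)"
    by (metis mult_2 power_add mult_div_mod_eq)
  ultimately have "?X ^ k * ?Y ^ m = q * q * r" by (simp only: q_def r_def mult_ac)
  then show ?thesis using poly_op_square_nonneg[OF r, of q x] by (simp only:)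
qed

lemma bernstein_sum_nonneg:
  assumes "\<And>k. k \<le> n \<Longrightarrow> 0 \<le> c k"
  shows "0 \<le> inner (poly_op B (\<Sum>k\<le>n. smult (c k) (bernstein_poly n k)) x) x"
  unfolding poly_op_sum inner_sum_left poly_op_smult bernstein_poly_def
  using assms bernstein_op_nonneg by (intro sum_nonneg) simp

lemma poly_op_nonneg:
  assumes "\<And>b. b \<in> {0..1} \<Longrightarrow> 0 < poly p b"
  shows "0 \<le> inner (poly_op B p x) x"
proof -
  obtain n c where c: "\<And>k. k \<le> n \<Longrightarrow> 0 \<le> c k" and p: "p = (\<Sum>k\<le>n. smult (c k) (bernstein_poly n k))"
    using positive_poly_bernstein_form[OF assms] by blast
  show ?thesis unfolding p by (rule bernstein_sum_nonneg[OF c])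
qed

text \<open>
  Apply positivity to \<open>M\<^sup>2 + e - p\<^sup>2\<close>, whose quadratic form is \<open>(M\<^sup>2 + e) |x|\<^sup>2 - |p(B) x|\<^sup>2\<close>.
\<close>

lemma poly_op_norm_le:
  assumes M: "\<And>b. b \<in> {0..1} \<Longrightarrow> \<bar>poly p b\<bar> \<le> M"
  shows "norm (poly_op B p x) \<le> M * norm x"
proof -
  have M0: "0 \<le> M" using M[of 0] by auto
  have "(norm (poly_op B p x))\<^sup>2 \<le> (M\<^sup>2 + e) * (norm x)\<^sup>2" if e: "0 < e" for e
  proof -
    have "0 \<le> inner (poly_op B ([:M\<^sup>2 + e:] - p * p) x) x"
    proof (rule poly_op_nonneg)
      fix b :: real assume "b \<in> {0..1}"
      then have "(poly p b)\<^sup>2 \<le> M\<^sup>2" using M[of b] M0 by (simp flip: abs_le_square_iff)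
      then show "0 < poly ([:M\<^sup>2 + e:] - p * p) b" using e by (simp add: power2_eq_square)
    qed
    also have "\<dots> = (M\<^sup>2 + e) * (norm x)\<^sup>2 - (norm (poly_op B p x))\<^sup>2"
      by (simp add: poly_op_diff poly_op_mult B_simps inner_diff_left poly_op_sym[of p "poly_op B p x"] dot_square_norm)
    finally show ?thesis by simp
  qed
  note E = this
  have "(norm (poly_op B p x))\<^sup>2 \<le> (M * norm x)\<^sup>2"
  proof (cases "x = 0")
    case True
    then show ?thesis by (simp add: linear_0[OF poly_op_linear])
  next
    case False
    show ?thesis
    proof (rule field_le_epsilon)
      fix e :: real assume "0 < e"
      then have "(norm (poly_op B p x))\<^sup>2 \<le> (M\<^sup>2 + e / (norm x)\<^sup>2) * (norm x)\<^sup>2"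
        using False by (intro E) simp
      also have "\<dots> = (M * norm x)\<^sup>2 + e"
        using False by (simp add: distrib_right power_mult_distrib)
      finally show "(norm (poly_op B p x))\<^sup>2 \<le> (M * norm x)\<^sup>2 + e" .
    qed
  qed
  then show ?thesis by (rule power2_le_imp_le) (simp add: M0)
qed

lemma fun_op_limit:
  assumes f: "continuous_on {0..1} f"
    and p: "uniform_limit {0..1} (\<lambda>n. poly (p n)) f sequentially"
  shows "(\<lambda>n. poly_op B (p n) x) \<longlonglongrightarrow> fun_op B f x"
proof -
  have close: "\<exists>N. \<forall>m\<ge>N. \<forall>n\<ge>N. norm (poly_op B (q m) x - poly_op B (q' n) x) < e"
    if q: "uniform_limit {0..1} (\<lambda>n. poly (q n)) f sequentially" "uniform_limit {0..1} (\<lambda>n. poly (q' n)) f sequentially"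
      and e: "0 < e" for q q' e
  proof -
    define d where "d = e / (2 * (norm x + 1))"
    have nx: "0 < norm x + 1" by (intro add_nonneg_pos) auto
    then have d: "0 < d" using e by (simp add: d_def)
    obtain N1 N2 where N: "\<And>n b. n \<ge> N1 \<Longrightarrow> b \<in> {0..1} \<Longrightarrow> dist (poly (q n) b) (f b) < d"
        "\<And>n b. n \<ge> N2 \<Longrightarrow> b \<in> {0..1} \<Longrightarrow> dist (poly (q' n) b) (f b) < d"
      using uniform_limitD[OF q(1) d] uniform_limitD[OF q(2) d] unfolding eventually_sequentially by blast
    show ?thesis
    proof (intro exI allI impI)
      fix m n assume mn: "max N1 N2 \<le> m" "max N1 N2 \<le> n"
      have "norm (poly_op B (q m - q' n) x) \<le> (2 * d) * norm x"
      proof (rule poly_op_norm_le)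
        fix b :: real assume "b \<in> {0..1}"
        then show "\<bar>poly (q m - q' n) b\<bar> \<le> 2 * d"
          using N(1)[of m b] N(2)[of n b] mn by (simp add: dist_real_def)
      qed
      also have "\<dots> < 2 * d * (norm x + 1)" using d by simp
      also have "\<dots> = e" using nx by (simp add: d_def field_simps)
      finally show "norm (poly_op B (q m) x - poly_op B (q' n) x) < e"
        by (simp add: poly_op_diff)
    qed
  qed
  let ?b = "\<lambda>n. poly_op B (bernstein_approx f n) x"
  note ub = bernstein_approx_uniform[OF f]
  have "Cauchy ?b" by (rule CauchyI) (rule close[OF ub ub])
  then have "convergent ?b" by (simp add: Cauchy_convergent_iff)
  then have b: "?b \<longlonglongrightarrow> fun_op B f x"
    unfolding fun_op_def by (rule convergent_LIMSEQ_iff[THEN iffD1])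
  have "(\<lambda>n. poly_op B (p n) x - ?b n) \<longlonglongrightarrow> 0"
  proof (rule LIMSEQ_I)
    fix e :: real assume "0 < e"
    from close[OF p ub this] show "\<exists>N. \<forall>n\<ge>N. norm (poly_op B (p n) x - ?b n - 0) < e"
      by (auto simp only: diff_zero)
  qed
  from tendsto_add[OF this b] show ?thesis by simp
qed

lemma fun_op_bernstein:
  "continuous_on {0..1} f \<Longrightarrow> (\<lambda>n. poly_op B (bernstein_approx f n) x) \<longlonglongrightarrow> fun_op B f x"
  by (rule fun_op_limit[OF _ bernstein_approx_uniform])

lemma fun_op_cong: "(\<And>b. b \<in> {0..1} \<Longrightarrow> f b = g b) \<Longrightarrow> fun_op B f x = fun_op B g x"
proof -
  assume eq: "\<And>b. b \<in> {0..1} \<Longrightarrow> f b = g b"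
  have "bernstein_approx f n = bernstein_approx g n" for n
    unfolding bernstein_approx_def
  proof (intro sum.cong refl arg_cong2[where f = smult] eq)
    fix k assume "k \<in> {..n}"
    then show "real k / real n \<in> {0..1}" by (cases "n = 0") auto
  qed
  then show ?thesis by (simp add: fun_op_def)
qed

lemma fun_op_poly: "fun_op B (poly p) x = poly_op B p x"
proof -
  have "(\<lambda>n. poly_op B p x) \<longlonglongrightarrow> fun_op B (poly p) x"
    by (rule fun_op_limit) (auto intro!: continuous_intros uniform_limitI)
  then show ?thesis by (simp add: LIMSEQ_const_iff)
qed

lemma fun_op_id: "fun_op B (\<lambda>b. b) x = B x"
proof -
  have "fun_op B (\<lambda>b. b) x = fun_op B (poly [:0, 1:]) x" by (rule fun_op_cong) simp
  then show ?thesis by (simp add: fun_op_poly B_simps)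
qed

lemma fun_op_const: "fun_op B (\<lambda>b. c) x = c *\<^sub>R x"
proof -
  have "fun_op B (\<lambda>b. c) x = fun_op B (poly [:c:]) x" by (rule fun_op_cong) simp
  then show ?thesis by (simp add: fun_op_poly B_simps)
qed

lemma fun_op_linear: assumes f: "continuous_on {0..1} f" shows "linear (fun_op B f)"
proof (rule linearI)
  show "fun_op B f (x + y) = fun_op B f x + fun_op B f y" for x y
    using tendsto_add[OF fun_op_bernstein[OF f, of x] fun_op_bernstein[OF f, of y]]
    by (intro LIMSEQ_unique[OF fun_op_bernstein[OF f]]) (simp add: linear_add[OF poly_op_linear])
  show "fun_op B f (c *\<^sub>R x) = c *\<^sub>R fun_op B f x" for c x
    using tendsto_scaleR[OF tendsto_const[of c] fun_op_bernstein[OF f, of x]]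
    by (intro LIMSEQ_unique[OF fun_op_bernstein[OF f]]) (simp add: linear_scale[OF poly_op_linear])
qed

lemma fun_op_add:
  assumes f: "continuous_on {0..1} f" and g: "continuous_on {0..1} g"
  shows "fun_op B (\<lambda>b. f b + g b) x = fun_op B f x + fun_op B g x"
proof -
  have "(\<lambda>n. poly_op B (bernstein_approx f n + bernstein_approx g n) x) \<longlonglongrightarrow> fun_op B (\<lambda>b. f b + g b) x"
  proof (rule fun_op_limit)
    have "poly (p + q) = (\<lambda>b. poly p b + poly q b)" for p q :: "real poly" by (rule ext) simp
    then show "uniform_limit {0..1} (\<lambda>n. poly (bernstein_approx f n + bernstein_approx g n)) (\<lambda>b. f b + g b) sequentially"
      by (simp only:) (intro uniform_limit_add bernstein_approx_uniform f g)
  qed (intro continuous_intros f g)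
  moreover have "(\<lambda>n. poly_op B (bernstein_approx f n + bernstein_approx g n) x) \<longlonglongrightarrow> fun_op B f x + fun_op B g x"
    unfolding poly_op_add by (intro tendsto_intros fun_op_bernstein f g)
  ultimately show ?thesis by (rule LIMSEQ_unique)
qed

lemma fun_op_mult:
  assumes f: "continuous_on {0..1} f" and g: "continuous_on {0..1} g"
  shows "fun_op B (\<lambda>b. f b * g b) x = fun_op B f (fun_op B g x)"
proof -
  let ?p = "bernstein_approx f" and ?q = "bernstein_approx g"
  note uf = bernstein_approx_uniform[OF f] and ug = bernstein_approx_uniform[OF g]
  have bd: "bounded (h ` {0..1})" if "continuous_on {0..1} h" for h :: "real \<Rightarrow> real"
    using that by (intro compact_imp_bounded compact_continuous_image) auto
  have "(\<lambda>n. poly_op B (?p n * ?q n) x) \<longlonglongrightarrow> fun_op B (\<lambda>b. f b * g b) x"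
  proof (rule fun_op_limit)
    have "poly (p * q) = (\<lambda>b. poly p b * poly q b)" for p q :: "real poly" by (rule ext) simp
    then show "uniform_limit {0..1} (\<lambda>n. poly (?p n * ?q n)) (\<lambda>b. f b * g b) sequentially"
      by (simp only:) (intro uniform_lim_mult uf ug bd f g)
  qed (intro continuous_intros f g)
  moreover have "(\<lambda>n. poly_op B (?p n * ?q n) x) \<longlonglongrightarrow> fun_op B f (fun_op B g x)"
  proof -
    obtain M where M: "\<And>b. b \<in> {0..1} \<Longrightarrow> \<bar>f b\<bar> \<le> M"
      using bd[OF f] unfolding bounded_iff by fastforce
    have "\<forall>\<^sub>F n in sequentially. \<forall>b\<in>{0..1}. dist (poly (?p n) b) (f b) < 1"
      using uniform_limitD[OF uf, of 1] by simp
    then have le: "\<forall>\<^sub>F n in sequentially. norm (poly_op B (?p n) (poly_op B (?q n) x - fun_op B g x)) \<le> (M + 1) * norm (poly_op B (?q n) x - fun_op B g x)"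
    proof eventually_elim
      case (elim n)
      have "\<bar>poly (?p n) b\<bar> \<le> M + 1" if "b \<in> {0..1}" for b
        using bspec[OF elim that] M[OF that] by (simp add: dist_real_def)
      then show ?case by (rule poly_op_norm_le)
    qed
    have "(\<lambda>n. (M + 1) * norm (poly_op B (?q n) x - fun_op B g x)) \<longlonglongrightarrow> (M + 1) * norm (fun_op B g x - fun_op B g x)"
      by (intro tendsto_intros fun_op_bernstein g)
    then have "(\<lambda>n. (M + 1) * norm (poly_op B (?q n) x - fun_op B g x)) \<longlonglongrightarrow> 0" by simp
    from Lim_null_comparison[OF le this]
    have "(\<lambda>n. poly_op B (?p n) (poly_op B (?q n) x - fun_op B g x)) \<longlonglongrightarrow> 0" .
    from tendsto_add[OF this fun_op_bernstein[OF f, of "fun_op B g x"]]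
    show ?thesis by (simp add: poly_op_mult linear_diff[OF poly_op_linear])
  qed
  ultimately show ?thesis by (rule LIMSEQ_unique)
qed

lemma fun_op_cmult: "continuous_on {0..1} f \<Longrightarrow> fun_op B (\<lambda>b. c * f b) x = c *\<^sub>R fun_op B f x"
  using fun_op_mult[of "\<lambda>_. c" f x] by (simp add: fun_op_const)

lemma fun_op_diff:
  assumes f: "continuous_on {0..1} f" and g: "continuous_on {0..1} g"
  shows "fun_op B (\<lambda>b. f b - g b) x = fun_op B f x - fun_op B g x"
proof -
  have "fun_op B (\<lambda>b. (f b - g b) + g b) x = fun_op B (\<lambda>b. f b - g b) x + fun_op B g x"
    by (intro fun_op_add continuous_intros f g)
  then show ?thesis by simp
qed

lemma fun_op_sym:
  assumes f: "continuous_on {0..1} f"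
  shows "inner (fun_op B f x) y = inner x (fun_op B f y)"
proof (rule LIMSEQ_unique)
  show "(\<lambda>n. inner (poly_op B (bernstein_approx f n) x) y) \<longlonglongrightarrow> inner (fun_op B f x) y"
    by (intro tendsto_intros fun_op_bernstein f)
  show "(\<lambda>n. inner (poly_op B (bernstein_approx f n) x) y) \<longlonglongrightarrow> inner x (fun_op B f y)"
    unfolding poly_op_sym by (intro tendsto_intros fun_op_bernstein f)
qed

lemma fun_op_nonneg:
  assumes f: "continuous_on {0..1} f" and nn: "\<And>b. b \<in> {0..1} \<Longrightarrow> 0 \<le> f b"
  shows "0 \<le> inner (fun_op B f x) x"
proof (rule LIMSEQ_le_const[OF tendsto_inner[OF fun_op_bernstein[OF f, of x] tendsto_const[of x]]])
  have "0 \<le> f (real k / real n)" if "k \<le> n" for k n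
    using that by (intro nn) (cases "n = 0"; auto)
  then show "\<exists>N. \<forall>n\<ge>N. 0 \<le> inner (poly_op B (bernstein_approx f n) x) x"
    unfolding bernstein_approx_def by (intro exI[of _ 0] allI impI bernstein_sum_nonneg) auto
qed

text \<open>
  The quadratic form of \<open>g\<^sup>2 - f\<^sup>2\<close> is the difference of the squared norms.
\<close>

lemma fun_op_norm_mono:
  assumes f: "continuous_on {0..1} f" and g: "continuous_on {0..1} g"
    and le: "\<And>b. b \<in> {0..1} \<Longrightarrow> \<bar>f b\<bar> \<le> \<bar>g b\<bar>"
  shows "norm (fun_op B f x) \<le> norm (fun_op B g x)"
proof -
  have sq: "inner (fun_op B (\<lambda>b. h b * h b) x) x = (norm (fun_op B h x))\<^sup>2" if "continuous_on {0..1} h" for h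
    using that by (simp add: fun_op_mult fun_op_sym[of h "fun_op B h x"] dot_square_norm)
  have "0 \<le> inner (fun_op B (\<lambda>b. g b * g b - f b * f b) x) x"
  proof (rule fun_op_nonneg)
    fix b :: real assume "b \<in> {0..1}"
    then have "(f b)\<^sup>2 \<le> (g b)\<^sup>2" using le[of b] by (simp flip: abs_le_square_iff)
    then show "0 \<le> g b * g b - f b * f b" by (simp add: power2_eq_square)
  qed (intro continuous_intros f g)
  also have "\<dots> = (norm (fun_op B g x))\<^sup>2 - (norm (fun_op B f x))\<^sup>2"
    by (subst fun_op_diff) (auto intro!: continuous_intros f g simp: inner_diff_left sq[OF f] sq[OF g])
  finally have "(norm (fun_op B f x))\<^sup>2 \<le> (norm (fun_op B g x))\<^sup>2" by simp
  then show ?thesis by (rule power2_le_imp_le) simp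
qed

lemma fun_op_norm_le:
  assumes f: "continuous_on {0..1} f" and le: "\<And>b. b \<in> {0..1} \<Longrightarrow> \<bar>f b\<bar> \<le> M"
  shows "norm (fun_op B f x) \<le> M * norm x"
proof -
  have M0: "0 \<le> M" using le[of 0] by auto
  have "norm (fun_op B f x) \<le> norm (fun_op B (\<lambda>_. M) x)"
    using le by (intro fun_op_norm_mono f continuous_intros) fastforce
  then show ?thesis using M0 by (simp add: fun_op_const)
qed

end

section \<open>Relaxation operators\<close>

lemma rl_scale:
  fixes a \<kappa> s :: real
  assumes k: "0 < \<kappa>" and s: "0 \<le> s"
  shows "rl a (\<lambda>t. g (\<kappa> * t)) s = \<kappa> powr (- a) * rl a g (\<kappa> * s)"
proof -
  have "(\<integral>x. indicator {0..\<kappa> * s} x *\<^sub>R ((\<kappa> * s - x) powr (a - 1) * g x) \<partial>lborel)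
      = \<bar>\<kappa>\<bar> *\<^sub>R (\<integral>x. indicator {0..\<kappa> * s} (0 + \<kappa> * x) *\<^sub>R ((\<kappa> * s - (0 + \<kappa> * x)) powr (a - 1) * g (0 + \<kappa> * x)) \<partial>lborel)"
    by (rule lborel_integral_real_affine) (use k in simp)
  also have "(\<lambda>x. indicator {0..\<kappa> * s} (0 + \<kappa> * x) *\<^sub>R ((\<kappa> * s - (0 + \<kappa> * x)) powr (a - 1) * g (0 + \<kappa> * x)))
      = (\<lambda>x. \<kappa> powr (a - 1) * (indicator {0..s} x *\<^sub>R ((s - x) powr (a - 1) * g (\<kappa> * x))))"
  proof (rule ext)
    fix x
    have "x \<le> s \<Longrightarrow> (\<kappa> * s - \<kappa> * x) powr (a - 1) = \<kappa> powr (a - 1) * (s - x) powr (a - 1)"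
      using k by (simp add: powr_mult flip: right_diff_distrib)
    then show "indicator {0..\<kappa> * s} (0 + \<kappa> * x) *\<^sub>R ((\<kappa> * s - (0 + \<kappa> * x)) powr (a - 1) * g (0 + \<kappa> * x))
      = \<kappa> powr (a - 1) * (indicator {0..s} x *\<^sub>R ((s - x) powr (a - 1) * g (\<kappa> * x)))"
      using k by (auto simp: indicator_def zero_le_mult_iff)
  qed
  also have "\<bar>\<kappa>\<bar> *\<^sub>R (\<integral>x. \<kappa> powr (a - 1) * (indicator {0..s} x *\<^sub>R ((s - x) powr (a - 1) * g (\<kappa> * x))) \<partial>lborel)
      = \<kappa> powr a * (\<integral>x. indicator {0..s} x *\<^sub>R ((s - x) powr (a - 1) * g (\<kappa> * x)) \<partial>lborel)"
  proof -
    have "\<kappa> * \<kappa> powr (a - 1) = \<kappa> powr a" using k powr_mult_base[of \<kappa> "a - 1"] by simp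
    then show ?thesis
      using k by (simp only: integral_mult_right_zero abs_of_pos real_scaleR_def[of \<kappa>] mult.assoc[symmetric, of \<kappa>])
  qed
  finally have "(LBINT t:{0..\<kappa> * s}. (\<kappa> * s - t) powr (a - 1) * g t) = \<kappa> powr a * (LBINT t:{0..s}. (s - t) powr (a - 1) * g (\<kappa> * t))"
    by (simp only: set_lebesgue_integral_def)
  then have "rl a g (\<kappa> * s) = \<kappa> powr a * rl a (\<lambda>t. g (\<kappa> * t)) s"
    by (simp add: rl_def)
  moreover have "\<kappa> powr (- a) * \<kappa> powr a = 1" using k by (simp flip: powr_add)
  ultimately show ?thesis by (simp add: mult.assoc[symmetric])
qed

lemma rl_cong_Ioc:
  assumes "f \<in> borel_measurable borel" "g \<in> borel_measurable borel"
    and "\<And>t. 0 < t \<Longrightarrow> t \<le> s \<Longrightarrow> f t = g t"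
  shows "rl a f s = rl a g s"
  unfolding rl_def
proof (intro arg_cong2[where f = "(/)"] refl set_lebesgue_integral_cong_AE)
  show "AE t\<in>{0..s} in lborel. (s - t) powr (a - 1) * f t = (s - t) powr (a - 1) * g t"
    using AE_lborel_singleton[of 0] by eventually_elim (use assms(3) in auto)
qed (use assms(1,2) in simp_all)

text \<open>
  \<open>R = M B\<close> is the inverse of the (in general unbounded) operator \<open>A\<close>.  The spectral value \<open>b\<close> of \<open>B\<close>
  corresponds to the spectral value \<open>1 / (M b)\<close> of \<open>A\<close>.
\<close>

locale fractional_resolvent = positive_contraction B
  for B :: "'h::{real_inner,banach} \<Rightarrow> 'h" +
  fixes M \<alpha> :: real
  assumes M: "0 < M" and \<alpha>: "0 < \<alpha>" "\<alpha> < 1" and inj: "B x = 0 \<Longrightarrow> x = 0"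
begin

definition R :: "'h \<Rightarrow> 'h" where "R x = M *\<^sub>R B x"

text \<open>
  \<open>E\<^sub>\<alpha>(- \<lambda> s\<^sup>\<alpha>)\<close> with \<open>\<lambda> = 1 / (M b)\<close>.  The value \<open>0\<close> at \<open>b = 0\<close> is the limit \<open>\<lambda> \<rightarrow> \<infinity>\<close>, so that the function is
  continuous in \<open>b\<close> on \<open>[0,1]\<close> for \<open>s > 0\<close>; for \<open>s \<le> 0\<close> it is the constant \<open>1\<close>, which makes \<open>S s\<close> the identity there.
\<close>

definition relaxation :: "real \<Rightarrow> real \<Rightarrow> real" where
  "relaxation s b = (if s \<le> 0 then 1 else if b \<le> 0 then 0 else ml \<alpha> (s * (M * b) powr (- 1 / \<alpha>)))"

definition S :: "real \<Rightarrow> 'h \<Rightarrow> 'h" where "S s = fun_op B (relaxation s)"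

lemma a1: "\<alpha> \<le> 1" using \<alpha> by simp

lemma R_linear: "linear R"
  unfolding R_def[abs_def] using lin by (intro linear_compose_scale_right)

lemmas R_simps = linear_add[OF R_linear] linear_diff[OF R_linear] linear_0[OF R_linear] linear_scale[OF R_linear]

lemma R_norm: "norm (R x) \<le> M * norm x"
  using contr[of x] M by (simp add: R_def)

lemma R_bounded_linear: "bounded_linear R"
  using R_linear R_norm by (auto simp: bounded_linear_def bounded_linear_axioms_def mult.commute)

lemma R_sym: "inner (R x) y = inner x (R y)"
  by (simp add: R_def sym)

lemma R_inj: "R x = R y \<Longrightarrow> x = y"
  using inj[of "x - y"] M by (simp add: R_def B_simps)

lemma relaxation_bounds: "0 \<le> relaxation s b" "relaxation s b \<le> 1"
proof -
  have "0 < ml \<alpha> (s * (M * b) powr (- 1 / \<alpha>))" "ml \<alpha> (s * (M * b) powr (- 1 / \<alpha>)) \<le> 1" if "0 < s"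
    using that \<alpha> a1 by (auto intro!: ml_pos ml_le_1 mult_nonneg_nonneg)
  then show "0 \<le> relaxation s b" "relaxation s b \<le> 1" by (auto simp: relaxation_def not_le less_imp_le)
qed

lemma relaxation_decay: "0 < s \<Longrightarrow> 0 \<le> b \<Longrightarrow> relaxation s b \<le> Gamma (\<alpha> + 1) * s powr (- \<alpha>) * (M * b)"
proof (cases "b = 0")
  case False
  assume s: "0 < s" and "0 \<le> b"
  with False M have b: "0 < b" "0 < M * b" by simp_all
  let ?k = "(M * b) powr (- 1 / \<alpha>)"
  have "(s * ?k) powr \<alpha> * ml \<alpha> (s * ?k) \<le> Gamma (\<alpha> + 1)"
    using s \<alpha> a1 by (intro ml_decay) auto
  moreover have "(s * ?k) powr \<alpha> = s powr \<alpha> / (M * b)"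
  proof -
    have "?k powr \<alpha> = (M * b) powr (- 1)"
      using \<alpha> by (simp only: powr_powr) simp
    also have "\<dots> = 1 / (M * b)"
      using b powr_minus_divide[of "M * b" 1] by (simp only: powr_one)
    finally show ?thesis using s by (simp add: powr_mult del: powr_powr)
  qed
  ultimately have "ml \<alpha> (s * ?k) \<le> Gamma (\<alpha> + 1) / (s powr \<alpha>) * (M * b)"
    using s b by (simp add: field_simps)
  then show ?thesis using s b by (simp add: relaxation_def powr_minus_divide)
qed (simp add: relaxation_def)

lemma relaxation_continuous: "continuous_on {0..1} (relaxation s)"
proof (cases "s \<le> 0")
  case True
  then have "relaxation s = (\<lambda>_. 1)" by (rule_tac ext) (simp add: relaxation_def)
  then show ?thesis by simp
next
  case False
  show ?thesis unfolding continuous_on_def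
  proof
    fix b :: real assume b: "b \<in> {0..1}"
    show "(relaxation s \<longlongrightarrow> relaxation s b) (at b within {0..1})"
    proof (cases "b = 0")
      case True
      have "((\<lambda>x. Gamma (\<alpha> + 1) * s powr (- \<alpha>) * (M * x)) \<longlongrightarrow> Gamma (\<alpha> + 1) * s powr (- \<alpha>) * (M * 0)) (at 0 within {0..1})"
        by (intro tendsto_intros)
      then have "((\<lambda>x. Gamma (\<alpha> + 1) * s powr (- \<alpha>) * (M * x)) \<longlongrightarrow> 0) (at 0 within {0..1})" by simp
      then have "(relaxation s \<longlongrightarrow> 0) (at 0 within {0..1})"
        by (rule Lim_null_comparison[rotated])
           (use relaxation_bounds relaxation_decay False in \<open>auto simp: eventually_at intro!: exI[of _ 1]\<close>)
      then show ?thesis using True False by (simp add: relaxation_def)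
    next
      case bn: False
      with b have b: "0 < b" by simp
      have "continuous_on {0<..} (\<lambda>x. ml \<alpha> (s * (M * x) powr (- 1 / \<alpha>)))"
        by (intro continuous_on_compose2[OF ml_continuous[OF \<alpha>(1), of UNIV]] continuous_intros) (use M in auto)
      then have "continuous_on {0<..} (relaxation s)"
        by (rule continuous_on_cong[THEN iffD1, rotated 2]) (use False in \<open>auto simp: relaxation_def\<close>)
      then have "isCont (relaxation s) b" using b by (simp add: continuous_on_eq_continuous_at)
      then show ?thesis unfolding isCont_def by (rule tendsto_within_subset) simp
    qed
  qed
qed

lemma relaxation_measurable: "(\<lambda>s. relaxation s b) \<in> borel_measurable borel"
proof -
  have "(\<lambda>s. ml \<alpha> (s * (M * b) powr (- 1 / \<alpha>))) \<in> borel_measurable borel"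
    by (intro borel_measurable_continuous_onI continuous_on_compose2[OF ml_continuous[OF \<alpha>(1), of UNIV]] continuous_intros) auto
  then have "(\<lambda>s. if s \<le> 0 then 1 else if b \<le> 0 then 0 else ml \<alpha> (s * (M * b) powr (- 1 / \<alpha>))) \<in> borel_measurable borel"
    by (intro measurable_If borel_measurable_const) auto
  then show ?thesis by (simp only: relaxation_def)
qed

text \<open>
  The scaling \<open>s \<mapsto> \<lambda>\<^bsup>1/\<alpha>\<^esup> s\<close> reduces the equation to the one for \<open>ml\<close>.  Multiplied by \<open>M b = 1 / \<lambda>\<close> it
  makes sense at \<open>b = 0\<close> as well.
\<close>

lemma relaxation_volterra:
  assumes s: "0 \<le> s" and b: "0 \<le> b"
  shows "M * b * relaxation s b - M * b = - rl \<alpha> (\<lambda>t. relaxation t b) s"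
proof (cases "b = 0")
  case True
  have "rl \<alpha> (\<lambda>t. relaxation t b) s = rl \<alpha> (\<lambda>t. 0) s"
    by (rule rl_cong_Ioc) (use True relaxation_measurable in \<open>auto simp: relaxation_def\<close>)
  then show ?thesis using True by (simp add: rl_def)
next
  case False
  with b M have b: "0 < b" "0 < M * b" by simp_all
  let ?k = "(M * b) powr (- 1 / \<alpha>)"
  have h: "relaxation t b = ml \<alpha> (?k * t)" if "0 \<le> t" for t
    using that b ml_0[OF \<alpha>(1)] by (cases "t = 0") (auto simp: relaxation_def mult.commute)
  have "rl \<alpha> (\<lambda>t. relaxation t b) s = rl \<alpha> (\<lambda>t. ml \<alpha> (?k * t)) s"
    by (rule rl_cong) (simp add: h)
  also have "\<dots> = ?k powr (- \<alpha>) * rl \<alpha> (ml \<alpha>) (?k * s)"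
    using b s by (intro rl_scale) auto
  also have "?k powr (- \<alpha>) = M * b" using b \<alpha> by (simp add: powr_powr)
  also have "rl \<alpha> (ml \<alpha>) (?k * s) = 1 - ml \<alpha> (?k * s)"
    using ml_volterra[OF \<alpha>(1), of "?k * s"] s by simp
  finally show ?thesis using h[OF s] by (simp add: algebra_simps)
qed

lemma S_linear: "linear (S s)"
  unfolding S_def by (rule fun_op_linear[OF relaxation_continuous])

lemmas S_simps = linear_add[OF S_linear] linear_diff[OF S_linear] linear_0[OF S_linear] linear_scale[OF S_linear]

lemma S_nonpos [simp]: "s \<le> 0 \<Longrightarrow> S s x = x"
proof -
  assume "s \<le> 0"
  then have "S s x = fun_op B (\<lambda>_. 1) x" unfolding S_def by (intro fun_op_cong) (simp add: relaxation_def)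
  then show ?thesis by (simp add: fun_op_const)
qed

lemma S_norm: "norm (S s x) \<le> norm x"
  using fun_op_norm_le[OF relaxation_continuous, of s 1 x] relaxation_bounds by (simp add: S_def)

lemma R_fun: "R x = fun_op B (\<lambda>b. M * b) x"
  by (subst fun_op_cmult) (auto simp: R_def fun_op_id)

lemma RS_fun: "R (S s x) = fun_op B (\<lambda>b. M * b * relaxation s b) x"
  unfolding R_fun S_def by (subst fun_op_mult) (auto intro!: continuous_intros relaxation_continuous)

lemma RS_commute: "R (S s x) = S s (R x)"
proof -
  have "S s (R x) = fun_op B (\<lambda>b. relaxation s b * (M * b)) x"
    unfolding R_fun S_def by (subst fun_op_mult) (auto intro!: continuous_intros relaxation_continuous)
  then show ?thesis unfolding RS_fun by (simp add: mult.commute)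
qed

lemma S_decay:
  assumes s: "0 < s"
  shows "norm (S s x) \<le> Gamma (\<alpha> + 1) * s powr (- \<alpha>) * norm (R x)"
proof -
  let ?C = "Gamma (\<alpha> + 1) * s powr (- \<alpha>)"
  have C: "0 \<le> ?C" using \<alpha> by (simp add: less_imp_le)
  have "norm (S s x) \<le> norm (fun_op B (\<lambda>b. ?C * (M * b)) x)"
    unfolding S_def
  proof (rule fun_op_norm_mono[OF relaxation_continuous])
    fix b :: real assume "b \<in> {0..1}"
    then have "\<bar>relaxation s b\<bar> \<le> ?C * (M * b)" using relaxation_bounds relaxation_decay[OF s, of b] by simp
    then show "\<bar>relaxation s b\<bar> \<le> \<bar>?C * (M * b)\<bar>" by simp
  qed (intro continuous_intros)
  also have "fun_op B (\<lambda>b. ?C * (M * b)) x = ?C *\<^sub>R R x"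
    unfolding R_fun by (rule fun_op_cmult) (intro continuous_intros)
  finally show ?thesis using C by simp
qed

text \<open>
  \<open>M b \<cdot> relaxation\<close> is an Abel integral of a function with values in \<open>[0,1]\<close> and hence Hoelder continuous in \<open>s\<close>,
  uniformly in \<open>b\<close>.  This fails for \<open>relaxation\<close> itself.
\<close>

lemma RS_holder:
  "norm (R (S s x) - R (S s' x)) \<le> 2 * \<bar>s - s'\<bar> powr \<alpha> / Gamma (\<alpha> + 1) * norm x"
proof -
  have *: "\<bar>M * b * relaxation u b - M * b * relaxation v b\<bar> \<le> 2 * (v - u) powr \<alpha> / Gamma (\<alpha> + 1)"
    if b: "b \<in> {0..1}" and uv: "0 \<le> u" "u \<le> v" for b u v
  proof -
    have "M * b * relaxation u b - M * b * relaxation v b = rl \<alpha> (\<lambda>t. relaxation t b) v - rl \<alpha> (\<lambda>t. relaxation t b) u"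
      using relaxation_volterra[of u b] relaxation_volterra[of v b] uv b by simp
    then show ?thesis using rl_holder[OF \<alpha>(1) a1 relaxation_measurable[of b] uv, of 1] relaxation_bounds by simp
  qed
  have "\<bar>M * b * relaxation s b - M * b * relaxation s' b\<bar> \<le> 2 * \<bar>s - s'\<bar> powr \<alpha> / Gamma (\<alpha> + 1)" if b: "b \<in> {0..1}" for b
  proof -
    have m: "relaxation u b = relaxation (max 0 u) b" for u by (simp add: relaxation_def max_def)
    have "\<bar>M * b * relaxation (max 0 s) b - M * b * relaxation (max 0 s') b\<bar> \<le> 2 * \<bar>max 0 s - max 0 s'\<bar> powr \<alpha> / Gamma (\<alpha> + 1)"
    proof -
      have "\<bar>M * b * relaxation u b - M * b * relaxation v b\<bar> \<le> 2 * \<bar>u - v\<bar> powr \<alpha> / Gamma (\<alpha> + 1)" if "0 \<le> u" "0 \<le> v" for u v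
      proof (cases "u \<le> v")
        case True
        then show ?thesis using *[OF b that(1) True] by simp
      next
        case False
        then have "v \<le> u" by simp
        from *[OF b that(2) this] show ?thesis
          using False abs_minus_commute[of "M * b * relaxation u b"] by simp
      qed
      then show ?thesis by simp
    qed
    also have "\<dots> \<le> 2 * \<bar>s - s'\<bar> powr \<alpha> / Gamma (\<alpha> + 1)"
      using \<alpha> by (intro divide_right_mono mult_left_mono powr_mono2) auto
    finally show ?thesis using m[of s] m[of s'] by simp
  qed
  then have "norm (fun_op B (\<lambda>b. M * b * relaxation s b - M * b * relaxation s' b) x) \<le> 2 * \<bar>s - s'\<bar> powr \<alpha> / Gamma (\<alpha> + 1) * norm x"
    by (intro fun_op_norm_le continuous_intros relaxation_continuous)
  then show ?thesis unfolding RS_fun by (subst (asm) fun_op_diff) (auto intro!: continuous_intros relaxation_continuous)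
qed

text \<open>
  An injective symmetric operator has dense range.  The resolvents \<open>r n = (1 + n B)\<^sup>-\<^sup>1 x\<close> satisfy \<open>x - r n = n B (r n)\<close>,
  which lies in the range.  They converge because their norms decrease, and \<open>B (r n) \<rightarrow> 0\<close> forces the limit
  into the kernel of \<open>B\<close>.
\<close>

lemma range_R_dense: assumes e: "0 < e" shows "\<exists>z. norm (x - R z) < e"
proof -
  define g where "g n b = 1 / (1 + real n * b)" for n b
  have pos1: "0 < 1 + real n * b" if "b \<in> {0..1}" for n b
    using that by (intro add_pos_nonneg) auto
  have gc: "continuous_on {0..1} (g n)" for n
    unfolding g_def using pos1[of _ n] by (intro continuous_intros) force
  define r where "r n = fun_op B (g n) x" for n
  have sq: "inner (fun_op B (\<lambda>b. h b * h b) x) x = (norm (fun_op B h x))\<^sup>2" if "continuous_on {0..1} h" for h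
    using that by (simp add: fun_op_mult fun_op_sym[of h "fun_op B h x"] dot_square_norm)
  have diff: "(norm (r n - r m))\<^sup>2 \<le> (norm (r n))\<^sup>2 - (norm (r m))\<^sup>2" if "n \<le> m" for n m
  proof -
    have "0 \<le> inner (fun_op B (\<lambda>b. (g n b * g n b - g m b * g m b) - (g n b - g m b) * (g n b - g m b)) x) x"
    proof (rule fun_op_nonneg)
      fix b :: real assume b: "b \<in> {0..1}"
      have "g m b \<le> g n b" unfolding g_def
        using pos1[OF b] b that by (intro divide_left_mono) (auto intro!: mult_right_mono)
      moreover have "0 \<le> g m b" using pos1[OF b, of m] by (simp add: g_def)
      ultimately have "0 \<le> 2 * (g m b * (g n b - g m b))" by simp
      also have "\<dots> = (g n b * g n b - g m b * g m b) - (g n b - g m b) * (g n b - g m b)"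
        by (simp add: algebra_simps)
      finally show "0 \<le> (g n b * g n b - g m b * g m b) - (g n b - g m b) * (g n b - g m b)" .
    qed (intro continuous_intros gc)
    also have "\<dots> = (norm (r n))\<^sup>2 - (norm (r m))\<^sup>2 - (norm (fun_op B (\<lambda>b. g n b - g m b) x))\<^sup>2"
      unfolding r_def
      by (simp add: fun_op_diff continuous_intros gc inner_diff_left sq)
    finally show ?thesis by (simp add: fun_op_diff gc r_def)
  qed
  have "decseq (\<lambda>n. (norm (r n))\<^sup>2)"
    unfolding decseq_def using diff by (metis diff_ge_0_iff_ge order_trans zero_le_power2)
  then obtain L where L: "(\<lambda>n. (norm (r n))\<^sup>2) \<longlonglongrightarrow> L"
    using decseq_convergent[of "\<lambda>n. (norm (r n))\<^sup>2" 0] by auto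
  have "Cauchy r"
  proof (rule metric_CauchyI)
    fix e :: real assume e: "0 < e"
    have "Cauchy (\<lambda>n. (norm (r n))\<^sup>2)" using L by (rule LIMSEQ_imp_Cauchy)
    then obtain N where N: "\<And>m n. m \<ge> N \<Longrightarrow> n \<ge> N \<Longrightarrow> \<bar>(norm (r m))\<^sup>2 - (norm (r n))\<^sup>2\<bar> < e\<^sup>2"
      using e unfolding Cauchy_def dist_real_def by (meson zero_less_power)
    have *: "dist (r n) (r m) < e" if "n \<ge> N" "n \<le> m" for m n
    proof -
      have "(norm (r n - r m))\<^sup>2 < e\<^sup>2" using diff[OF that(2)] N[of n m] that by linarith
      then show ?thesis using e by (simp add: dist_norm power2_less_imp_less)
    qed
    show "\<exists>N. \<forall>m\<ge>N. \<forall>n\<ge>N. dist (r m) (r n) < e"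
      using * by (metis dist_commute nle_le)
  qed
  then obtain r0 where r0: "r \<longlonglongrightarrow> r0" using Cauchy_convergent_iff convergent_def by blast
  have Bbl: "bounded_linear B"
    using lin contr by (auto simp: bounded_linear_def bounded_linear_axioms_def intro!: exI[of _ 1])
  have "(\<lambda>n. B (r n)) \<longlonglongrightarrow> B r0" by (rule bounded_linear.tendsto[OF Bbl r0])
  moreover have "(\<lambda>n. B (r n)) \<longlonglongrightarrow> 0"
  proof (rule Lim_null_comparison)
    have "norm (B (r n)) \<le> 1 / real n * norm x" if n: "n > 0" for n
    proof -
      have "B (r n) = fun_op B (\<lambda>b. b * g n b) x"
        by (subst fun_op_mult) (auto intro!: gc continuous_intros simp: fun_op_id r_def)
      moreover have "norm (fun_op B (\<lambda>b. b * g n b) x) \<le> 1 / real n * norm x"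
      proof (rule fun_op_norm_le)
        fix b :: real assume b: "b \<in> {0..1}"
        have "real n * b \<le> 1 + real n * b" by simp
        then show "\<bar>b * g n b\<bar> \<le> 1 / real n"
          using pos1[OF b, of n] b n by (simp add: g_def field_simps)
      qed (intro continuous_intros gc)
      ultimately show ?thesis by simp
    qed
    then show "\<forall>\<^sub>F n in sequentially. norm (B (r n)) \<le> 1 / real n * norm x"
      by (auto simp: eventually_sequentially intro!: exI[of _ 1])
    have "(\<lambda>n. 1 / real n * norm x) \<longlonglongrightarrow> 0 * norm x" by (intro tendsto_intros lim_1_over_n)
    then show "(\<lambda>n. 1 / real n * norm x) \<longlonglongrightarrow> 0" by simp
  qed
  ultimately have "r0 = 0" using inj LIMSEQ_unique by blast
  with r0 e obtain n where n: "norm (r n) < e"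
    unfolding lim_sequentially by (metis dist_0_norm dist_commute order_refl)
  have "R ((real n / M) *\<^sub>R r n) = real n *\<^sub>R B (r n)" using M by (simp add: R_def B_simps)
  moreover have "x - real n *\<^sub>R B (r n) = r n"
  proof -
    have "x - real n *\<^sub>R B (r n) = fun_op B (\<lambda>b. 1 - real n * (b * g n b)) x"
      by (simp add: fun_op_diff fun_op_const fun_op_cmult fun_op_mult fun_op_id continuous_intros gc r_def)
    also have "\<dots> = r n" unfolding r_def
    proof (rule fun_op_cong)
      fix b :: real assume b: "b \<in> {0..1}"
      show "1 - real n * (b * g n b) = g n b" using pos1[OF b, of n] by (simp add: g_def field_simps)
    qed
    finally show ?thesis .
  qed
  ultimately show ?thesis using n by metis
qed

end

lemma norm_diff_add_le: "norm (x - y + z) \<le> norm x + norm y + norm (z :: 'a::real_normed_vector)"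
  using norm_triangle_ineq[of "x - y" z] norm_triangle_ineq4[of x y] by linarith

context fractional_resolvent
begin

text \<open>
  On the range of \<open>R\<close> this is the uniform Hoelder estimate; the range is dense and the operators \<open>S s\<close> are
  contractions.
\<close>

lemma S_continuous: "continuous_on A (\<lambda>s. S s x)"
proof (rule continuous_at_imp_continuous_on, rule ballI)
  fix s0
  show "isCont (\<lambda>s. S s x) s0"
    unfolding isCont_def tendsto_iff
  proof (intro allI impI)
    fix e :: real assume e: "0 < e"
    obtain z where z: "norm (x - R z) < e / 4" using range_R_dense[of "e / 4" x] e by auto
    have "((\<lambda>s. \<bar>s - s0\<bar>) \<longlongrightarrow> \<bar>s0 - s0\<bar>) (at s0)" by (intro tendsto_intros)
    then have "((\<lambda>s. \<bar>s - s0\<bar> powr \<alpha>) \<longlongrightarrow> 0) (at s0)"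
      using \<alpha> tendsto_powr2[of "\<lambda>u. \<bar>u - s0\<bar>" 0 "at s0" "\<lambda>_. \<alpha>" \<alpha>] by simp
    then have "((\<lambda>s. \<bar>s - s0\<bar> powr \<alpha> * (2 / Gamma (\<alpha> + 1) * norm z)) \<longlongrightarrow> 0 * (2 / Gamma (\<alpha> + 1) * norm z)) (at s0)"
      by (intro tendsto_mult tendsto_const)
    then have "\<forall>\<^sub>F s in at s0. \<bar>s - s0\<bar> powr \<alpha> * (2 / Gamma (\<alpha> + 1) * norm z) < e / 2"
      using e by (intro order_tendstoD(2)) auto
    then have "\<forall>\<^sub>F s in at s0. 2 * \<bar>s - s0\<bar> powr \<alpha> / Gamma (\<alpha> + 1) * norm z < e / 2"
      by (simp add: mult_ac)
    then show "\<forall>\<^sub>F s in at s0. dist (S s x) (S s0 x) < e"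
    proof eventually_elim
      case (elim s)
      have "norm (S s x - S s0 x) = norm (S s (x - R z) - S s0 (x - R z) + (R (S s z) - R (S s0 z)))"
        by (simp add: S_simps RS_commute)
      also have "\<dots> \<le> norm (S s (x - R z)) + norm (S s0 (x - R z)) + norm (R (S s z) - R (S s0 z))"
        by (rule norm_diff_add_le)
      also have "\<dots> < e / 4 + e / 4 + e / 2"
        using S_norm[of s "x - R z"] S_norm[of s0 "x - R z"] RS_holder[of s z s0] z elim by linarith
      finally show ?case by (simp add: dist_norm)
    qed
  qed
qed

lemma S_continuous_joint:
  assumes "continuous_on A g" "continuous_on A f"
  shows "continuous_on A (\<lambda>p. S (g p) (f p))"
  unfolding continuous_on_def
proof
  fix p assume p: "p \<in> A"
  have g: "(g \<longlongrightarrow> g p) (at p within A)" and f: "(f \<longlongrightarrow> f p) (at p within A)"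
    using assms p by (auto simp: continuous_on_def)
  have "((\<lambda>q. S (g q) (f q) - S (g q) (f p)) \<longlongrightarrow> 0) (at p within A)"
  proof (rule Lim_null_comparison)
    show "\<forall>\<^sub>F q in at p within A. norm (S (g q) (f q) - S (g q) (f p)) \<le> norm (f q - f p)"
      using S_norm by (auto simp flip: S_simps)
    show "((\<lambda>q. norm (f q - f p)) \<longlongrightarrow> 0) (at p within A)"
      using f by (simp add: LIM_zero_iff tendsto_norm_zero_iff)
  qed
  moreover have "((\<lambda>q. S (g q) (f p)) \<longlongrightarrow> S (g p) (f p)) (at p within A)"
    using S_continuous[of UNIV "f p"] g
    by (intro isCont_tendsto_compose[of "g p" "\<lambda>s. S s (f p)"]) (auto simp: continuous_on_eq_continuous_at)
  ultimately show "((\<lambda>q. S (g q) (f q)) \<longlongrightarrow> S (g p) (f p)) (at p within A)"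
    using tendsto_add by fastforce
qed

lemma S_inner_measurable: "(\<lambda>s. inner (S s x) y) \<in> borel_measurable borel"
  by (intro borel_measurable_continuous_onI continuous_intros S_continuous)

text \<open>
  For a Bernstein polynomial the calculus is a finite linear combination of point evaluations, for which the
  scalar equation applies term by term; the passage to the limit is dominated by the Abel kernel.
\<close>

lemma S_volterra:
  assumes s: "0 \<le> s"
  shows "inner (R (S s x) - R x) y = - rl \<alpha> (\<lambda>t. inner (S t x) y) s"
proof -
  \<comment> \<open>the weight of the evaluation at \<open>k / n\<close> in the bilinear form of the Bernstein polynomial of degree \<open>n\<close>\<close>
  define w where "w n k = inner (poly_op B (bernstein_poly n k) x) y" for n k
  define \<Phi> where "\<Phi> n f = inner (poly_op B (bernstein_approx f n) x) y" for n f
  have \<Phi>: "\<Phi> n f = (\<Sum>k\<le>n. f (real k / real n) * w n k)" for n f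
    by (simp add: \<Phi>_def w_def bernstein_approx_def poly_op_sum poly_op_smult inner_sum_left)
  have lim: "(\<lambda>n. \<Phi> n f) \<longlonglongrightarrow> inner (fun_op B f x) y" if "continuous_on {0..1} f" for f
    unfolding \<Phi>_def by (intro tendsto_intros fun_op_bernstein that)
  have bound: "\<bar>\<Phi> n f\<bar> \<le> norm x * norm y" if f: "\<And>b. 0 \<le> f b \<and> f b \<le> 1" for n f
  proof -
    have "norm (poly_op B (bernstein_approx f n) x) \<le> 1 * norm x"
    proof (rule poly_op_norm_le)
      fix b :: real assume b: "b \<in> {0..1}"
      have "0 \<le> (\<Sum>k\<le>n. f (real k / real n) * Bernstein n k b)"
        using b f by (intro sum_nonneg mult_nonneg_nonneg Bernstein_nonneg) auto
      moreover have "(\<Sum>k\<le>n. f (real k / real n) * Bernstein n k b) \<le> (\<Sum>k\<le>n. 1 * Bernstein n k b)"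
        using b f by (intro sum_mono mult_right_mono Bernstein_nonneg) auto
      ultimately show "\<bar>poly (bernstein_approx f n) b\<bar> \<le> 1"
        by (simp add: bernstein_approx_def poly_sum poly_bernstein_poly)
    qed
    then have "norm (poly_op B (bernstein_approx f n) x) * norm y \<le> norm x * norm y"
      by (intro mult_right_mono) auto
    then show ?thesis unfolding \<Phi>_def using Cauchy_Schwarz_ineq2[of "poly_op B (bernstein_approx f n) x" y] by linarith
  qed
  have meas: "(\<lambda>t. \<Phi> n (relaxation t)) \<in> borel_measurable borel" for n
    unfolding \<Phi> by (intro borel_measurable_sum borel_measurable_times relaxation_measurable borel_measurable_const)
  have int: "set_integrable lborel {0..s} (\<lambda>t. (s - t) powr (\<alpha> - 1) * relaxation t b)" for b
    using s \<alpha> relaxation_bounds by (intro abel_integrand_integrable[where C = 1] relaxation_measurable) auto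
  have "\<Phi> n (\<lambda>b. M * b * relaxation s b - M * b) = - rl \<alpha> (\<lambda>t. \<Phi> n (relaxation t)) s" for n
  proof -
    have "rl \<alpha> (\<lambda>t. \<Sum>k\<le>m. relaxation t (real k / real n) * w n k) s = (\<Sum>k\<le>m. rl \<alpha> (\<lambda>t. relaxation t (real k / real n)) s * w n k)" for m
    proof (induction m)
      case 0
      show ?case using rl_cmult[of \<alpha> "w n 0" "\<lambda>t. relaxation t 0" s] by (simp add: mult.commute)
    next
      case (Suc m)
      have i: "set_integrable lborel {0..s} (\<lambda>t. (s - t) powr (\<alpha> - 1) * (relaxation t (real k / real n) * w n k))" for k
        using set_integrable_mult_left[of "w n k" lborel "{0..s}", OF int[of "real k / real n"]] by (simp only: mult.assoc)
      have "set_integrable lborel {0..s} (\<lambda>t. \<Sum>k\<le>m. (s - t) powr (\<alpha> - 1) * (relaxation t (real k / real n) * w n k))"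
        unfolding set_integrable_def scaleR_sum_right by (intro Bochner_Integration.integrable_sum) (use i in \<open>simp only: set_integrable_def\<close>)
      then have "set_integrable lborel {0..s} (\<lambda>t. (s - t) powr (\<alpha> - 1) * (\<Sum>k\<le>m. relaxation t (real k / real n) * w n k))"
        by (simp only: sum_distrib_left)
      from rl_add[OF this i[of "Suc m"]]
      show ?case using Suc.IH rl_cmult[of \<alpha> "w n (Suc m)" "\<lambda>t. relaxation t (real (Suc m) / real n)" s]
        by (simp only: sum.atMost_Suc mult.commute)
    qed
    then have "- rl \<alpha> (\<lambda>t. \<Phi> n (relaxation t)) s = (\<Sum>k\<le>n. - rl \<alpha> (\<lambda>t. relaxation t (real k / real n)) s * w n k)"
      by (simp only: \<Phi> sum_negf minus_mult_left[symmetric])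
    also have "\<dots> = (\<Sum>k\<le>n. (M * (real k / real n) * relaxation s (real k / real n) - M * (real k / real n)) * w n k)"
      by (intro sum.cong refl arg_cong2[where f = "(*)"] relaxation_volterra[symmetric] s) simp
    finally show ?thesis by (simp only: \<Phi>)
  qed
  moreover have "(\<lambda>n. \<Phi> n (\<lambda>b. M * b * relaxation s b - M * b)) \<longlonglongrightarrow> inner (R (S s x) - R x) y"
  proof -
    have "fun_op B (\<lambda>b. M * b * relaxation s b - M * b) x = R (S s x) - R x"
      unfolding RS_fun R_fun[of x] by (rule fun_op_diff) (intro continuous_intros relaxation_continuous)+
    moreover have "(\<lambda>n. \<Phi> n (\<lambda>b. M * b * relaxation s b - M * b)) \<longlonglongrightarrow> inner (fun_op B (\<lambda>b. M * b * relaxation s b - M * b) x) y"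
      by (intro lim continuous_intros relaxation_continuous)
    ultimately show ?thesis by simp
  qed
  moreover have "(\<lambda>n. rl \<alpha> (\<lambda>t. \<Phi> n (relaxation t)) s) \<longlonglongrightarrow> rl \<alpha> (\<lambda>t. inner (S t x) y) s"
    unfolding rl_def set_lebesgue_integral_def
  proof (intro tendsto_divide tendsto_const integral_dominated_convergence)
    let ?w = "\<lambda>t. (norm x * norm y) * (indicator {0..s} t *\<^sub>R (s - t) powr (\<alpha> - 1))"
    show "integrable lborel ?w"
      using abel_kernel_set_integral(1)[OF \<alpha>(1) s] unfolding set_integrable_def by (rule integrable_mult_right)
    show "(\<lambda>t. indicator {0..s} t *\<^sub>R ((s - t) powr (\<alpha> - 1) * inner (S t x) y)) \<in> borel_measurable lborel"
      using S_inner_measurable by simp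
    show "(\<lambda>t. indicator {0..s} t *\<^sub>R ((s - t) powr (\<alpha> - 1) * \<Phi> n (relaxation t))) \<in> borel_measurable lborel" for n
      using meas by simp
    show "AE t in lborel. (\<lambda>n. indicator {0..s} t *\<^sub>R ((s - t) powr (\<alpha> - 1) * \<Phi> n (relaxation t)))
        \<longlonglongrightarrow> indicator {0..s} t *\<^sub>R ((s - t) powr (\<alpha> - 1) * inner (S t x) y)"
      unfolding S_def by (intro AE_I2 tendsto_intros lim relaxation_continuous)
    show "AE t in lborel. norm (indicator {0..s} t *\<^sub>R ((s - t) powr (\<alpha> - 1) * \<Phi> n (relaxation t))) \<le> ?w t" for n
    proof (intro AE_I2)
      fix t
      have "\<bar>\<Phi> n (relaxation t)\<bar> \<le> norm x * norm y" by (rule bound) (simp add: relaxation_bounds)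
      then have "indicator {0..s} t * (s - t) powr (\<alpha> - 1) * \<bar>\<Phi> n (relaxation t)\<bar> \<le> indicator {0..s} t * (s - t) powr (\<alpha> - 1) * (norm x * norm y)"
        by (intro mult_left_mono) auto
      then show "norm (indicator {0..s} t *\<^sub>R ((s - t) powr (\<alpha> - 1) * \<Phi> n (relaxation t))) \<le> ?w t"
        by (simp add: abs_mult mult_ac)
    qed
  qed (use \<alpha> in simp)
  ultimately show ?thesis
    using LIMSEQ_unique[OF _ tendsto_minus] by fastforce
qed

text \<open>
  Smoothing.  For \<open>x = R z\<close> the preimage is \<open>S s z\<close>, bounded by \<open>s\<^sup>-\<^sup>\<alpha>\<close> times the norm of \<open>R z\<close>; approximate
  a general \<open>x\<close> by such vectors.
\<close>

lemma S_in_range: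
  assumes s: "0 < s"
  shows "\<exists>g. R g = S s x \<and> norm g \<le> Gamma (\<alpha> + 1) * s powr (- \<alpha>) * norm x"
proof -
  let ?C = "Gamma (\<alpha> + 1) * s powr (- \<alpha>)"
  have C: "0 \<le> ?C" using \<alpha> by (simp add: less_imp_le)
  have "\<exists>z. norm (x - R z) < 1 / real (Suc n)" for n by (rule range_R_dense) simp
  then obtain z where z: "\<And>n. norm (x - R (z n)) < 1 / real (Suc n)" by metis
  have Rz: "(\<lambda>n. R (z n)) \<longlonglongrightarrow> x"
  proof -
    have "(\<lambda>n. x - R (z n)) \<longlonglongrightarrow> 0"
    proof (rule Lim_null_comparison)
      show "\<forall>\<^sub>F n in sequentially. norm (x - R (z n)) \<le> 1 / real (Suc n)"
        using z by (intro always_eventually allI less_imp_le)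
      show "(\<lambda>n. 1 / real (Suc n)) \<longlonglongrightarrow> 0" by (rule LIMSEQ_Suc[OF lim_1_over_n])
    qed
    from tendsto_diff[OF tendsto_const[of x] this] show ?thesis by simp
  qed
  have "Cauchy (\<lambda>n. S s (z n))"
  proof (rule metric_CauchyI)
    fix e :: real assume e: "0 < e"
    have "Cauchy (\<lambda>n. R (z n))" using Rz by (rule LIMSEQ_imp_Cauchy)
    then obtain N where N: "\<And>m n. m \<ge> N \<Longrightarrow> n \<ge> N \<Longrightarrow> norm (R (z m) - R (z n)) < e / (?C + 1)"
      using e C unfolding Cauchy_def dist_norm by (meson add_nonneg_pos divide_pos_pos zero_less_one)
    show "\<exists>N. \<forall>m\<ge>N. \<forall>n\<ge>N. dist (S s (z m)) (S s (z n)) < e"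
    proof (intro exI allI impI)
      fix m n assume mn: "N \<le> m" "N \<le> n"
      have "norm (S s (z m) - S s (z n)) \<le> ?C * norm (R (z m) - R (z n))"
        using S_decay[OF s, of "z m - z n"] by (simp add: S_simps R_simps)
      also have "\<dots> \<le> ?C * (e / (?C + 1))" using N[OF mn] C by (intro mult_left_mono) auto
      also have "\<dots> < e" using e C by (simp add: field_simps add_nonneg_pos)
      finally show "dist (S s (z m)) (S s (z n)) < e" by (simp add: dist_norm)
    qed
  qed
  then obtain g where g: "(\<lambda>n. S s (z n)) \<longlonglongrightarrow> g" using Cauchy_convergent_iff convergent_def by blast
  have "(\<lambda>n. R (S s (z n))) \<longlonglongrightarrow> R g" by (rule bounded_linear.tendsto[OF R_bounded_linear g])
  moreover have "bounded_linear (S s)"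
    using S_linear S_norm by (auto simp: bounded_linear_def bounded_linear_axioms_def intro!: exI[of _ 1])
  then have "(\<lambda>n. S s (R (z n))) \<longlonglongrightarrow> S s x" by (rule bounded_linear.tendsto[OF _ Rz])
  ultimately have "R g = S s x" unfolding RS_commute by (rule LIMSEQ_unique)
  moreover have "norm g \<le> ?C * norm x"
  proof (rule LIMSEQ_le)
    show "(\<lambda>n. norm (S s (z n))) \<longlonglongrightarrow> norm g" using g by (rule tendsto_norm)
    show "(\<lambda>n. ?C * norm (R (z n))) \<longlonglongrightarrow> ?C * norm x" by (intro tendsto_intros Rz)
    show "\<exists>N. \<forall>n\<ge>N. norm (S s (z n)) \<le> ?C * norm (R (z n))" using S_decay[OF s] by blast
  qed
  ultimately show ?thesis by blast
qed

text \<open>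
  \<open>K s = A S(s)\<close>, which is bounded for \<open>s > 0\<close>.  The choice is unique since \<open>R\<close> is injective; the value at
  \<open>s \<le> 0\<close> is a default that keeps \<open>K\<close> measurable on the whole line.
\<close>

definition K :: "real \<Rightarrow> 'h \<Rightarrow> 'h" where
  "K s x = (if s \<le> 0 then 0 else (SOME g. R g = S s x))"

lemma R_K: "0 < s \<Longrightarrow> R (K s x) = S s x"
  using someI_ex[of "\<lambda>g. R g = S s x"] S_in_range[of s x] by (auto simp: K_def)

lemma K_norm:
  assumes s: "0 < s" shows "norm (K s x) \<le> Gamma (\<alpha> + 1) * s powr (- \<alpha>) * norm x"
proof -
  obtain g where "R g = S s x" "norm g \<le> Gamma (\<alpha> + 1) * s powr (- \<alpha>) * norm x"
    using S_in_range[OF s] by blast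
  moreover from this have "K s x = g" using R_K[OF s] R_inj by metis
  ultimately show ?thesis by simp
qed

lemma K_R: "0 < s \<Longrightarrow> K s (R z) = S s z"
  by (rule R_inj) (simp add: R_K RS_commute)

lemma K_diff: "K s (x - y) = K s x - K s y"
proof (cases "0 < s")
  case True
  then show ?thesis by (rule_tac R_inj) (simp add: R_K R_simps S_simps)
qed (simp add: K_def)

lemma K_continuous: "continuous_on {0<..} (\<lambda>s. K s x)"
  unfolding continuous_on_def
proof
  fix s0 :: real assume "s0 \<in> {0<..}"
  then have s0: "0 < s0" by simp
  define C where "C = Gamma (\<alpha> + 1) * (s0 / 2) powr (- \<alpha>)"
  have C: "0 \<le> C" using \<alpha> by (simp add: C_def less_imp_le)
  have Kb: "norm (K s z) \<le> C * norm z" if "s0 / 2 \<le> s" for s z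
  proof -
    have "norm (K s z) \<le> Gamma (\<alpha> + 1) * s powr (- \<alpha>) * norm z" using that s0 by (intro K_norm) auto
    also have "\<dots> \<le> C * norm z"
      unfolding C_def using that s0 \<alpha> by (intro mult_right_mono mult_left_mono powr_mono2') (auto simp: less_imp_le)
    finally show ?thesis .
  qed
  show "((\<lambda>s. K s x) \<longlongrightarrow> K s0 x) (at s0 within {0<..})"
    unfolding tendsto_iff
  proof (intro allI impI)
    fix e :: real assume e: "0 < e"
    then have "0 < e / (4 * (C + 1))" using C by simp
    from range_R_dense[OF this, of x] obtain z where z: "norm (x - R z) < e / (4 * (C + 1))" by blast
    have Cz: "C * norm (x - R z) \<le> e / 4"
    proof -
      have "C * norm (x - R z) \<le> C * (e / (4 * (C + 1)))" using z C by (intro mult_left_mono) auto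
      also have "\<dots> = (C / (C + 1)) * (e / 4)" by simp
      also have "\<dots> \<le> 1 * (e / 4)" using C e by (intro mult_right_mono) (auto simp: divide_le_eq_1)
      finally show ?thesis by simp
    qed
    have "((\<lambda>s. S s z) \<longlongrightarrow> S s0 z) (at s0 within {0<..})"
      using S_continuous[of "{0<..}" z] s0 by (simp add: continuous_on_def)
    then have "\<forall>\<^sub>F s in at s0 within {0<..}. dist (S s z) (S s0 z) < e / 2"
      by (rule tendstoD) (use e in simp)
    moreover have "\<forall>\<^sub>F s in at s0 within {0<..}. s0 / 2 < s"
      using s0 by (intro order_tendstoD(1)[OF tendsto_ident_at]) simp
    ultimately show "\<forall>\<^sub>F s in at s0 within {0<..}. dist (K s x) (K s0 x) < e"
    proof eventually_elim
      case (elim s)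
      have s: "0 < s" using elim s0 by simp
      have "norm (K s x - K s0 x) = norm (K s (x - R z) - K s0 (x - R z) + (S s z - S s0 z))"
        using s s0 by (simp add: K_diff K_R)
      also have "\<dots> \<le> norm (K s (x - R z)) + norm (K s0 (x - R z)) + norm (S s z - S s0 z)"
        by (rule norm_diff_add_le)
      also have "\<dots> < e / 4 + e / 4 + e / 2"
        using Kb[of s "x - R z"] Kb[of s0 "x - R z"] Cz elim s0 by (simp add: dist_norm)
      finally show ?case by (simp add: dist_norm)
    qed
  qed
qed

lemma K_inner_measurable: "(\<lambda>s. inner (K s x) y) \<in> borel_measurable borel"
proof -
  have "(\<lambda>s. indicator {0<..} s *\<^sub>R inner (K s x) y) \<in> borel_measurable borel"
    by (intro borel_measurable_continuous_on_indicator continuous_intros K_continuous) simp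
  moreover have "(\<lambda>s. indicator {0<..} s *\<^sub>R inner (K s x) y) = (\<lambda>s. inner (K s x) y)"
    by (rule ext) (simp add: K_def indicator_def)
  ultimately show ?thesis by (simp only:)
qed

text \<open>
  The singularity \<open>t\<^sup>-\<^sup>\<alpha>\<close> of \<open>K\<close> is integrable against the Abel kernel, and the Beta integral bounds the
  result independently of \<open>s\<close>.
\<close>

lemma K_abel_integral:
  assumes s: "0 \<le> s"
  shows "set_integrable lborel {0..s} (\<lambda>t. (s - t) powr (\<alpha> - 1) * inner (K t x) y)"
    and "\<bar>rl \<alpha> (\<lambda>t. inner (K t x) y) s\<bar> \<le> Gamma (\<alpha> + 1) * Gamma (1 - \<alpha>) * norm x * norm y"
proof -
  let ?C = "Gamma (\<alpha> + 1) * norm x * norm y"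
  let ?k = "\<lambda>t. (s - t) powr (\<alpha> - 1) * (t - 0) powr ((1 - \<alpha>) - 1)"
  have a: "0 < 1 - \<alpha>" using \<alpha> by simp
  have I1: "set_integrable lborel {0..s} ?k"
    by (rule lborel_set_integral_of_has_integral(1)[OF has_integral_abel_beta[OF \<alpha>(1) a s]]) simp_all
  have I2: "(LBINT t:{0..s}. ?k t) = (s - 0) powr (\<alpha> + (1 - \<alpha>) - 1) * Beta \<alpha> (1 - \<alpha>)"
    by (rule lborel_set_integral_of_has_integral(2)[OF has_integral_abel_beta[OF \<alpha>(1) a s]]) simp_all
  have le: "\<bar>(s - t) powr (\<alpha> - 1) * inner (K t x) y\<bar> \<le> ?C * ?k t" if "0 \<le> t" for t
  proof -
    have "\<bar>inner (K t x) y\<bar> \<le> ?C * t powr (- \<alpha>)"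
    proof (cases "t = 0")
      case False
      then have t: "0 < t" using that by simp
      have "\<bar>inner (K t x) y\<bar> \<le> norm (K t x) * norm y" by (rule Cauchy_Schwarz_ineq2)
      also have "\<dots> \<le> Gamma (\<alpha> + 1) * t powr (- \<alpha>) * norm x * norm y"
        by (intro mult_right_mono K_norm t) simp
      finally show ?thesis by (simp only: mult_ac)
    qed (simp add: K_def)
    then have "(s - t) powr (\<alpha> - 1) * \<bar>inner (K t x) y\<bar> \<le> (s - t) powr (\<alpha> - 1) * (?C * t powr (- \<alpha>))"
      by (rule mult_left_mono) simp
    then show ?thesis by (simp add: abs_mult mult_ac)
  qed
  show int: "set_integrable lborel {0..s} (\<lambda>t. (s - t) powr (\<alpha> - 1) * inner (K t x) y)"
  proof (rule set_integrable_bound)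
    show "set_integrable lborel {0..s} (\<lambda>t. ?C * ?k t)" using I1 by (rule set_integrable_mult_right)
    show "set_borel_measurable lborel {0..s} (\<lambda>t. (s - t) powr (\<alpha> - 1) * inner (K t x) y)"
      using K_inner_measurable by (intro set_borel_measurable_lborelI borel_measurable_times) auto
    show "AE t in lborel. t \<in> {0..s} \<longrightarrow> norm ((s - t) powr (\<alpha> - 1) * inner (K t x) y) \<le> norm (?C * ?k t)"
    proof (intro AE_I2 impI)
      fix t assume "t \<in> {0..s}"
      then have "\<bar>(s - t) powr (\<alpha> - 1) * inner (K t x) y\<bar> \<le> ?C * ?k t" by (intro le) auto
      also have "\<dots> \<le> \<bar>?C * ?k t\<bar>" by (rule abs_ge_self)
      finally show "norm ((s - t) powr (\<alpha> - 1) * inner (K t x) y) \<le> norm (?C * ?k t)"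
        by (simp only: real_norm_def)
    qed
  qed
  have "\<bar>LBINT t:{0..s}. (s - t) powr (\<alpha> - 1) * inner (K t x) y\<bar> \<le> (LBINT t:{0..s}. \<bar>(s - t) powr (\<alpha> - 1) * inner (K t x) y\<bar>)"
    using integral_norm_bound[of lborel "\<lambda>t. indicator {0..s} t *\<^sub>R ((s - t) powr (\<alpha> - 1) * inner (K t x) y)"]
    by (simp add: set_lebesgue_integral_def abs_mult)
  also have "\<dots> \<le> (LBINT t:{0..s}. ?C * ?k t)"
  proof (rule set_integral_mono)
    show "set_integrable lborel {0..s} (\<lambda>t. ?C * ?k t)" using I1 by (rule set_integrable_mult_right)
  qed (use int le in \<open>auto intro: set_integrable_abs\<close>)
  also have "\<dots> = ?C * (s powr 0 * (Gamma \<alpha> * Gamma (1 - \<alpha>)))"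
    using I2 by (simp add: Beta_def)
  also have "\<dots> \<le> ?C * (Gamma \<alpha> * Gamma (1 - \<alpha>))"
    using \<alpha> by (intro mult_left_mono mult_nonneg_nonneg) (auto simp: less_imp_le)
  finally have "\<bar>LBINT t:{0..s}. (s - t) powr (\<alpha> - 1) * inner (K t x) y\<bar> / Gamma \<alpha> \<le> ?C * (Gamma \<alpha> * Gamma (1 - \<alpha>)) / Gamma \<alpha>"
    by (rule divide_right_mono) (use \<alpha> in \<open>simp add: less_imp_le\<close>)
  moreover have "\<bar>rl \<alpha> (\<lambda>t. inner (K t x) y) s\<bar> = \<bar>LBINT t:{0..s}. (s - t) powr (\<alpha> - 1) * inner (K t x) y\<bar> / Gamma \<alpha>"
    using \<alpha> by (simp add: rl_def abs_divide)
  ultimately show "\<bar>rl \<alpha> (\<lambda>t. inner (K t x) y) s\<bar> \<le> Gamma (\<alpha> + 1) * Gamma (1 - \<alpha>) * norm x * norm y"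
    using \<alpha> by (simp add: mult_ac)
qed

text \<open>
  The equation of \<open>S\<close> with one power of \<open>A\<close> more.  On the range of \<open>R\<close> it is \<open>S_volterra\<close>; both sides are bounded
  in \<open>x\<close> uniformly, so it extends to the closure.
\<close>

lemma K_volterra:
  assumes s: "0 \<le> s"
  shows "inner (S s x - x) y = - rl \<alpha> (\<lambda>t. inner (K t x) y) s"
proof -
  let ?D = "Gamma (\<alpha> + 1) * Gamma (1 - \<alpha>)"
  have D: "0 \<le> ?D" using \<alpha> by (simp add: less_imp_le)
  have R: "inner (S s (R z) - R z) y = - rl \<alpha> (\<lambda>t. inner (K t (R z)) y) s" for z
  proof -
    have "rl \<alpha> (\<lambda>t. inner (K t (R z)) y) s = rl \<alpha> (\<lambda>t. inner (S t z) y) s"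
      by (rule rl_cong_Ioc) (auto intro: K_inner_measurable S_inner_measurable simp: K_R)
    then show ?thesis using S_volterra[OF s, of z y] by (simp add: RS_commute)
  qed
  have "\<bar>inner (S s x - x) y + rl \<alpha> (\<lambda>t. inner (K t x) y) s\<bar> \<le> e" if e: "0 < e" for e
  proof -
    let ?E = "(2 + ?D) * norm y + 1"
    have E: "0 < ?E" using D by (intro add_nonneg_pos mult_nonneg_nonneg) auto
    then have "0 < e / ?E" using e by simp
    from range_R_dense[OF this, of x] obtain z where z: "norm (x - R z) < e / ?E" by blast
    define d where "d = x - R z"
    have "rl \<alpha> (\<lambda>t. inner (K t d) y) s = rl \<alpha> (\<lambda>t. inner (K t x) y - inner (K t (R z)) y) s"
      by (simp add: d_def K_diff inner_diff_left)
    also have "\<dots> = rl \<alpha> (\<lambda>t. inner (K t x) y) s - rl \<alpha> (\<lambda>t. inner (K t (R z)) y) s"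
      by (intro rl_diff K_abel_integral s)
    finally have "\<bar>inner (S s x - x) y + rl \<alpha> (\<lambda>t. inner (K t x) y) s\<bar> = \<bar>inner (S s d - d) y + rl \<alpha> (\<lambda>t. inner (K t d) y) s\<bar>"
      using R[of z] by (simp add: d_def S_simps inner_diff_left)
    also have "\<dots> \<le> \<bar>inner (S s d - d) y\<bar> + \<bar>rl \<alpha> (\<lambda>t. inner (K t d) y) s\<bar>" by simp
    also have "\<dots> \<le> 2 * norm d * norm y + ?D * norm d * norm y"
    proof (intro add_mono K_abel_integral s)
      have "\<bar>inner (S s d - d) y\<bar> \<le> norm (S s d - d) * norm y" by (rule Cauchy_Schwarz_ineq2)
      also have "\<dots> \<le> 2 * norm d * norm y"
        using norm_triangle_ineq4[of "S s d" d] S_norm[of s d] by (intro mult_right_mono) auto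
      finally show "\<bar>inner (S s d - d) y\<bar> \<le> 2 * norm d * norm y" .
    qed
    also have "\<dots> = norm d * ((2 + ?D) * norm y)" by (simp add: algebra_simps)
    also have "\<dots> \<le> norm d * ?E" by (intro mult_left_mono) auto
    also have "\<dots> \<le> e / ?E * ?E" using z E by (intro mult_right_mono) (auto simp: d_def)
    also have "\<dots> = e" using E by simp
    finally show ?thesis .
  qed
  then have "\<bar>inner (S s x - x) y + rl \<alpha> (\<lambda>t. inner (K t x) y) s\<bar> \<le> 0"
    by (rule_tac field_le_epsilon) simp
  then show ?thesis by simp
qed

end

section \<open>Uniqueness for the abstract equation\<close>

lemma rl_abs_le:
  assumes a: "0 < a"
    and g: "set_integrable lborel {0..s} (\<lambda>t. (s - t) powr (a - 1) * g t)"
    and h: "set_integrable lborel {0..s} (\<lambda>t. (s - t) powr (a - 1) * h t)"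
    and le: "\<And>t. 0 \<le> t \<Longrightarrow> t \<le> s \<Longrightarrow> \<bar>g t\<bar> \<le> h t"
  shows "\<bar>rl a g s\<bar> \<le> rl a h s"
proof -
  have "\<bar>LBINT t:{0..s}. (s - t) powr (a - 1) * g t\<bar> \<le> (LBINT t:{0..s}. \<bar>(s - t) powr (a - 1) * g t\<bar>)"
    using integral_norm_bound[of lborel "\<lambda>t. indicator {0..s} t *\<^sub>R ((s - t) powr (a - 1) * g t)"]
    by (simp add: set_lebesgue_integral_def abs_mult)
  also have "\<dots> \<le> (LBINT t:{0..s}. (s - t) powr (a - 1) * h t)"
    using g h le by (intro set_integral_mono set_integrable_abs) (auto simp: abs_mult intro!: mult_left_mono)
  finally show ?thesis using a by (simp add: rl_def abs_divide divide_right_mono)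
qed

lemma rl_shift:
  assumes d: "0 \<le> d"
  shows "rl a (\<lambda>t. if d \<le> t then g (t - d) else 0) s = (if d \<le> s then rl a g (s - d) else 0)"
proof (cases "d \<le> s")
  case True
  have "(\<integral>x. indicator {0..s} x *\<^sub>R ((s - x) powr (a - 1) * (if d \<le> x then g (x - d) else 0)) \<partial>lborel)
    = \<bar>1\<bar> *\<^sub>R (\<integral>x. indicator {0..s} (d + 1 * x) *\<^sub>R ((s - (d + 1 * x)) powr (a - 1) * (if d \<le> d + 1 * x then g (d + 1 * x - d) else 0)) \<partial>lborel)"
    by (rule lborel_integral_real_affine) simp
  also have "(\<lambda>x. indicator {0..s} (d + 1 * x) *\<^sub>R ((s - (d + 1 * x)) powr (a - 1) * (if d \<le> d + 1 * x then g (d + 1 * x - d) else 0)))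
     = (\<lambda>x. indicator {0..s - d} x *\<^sub>R ((s - d - x) powr (a - 1) * g x))"
    using d by (intro ext) (auto simp: indicator_def algebra_simps)
  finally show ?thesis using True by (simp add: rl_def set_lebesgue_integral_def)
next
  case False
  have "rl a (\<lambda>t. if d \<le> t then g (t - d) else 0) s = rl a (\<lambda>t. 0) s"
    by (rule rl_cong) (use False in auto)
  then show ?thesis using False by (simp add: rl_def)
qed

context fractional_resolvent
begin

lemma R_power_simps: "(R ^^ k) (R x) = R ((R ^^ k) x)"
  by (rule funpow_swap1[symmetric])

lemma R_power_sym: "inner ((R ^^ k) x) y = inner x ((R ^^ k) y)"
  by (induction k arbitrary: x y) (simp_all add: R_sym R_power_simps[symmetric] del: funpow.simps(2) add: funpow_Suc_right)

lemma R_power_nonzero: "x \<noteq> 0 \<Longrightarrow> (R ^^ k) x \<noteq> 0"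
  by (induction k) (use R_inj[of _ 0] R_simps(3) in auto)

text \<open>
  The ratios of consecutive norms do not decrease: \<open>|R v|\<^sup>2 = (v, R\<^sup>2 v) \<le> |v| |R\<^sup>2 v|\<close> by symmetry.
\<close>

lemma R_power_lower:
  assumes x: "x \<noteq> 0"
  shows "norm x * (norm (R x) / norm x) ^ k \<le> norm ((R ^^ k) x)"
proof -
  let ?r = "norm (R x) / norm x"
  have step: "?r * norm ((R ^^ k) x) \<le> norm ((R ^^ Suc k) x)" for k
  proof (induction k)
    case 0
    show ?case using x by simp
  next
    case (Suc k)
    let ?v = "(R ^^ k) x"
    have v: "0 < norm ?v" using R_power_nonzero[OF x, of k] by simp
    have "(norm (R ?v))\<^sup>2 = inner ?v (R (R ?v))" by (simp add: power2_norm_eq_inner R_sym)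
    also have "\<dots> \<le> norm ?v * norm (R (R ?v))" by (rule norm_cauchy_schwarz)
    finally have 1: "norm (R ?v) * norm (R ?v) \<le> norm ?v * norm (R (R ?v))" by (simp add: power2_eq_square)
    have "(?r * norm (R ?v)) * norm ?v = (?r * norm ?v) * norm (R ?v)" by simp
    also have "\<dots> \<le> norm (R ?v) * norm (R ?v)" using Suc.IH by (intro mult_right_mono) auto
    also note 1
    finally have "(?r * norm (R ?v)) * norm ?v \<le> norm (R (R ?v)) * norm ?v" by (simp only: mult.commute)
    then have "?r * norm (R ?v) \<le> norm (R (R ?v))" using v by (rule mult_right_le_imp_le)
    then show ?case by (simp only: funpow.simps o_apply)
  qed
  show ?thesis
  proof (induction k)
    case (Suc k)
    have "norm x * ?r ^ Suc k = ?r * (norm x * ?r ^ k)" by simp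
    also have "\<dots> \<le> ?r * norm ((R ^^ k) x)" using Suc.IH by (intro mult_left_mono) auto
    also have "\<dots> \<le> norm ((R ^^ Suc k) x)" by (rule step)
    finally show ?case .
  qed simp
qed

text \<open>
  \<open>k\<close> applications of the equation bound \<open>R\<^sup>k W\<close> by \<open>C\<close> times the \<open>k\<close>-th term of the Mittag-Leffler series, which
  decays faster than any geometric sequence and thus contradicts \<open>R_power_lower\<close>.
\<close>

lemma volterra_homogeneous_zero:
  assumes W: "continuous_on UNIV W"
    and eq: "\<And>s \<eta>. 0 \<le> s \<Longrightarrow> s \<le> L \<Longrightarrow> inner (R (W s)) \<eta> = - rl \<alpha> (\<lambda>t. inner (W t) \<eta>) s"
    and s: "0 \<le> s" "s \<le> L"
  shows "W s = 0"
proof (rule ccontr)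
  assume nz: "W s \<noteq> 0"
  have "bounded (W ` {0..L})"
    by (intro compact_imp_bounded compact_continuous_image continuous_on_subset[OF W]) auto
  then obtain C where C: "\<And>t. 0 \<le> t \<Longrightarrow> t \<le> L \<Longrightarrow> norm (W t) \<le> C"
    unfolding bounded_iff by (meson atLeastAtMost_iff image_eqI)
  have C0: "0 \<le> C" using C[of s] s norm_ge_zero[of "W s"] by linarith
  have int: "set_integrable lborel {0..u} (\<lambda>t. (u - t) powr (\<alpha> - 1) * g t)"
    if "continuous_on UNIV g" "0 \<le> u" for g u
  proof -
    have "continuous_on {0..u} g" using that(1) by (rule continuous_on_subset) simp
    then obtain D where "\<And>t. 0 \<le> t \<Longrightarrow> t \<le> u \<Longrightarrow> \<bar>g t\<bar> \<le> D" by (rule continuous_bounded_Icc) blast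
    then show ?thesis using that \<alpha>
      by (intro abel_integrand_integrable[where C = D] borel_measurable_continuous_onI) auto
  qed
  have Rkc: "continuous_on UNIV (\<lambda>t. (R ^^ k) (W t))" for k
  proof (induction k)
    case 0 then show ?case using W by simp
  next
    case (Suc k)
    show ?case using bounded_linear.continuous_on[OF R_bounded_linear Suc.IH] by simp
  qed
  have bound: "\<bar>inner ((R ^^ k) (W t)) \<eta>\<bar> \<le> C * norm \<eta> * ml_term \<alpha> k t" if t: "0 \<le> t" "t \<le> L" for k t \<eta>
    using t
  proof (induction k arbitrary: t)
    case 0
    have "\<bar>inner (W t) \<eta>\<bar> \<le> norm (W t) * norm \<eta>" by (rule Cauchy_Schwarz_ineq2)
    also have "\<dots> \<le> C * norm \<eta>" using C 0 by (intro mult_right_mono) auto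
    finally show ?case by simp
  next
    case (Suc k)
    have "inner ((R ^^ Suc k) (W t)) \<eta> = inner (R (W t)) ((R ^^ k) \<eta>)"
      by (simp only: funpow_Suc_right o_apply R_power_sym)
    also have "\<dots> = - rl \<alpha> (\<lambda>u. inner ((R ^^ k) (W u)) \<eta>) t"
      using Suc.prems by (simp only: eq R_power_sym)
    finally have "\<bar>inner ((R ^^ Suc k) (W t)) \<eta>\<bar> = \<bar>rl \<alpha> (\<lambda>u. inner ((R ^^ k) (W u)) \<eta>) t\<bar>" by simp
    also have "\<dots> \<le> rl \<alpha> (\<lambda>u. C * norm \<eta> * ml_term \<alpha> k (max 0 u)) t"
    proof (rule rl_abs_le[OF \<alpha>(1)])
      fix u assume "0 \<le> u" "u \<le> t"
      then show "\<bar>inner ((R ^^ k) (W u)) \<eta>\<bar> \<le> C * norm \<eta> * ml_term \<alpha> k (max 0 u)"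
        using Suc.IH[of u] Suc.prems by simp
    qed (intro int continuous_intros Rkc \<alpha> Suc.prems)+
    also have "\<dots> = C * norm \<eta> * rl \<alpha> (\<lambda>u. ml_term \<alpha> k (max 0 u)) t" by (rule rl_cmult)
    also have "rl \<alpha> (\<lambda>u. ml_term \<alpha> k (max 0 u)) t = rl \<alpha> (ml_term \<alpha> k) t" by (rule rl_cong) simp
    also have "\<dots> = ml_term \<alpha> (Suc k) t" by (rule rl_ml_term[OF \<alpha>(1) Suc.prems(1)])
    finally show ?case .
  qed
  let ?v = "W s"
  have nv: "0 < norm ?v" and nRv: "0 < norm (R ?v)"
    using nz R_power_nonzero[OF nz, of 1] by auto
  \<comment> \<open>twice the reciprocal of the ratio in the geometric lower bound\<close>
  define q where "q = 2 * norm ?v / norm (R ?v)"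
  have q: "0 < q" using nv nRv by (simp add: q_def)
  define D where "D = C * exp (q powr (1 / \<alpha>) * s)"
  have "norm ?v * 2 ^ k \<le> D" for k
  proof -
    let ?u = "(R ^^ k) ?v"
    have "norm ?u * norm ?u = \<bar>inner ?u ?u\<bar>" by (simp add: dot_square_norm power2_eq_square)
    also have "\<dots> \<le> C * norm ?u * ml_term \<alpha> k s" using s by (rule bound)
    also have "\<dots> \<le> C * norm ?u * ((1 / q) ^ k * exp (q powr (1 / \<alpha>) * s))"
      using C0 by (intro mult_left_mono ml_term_le \<alpha> s q) auto
    finally have "norm ?u * norm ?u \<le> (D * (1 / q) ^ k) * norm ?u" by (simp add: D_def mult_ac)
    moreover have "0 < norm ?u" using R_power_nonzero[OF nz, of k] by simp
    ultimately have "norm ?u \<le> D * (1 / q) ^ k" by simp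
    with R_power_lower[OF nz, of k] have "norm ?v * (norm (R ?v) / norm ?v) ^ k \<le> D * (1 / q) ^ k" by linarith
    then have "norm ?v * (norm (R ?v) / norm ?v) ^ k * q ^ k \<le> D * (1 / q) ^ k * q ^ k"
      using q by (intro mult_right_mono) auto
    moreover have "(norm (R ?v) / norm ?v) ^ k * q ^ k = 2 ^ k"
      using nv nRv by (simp add: q_def flip: power_mult_distrib)
    moreover have "(1 / q) ^ k * q ^ k = 1" using q by (simp flip: power_mult_distrib)
    ultimately show ?thesis by (simp only: mult.assoc mult_1_right)
  qed
  moreover obtain k where "D / norm ?v < 2 ^ k" using real_arch_pow[of 2 "D / norm ?v"] by auto
  then have "D < norm ?v * 2 ^ k" using nv by (simp add: field_simps)
  ultimately show False by (metis not_le)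
qed

text \<open>
  Integrating the equation once and applying \<open>rl \<alpha>\<close> turns it, by the semigroup law, into the Volterra equation
  \<open>R V = - rl \<alpha> V\<close> for the primitive \<open>V\<close> of \<open>w\<close>.  The test vectors are taken from the range of \<open>R\<close>, where the
  weak equation involves no unbounded operator.
\<close>

lemma homogeneous_solution_zero:
  assumes L: "0 < L" and w: "continuous_on {0..L} w"
    and D: "\<And>\<eta> s. s \<in> {0<..L} \<Longrightarrow>
      (rl (1 - \<alpha>) (\<lambda>t. inner (w t) (R \<eta>)) has_real_derivative - inner (w s) \<eta>) (at s within {0<..L})"
    and s: "s \<in> {0..L}"
  shows "w s = 0"
proof -
  \<comment> \<open>extend \<open>w\<close> continuously by clamping its argument\<close>
  define cl where "cl t = max 0 (min L t)" for t :: real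
  have clc: "continuous_on A cl" for A unfolding cl_def by (intro continuous_intros)
  have cl: "cl t \<in> {0..L}" for t using L by (auto simp: cl_def)
  have cl_id: "t \<in> {0..L} \<Longrightarrow> cl t = t" for t by (auto simp: cl_def)
  define v where "v t = w (cl t)" for t
  have vc: "continuous_on A v" for A
    unfolding v_def by (rule continuous_on_compose2[OF w clc]) (use cl in auto)
  define V where "V t = integral {0..cl t} v" for t
  have vi: "v integrable_on {0..t}" for t by (rule integrable_continuous_real[OF vc])
  have Vc: "continuous_on A V" for A
    unfolding V_def
    by (rule continuous_on_compose2[OF indefinite_integral_continuous_1[OF vi[of L]] clc]) (use cl in auto)
  have Vin: "(\<lambda>u. inner (v u) \<eta>) integrable_on {0..t}" "inner (V t) \<eta> = integral {0..t} (\<lambda>u. inner (v u) \<eta>)"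
    if "t \<in> {0..L}" for t \<eta>
  proof -
    have "((\<lambda>u. inner (v u) \<eta>) has_integral inner (V t) \<eta>) {0..t}"
      using has_integral_linear[OF integrable_integral[OF vi[of t]] bounded_linear_inner_left[of \<eta>]] cl_id[OF that]
      by (simp add: V_def o_def)
    then show "(\<lambda>u. inner (v u) \<eta>) integrable_on {0..t}" "inner (V t) \<eta> = integral {0..t} (\<lambda>u. inner (v u) \<eta>)"
      by (auto simp: integral_unique)
  qed
  have ic: "continuous_on A (\<lambda>u. inner (v u) \<eta>)" for A \<eta> by (intro continuous_intros vc)
  have im: "(\<lambda>u. inner (v u) \<eta>) \<in> borel_measurable borel" for \<eta>
    by (intro borel_measurable_continuous_onI ic)
  have rlv: "rl (1 - \<alpha>) (\<lambda>t. inner (w t) \<eta>) t = rl (1 - \<alpha>) (\<lambda>t. inner (v t) \<eta>) t" if "t \<le> L" for t \<eta>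
    using that cl_id by (intro rl_cong) (auto simp: v_def)
  have V1: "rl (1 - \<alpha>) (\<lambda>t. inner (v t) (R \<eta>)) t = - inner (V t) \<eta>" if t: "t \<in> {0..L}" for t \<eta>
  proof -
    let ?g = "rl (1 - \<alpha>) (\<lambda>t. inner (v t) (R \<eta>))"
    obtain C where C: "\<And>u. 0 \<le> u \<Longrightarrow> u \<le> t \<Longrightarrow> \<bar>inner (v u) (R \<eta>)\<bar> \<le> C"
      using continuous_bounded_Icc[OF ic[of "{0..t}" "R \<eta>"]] by blast
    have "((\<lambda>u. - inner (v u) \<eta>) has_integral (?g t - ?g 0)) {0..t}"
    proof (rule fundamental_theorem_of_calculus_interior)
      show "continuous_on {0..t} ?g" using \<alpha> C by (intro rl_continuous_on im) auto
      fix u assume u: "u \<in> {0<..<t}"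
      have "(rl (1 - \<alpha>) (\<lambda>t. inner (w t) (R \<eta>)) has_real_derivative - inner (w u) \<eta>) (at u within {0<..<t})"
        by (rule DERIV_subset[OF D[where \<eta> = \<eta> and s = u]]) (use u t in auto)
      then have "(rl (1 - \<alpha>) (\<lambda>t. inner (w t) (R \<eta>)) has_real_derivative - inner (w u) \<eta>) (at u)"
        using at_within_open[OF u open_greaterThanLessThan] by (simp only:)
      then have "(?g has_real_derivative - inner (w u) \<eta>) (at u)"
      proof (rule has_field_derivative_transform_within_open[where S = "{0<..<t}"])
        fix r assume "r \<in> {0<..<t}"
        then show "rl (1 - \<alpha>) (\<lambda>t. inner (w t) (R \<eta>)) r = ?g r" using t by (intro rlv) simp
      qed (use u in simp_all)
      moreover have "w u = v u" using u t cl_id[of u] by (simp add: v_def)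
      ultimately show "(?g has_vector_derivative - inner (v u) \<eta>) (at u)"
        by (simp add: has_real_derivative_iff_has_vector_derivative)
    qed (use t in auto)
    then have "integral {0..t} (\<lambda>u. - inner (v u) \<eta>) = ?g t - ?g 0" by (rule integral_unique)
    then show ?thesis using Vin[OF t, of \<eta>] by simp
  qed
  have "V t = 0" if t: "t \<in> {0..L}" for t
  proof (rule volterra_homogeneous_zero[OF Vc, of L])
    fix t \<eta> assume t: "0 \<le> t" "t \<le> L"
    have si: "set_integrable lborel {0..t} (\<lambda>u. inner (v u) (R \<eta>))"
      by (rule borel_integrable_atLeastAtMost'[OF ic])
    have "rl \<alpha> (rl (1 - \<alpha>) (\<lambda>u. inner (v u) (R \<eta>))) t = (LBINT u:{0..t}. inner (v u) (R \<eta>))"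
      using \<alpha> t by (intro rl_semigroup im si) auto
    also have "\<dots> = integral {0..t} (\<lambda>u. inner (v u) (R \<eta>))"
      by (rule set_borel_integral_eq_integral(2)[OF si])
    also have "\<dots> = inner (R (V t)) \<eta>" using Vin(2)[of t "R \<eta>"] t by (simp add: R_sym)
    also have "rl \<alpha> (rl (1 - \<alpha>) (\<lambda>u. inner (v u) (R \<eta>))) t = rl \<alpha> (\<lambda>u. (-1) * inner (V u) \<eta>) t"
      by (rule rl_cong) (use V1 t in auto)
    also have "\<dots> = - rl \<alpha> (\<lambda>u. inner (V u) \<eta>) t" by (subst rl_cmult) simp
    finally show "inner (R (V t)) \<eta> = - rl \<alpha> (\<lambda>t. inner (V t) \<eta>) t" by simp
  qed (use t in auto)
  then have V0: "integral {0..t} v = 0" if "t \<in> {0..L}" for t using that cl_id by (force simp: V_def)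
  have "((\<lambda>u. integral {0..u} v) has_vector_derivative v s) (at s within {0..L})"
    by (rule integral_has_vector_derivative[OF vc s])
  moreover have "((\<lambda>u. integral {0..u} v) has_vector_derivative 0) (at s within {0..L})"
    by (rule has_vector_derivative_transform[OF s _ has_vector_derivative_const]) (simp add: V0)
  ultimately have "v s = 0"
    using vector_derivative_unique_within[of s "{0..L}"] L s
    by (simp add: trivial_limit_within islimpt_Icc)
  then show ?thesis using cl_id[OF s] by (simp add: v_def)
qed

end

section \<open>Existence for the abstract equation\<close>

context fractional_resolvent
begin

context
  fixes a T :: real and f f' F :: "real \<Rightarrow> 'h" and c :: "real \<Rightarrow> real" and \<phi> :: 'h
  assumes aT: "a < T"
    and f': "\<And>t. t \<in> {a..T} \<Longrightarrow> (f has_vector_derivative f' t) (at t within {a..T})"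
    and f'c: "continuous_on {a..T} f'"
    and cc: "continuous_on UNIV c" and cmono: "\<And>s t. s \<in> {a..T} \<Longrightarrow> t \<in> {a..T} \<Longrightarrow> s < t \<Longrightarrow> c s < c t"
    and c0: "c a = 0"
    and Fc: "continuous_on UNIV F" and Ff: "\<And>t. t \<in> {a..T} \<Longrightarrow> F (c t) = f t"
begin

text \<open>
  The Duhamel integral.  Since \<open>S\<close> is the identity for negative arguments, the times \<open>t\<close> after the current one
  contribute \<open>f T - f t\<close>, and the domain of integration does not depend on \<open>s\<close>
  (lemma \<open>G_truncated\<close>).
\<close>

definition G :: "real \<Rightarrow> 'h" where "G s = integral {a..T} (\<lambda>t. S (s - c t) (f' t))"

definition AU :: "real \<Rightarrow> 'h" where "AU s = K s \<phi> + (f T - S s (f a) - G s)"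

text \<open>
  \<open>U\<close> is Duhamel's formula in the clock \<open>c\<close>, integrated by parts; \<open>AU\<close> is \<open>A\<close> applied to it.  The source is
  evaluated at \<open>T\<close> because \<open>G\<close> contains its increment after the current time.
\<close>

definition U :: "real \<Rightarrow> 'h" where "U s = S s \<phi> + R (f T - S s (f a) - G s)"

lemma R_AU: "0 < s \<Longrightarrow> R (AU s) = U s"
  by (simp add: AU_def U_def R_K R_simps)

lemma integrand_continuous: "continuous_on {a..T} (\<lambda>t. S (s - c t) (f' t))"
  by (intro S_continuous_joint continuous_intros f'c continuous_on_subset[OF cc]) simp

lemma G_continuous: "continuous_on A G"
proof -
  have "continuous_on (UNIV \<times> cbox a T) (\<lambda>(s, t). S (s - c t) (f' t))"
    unfolding split_beta
    by (intro S_continuous_joint continuous_intros continuous_on_compose2[OF cc] continuous_on_compose2[OF f'c]) auto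
  from integral_continuous_on_param[OF this] have "continuous_on UNIV G" by (simp add: G_def[abs_def])
  then show ?thesis by (rule continuous_on_subset) simp
qed

lemma U_continuous: "continuous_on A U"
  unfolding U_def
  by (intro continuous_intros S_continuous bounded_linear.continuous_on[OF R_bounded_linear] G_continuous)

lemma AU_continuous: "continuous_on {0<..} AU"
  unfolding AU_def by (intro continuous_intros S_continuous K_continuous G_continuous)

lemma integral_f': "s \<in> {a..T} \<Longrightarrow> t \<in> {a..T} \<Longrightarrow> s \<le> t \<Longrightarrow> (f' has_integral (f t - f s)) {s..t}"
proof (rule fundamental_theorem_of_calculus)
  fix x assume "s \<in> {a..T}" "t \<in> {a..T}" "x \<in> {s..t}"
  then show "(f has_vector_derivative f' x) (at x within {s..t})"
    by (intro has_vector_derivative_within_subset[OF f']) auto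
qed

lemma c_nonneg: "t \<in> {a..T} \<Longrightarrow> 0 \<le> c t"
  using cmono[of a t] c0 aT by (cases "t = a") auto

lemma c_le_iff: "s \<in> {a..T} \<Longrightarrow> t \<in> {a..T} \<Longrightarrow> c s \<le> c t \<longleftrightarrow> s \<le> t"
  using cmono[of s t] cmono[of t s] by (cases s t rule: linorder_cases) auto

lemma U_0: "U 0 = \<phi>"
proof -
  have "G 0 = integral {a..T} f'"
    unfolding G_def by (rule integral_cong) (use c_nonneg in auto)
  also have "\<dots> = f T - f a" using integral_f'[of a T] aT by (simp add: integral_unique)
  finally show ?thesis by (simp add: U_def R_simps)
qed

lemma G_truncated:
  assumes t: "t \<in> {a..T}"
  shows "inner (G (c t) - f T + f t) \<eta> = (LBINT r:{a..T}. (if c r \<le> c t then inner (S (c t - c r) (f' r)) \<eta> else 0))"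
proof -
  let ?g = "\<lambda>r. S (c t - c r) (f' r)"
  have i: "?g integrable_on {u..v}" if "a \<le> u" "v \<le> T" for u v
    by (rule integrable_continuous_real[OF continuous_on_subset[OF integrand_continuous]]) (use that in auto)
  have "G (c t) = integral {a..t} ?g + integral {t..T} ?g"
    unfolding G_def using t by (intro Henstock_Kurzweil_Integration.integral_combine[symmetric] i) auto
  also have "integral {t..T} ?g = integral {t..T} f'"
    by (rule integral_cong) (use t c_le_iff[OF t] in auto)
  also have "\<dots> = f T - f t" using integral_f'[of t T] t by (simp add: integral_unique)
  finally have "G (c t) - f T + f t = integral {a..t} ?g" by simp
  moreover have "((\<lambda>r. inner (?g r) \<eta>) has_integral inner (integral {a..t} ?g) \<eta>) {a..t}"
    using has_integral_linear[OF integrable_integral[OF i[of a t]] bounded_linear_inner_left[of \<eta>]] t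
    by (simp add: o_def)
  ultimately have "inner (G (c t) - f T + f t) \<eta> = integral {a..t} (\<lambda>r. inner (?g r) \<eta>)"
    by (simp add: integral_unique)
  also have "\<dots> = (LBINT r:{a..t}. inner (?g r) \<eta>)"
  proof (rule set_borel_integral_eq_integral(2)[symmetric, OF borel_integrable_atLeastAtMost'])
    show "continuous_on {a..t} (\<lambda>r. inner (?g r) \<eta>)"
      by (intro continuous_intros continuous_on_subset[OF integrand_continuous]) (use t in auto)
  qed
  also have "\<dots> = (LBINT r:{a..T}. (if c r \<le> c t then inner (?g r) \<eta> else 0))"
    unfolding set_lebesgue_integral_def
    by (rule Bochner_Integration.integral_cong) (use t c_le_iff[OF _ t] in \<open>auto simp: indicator_def\<close>)
  finally show ?thesis .
qed

text \<open>
  Fubini: the inner Abel integral of \<open>S (u - c r)\<close> starts at \<open>u = c r\<close>, and by \<open>S_volterra\<close> it equals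
  \<open>R (f' r - S (s - c r) (f' r))\<close>.
\<close>

lemma rl_G:
  assumes s: "0 \<le> s" "s \<le> c T"
  shows "rl \<alpha> (\<lambda>u. inner (G u - f T + F u) \<eta>) s = inner (R (f T - f a - G s)) \<eta>"
proof -
  \<comment> \<open>\<open>Y\<close> and \<open>P\<close> are the integrands of the inner and of the double integral\<close>
  define Y where "Y u r = (if c r \<le> u then inner (S (u - c r) (f' r)) \<eta> else 0)" for u r
  define P where "P r u = indicator {0..s} u * (s - u) powr (\<alpha> - 1) * (indicator {a..T} r * Y u r)" for r u
  \<comment> \<open>the clock runs through all of \<open>[0, c T]\<close>\<close>
  have surj: "\<exists>t\<in>{a..T}. c t = u" if "0 \<le> u" "u \<le> c T" for u
    using IVT'[of c a u T] that aT c0 continuous_on_subset[OF cc, of "{a..T}"] by auto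
  have inner_eq: "inner (G u - f T + F u) \<eta> = (LBINT r:{a..T}. Y u r)" if "0 \<le> u" "u \<le> s" for u
    using surj[of u] that s G_truncated Ff unfolding Y_def by fastforce
  have "bounded (f' ` {a..T})" by (intro compact_imp_bounded compact_continuous_image f'c) auto
  then obtain C0 where C0: "\<And>t. t \<in> {a..T} \<Longrightarrow> norm (f' t) \<le> C0"
    unfolding bounded_iff by (meson image_eqI)
  define C where "C = C0 * norm \<eta>"
  have Yb: "\<bar>Y u r\<bar> \<le> C" if "r \<in> {a..T}" for u r
  proof -
    have "\<bar>inner (S (u - c r) (f' r)) \<eta>\<bar> \<le> norm (S (u - c r) (f' r)) * norm \<eta>" by (rule Cauchy_Schwarz_ineq2)
    also have "\<dots> \<le> C" unfolding C_def using C0[OF that] S_norm[of "u - c r" "f' r"] by (intro mult_right_mono) auto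
    finally have "\<bar>inner (S (u - c r) (f' r)) \<eta>\<bar> \<le> C" .
    moreover have "0 \<le> C" using calculation abs_ge_zero order_trans by blast
    ultimately show ?thesis by (simp add: Y_def)
  qed
  have Cnn: "0 \<le> C" using Yb[of a 0] aT by auto
  define Dm where "Dm = {p :: real \<times> real. fst p \<in> {a..T} \<and> snd p \<in> {0..s} \<and> c (fst p) \<le> snd p}"
  have Dm: "closed Dm"
    unfolding Dm_def atLeastAtMost_iff
    by (intro closed_Collect_conj closed_Collect_le continuous_intros continuous_on_compose2[OF cc]) auto
  have fs: "fst \<in> borel_measurable (borel :: (real \<times> real) measure)" "snd \<in> borel_measurable (borel :: (real \<times> real) measure)"
    by (intro borel_measurable_continuous_onI continuous_intros)+
  have kern: "(\<lambda>p. (s - snd p) powr (\<alpha> - 1)) \<in> borel_measurable (borel :: (real \<times> real) measure)"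
    by (intro powr_real_measurable borel_measurable_diff fs borel_measurable_const)
  have meas: "case_prod P \<in> borel_measurable (lborel \<Otimes>\<^sub>M lborel)"
  proof -
    have "(\<lambda>p. indicator Dm p *\<^sub>R inner (S (snd p - c (fst p)) (f' (fst p))) \<eta>) \<in> borel_measurable borel"
    proof (rule borel_measurable_continuous_on_indicator)
      show "continuous_on Dm (\<lambda>p. inner (S (snd p - c (fst p)) (f' (fst p))) \<eta>)"
        by (intro continuous_intros S_continuous_joint continuous_on_compose2[OF cc] continuous_on_compose2[OF f'c])
           (auto simp: Dm_def)
    qed (rule borel_closed[OF Dm])
    from borel_measurable_times[OF kern this]
    have "(\<lambda>p. (s - snd p) powr (\<alpha> - 1) * (indicator Dm p *\<^sub>R inner (S (snd p - c (fst p)) (f' (fst p))) \<eta>)) \<in> borel_measurable borel" .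
    moreover have "(\<lambda>p. (s - snd p) powr (\<alpha> - 1) * (indicator Dm p *\<^sub>R inner (S (snd p - c (fst p)) (f' (fst p))) \<eta>)) = case_prod P"
      by (rule ext) (auto simp: P_def Y_def Dm_def indicator_def split_beta)
    ultimately have "case_prod P \<in> borel_measurable borel" by (simp only:)
    then show ?thesis unfolding lborel_prod by (subst measurable_cong_sets[OF sets_lborel refl])
  qed
  define Q where "Q r u = (indicator {a..T} r * C) * (indicator {0..s} u * (s - u) powr (\<alpha> - 1))" for r u
  have kint: "integrable lborel (\<lambda>u. indicator {0..s} u * (s - u) powr (\<alpha> - 1))"
    using abel_kernel_set_integral(1)[OF \<alpha>(1) s(1)] unfolding set_integrable_def real_scaleR_def .
  have aint: "integrable lborel (\<lambda>r. indicator {a..T} r * z)" for z :: real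
    by (intro integrable_mult_left integrable_real_indicator) (simp_all add: emeasure_lborel_Icc_eq)
  have Qint: "integrable (lborel \<Otimes>\<^sub>M lborel) (case_prod Q)"
  proof (rule lborel_pair.Fubini_integrable)
    have 1: "(\<lambda>p. indicator {a..T} (fst p) :: real) \<in> borel_measurable (borel :: (real \<times> real) measure)"
      by (rule measurable_compose[OF fs(1) borel_measurable_indicator]) (rule atLeastAtMost_borel)
    have 2: "(\<lambda>p. indicator {0..s} (snd p) :: real) \<in> borel_measurable (borel :: (real \<times> real) measure)"
      by (rule measurable_compose[OF fs(2) borel_measurable_indicator]) (rule atLeastAtMost_borel)
    have "case_prod Q = (\<lambda>p. (indicator {a..T} (fst p) * C) * (indicator {0..s} (snd p) * (s - snd p) powr (\<alpha> - 1)))"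
      by (rule ext) (simp add: Q_def split_beta)
    moreover have "\<dots> \<in> borel_measurable borel"
      by (intro borel_measurable_times 1 2 kern borel_measurable_const)
    ultimately have "case_prod Q \<in> borel_measurable borel" by (simp only:)
    then show "case_prod Q \<in> borel_measurable (lborel \<Otimes>\<^sub>M lborel)"
      unfolding lborel_prod by (subst measurable_cong_sets[OF sets_lborel refl])
    have "norm (case_prod Q (r, u)) = Q r u" for r u
      using Cnn by (simp add: Q_def)
    then have "(\<lambda>r. \<integral>u. norm (case_prod Q (r, u)) \<partial>lborel) = (\<lambda>r. indicator {a..T} r * (C * (\<integral>u. indicator {0..s} u * (s - u) powr (\<alpha> - 1) \<partial>lborel)))"
      by (simp only: Q_def integral_mult_right_zero mult.assoc)
    then show "integrable lborel (\<lambda>r. \<integral>u. norm (case_prod Q (r, u)) \<partial>lborel)"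
      by (simp only: aint)
    show "AE r in lborel. integrable lborel (\<lambda>u. case_prod Q (r, u))"
      unfolding prod.case Q_def by (intro AE_I2 integrable_mult_right kint)
  qed
  have Pint: "integrable (lborel \<Otimes>\<^sub>M lborel) (case_prod P)"
  proof (rule Bochner_Integration.integrable_bound[OF Qint meas], rule AE_I2)
    fix p :: "real \<times> real"
    obtain r u where p: "p = (r, u)" by (cases p)
    have "indicator {a..T} r * \<bar>Y u r\<bar> \<le> indicator {a..T} r * C"
      using Yb[of r u] by (auto simp: indicator_def)
    then have "(indicator {0..s} u * (s - u) powr (\<alpha> - 1)) * (indicator {a..T} r * \<bar>Y u r\<bar>)
        \<le> (indicator {0..s} u * (s - u) powr (\<alpha> - 1)) * (indicator {a..T} r * C)"
      by (rule mult_left_mono) simp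
    then have "\<bar>P r u\<bar> \<le> Q r u" by (simp add: P_def Q_def abs_mult mult_ac)
    then show "norm (case_prod P p) \<le> norm (case_prod Q p)" by (simp add: p)
  qed
  have sm: "inner (R (f' r - S (s - c r) (f' r))) \<eta> * Gamma \<alpha> = (\<integral>u. indicator {0..s} u * (s - u) powr (\<alpha> - 1) * Y u r \<partial>lborel)"
    if r: "r \<in> {a..T}" for r
  proof -
    have "(\<integral>u. indicator {0..s} u * (s - u) powr (\<alpha> - 1) * Y u r \<partial>lborel) = rl \<alpha> (\<lambda>u. Y u r) s * Gamma \<alpha>"
      using \<alpha> by (simp add: rl_def set_lebesgue_integral_def mult.assoc)
    also have "rl \<alpha> (\<lambda>u. Y u r) s = (if c r \<le> s then rl \<alpha> (\<lambda>u. inner (S u (f' r)) \<eta>) (s - c r) else 0)"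
      unfolding Y_def by (rule rl_shift[OF c_nonneg[OF r]])
    also have "\<dots> = inner (R (f' r - S (s - c r) (f' r))) \<eta>"
      using S_volterra[of "s - c r" "f' r" \<eta>] by (auto simp: R_simps inner_diff_left)
    finally show ?thesis by simp
  qed
  have "rl \<alpha> (\<lambda>u. inner (G u - f T + F u) \<eta>) s = rl \<alpha> (\<lambda>u. LBINT r:{a..T}. Y u r) s"
    by (rule rl_cong) (rule inner_eq)
  also have "\<dots> = (\<integral>u. \<integral>r. P r u \<partial>lborel \<partial>lborel) / Gamma \<alpha>"
    unfolding rl_def set_lebesgue_integral_def P_def integral_mult_right_zero real_scaleR_def by (simp only: mult.assoc)
  also have "(\<integral>u. \<integral>r. P r u \<partial>lborel \<partial>lborel) = (\<integral>r. \<integral>u. P r u \<partial>lborel \<partial>lborel)"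
    by (rule lborel_pair.Fubini_integral[OF Pint])
  also have "\<dots> = (\<integral>r. indicator {a..T} r * inner (R (f' r - S (s - c r) (f' r))) \<eta> * Gamma \<alpha> \<partial>lborel)"
  proof (rule Bochner_Integration.integral_cong[OF refl])
    fix r
    have "(\<lambda>u. P r u) = (\<lambda>u. indicator {a..T} r * (indicator {0..s} u * (s - u) powr (\<alpha> - 1) * Y u r))"
      by (rule ext) (simp add: P_def)
    then show "(\<integral>u. P r u \<partial>lborel) = indicator {a..T} r * inner (R (f' r - S (s - c r) (f' r))) \<eta> * Gamma \<alpha>"
      using sm[of r] by (cases "r \<in> {a..T}") (simp_all only: integral_mult_right_zero indicator_simps mult_1_left mult_zero_left not_False_eq_True Bochner_Integration.integral_zero)
  qed
  also have "\<dots> / Gamma \<alpha> = (LBINT r:{a..T}. inner (R (f' r - S (s - c r) (f' r))) \<eta>)"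
    using \<alpha> by (simp add: set_lebesgue_integral_def)
  also have "\<dots> = integral {a..T} (\<lambda>r. inner (R (f' r - S (s - c r) (f' r))) \<eta>)"
    by (intro set_borel_integral_eq_integral(2) borel_integrable_atLeastAtMost' continuous_intros
        bounded_linear.continuous_on[OF R_bounded_linear] f'c integrand_continuous)
  also have "\<dots> = inner (R (f T - f a - G s)) \<eta>"
  proof -
    have "((\<lambda>r. f' r - S (s - c r) (f' r)) has_integral (f T - f a - G s)) {a..T}"
      unfolding G_def using aT
      by (intro has_integral_diff integral_f' integrable_integral integrable_continuous_real integrand_continuous) auto
    from has_integral_linear[OF has_integral_linear[OF this R_bounded_linear] bounded_linear_inner_left[of \<eta>]]
    show ?thesis by (simp add: o_def integral_unique)
  qed
  finally show ?thesis .
qed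

text \<open>
  The integral equation \<open>U - \<phi> = rl \<alpha> (F - A U)\<close>: \<open>\<phi>\<close> contributes through \<open>K_volterra\<close>, \<open>f a\<close> through
  \<open>S_volterra\<close> and the rest through \<open>rl_G\<close>.
\<close>

lemma U_volterra:
  assumes s: "0 \<le> s" "s \<le> c T"
  shows "set_integrable lborel {0..s} (\<lambda>u. (s - u) powr (\<alpha> - 1) * inner (F u - AU u) \<eta>)"
    and "inner (U s - \<phi>) \<eta> = rl \<alpha> (\<lambda>u. inner (F u - AU u) \<eta>) s"
proof -
  have int: "set_integrable lborel {0..s} (\<lambda>u. (s - u) powr (\<alpha> - 1) * g u)" if "continuous_on UNIV g" for g
  proof -
    have "continuous_on {0..s} g" using that(1) by (rule continuous_on_subset) simp
    then obtain D where "\<And>t. 0 \<le> t \<Longrightarrow> t \<le> s \<Longrightarrow> \<bar>g t\<bar> \<le> D" by (rule continuous_bounded_Icc) blast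
    then show ?thesis using that \<alpha> s
      by (intro abel_integrand_integrable[where C = D] borel_measurable_continuous_onI) auto
  qed
  have i1: "set_integrable lborel {0..s} (\<lambda>u. (s - u) powr (\<alpha> - 1) * inner (S u (f a)) \<eta>)"
    by (intro int continuous_intros S_continuous)
  have i2: "set_integrable lborel {0..s} (\<lambda>u. (s - u) powr (\<alpha> - 1) * inner (G u - f T + F u) \<eta>)"
    by (intro int continuous_intros G_continuous Fc)
  have i12: "set_integrable lborel {0..s} (\<lambda>u. (s - u) powr (\<alpha> - 1) * (inner (S u (f a)) \<eta> + inner (G u - f T + F u) \<eta>))"
    by (intro int continuous_intros G_continuous Fc S_continuous)
  note i3 = K_abel_integral(1)[OF s(1), of \<phi> \<eta>]
  have eq: "inner (F u - AU u) \<eta> = inner (S u (f a)) \<eta> + inner (G u - f T + F u) \<eta> - inner (K u \<phi>) \<eta>" for u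
    by (simp add: AU_def algebra_simps inner_add_left inner_diff_left)
  show "set_integrable lborel {0..s} (\<lambda>u. (s - u) powr (\<alpha> - 1) * inner (F u - AU u) \<eta>)"
    unfolding eq right_diff_distrib by (rule set_integral_diff(1)[OF i12 i3])
  have "rl \<alpha> (\<lambda>u. inner (F u - AU u) \<eta>) s
    = rl \<alpha> (\<lambda>u. inner (S u (f a)) \<eta>) s + rl \<alpha> (\<lambda>u. inner (G u - f T + F u) \<eta>) s - rl \<alpha> (\<lambda>u. inner (K u \<phi>) \<eta>) s"
    unfolding eq rl_diff[OF i12 i3] rl_add[OF i1 i2] ..
  also have "\<dots> = inner (R (f a) - R (S s (f a))) \<eta> + inner (R (f T - f a - G s)) \<eta> + inner (S s \<phi> - \<phi>) \<eta>"
    using S_volterra[OF s(1), of "f a" \<eta>] rl_G[OF s] K_volterra[OF s(1), of \<phi> \<eta>] by (simp add: inner_diff_left)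
  also have "\<dots> = inner (U s - \<phi>) \<eta>"
    by (simp add: U_def R_simps inner_add_left inner_diff_left)
  finally show "inner (U s - \<phi>) \<eta> = rl \<alpha> (\<lambda>u. inner (F u - AU u) \<eta>) s" by simp
qed

text \<open>
  Apply \<open>rl (1 - \<alpha>)\<close> to the integral equation: by the semigroup law the result is the primitive of
  \<open>F - A U\<close>, which is continuous for \<open>s > 0\<close>.
\<close>

lemma U_equation:
  assumes s: "s \<in> {0<..c T}"
  shows "(rl (1 - \<alpha>) (\<lambda>u. inner (U u - \<phi>) \<eta>) has_real_derivative inner (F s - AU s) \<eta>) (at s within {0<..c T})"
proof -
  let ?g = "\<lambda>u. inner (F u - AU u) \<eta>"
  let ?L = "c T"
  have L: "0 < ?L" using s by auto
  have gc: "continuous_on {0<..} ?g" by (intro continuous_intros AU_continuous continuous_on_subset[OF Fc]) simp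
  have gm: "?g \<in> borel_measurable borel"
  proof -
    have 1: "(\<lambda>u. inner (F u - (f T - S u (f a) - G u)) \<eta>) \<in> borel_measurable borel"
      by (intro borel_measurable_continuous_onI continuous_intros Fc S_continuous G_continuous)
    have "?g = (\<lambda>u. inner (F u - (f T - S u (f a) - G u)) \<eta> - inner (K u \<phi>) \<eta>)"
      by (rule ext) (simp add: AU_def inner_diff_left inner_add_left)
    then show ?thesis using borel_measurable_diff[OF 1 K_inner_measurable] by (simp only:)
  qed
  have gi: "set_integrable lborel {0..u} ?g" if u: "0 \<le> u" "u \<le> ?L" for u
  proof -
    have "set_integrable lborel {0..?L} (\<lambda>u. (?L - u) powr (\<alpha> - 1) * ?g u)"
      using L by (intro U_volterra) auto
    then have "set_integrable lborel {0..?L} (\<lambda>u. ?L powr (1 - \<alpha>) * ((?L - u) powr (\<alpha> - 1) * ?g u))"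
      by (rule set_integrable_mult_right)
    then have "set_integrable lborel {0..?L} ?g"
    proof (rule set_integrable_bound)
      show "set_borel_measurable lborel {0..?L} ?g" using gm by (intro set_borel_measurable_lborelI) auto
      show "AE x in lborel. x \<in> {0..?L} \<longrightarrow> norm (?g x) \<le> norm (?L powr (1 - \<alpha>) * ((?L - x) powr (\<alpha> - 1) * ?g x))"
        using AE_lborel_singleton[of ?L]
      proof eventually_elim
        case (elim x)
        show ?case
        proof
          assume x: "x \<in> {0..?L}"
          have "?L powr (\<alpha> - 1) \<le> (?L - x) powr (\<alpha> - 1)"
            using x elim \<alpha> by (intro powr_mono2') auto
          then have "?L powr (1 - \<alpha>) * ?L powr (\<alpha> - 1) \<le> ?L powr (1 - \<alpha>) * (?L - x) powr (\<alpha> - 1)"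
            by (rule mult_left_mono) simp
          then have "1 \<le> ?L powr (1 - \<alpha>) * (?L - x) powr (\<alpha> - 1)"
            using L by (simp flip: powr_add)
          then have "1 * \<bar>?g x\<bar> \<le> (?L powr (1 - \<alpha>) * (?L - x) powr (\<alpha> - 1)) * \<bar>?g x\<bar>"
            by (rule mult_right_mono) simp
          then show "norm (?g x) \<le> norm (?L powr (1 - \<alpha>) * ((?L - x) powr (\<alpha> - 1) * ?g x))"
            by (simp add: abs_mult mult.assoc)
        qed
      qed
    qed
    then show ?thesis by (rule set_integrable_subset) (use u in auto)
  qed
  have I: "rl (1 - \<alpha>) (\<lambda>u. inner (U u - \<phi>) \<eta>) u = integral {0..u} ?g" if u: "0 \<le> u" "u \<le> ?L" for u
  proof -
    have "rl (1 - \<alpha>) (\<lambda>u. inner (U u - \<phi>) \<eta>) u = rl (1 - \<alpha>) (rl \<alpha> ?g) u"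
      by (rule rl_cong) (use U_volterra(2) u in auto)
    also have "\<dots> = (LBINT r:{0..u}. ?g r)"
      using \<alpha> u gm gi by (intro rl_semigroup) auto
    also have "\<dots> = integral {0..u} ?g" by (rule set_borel_integral_eq_integral(2)[OF gi[OF u]])
    finally show ?thesis .
  qed
  \<comment> \<open>start the primitive inside \<open>(0, s)\<close>, since \<open>A U\<close> is singular at \<open>0\<close>\<close>
  define b where "b = s / 2"
  have b: "0 < b" "b < s" using s by (auto simp: b_def)
  have gint: "?g integrable_on {0..?L}" using set_borel_integral_eq_integral(1)[OF gi[of ?L]] L by simp
  have "((\<lambda>u. integral {b..u} ?g) has_vector_derivative ?g s) (at s within {b..?L})"
    by (rule integral_has_vector_derivative[OF continuous_on_subset[OF gc]]) (use b s in auto)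
  then have "((\<lambda>u. integral {0..b} ?g + integral {b..u} ?g) has_vector_derivative 0 + ?g s) (at s within {b..?L})"
    by (intro has_vector_derivative_add has_vector_derivative_const)
  then have "((\<lambda>u. integral {0..b} ?g + integral {b..u} ?g) has_vector_derivative ?g s) (at s within {b..?L})"
    by simp
  then have "(rl (1 - \<alpha>) (\<lambda>u. inner (U u - \<phi>) \<eta>) has_vector_derivative ?g s) (at s within {b..?L})"
  proof (rule has_vector_derivative_transform[rotated 2])
    show "s \<in> {b..?L}" using b s by auto
    fix u assume u: "u \<in> {b..?L}"
    have "?g integrable_on {0..u}" by (rule integrable_subinterval_real[OF gint]) (use u b in auto)
    then have "integral {0..b} ?g + integral {b..u} ?g = integral {0..u} ?g"
      using b u by (intro Henstock_Kurzweil_Integration.integral_combine) auto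
    then show "rl (1 - \<alpha>) (\<lambda>u. inner (U u - \<phi>) \<eta>) u = integral {0..b} ?g + integral {b..u} ?g"
      using I[of u] u b by simp
  qed
  moreover have "at s within {b..?L} = at s within {0<..?L}"
    by (rule at_within_nhd[of s "{b<..}"]) (use b in auto)
  ultimately show ?thesis
    by (simp only: has_real_derivative_iff_has_vector_derivative)
qed

end

end

section \<open>Completeness of the space of square integrable functions\<close>

lemma finite_measure_unit_leb: "finite_measure unit_leb"
  by (rule finite_measure_lebesgue_on) simp

interpretation unit_leb: finite_measure unit_leb
  by (rule finite_measure_unit_leb)

lemma space_unit_leb: "space unit_leb = {0<..<1}"
  by simp

lemma AE_unit_lebI: "(\<And>x. 0 < x \<Longrightarrow> x < 1 \<Longrightarrow> P x) \<Longrightarrow> AE x in unit_leb. P x"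
  by (intro AE_I2) simp

lemma borel_measurable_unit_leb: "f \<in> borel_measurable borel \<Longrightarrow> f \<in> borel_measurable unit_leb"
  by (intro measurable_restrict_space1 measurable_completion) simp

lemma continuous_unit_leb_measurable: "continuous_on {0<..<1} f \<Longrightarrow> f \<in> borel_measurable unit_leb"
  by (rule continuous_imp_measurable_on_sets_lebesgue) simp_all

lemma square_integrable_bound:
  assumes g: "square_integrable g" and f: "f \<in> borel_measurable unit_leb"
    and le: "\<And>x. 0 < x \<Longrightarrow> x < 1 \<Longrightarrow> \<bar>f x\<bar> \<le> \<bar>g x\<bar>"
  shows "square_integrable f"
  unfolding square_integrable_def
proof
  show "integrable unit_leb (\<lambda>x. (f x)\<^sup>2)"
  proof (rule Bochner_Integration.integrable_bound)
    show "integrable unit_leb (\<lambda>x. (g x)\<^sup>2)" using g by (simp add: square_integrable_def)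
    show "(\<lambda>x. (f x)\<^sup>2) \<in> borel_measurable unit_leb" using f by (rule borel_measurable_power)
    show "AE x in unit_leb. norm ((f x)\<^sup>2) \<le> norm ((g x)\<^sup>2)"
      by (rule AE_unit_lebI) (use le in \<open>simp add: abs_le_square_iff\<close>)
  qed
qed (rule f)

lemma square_integrable_const: "square_integrable (\<lambda>x. c)"
  unfolding square_integrable_def by (intro conjI borel_measurable_const unit_leb.integrable_const)

lemma square_integrable_bounded:
  assumes "f \<in> borel_measurable unit_leb" "\<And>x. 0 < x \<Longrightarrow> x < 1 \<Longrightarrow> \<bar>f x\<bar> \<le> C"
  shows "square_integrable f"
  by (rule square_integrable_bound[OF square_integrable_const[of C] assms(1)]) (use assms(2) in force)

lemma square_integrable_continuous:
  assumes "continuous_on {0..1} f" shows "square_integrable f"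
proof -
  have "bounded (f ` {0..1})" using assms by (intro compact_imp_bounded compact_continuous_image) auto
  then obtain C where "\<And>x. x \<in> {0..1} \<Longrightarrow> \<bar>f x\<bar> \<le> C"
    unfolding bounded_iff real_norm_def by (meson image_eqI)
  moreover have "continuous_on {0<..<1} f" by (rule continuous_on_subset[OF assms]) auto
  ultimately show ?thesis
    by (intro square_integrable_bounded[of _ C] continuous_unit_leb_measurable) auto
qed

lemma square_integrable_mult_bounded:
  assumes f: "square_integrable f" and g: "g \<in> borel_measurable unit_leb" and C: "\<And>x. 0 < x \<Longrightarrow> x < 1 \<Longrightarrow> \<bar>g x\<bar> \<le> C"
  shows "square_integrable (\<lambda>x. g x * f x)"
proof (rule square_integrable_bound[OF square_integrable_cmult[OF f, of C]])
  show "(\<lambda>x. g x * f x) \<in> borel_measurable unit_leb"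
    using f g by (auto simp: square_integrable_def)
  fix x :: real assume "0 < x" "x < 1"
  then have "\<bar>g x\<bar> * \<bar>f x\<bar> \<le> \<bar>C\<bar> * \<bar>f x\<bar>" using C[of x] by (intro mult_right_mono) auto
  then show "\<bar>g x * f x\<bar> \<le> \<bar>C * f x\<bar>" by (simp add: abs_mult)
qed

lemma square_integrable_uminus: "square_integrable f \<Longrightarrow> square_integrable (\<lambda>x. - f x)"
  using square_integrable_cmult[of f "-1"] by simp

lemma square_integrable_diff: "square_integrable f \<Longrightarrow> square_integrable g \<Longrightarrow> square_integrable (\<lambda>x. f x - g x)"
  using square_integrable_add[of f "\<lambda>x. - g x"] square_integrable_uminus[of g] by simp

lemma square_integrable_abs: "square_integrable f \<Longrightarrow> square_integrable (\<lambda>x. \<bar>f x\<bar>)"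
  by (rule square_integrable_bound) (auto simp: square_integrable_def)

lemma square_integrable_integrable: "square_integrable f \<Longrightarrow> integrable unit_leb f"
  using square_integrable_mult[OF square_integrable_const[of 1]] by fastforce

lemma square_integrable_rep: "square_integrable (rep_L2 u)"
  using Quotient3_rep_reflp[OF Quotient3_L2, of u] by (simp add: L2rel_def)

lemma abs_rep_L2 [simp]: "abs_L2 (rep_L2 u) = u"
  by (rule Quotient3_abs_rep[OF Quotient3_L2])

lemma rep_abs_L2_AE: "square_integrable f \<Longrightarrow> AE x in unit_leb. rep_L2 (abs_L2 f) x = f x"
  using Quotient3_rep_abs[OF Quotient3_L2, of f] by (simp add: L2rel_def)

lemma abs_L2_eq_iff:
  assumes "square_integrable f" "square_integrable g"
  shows "abs_L2 f = abs_L2 g \<longleftrightarrow> (AE x in unit_leb. f x = g x)"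
  using Quotient3_rel[OF Quotient3_L2, of f g] assms by (auto simp: L2rel_def)

lemma abs_L2_cases:
  obtains f where "square_integrable f" "u = abs_L2 f"
  using square_integrable_rep[of u] abs_rep_L2[of u] by metis

lemma abs_L2_add: "square_integrable f \<Longrightarrow> square_integrable g \<Longrightarrow> abs_L2 f + abs_L2 g = abs_L2 (\<lambda>x. f x + g x)"
  by (rule plus_L2.abs_eq) (auto simp: L2rel_def)

lemma abs_L2_scale: "square_integrable f \<Longrightarrow> c *\<^sub>R abs_L2 f = abs_L2 (\<lambda>x. c * f x)"
  by (rule scaleR_L2.abs_eq) (auto simp: L2rel_def)

lemma abs_L2_uminus: "square_integrable f \<Longrightarrow> - abs_L2 f = abs_L2 (\<lambda>x. - f x)"
  by (rule uminus_L2.abs_eq) (auto simp: L2rel_def)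

lemma abs_L2_diff: "square_integrable f \<Longrightarrow> square_integrable g \<Longrightarrow> abs_L2 f - abs_L2 g = abs_L2 (\<lambda>x. f x - g x)"
  by (simp add: minus_L2_def abs_L2_uminus abs_L2_add square_integrable_uminus)

lemma inner_abs_L2: "square_integrable f \<Longrightarrow> square_integrable g \<Longrightarrow> inner (abs_L2 f) (abs_L2 g) = (\<integral>x. f x * g x \<partial>unit_leb)"
  by (rule inner_L2.abs_eq) (auto simp: L2rel_def)

lemma norm_abs_L2: "square_integrable f \<Longrightarrow> (norm (abs_L2 f))\<^sup>2 = (\<integral>x. (f x)\<^sup>2 \<partial>unit_leb)"
  unfolding power2_norm_eq_inner by (simp add: inner_abs_L2 power2_eq_square)

lemma abs_L2_zero: "abs_L2 (\<lambda>x. 0) = 0"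
  by (rule zero_L2.abs_eq[symmetric])

lemma integral_mult_le_norm:
  assumes "square_integrable f" "square_integrable g"
  shows "\<bar>\<integral>x. f x * g x \<partial>unit_leb\<bar> \<le> norm (abs_L2 f) * norm (abs_L2 g)"
  using Cauchy_Schwarz_ineq2[of "abs_L2 f" "abs_L2 g"] assms by (simp add: inner_abs_L2)

text \<open>
  Riesz--Fischer: the sum of the increments is finite almost everywhere, so the representatives converge
  pointwise, and by Fatou's lemma the limit is also the limit in norm.
\<close>

lemma L2_fast_Cauchy_convergent:
  fixes X :: "nat \<Rightarrow> L2"
  assumes fast: "\<And>m n. m \<le> n \<Longrightarrow> norm (X m - X n) \<le> (1 / 2) ^ m"
  shows "convergent X"
proof -
  define f where "f n = rep_L2 (X n)" for n
  have f: "square_integrable (f n)" "abs_L2 (f n) = X n" for n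
    by (simp_all add: f_def square_integrable_rep)
  have fm [measurable]: "f n \<in> borel_measurable unit_leb" for n using f(1)[of n] by (simp add: square_integrable_def)
  define d where "d n x = \<bar>f n x - f (Suc n) x\<bar>" for n x
  have dsi: "square_integrable (d n)" for n
    unfolding d_def by (intro square_integrable_abs square_integrable_diff f)
  have dm: "d n \<in> borel_measurable unit_leb" for n using dsi[of n] by (simp add: square_integrable_def)
  have dint: "(\<integral>x. d n x \<partial>unit_leb) \<le> (1 / 2) ^ n * norm (abs_L2 (\<lambda>x. 1))" for n
  proof -
    have "(norm (abs_L2 (d n)))\<^sup>2 = (norm (X n - X (Suc n)))\<^sup>2"
      using f dsi[of n] unfolding f(2)[symmetric]
      by (simp add: norm_abs_L2 abs_L2_diff square_integrable_diff d_def)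
    then have nd: "norm (abs_L2 (d n)) = norm (X n - X (Suc n))" by simp
    have "(\<integral>x. d n x \<partial>unit_leb) = (\<integral>x. d n x * 1 \<partial>unit_leb)" by simp
    also have "\<dots> \<le> norm (abs_L2 (d n)) * norm (abs_L2 (\<lambda>x. 1))"
      using integral_mult_le_norm[OF dsi[of n] square_integrable_const[of 1]] by linarith
    also have "\<dots> \<le> (1 / 2) ^ n * norm (abs_L2 (\<lambda>x. 1))"
      unfolding nd by (intro mult_right_mono fast) auto
    finally show ?thesis .
  qed
  have "(\<integral>\<^sup>+x. (\<Sum>n. ennreal (d n x)) \<partial>unit_leb) = (\<Sum>n. \<integral>\<^sup>+x. ennreal (d n x) \<partial>unit_leb)"
    by (rule nn_integral_suminf) (use dm in measurable)
  also have "\<dots> = (\<Sum>n. ennreal (\<integral>x. d n x \<partial>unit_leb))"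
    by (intro suminf_cong nn_integral_eq_integral square_integrable_integrable dsi) (simp add: d_def)
  also have "\<dots> \<le> (\<Sum>n. ennreal ((1 / 2) ^ n * norm (abs_L2 (\<lambda>x. 1))))"
    by (intro suminf_le ennreal_leI dint) auto
  also have "\<dots> = ennreal (\<Sum>n. (1 / 2) ^ n * norm (abs_L2 (\<lambda>x. 1)))"
    by (rule suminf_ennreal2) (auto intro!: summable_mult2 summable_geometric)
  also have "\<dots> < \<infinity>" by simp
  finally have "AE x in unit_leb. (\<Sum>n. ennreal (d n x)) \<noteq> \<infinity>"
    by (intro nn_integral_PInf_AE) (use dm in measurable)
  then have conv: "AE x in unit_leb. convergent (\<lambda>n. f n x)"
  proof eventually_elim
    case (elim x)
    have "summable (\<lambda>n. d n x)"
      by (rule summable_suminf_not_top) (use elim in \<open>auto simp: d_def\<close>)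
    then have "summable (\<lambda>n. f n x - f (Suc n) x)"
      unfolding d_def by (rule summable_rabs_cancel)
    then have "convergent (\<lambda>n. \<Sum>i<n. f i x - f (Suc i) x)"
      by (simp add: summable_iff_convergent)
    then have "convergent (\<lambda>n. f 0 x - f n x)" using sum_lessThan_telescope'[of "\<lambda>i. f i x"] by simp
    from convergent_diff[OF convergent_const[of "f 0 x"] this] show ?case by simp
  qed
  define g where "g x = lim (\<lambda>n. f n x)" for x
  have gm: "g \<in> borel_measurable unit_leb"
    unfolding g_def by (rule borel_measurable_lim_metric) (rule fm)
  have glim: "AE x in unit_leb. (\<lambda>n. f n x) \<longlonglongrightarrow> g x"
    using conv by eventually_elim (simp add: g_def convergent_LIMSEQ_iff)
  have fatou: "(\<integral>\<^sup>+x. ennreal ((f m x - g x)\<^sup>2) \<partial>unit_leb) \<le> ennreal (((1 / 2) ^ m)\<^sup>2)" for m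
  proof -
    have "(\<integral>\<^sup>+x. ennreal ((f m x - g x)\<^sup>2) \<partial>unit_leb) = (\<integral>\<^sup>+x. liminf (\<lambda>n. ennreal ((f m x - f n x)\<^sup>2)) \<partial>unit_leb)"
    proof (rule nn_integral_cong_AE)
      show "AE x in unit_leb. ennreal ((f m x - g x)\<^sup>2) = liminf (\<lambda>n. ennreal ((f m x - f n x)\<^sup>2))"
        using glim
      proof eventually_elim
        case (elim x)
        have "(\<lambda>n. ennreal ((f m x - f n x)\<^sup>2)) \<longlonglongrightarrow> ennreal ((f m x - g x)\<^sup>2)"
          by (intro tendsto_ennrealI tendsto_intros elim)
        then show ?case by (rule lim_imp_Liminf[symmetric, rotated]) simp
      qed
    qed
    also have "\<dots> \<le> liminf (\<lambda>n. \<integral>\<^sup>+x. ennreal ((f m x - f n x)\<^sup>2) \<partial>unit_leb)"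
      by (rule nn_integral_liminf) simp
    also have "\<dots> \<le> liminf (\<lambda>n. ennreal (((1 / 2) ^ m)\<^sup>2))"
    proof (rule Liminf_mono)
      show "\<forall>\<^sub>F n in sequentially. (\<integral>\<^sup>+x. ennreal ((f m x - f n x)\<^sup>2) \<partial>unit_leb) \<le> ennreal (((1 / 2) ^ m)\<^sup>2)"
        unfolding eventually_sequentially
      proof (intro exI allI impI)
        fix n assume mn: "m \<le> n"
        have si: "square_integrable (\<lambda>x. f m x - f n x)" by (intro square_integrable_diff f)
        have "(\<integral>\<^sup>+x. ennreal ((f m x - f n x)\<^sup>2) \<partial>unit_leb) = ennreal (\<integral>x. (f m x - f n x)\<^sup>2 \<partial>unit_leb)"
          by (rule nn_integral_eq_integral) (use si in \<open>auto simp: square_integrable_def\<close>)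
        also have "(\<integral>x. (f m x - f n x)\<^sup>2 \<partial>unit_leb) = (norm (X m - X n))\<^sup>2"
          using norm_abs_L2[OF si] abs_L2_diff[OF f(1) f(1)] f(2) by simp
        also have "\<dots> \<le> ((1 / 2) ^ m)\<^sup>2" using fast[OF mn] by (intro power_mono) auto
        finally show "(\<integral>\<^sup>+x. ennreal ((f m x - f n x)\<^sup>2) \<partial>unit_leb) \<le> ennreal (((1 / 2) ^ m)\<^sup>2)"
          by (simp add: ennreal_leI)
      qed
    qed
    finally show ?thesis by (simp add: Liminf_const)
  qed
  have dsi2: "square_integrable (\<lambda>x. f m x - g x)" for m
    unfolding square_integrable_def
  proof
    show "(\<lambda>x. f m x - g x) \<in> borel_measurable unit_leb" by (intro borel_measurable_diff fm gm)
    then show "integrable unit_leb (\<lambda>x. (f m x - g x)\<^sup>2)"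
      using fatou[of m] by (intro integrableI_nonneg borel_measurable_power) (auto intro: order.strict_trans1)
  qed
  have gsi: "square_integrable g"
    using square_integrable_diff[OF f(1)[of 0] dsi2[of 0]] by simp
  have "norm (X m - abs_L2 g) \<le> (1 / 2) ^ m" for m
  proof -
    have "ennreal ((norm (X m - abs_L2 g))\<^sup>2) = ennreal (\<integral>x. (f m x - g x)\<^sup>2 \<partial>unit_leb)"
      using norm_abs_L2[OF dsi2[of m]] abs_L2_diff[OF f(1) gsi] f(2) by simp
    also have "\<dots> = (\<integral>\<^sup>+x. ennreal ((f m x - g x)\<^sup>2) \<partial>unit_leb)"
      by (rule nn_integral_eq_integral[symmetric]) (use dsi2[of m] in \<open>auto simp: square_integrable_def\<close>)
    also have "\<dots> \<le> ennreal (((1 / 2) ^ m)\<^sup>2)" by (rule fatou)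
    finally have "(norm (X m - abs_L2 g))\<^sup>2 \<le> ((1 / 2) ^ m)\<^sup>2" by simp
    then show ?thesis by (rule power2_le_imp_le) simp
  qed
  then have "X \<longlonglongrightarrow> abs_L2 g"
  proof -
    assume le: "\<And>m. norm (X m - abs_L2 g) \<le> (1 / 2) ^ m"
    have "(\<lambda>m. X m - abs_L2 g) \<longlonglongrightarrow> 0"
      by (rule Lim_null_comparison[OF always_eventually LIMSEQ_realpow_zero]) (use le in auto)
    then show ?thesis by (simp add: LIM_zero_iff)
  qed
  then show ?thesis by (rule convergentI)
qed

text \<open>
  Every Cauchy sequence has a subsequence with geometrically decreasing increments.
\<close>

instance L2 :: banach
proof
  fix X :: "nat \<Rightarrow> L2" assume C: "Cauchy X"
  have "\<exists>N. \<forall>m\<ge>N. \<forall>n\<ge>N. norm (X m - X n) < (1 / 2) ^ k" for k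
    using C unfolding Cauchy_def dist_norm by simp
  then obtain N where N: "\<And>k m n. m \<ge> N k \<Longrightarrow> n \<ge> N k \<Longrightarrow> norm (X m - X n) < (1 / 2) ^ k"
    by metis
  define r where "r k = k + (\<Sum>i\<le>k. N i)" for k
  have rmono: "strict_mono r" by (auto simp: strict_mono_Suc_iff r_def)
  have rN: "N k \<le> r k" for k
    using member_le_sum[of k "{..k}" N] by (simp add: r_def trans_le_add2)
  have "convergent (X \<circ> r)"
  proof (rule L2_fast_Cauchy_convergent)
    fix m n :: nat assume "m \<le> n"
    then have "r m \<le> r n" using rmono by (simp add: strict_mono_less_eq)
    then show "norm ((X \<circ> r) m - (X \<circ> r) n) \<le> (1 / 2) ^ m"
      using N[of m "r m" "r n"] rN[of m] by simp
  qed
  then obtain l where "(X \<circ> r) \<longlonglongrightarrow> l" by (auto simp: convergent_def)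
  then show "convergent X"
    using Cauchy_converges_subseq[OF C rmono] by (auto simp: convergent_def)
qed

section \<open>Density of polynomials\<close>

lemma L2_dominated_tendsto:
  assumes f: "\<And>n. square_integrable (f n)" and g: "square_integrable g" and h: "square_integrable h"
    and lim: "AE x in unit_leb. (\<lambda>n. f n x) \<longlonglongrightarrow> g x"
    and le: "\<And>n x. 0 < x \<Longrightarrow> x < 1 \<Longrightarrow> \<bar>f n x - g x\<bar> \<le> h x"
  shows "(\<lambda>n. abs_L2 (f n)) \<longlonglongrightarrow> abs_L2 g"
proof -
  have d: "square_integrable (\<lambda>x. f n x - g x)" for n by (intro square_integrable_diff f g)
  have "(\<lambda>n. \<integral>x. (f n x - g x)\<^sup>2 \<partial>unit_leb) \<longlonglongrightarrow> (\<integral>x. 0 \<partial>unit_leb)"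
  proof (rule integral_dominated_convergence)
    show "integrable unit_leb (\<lambda>x. (h x)\<^sup>2)" using h by (simp add: square_integrable_def)
    show "(\<lambda>x. (f n x - g x)\<^sup>2) \<in> borel_measurable unit_leb" for n
      using d[of n] by (intro borel_measurable_power) (simp add: square_integrable_def)
    show "AE x in unit_leb. (\<lambda>n. (f n x - g x)\<^sup>2) \<longlonglongrightarrow> 0"
      using lim
    proof eventually_elim
      case (elim x)
      have "(\<lambda>n. (f n x - g x)\<^sup>2) \<longlonglongrightarrow> (g x - g x)\<^sup>2" by (intro tendsto_intros elim)
      then show ?case by simp
    qed
    show "AE x in unit_leb. norm ((f n x - g x)\<^sup>2) \<le> (h x)\<^sup>2" for n
    proof (rule AE_unit_lebI)
      fix x :: real assume "0 < x" "x < 1"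
      then have "\<bar>f n x - g x\<bar>\<^sup>2 \<le> (h x)\<^sup>2" by (intro power_mono le) auto
      then show "norm ((f n x - g x)\<^sup>2) \<le> (h x)\<^sup>2" by simp
    qed
  qed simp
  then have "(\<lambda>n. (norm (abs_L2 (f n) - abs_L2 g))\<^sup>2) \<longlonglongrightarrow> 0"
    by (simp add: abs_L2_diff[OF f g] norm_abs_L2[OF d])
  then have "(\<lambda>n. sqrt ((norm (abs_L2 (f n) - abs_L2 g))\<^sup>2)) \<longlonglongrightarrow> sqrt 0"
    by (rule tendsto_real_sqrt)
  then show ?thesis by (simp add: tendsto_norm_zero_iff LIM_zero_iff)
qed

lemma norm_abs_L2_le:
  assumes "f \<in> borel_measurable unit_leb" "\<And>x. 0 < x \<Longrightarrow> x < 1 \<Longrightarrow> \<bar>f x\<bar> \<le> C" "0 \<le> C"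
  shows "norm (abs_L2 f) \<le> C"
proof -
  have si: "square_integrable f" by (rule square_integrable_bounded) (use assms in auto)
  have "(norm (abs_L2 f))\<^sup>2 = (\<integral>x. (f x)\<^sup>2 \<partial>unit_leb)" by (rule norm_abs_L2[OF si])
  also have "\<dots> \<le> (\<integral>x. C\<^sup>2 \<partial>unit_leb)"
  proof (rule integral_mono_AE)
    show "integrable unit_leb (\<lambda>x. (f x)\<^sup>2)" using si by (simp add: square_integrable_def)
    show "integrable unit_leb (\<lambda>x. C\<^sup>2)" by (rule unit_leb.integrable_const)
    show "AE x in unit_leb. (f x)\<^sup>2 \<le> C\<^sup>2"
    proof (rule AE_unit_lebI)
      fix x :: real assume "0 < x" "x < 1"
      then have "\<bar>f x\<bar>\<^sup>2 \<le> C\<^sup>2" by (intro power_mono assms) auto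
      then show "(f x)\<^sup>2 \<le> C\<^sup>2" by simp
    qed
  qed
  also have "\<dots> = C\<^sup>2" by (simp add: measure_restrict_space)
  finally show ?thesis using assms(3) by (rule power2_le_imp_le)
qed

text \<open>
  Dominated convergence reduces the claim first to bounded functions, by truncation, and then to continuous
  ones, as the pointwise limits that measurability provides; Bernstein polynomials approximate these uniformly.
\<close>

lemma polynomials_dense_L2:
  assumes e: "0 < e"
  shows "\<exists>p :: real poly. norm (u - abs_L2 (poly p)) < e"
proof -
  obtain f where f: "square_integrable f" "u = abs_L2 f" by (rule abs_L2_cases)
  have fm: "f \<in> borel_measurable unit_leb" using f(1) by (simp add: square_integrable_def)
  have e3: "0 < e / 3" using e by simp
  define ft where "ft m x = max (- real m) (min (real m) (f x))" for m x
  have ftm: "ft m \<in> borel_measurable unit_leb" for m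
    unfolding ft_def by (intro borel_measurable_max borel_measurable_min fm borel_measurable_const)
  have ftb: "\<bar>ft m x\<bar> \<le> real m" for m x unfolding ft_def by (auto simp: max_def min_def)
  have ftsi: "square_integrable (ft m)" for m by (rule square_integrable_bounded[OF ftm ftb])
  have "(\<lambda>m. abs_L2 (ft m)) \<longlonglongrightarrow> abs_L2 f"
  proof (rule L2_dominated_tendsto[OF ftsi f(1) square_integrable_abs[OF f(1)]])
    show "AE x in unit_leb. (\<lambda>n. ft n x) \<longlonglongrightarrow> f x"
    proof (rule AE_I2)
      fix x
      obtain N where N: "\<bar>f x\<bar> \<le> real N" using real_arch_simple by blast
      have "ft n x = f x" if "n \<ge> N" for n
        using N that by (auto simp: ft_def max_def min_def abs_le_iff)
      then show "(\<lambda>n. ft n x) \<longlonglongrightarrow> f x"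
        by (intro tendsto_eventually) (auto simp: eventually_sequentially)
    qed
    show "\<bar>ft n x - f x\<bar> \<le> \<bar>f x\<bar>" for n x by (auto simp: ft_def max_def min_def abs_if)
  qed
  from LIMSEQ_D[OF this e3] obtain m where m: "norm (abs_L2 (ft m) - abs_L2 f) < e / 3" by auto
  have "ft m measurable_on {0<..<1}"
    using ftm by (subst measurable_on_iff_borel_measurable) auto
  then obtain N g where N: "negligible N" and gc: "\<And>n. continuous_on UNIV (g n)"
    and g: "\<And>x. x \<notin> N \<Longrightarrow> (\<lambda>n. g n x) \<longlonglongrightarrow> (if x \<in> {0<..<1} then ft m x else 0)"
    unfolding measurable_on_def by blast
  define gt where "gt n x = max (- real m) (min (real m) (g n x))" for n x
  have gtc: "continuous_on A (gt n)" for n A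
    unfolding gt_def by (intro continuous_intros continuous_on_subset[OF gc]) simp
  have gtb: "\<bar>gt n x\<bar> \<le> real m" for n x unfolding gt_def by (auto simp: max_def min_def)
  have "(\<lambda>n. abs_L2 (gt n)) \<longlonglongrightarrow> abs_L2 (ft m)"
  proof (rule L2_dominated_tendsto[OF square_integrable_continuous[OF gtc] ftsi square_integrable_const[of "2 * real m"]])
    have "AE x in lebesgue. x \<notin> N" using N by (simp add: AE_not_in negligible_iff_null_sets)
    then have "AE x in lebesgue. x \<in> {0<..<1} \<longrightarrow> x \<notin> N" by eventually_elim simp
    then have "AE x in unit_leb. x \<notin> N" by (simp add: AE_restrict_space_iff)
    then show "AE x in unit_leb. (\<lambda>n. gt n x) \<longlonglongrightarrow> ft m x"
    proof (rule AE_mp, intro AE_unit_lebI impI)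
      fix x :: real assume x: "0 < x" "x < 1" "x \<notin> N"
      then have "(\<lambda>n. g n x) \<longlonglongrightarrow> ft m x" using g[of x] by simp
      then have "(\<lambda>n. gt n x) \<longlonglongrightarrow> max (- real m) (min (real m) (ft m x))"
        unfolding gt_def by (intro tendsto_intros)
      moreover have "max (- real m) (min (real m) (ft m x)) = ft m x" using ftb[of m x] by (auto simp: max_def min_def)
      ultimately show "(\<lambda>n. gt n x) \<longlonglongrightarrow> ft m x" by simp
    qed
    show "\<bar>gt n x - ft m x\<bar> \<le> 2 * real m" for n x using gtb[of n x] ftb[of m x] by linarith
  qed
  from LIMSEQ_D[OF this e3] obtain n where n: "norm (abs_L2 (gt n) - abs_L2 (ft m)) < e / 3" by auto
  from uniform_limitD[OF bernstein_approx_uniform[OF gtc[of _ n]] e3]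
  obtain k where k: "\<And>x. x \<in> {0..1} \<Longrightarrow> dist (poly (bernstein_approx (gt n) k) x) (gt n x) < e / 3"
    by (auto simp only: eventually_sequentially)
  let ?p = "bernstein_approx (gt n) k"
  have pc: "continuous_on A (poly ?p)" for A by (intro continuous_intros)
  have "norm (abs_L2 (\<lambda>x. gt n x - poly ?p x)) \<le> e / 3"
  proof (rule norm_abs_L2_le)
    show "(\<lambda>x. gt n x - poly ?p x) \<in> borel_measurable unit_leb"
      by (intro continuous_unit_leb_measurable continuous_intros gtc)
    fix x :: real assume "0 < x" "x < 1"
    then show "\<bar>gt n x - poly ?p x\<bar> \<le> e / 3" using k[of x] by (simp add: dist_real_def abs_minus_commute)
  qed (use e in simp)
  then have p: "norm (abs_L2 (gt n) - abs_L2 (poly ?p)) \<le> e / 3"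
    by (simp add: abs_L2_diff square_integrable_continuous gtc pc)
  have "norm (abs_L2 f - abs_L2 (poly ?p)) < e"
    using m n p norm_triangle_ineq[of "abs_L2 f - abs_L2 (ft m)" "abs_L2 (ft m) - abs_L2 (poly ?p)"]
      norm_triangle_ineq[of "abs_L2 (ft m) - abs_L2 (gt n)" "abs_L2 (gt n) - abs_L2 (poly ?p)"]
    by (simp add: norm_minus_commute)
  then show ?thesis using f(2) by blast
qed

section \<open>Test functions\<close>

definition test_function :: "(real \<Rightarrow> real) \<Rightarrow> (real \<Rightarrow> real) \<Rightarrow> bool" where
  "test_function \<psi> \<psi>' \<longleftrightarrow> (\<forall>x. (\<psi> has_real_derivative \<psi>' x) (at x)) \<and> continuous_on UNIV \<psi>' \<and>
     (\<exists>K\<subseteq>{0<..<1}. compact K \<and> (\<forall>x. x \<notin> K \<longrightarrow> \<psi> x = 0))"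

text \<open>
  A continuously differentiable function supported on the interior of the unit interval; for \<open>n \<rightarrow> \<infinity>\<close> its
  support exhausts \<open>(0,1)\<close>.
\<close>

definition cutoff :: "nat \<Rightarrow> real \<Rightarrow> real" where
  "cutoff n x = (max 0 (x * (1 - x) - 1 / real (Suc n)))\<^sup>2"

lemma positive_part_square_deriv: "((\<lambda>y. (max 0 y)\<^sup>2) has_real_derivative 2 * max 0 y) (at (y :: real))"
proof -
  consider "0 < y" | "y < 0" | "y = 0" by linarith
  then show ?thesis
  proof cases
    case 1
    have "((\<lambda>y. y\<^sup>2) has_real_derivative 2 * max 0 y) (at y)" using 1 by (auto intro!: derivative_eq_intros)
    then show ?thesis
      by (rule has_field_derivative_transform_within_open[of _ _ _ "{0<..}"]) (use 1 in auto)
  next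
    case 2
    have "((\<lambda>y. 0) has_real_derivative 2 * max 0 y) (at y)" using 2 by (auto intro!: derivative_eq_intros)
    then show ?thesis
      by (rule has_field_derivative_transform_within_open[of _ _ _ "{..<0}"]) (use 2 in auto)
  next
    case 3
    have "((\<lambda>h. ((max 0 (0 + h))\<^sup>2 - (max 0 0)\<^sup>2) / h) \<longlongrightarrow> 0) (at (0::real))"
    proof (rule Lim_null_comparison)
      show "\<forall>\<^sub>F h in at 0. norm (((max 0 (0 + h))\<^sup>2 - (max 0 0)\<^sup>2) / h) \<le> \<bar>h\<bar>"
        by (intro always_eventually allI) (auto simp: max_def power2_eq_square abs_if)
      have "((\<lambda>h. \<bar>h\<bar>) \<longlongrightarrow> \<bar>0\<bar>) (at (0::real))" by (intro tendsto_intros)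
      then show "((\<lambda>h. \<bar>h\<bar>) \<longlongrightarrow> 0) (at (0::real))" by simp
    qed
    then show ?thesis using 3 by (simp add: DERIV_def)
  qed
qed

lemma cutoff_deriv:
  "(cutoff n has_real_derivative 2 * max 0 (x * (1 - x) - 1 / real (Suc n)) * (1 - 2 * x)) (at x)"
proof -
  have "((\<lambda>x. x * (1 - x) - 1 / real (Suc n)) has_real_derivative 1 - 2 * x) (at x)"
    by (auto intro!: derivative_eq_intros)
  from DERIV_chain2[OF positive_part_square_deriv this] show ?thesis by (simp add: cutoff_def[abs_def])
qed

lemma test_function_cutoff_poly:
  "test_function (\<lambda>x. cutoff n x * poly p x)
     (\<lambda>x. cutoff n x * poly (pderiv p) x + 2 * max 0 (x * (1 - x) - 1 / real (Suc n)) * (1 - 2 * x) * poly p x)"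
  unfolding test_function_def
proof (intro conjI allI)
  show "((\<lambda>x. cutoff n x * poly p x) has_real_derivative
      cutoff n x * poly (pderiv p) x + 2 * max 0 (x * (1 - x) - 1 / real (Suc n)) * (1 - 2 * x) * poly p x) (at x)" for x
    by (rule DERIV_mult'[OF cutoff_deriv poly_DERIV])
  show "continuous_on UNIV (\<lambda>x. cutoff n x * poly (pderiv p) x + 2 * max 0 (x * (1 - x) - 1 / real (Suc n)) * (1 - 2 * x) * poly p x)"
    unfolding cutoff_def by (intro continuous_intros)
  let ?K = "{x :: real. 1 / real (Suc n) \<le> x * (1 - x)}"
  have pos: "0 < x \<and> x < 1" if "x \<in> ?K" for x :: real
  proof -
    have "0 < x * (1 - x)" using that by (rule_tac less_le_trans[of 0 "1 / real (Suc n)"]) auto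
    then show ?thesis by (auto simp: zero_less_mult_iff)
  qed
  show "\<exists>K\<subseteq>{0<..<1}. compact K \<and> (\<forall>x. x \<notin> K \<longrightarrow> cutoff n x * poly p x = 0)"
  proof (intro exI[of _ ?K] conjI allI impI)
    show "?K \<subseteq> {0<..<1}" using pos by auto
    have "closed ?K" by (intro closed_Collect_le continuous_intros)
    moreover have "?K \<subseteq> {0..1}" using pos by force
    then have "bounded ?K" by (rule bounded_subset[OF bounded_closed_interval])
    ultimately show "compact ?K" by (simp add: compact_eq_bounded_closed)
    fix x assume "x \<notin> ?K"
    then show "cutoff n x * poly p x = 0" by (simp add: cutoff_def)
  qed
qed

text \<open>
  The test functions \<open>cutoff n\<close> times a polynomial suffice: \<open>cutoff n\<close> times \<open>f\<close> is orthogonal to all polynomials,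
  hence zero, and every point lies in the support of some \<open>cutoff n\<close>.
\<close>

lemma test_functions_separate:
  assumes si: "\<And>n. square_integrable (\<lambda>x. cutoff n x * f x)"
    and orth: "\<And>\<psi> \<psi>'. test_function \<psi> \<psi>' \<Longrightarrow> (\<integral>x. f x * \<psi> x \<partial>unit_leb) = 0"
  shows "AE x in unit_leb. f x = 0"
proof -
  have "AE x in unit_leb. cutoff n x * f x = 0" for n
  proof -
    let ?w = "abs_L2 (\<lambda>x. cutoff n x * f x)"
    have p0: "inner ?w (abs_L2 (poly p)) = 0" for p
    proof -
      have "inner ?w (abs_L2 (poly p)) = (\<integral>x. cutoff n x * f x * poly p x \<partial>unit_leb)"
        by (rule inner_abs_L2[OF si]) (intro square_integrable_continuous continuous_intros)
      also have "\<dots> = (\<integral>x. f x * (cutoff n x * poly p x) \<partial>unit_leb)"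
        by (intro Bochner_Integration.integral_cong refl) (simp add: mult_ac)
      also have "\<dots> = 0" by (rule orth[OF test_function_cutoff_poly])
      finally show ?thesis .
    qed
    have "?w = 0"
    proof (rule ccontr)
      assume nz: "?w \<noteq> 0"
      then obtain p where p: "norm (?w - abs_L2 (poly p)) < norm ?w"
        using polynomials_dense_L2[of "norm ?w" ?w] by auto
      have "(norm ?w)\<^sup>2 = inner ?w (?w - abs_L2 (poly p))"
        by (simp add: inner_diff_right p0 power2_norm_eq_inner)
      also have "\<dots> \<le> norm ?w * norm (?w - abs_L2 (poly p))" by (rule norm_cauchy_schwarz)
      also have "\<dots> < norm ?w * norm ?w" using p nz by (intro mult_strict_left_mono) auto
      finally show False by (simp add: power2_eq_square)
    qed
    then have "?w = abs_L2 (\<lambda>x. 0)" by (simp add: abs_L2_zero)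
    then show ?thesis using abs_L2_eq_iff[OF si square_integrable_zero] by simp
  qed
  then have "AE x in unit_leb. \<forall>n. cutoff n x * f x = 0" unfolding AE_all_countable by blast
  then show ?thesis
  proof (rule AE_mp, intro AE_unit_lebI impI)
    fix x :: real assume x: "0 < x" "x < 1" and z: "\<forall>n. cutoff n x * f x = 0"
    have "0 < x * (1 - x)" using x by simp
    then obtain n where "1 / real (Suc n) < x * (1 - x)"
      using nat_approx_posE by blast
    then have "cutoff n x \<noteq> 0" by (simp add: cutoff_def)
    then show "f x = 0" using z by auto
  qed
qed

section \<open>The weighted integration operator and its adjoint\<close>

lemma unit_leb_integral_of_absolutely_integrable:
  assumes f: "(f has_integral I) {r..s}" and ai: "f absolutely_integrable_on {r<..<s}" and rs: "0 \<le> r" "s \<le> 1"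
    and g: "\<And>x. 0 < x \<Longrightarrow> x < 1 \<Longrightarrow> g x = indicator {r<..<s} x * (f x :: real)"
  shows "integrable unit_leb g" "(\<integral>x. g x \<partial>unit_leb) = I"
proof -
  have f': "(f has_integral I) {r<..<s}" using f by (simp add: has_integral_Icc_iff_Ioo)
  from ai have i: "integrable lebesgue (\<lambda>x. indicator {r<..<s} x *\<^sub>R f x)" by (simp add: set_integrable_def)
  have eq: "(\<lambda>x. indicator {0<..<1} x *\<^sub>R g x) = (\<lambda>x. indicator {r<..<s} x *\<^sub>R f x)"
    by (rule ext) (use g rs in \<open>auto simp: indicator_def\<close>)
  show "integrable unit_leb g"
    using i by (subst integrable_restrict_space) (simp_all only: eq, simp)
  have "(\<integral>x. g x \<partial>unit_leb) = (\<integral>x. indicator {r<..<s} x *\<^sub>R f x \<partial>lebesgue)"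
    by (subst integral_restrict_space) (simp_all only: eq, simp)
  also have "\<dots> = integral {r<..<s} f"
    using set_lebesgue_integral_eq_integral(2)[of "{r<..<s}" f] i by (simp add: set_integrable_def set_lebesgue_integral_def)
  also have "\<dots> = I" using f' by (rule integral_unique)
  finally show "(\<integral>x. g x \<partial>unit_leb) = I" .
qed

lemma unit_leb_integral_of_has_integral:
  assumes f: "(f has_integral I) {r..s}" and nn: "\<And>x. x \<in> {r..s} \<Longrightarrow> 0 \<le> f x" and rs: "0 \<le> r" "s \<le> 1"
    and g: "\<And>x. 0 < x \<Longrightarrow> x < 1 \<Longrightarrow> g x = indicator {r<..<s} x * (f x :: real)"
  shows "integrable unit_leb g" "(\<integral>x. g x \<partial>unit_leb) = I"
proof -
  have "(f has_integral I) {r<..<s}" using f by (simp add: has_integral_Icc_iff_Ioo)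
  then have "f absolutely_integrable_on {r<..<s}"
    using nn by (intro nonnegative_absolutely_integrable_1) auto
  from unit_leb_integral_of_absolutely_integrable[OF f this rs g]
  show "integrable unit_leb g" "(\<integral>x. g x \<partial>unit_leb) = I" by auto
qed

lemma unit_leb_integral_of_continuous:
  assumes f: "(f has_integral I) {r..s}" and c: "continuous_on {r..s} f" and rs: "0 \<le> r" "s \<le> 1"
    and g: "\<And>x. 0 < x \<Longrightarrow> x < 1 \<Longrightarrow> g x = indicator {r<..<s} x * (f x :: real)"
  shows "integrable unit_leb g" "(\<integral>x. g x \<partial>unit_leb) = I"
proof -
  have "f absolutely_integrable_on {r..s}" by (rule absolutely_integrable_continuous_real[OF c])
  then have "f absolutely_integrable_on {r<..<s}" by (rule set_integrable_subset) auto
  from unit_leb_integral_of_absolutely_integrable[OF f this rs g]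
  show "integrable unit_leb g" "(\<integral>x. g x \<partial>unit_leb) = I" by auto
qed

lemma norm_abs_L2_indicator:
  assumes "0 < y" "y < 1"
  shows "square_integrable (indicator {..<y})" "norm (abs_L2 (indicator {..<y})) = sqrt y"
proof -
  show si: "square_integrable (indicator {..<y})"
    by (rule square_integrable_bounded[of _ 1]) (auto intro!: borel_measurable_unit_leb)
  have "((\<lambda>_. 1) has_integral y) {0..y}"
    using has_integral_const_real[of "1::real" 0 y] assms by simp
  then have "(\<integral>x. (indicator {..<y} x)\<^sup>2 \<partial>unit_leb) = y"
    by (rule unit_leb_integral_of_has_integral(2)) (use assms in \<open>auto simp: indicator_def\<close>)
  then have "(norm (abs_L2 (indicator {..<y})))\<^sup>2 = y" by (simp only: norm_abs_L2[OF si])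
  then show "norm (abs_L2 (indicator {..<y})) = sqrt y"
    by (metis norm_ge_zero real_sqrt_abs abs_of_nonneg)
qed

interpretation unit_leb_pair: pair_sigma_finite unit_leb unit_leb
  by (intro pair_sigma_finite.intro unit_leb.sigma_finite_measure_axioms)

definition primitive :: "(real \<Rightarrow> real) \<Rightarrow> real \<Rightarrow> real" where
  "primitive f y = (\<integral>x. indicator {..<y} x * f x \<partial>unit_leb)"

lemma primitive_integrable:
  assumes "square_integrable f" shows "integrable unit_leb (\<lambda>x. indicator {..<y} x * f x)"
proof (rule Bochner_Integration.integrable_bound[OF square_integrable_integrable[OF assms]])
  show "(\<lambda>x. indicator {..<y} x * f x) \<in> borel_measurable unit_leb"
    using assms by (intro borel_measurable_times borel_measurable_unit_leb[of "indicator {..<y}"]) (auto simp: square_integrable_def)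
qed (auto simp: indicator_def)

lemma primitive_bound:
  assumes "square_integrable f" "0 < y" "y < 1"
  shows "\<bar>primitive f y\<bar> \<le> sqrt y * norm (abs_L2 f)"
  using integral_mult_le_norm[OF norm_abs_L2_indicator(1)[OF assms(2,3)] assms(1)] norm_abs_L2_indicator(2)[OF assms(2,3)]
  by (simp add: primitive_def)

definition less_kernel :: "real \<times> real \<Rightarrow> real" where
  "less_kernel p = (if snd p < fst p then 1 else 0)"

lemma id_measurable_unit_leb: "(\<lambda>x. x) \<in> borel_measurable unit_leb"
  by (rule borel_measurable_unit_leb) simp

text \<open>
  The kernel \<open>less_kernel\<close> is the indicator of the triangle below the diagonal; measurability of the double
  integrands follows from that of their factors.
\<close>

lemma less_kernel_measurable:
  assumes q: "q \<in> borel_measurable unit_leb" and h: "h \<in> borel_measurable unit_leb"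
  shows "(\<lambda>p. less_kernel p * (q (fst p) * h (snd p))) \<in> borel_measurable (unit_leb \<Otimes>\<^sub>M unit_leb)"
proof -
  have fm: "fst \<in> borel_measurable (unit_leb \<Otimes>\<^sub>M unit_leb)"
    using measurable_compose[OF measurable_fst[of unit_leb unit_leb] id_measurable_unit_leb] by simp
  have sm: "snd \<in> borel_measurable (unit_leb \<Otimes>\<^sub>M unit_leb)"
    using measurable_compose[OF measurable_snd[of unit_leb unit_leb] id_measurable_unit_leb] by simp
  have "less_kernel \<in> borel_measurable (unit_leb \<Otimes>\<^sub>M unit_leb)"
    unfolding less_kernel_def[abs_def]
    by (intro measurable_If borel_measurable_const borel_measurable_less fm sm)
  moreover have "(\<lambda>p. q (fst p)) \<in> borel_measurable (unit_leb \<Otimes>\<^sub>M unit_leb)"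
    by (rule measurable_compose[OF measurable_fst q])
  moreover have "(\<lambda>p. h (snd p)) \<in> borel_measurable (unit_leb \<Otimes>\<^sub>M unit_leb)"
    by (rule measurable_compose[OF measurable_snd h])
  ultimately show ?thesis by (intro borel_measurable_times)
qed

lemma primitive_measurable:
  assumes f: "square_integrable f" shows "primitive f \<in> borel_measurable unit_leb"
proof -
  have "f \<in> borel_measurable unit_leb" using f by (simp add: square_integrable_def)
  from less_kernel_measurable[OF borel_measurable_const[of 1] this]
  have "(\<lambda>y. \<integral>x. less_kernel (y, x) * (1 * f x) \<partial>unit_leb) \<in> borel_measurable unit_leb"
    by (intro unit_leb.borel_measurable_lebesgue_integral) (simp add: split_beta')
  moreover have "less_kernel (y, x) * (1 * f x) = indicator {..<y} x * f x" for x y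
    by (simp add: less_kernel_def)
  then have "(\<lambda>y. \<integral>x. less_kernel (y, x) * (1 * f x) \<partial>unit_leb) = primitive f"
    by (intro ext) (simp only: primitive_def)
  ultimately show ?thesis by (simp only:)
qed

locale degenerate_elliptic =
  fixes \<beta> :: real
  assumes \<beta>1: "1 < \<beta>" and \<beta>2: "\<beta> < 2"
begin

abbreviation wt :: "real \<Rightarrow> real" where "wt y \<equiv> y powr (- \<beta> / 2)"

text \<open>
  The weight in the pointwise bounds for \<open>Tf f\<close> and \<open>Tsf q\<close>: by the Cauchy--Schwarz inequality both are at most a
  constant times \<open>bw\<close>, which is square integrable because \<open>\<beta> < 2\<close>.
\<close>

abbreviation bw :: "real \<Rightarrow> real" where "bw y \<equiv> y powr ((1 - \<beta>) / 2)"

lemma powr_unit_measurable: "(\<lambda>y. y powr c) \<in> borel_measurable unit_leb"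
  by (rule borel_measurable_unit_leb) simp

lemma bw_L2: "square_integrable bw" "norm (abs_L2 bw) = sqrt (1 / (2 - \<beta>))"
proof -
  have 1: "((\<lambda>x. x powr (1 - \<beta>)) has_integral (1 powr (1 - \<beta> + 1) / (1 - \<beta> + 1))) {0..1}"
    by (rule has_integral_powr_from_0) (use \<beta>2 in auto)
  have bw2: "(bw x)\<^sup>2 = indicator {0<..<1} x * x powr (1 - \<beta>)" if "0 < x" "x < 1" for x
    using that by (simp add: power2_eq_square flip: powr_add)
  note I = unit_leb_integral_of_has_integral[OF 1 _ _ _ bw2]
  show si: "square_integrable bw"
    unfolding square_integrable_def by (intro conjI powr_unit_measurable I(1)) auto
  have "(\<integral>x. (bw x)\<^sup>2 \<partial>unit_leb) = 1 / (2 - \<beta>)"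
    by (subst I(2)) auto
  then have "(norm (abs_L2 bw))\<^sup>2 = 1 / (2 - \<beta>)" by (simp only: norm_abs_L2[OF si])
  then show "norm (abs_L2 bw) = sqrt (1 / (2 - \<beta>))"
    by (metis norm_ge_zero real_sqrt_abs abs_of_nonneg)
qed

text \<open>
  In terms of the flux \<open>w = x\<^sup>\<beta> v'\<close> of the solution of \<open>A v = f\<close>, which vanishes at \<open>0\<close>, this is
  \<open>- x\<^bsup>\<beta>/2\<^esup> v' = - x\<^bsup>-\<beta>/2\<^esup> w\<close>.
\<close>

definition Tf :: "(real \<Rightarrow> real) \<Rightarrow> real \<Rightarrow> real" where
  "Tf f y = wt y * primitive f y"

text \<open>
  The formal adjoint of \<open>Tf\<close>.  It integrates towards \<open>1\<close>, and so encodes the boundary condition there.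
\<close>

definition Tsf :: "(real \<Rightarrow> real) \<Rightarrow> real \<Rightarrow> real" where
  "Tsf q x = (\<integral>y. indicator {x<..} y * (wt y * q y) \<partial>unit_leb)"

lemma wt_bound: 
  assumes "square_integrable f" "0 < y" "y < 1"
  shows "wt y * \<bar>primitive f y\<bar> \<le> norm (abs_L2 f) * bw y"
proof -
  have "wt y * \<bar>primitive f y\<bar> \<le> wt y * (sqrt y * norm (abs_L2 f))"
    by (intro mult_left_mono primitive_bound assms) simp
  also have "wt y * sqrt y = bw y"
    using assms by (simp add: powr_half_sqrt[symmetric] powr_add[symmetric] diff_divide_distrib)
  then have "wt y * (sqrt y * norm (abs_L2 f)) = norm (abs_L2 f) * bw y"
    by (simp add: mult.assoc[symmetric] mult.commute)
  finally show ?thesis .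
qed

lemma Tf_square_integrable:
  assumes f: "square_integrable f" shows "square_integrable (Tf f)"
proof (rule square_integrable_bound[OF square_integrable_cmult[OF bw_L2(1)]])
  show "Tf f \<in> borel_measurable unit_leb"
    unfolding Tf_def by (intro borel_measurable_times powr_unit_measurable primitive_measurable f)
  fix y :: real assume "0 < y" "y < 1"
  then show "\<bar>Tf f y\<bar> \<le> \<bar>norm (abs_L2 f) * bw y\<bar>"
    using wt_bound[OF f] by (simp add: Tf_def abs_mult)
qed

lemma Tf_norm:
  assumes f: "square_integrable f"
  shows "norm (abs_L2 (Tf f)) \<le> sqrt (1 / (2 - \<beta>)) * norm (abs_L2 f)"
proof -
  let ?g = "\<lambda>y. norm (abs_L2 f) * bw y"
  have g: "square_integrable ?g" by (rule square_integrable_cmult[OF bw_L2(1)])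
  note Tsi = Tf_square_integrable[OF f]
  have "(norm (abs_L2 (Tf f)))\<^sup>2 = (\<integral>y. (Tf f y)\<^sup>2 \<partial>unit_leb)" by (rule norm_abs_L2[OF Tsi])
  also have "\<dots> \<le> (\<integral>y. (?g y)\<^sup>2 \<partial>unit_leb)"
  proof (rule integral_mono_AE)
    show "integrable unit_leb (\<lambda>y. (Tf f y)\<^sup>2)" "integrable unit_leb (\<lambda>y. (?g y)\<^sup>2)"
      using Tsi g by (simp_all only: square_integrable_def)
    show "AE y in unit_leb. (Tf f y)\<^sup>2 \<le> (?g y)\<^sup>2"
    proof (rule AE_unit_lebI)
      fix y :: real assume "0 < y" "y < 1"
      then have "\<bar>Tf f y\<bar> \<le> ?g y" using wt_bound[OF f] by (simp add: Tf_def abs_mult)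
      then have "\<bar>Tf f y\<bar>\<^sup>2 \<le> (?g y)\<^sup>2" by (intro power_mono) auto
      then show "(Tf f y)\<^sup>2 \<le> (?g y)\<^sup>2" by simp
    qed
  qed
  also have "\<dots> = (norm (abs_L2 ?g))\<^sup>2" by (rule norm_abs_L2[OF g, symmetric])
  finally have "norm (abs_L2 (Tf f)) \<le> norm (abs_L2 ?g)" by (rule power2_le_imp_le) simp
  also have "abs_L2 ?g = norm (abs_L2 f) *\<^sub>R abs_L2 bw" by (rule abs_L2_scale[OF bw_L2(1), symmetric])
  finally show ?thesis by (simp add: bw_L2(2) mult.commute)
qed

text \<open>
  The weight \<open>y\<^sup>-\<^sup>\<beta>\<close> is integrable away from \<open>0\<close>, and its tail integral behaves like \<open>x\<^bsup>1-\<beta>\<^esup>\<close>.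
\<close>

lemma tail_weight_L2:
  assumes x: "0 < x" "x < 1"
  shows "square_integrable (\<lambda>y. indicator {x<..} y * wt y)"
    and "norm (abs_L2 (\<lambda>y. indicator {x<..} y * wt y)) \<le> bw x / sqrt (\<beta> - 1)"
proof -
  let ?k = "\<lambda>y. indicator {x<..} y * wt y"
  have der: "((\<lambda>y. - (y powr (1 - \<beta>)) / (\<beta> - 1)) has_vector_derivative y powr (- \<beta>)) (at y within {x..1})"
    if "y \<in> {x..1}" for y
  proof -
    have "((\<lambda>y. y powr (1 - \<beta>)) has_real_derivative (1 - \<beta>) * y powr (1 - \<beta> - 1)) (at y within {x..1})"
      using that x by (intro has_real_derivative_powr[THEN has_field_derivative_at_within]) auto
    then have "((\<lambda>y. - (y powr (1 - \<beta>)) / (\<beta> - 1)) has_real_derivative - ((1 - \<beta>) * y powr (1 - \<beta> - 1)) / (\<beta> - 1)) (at y within {x..1})"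
      by (intro DERIV_cdivide DERIV_minus)
    moreover have "- ((1 - \<beta>) * z) / (\<beta> - 1) = z" for z
      using \<beta>1 by (simp add: divide_eq_eq algebra_simps)
    ultimately have "((\<lambda>y. - (y powr (1 - \<beta>)) / (\<beta> - 1)) has_real_derivative y powr (- \<beta>)) (at y within {x..1})"
      by simp
    then show ?thesis by (simp add: has_real_derivative_iff_has_vector_derivative)
  qed
  have "((\<lambda>y. y powr (- \<beta>)) has_integral (- (1 powr (1 - \<beta>)) / (\<beta> - 1) - (- (x powr (1 - \<beta>)) / (\<beta> - 1)))) {x..1}"
    using x by (intro fundamental_theorem_of_calculus der) auto
  then have 1: "((\<lambda>y. y powr (- \<beta>)) has_integral ((x powr (1 - \<beta>) - 1) / (\<beta> - 1))) {x..1}"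
    by (simp add: diff_divide_distrib)
  have k2: "(?k y)\<^sup>2 = indicator {x<..<1} y * y powr (- \<beta>)" if "0 < y" "y < 1" for y
    using that by (simp add: power_mult_distrib power2_eq_square indicator_def flip: powr_add)
  note I = unit_leb_integral_of_has_integral[OF 1 _ _ _ k2]
  show si: "square_integrable ?k"
    unfolding square_integrable_def using x
    by (intro conjI I(1) borel_measurable_times powr_unit_measurable borel_measurable_unit_leb[of "indicator {x<..}"]) auto
  have "(norm (abs_L2 ?k))\<^sup>2 = (x powr (1 - \<beta>) - 1) / (\<beta> - 1)"
    unfolding norm_abs_L2[OF si] using x by (intro I(2)) auto
  also have "\<dots> \<le> x powr (1 - \<beta>) / (\<beta> - 1)" using \<beta>1 by (intro divide_right_mono) auto
  also have "\<dots> = (bw x / sqrt (\<beta> - 1))\<^sup>2"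
    using \<beta>1 x by (simp add: power_divide power2_eq_square flip: powr_add)
  finally show "norm (abs_L2 ?k) \<le> bw x / sqrt (\<beta> - 1)"
    by (rule power2_le_imp_le) (use \<beta>1 in simp)
qed

lemma Tsf_bound:
  assumes q: "square_integrable q" and x: "0 < x" "x < 1"
  shows "\<bar>Tsf q x\<bar> \<le> norm (abs_L2 q) / sqrt (\<beta> - 1) * bw x"
proof -
  have "\<bar>Tsf q x\<bar> = \<bar>\<integral>y. (indicator {x<..} y * wt y) * q y \<partial>unit_leb\<bar>"
    by (simp add: Tsf_def mult.assoc)
  also have "\<dots> \<le> norm (abs_L2 (\<lambda>y. indicator {x<..} y * wt y)) * norm (abs_L2 q)"
    by (rule integral_mult_le_norm[OF tail_weight_L2(1)[OF x] q])
  also have "\<dots> \<le> bw x / sqrt (\<beta> - 1) * norm (abs_L2 q)"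
    by (intro mult_right_mono tail_weight_L2 x) simp
  finally show ?thesis by (simp add: mult.commute)
qed

lemma wq_measurable: "square_integrable q \<Longrightarrow> (\<lambda>y. wt y * q y) \<in> borel_measurable unit_leb"
  by (intro borel_measurable_times powr_unit_measurable) (simp add: square_integrable_def)

lemma Tsf_measurable:
  assumes q: "square_integrable q" shows "Tsf q \<in> borel_measurable unit_leb"
proof -
  have m: "(\<lambda>p. less_kernel p * ((wt (fst p) * q (fst p)) * 1)) \<in> borel_measurable (unit_leb \<Otimes>\<^sub>M unit_leb)"
    by (rule less_kernel_measurable[OF wq_measurable[OF q] borel_measurable_const[of 1]])
  have "(\<lambda>p. less_kernel (snd p, fst p) * ((wt (snd p) * q (snd p)) * 1)) \<in> borel_measurable (unit_leb \<Otimes>\<^sub>M unit_leb)"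
    using measurable_compose[OF measurable_pair_swap' m] by (simp add: split_beta')
  then have "(\<lambda>x. \<integral>y. less_kernel (y, x) * ((wt y * q y) * 1) \<partial>unit_leb) \<in> borel_measurable unit_leb"
    by (intro unit_leb.borel_measurable_lebesgue_integral) (simp add: split_beta')
  moreover have "less_kernel (y, x) * ((wt y * q y) * 1) = indicator {x<..} y * (wt y * q y)" for x y
    by (simp add: less_kernel_def)
  then have "(\<lambda>x. \<integral>y. less_kernel (y, x) * ((wt y * q y) * 1) \<partial>unit_leb) = Tsf q"
    by (intro ext) (simp only: Tsf_def)
  ultimately show ?thesis by (simp only:)
qed

lemma Tsf_square_integrable:
  assumes q: "square_integrable q" shows "square_integrable (Tsf q)"
proof (rule square_integrable_bound[OF square_integrable_cmult[OF bw_L2(1)] Tsf_measurable[OF q]])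
  fix x :: real assume x: "0 < x" "x < 1"
  have "\<bar>Tsf q x\<bar> \<le> norm (abs_L2 q) / sqrt (\<beta> - 1) * bw x" by (rule Tsf_bound[OF q x])
  also have "\<dots> \<le> \<bar>norm (abs_L2 q) / sqrt (\<beta> - 1) * bw x\<bar>" by (rule abs_ge_self)
  finally show "\<bar>Tsf q x\<bar> \<le> \<bar>norm (abs_L2 q) / sqrt (\<beta> - 1) * bw x\<bar>" .
qed

text \<open>
  Fubini on the triangle \<open>x < y\<close>.
\<close>

lemma Tsf_adjoint:
  assumes q: "square_integrable q" and h: "square_integrable h"
  shows "(\<integral>x. Tsf q x * h x \<partial>unit_leb) = (\<integral>y. q y * Tf h y \<partial>unit_leb)"
proof -
  define P where "P y x = less_kernel (y, x) * ((wt y * q y) * h x)" for y x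
  have hm: "h \<in> borel_measurable unit_leb" using h by (simp add: square_integrable_def)
  have qm: "q \<in> borel_measurable unit_leb" using q by (simp add: square_integrable_def)
  have Px: "P y = (\<lambda>x. (wt y * q y) * (indicator {..<y} x * h x))" for y
    by (rule ext) (simp add: P_def less_kernel_def indicator_def)
  have meas: "case_prod P \<in> borel_measurable (unit_leb \<Otimes>\<^sub>M unit_leb)"
  proof -
    have "case_prod P = (\<lambda>p. less_kernel p * ((wt (fst p) * q (fst p)) * h (snd p)))"
      by (rule ext) (simp add: P_def split_beta)
    then show ?thesis using less_kernel_measurable[OF wq_measurable[OF q] hm] by (simp only:)
  qed
  have int: "integrable (unit_leb \<Otimes>\<^sub>M unit_leb) (case_prod P)"
  proof (rule unit_leb_pair.Fubini_integrable[OF meas])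
    have ha: "square_integrable (\<lambda>x. \<bar>h x\<bar>)" by (rule square_integrable_abs[OF h])
    have eq: "(\<lambda>y. \<integral>x. norm (case_prod P (y, x)) \<partial>unit_leb) = (\<lambda>y. \<bar>q y\<bar> * Tf (\<lambda>x. \<bar>h x\<bar>) y)"
    proof (rule ext)
      fix y
      have "(\<lambda>x. norm (case_prod P (y, x))) = (\<lambda>x. (wt y * \<bar>q y\<bar>) * (indicator {..<y} x * \<bar>h x\<bar>))"
        by (rule ext) (simp add: Px abs_mult)
      then have "(\<integral>x. norm (case_prod P (y, x)) \<partial>unit_leb) = (wt y * \<bar>q y\<bar>) * primitive (\<lambda>x. \<bar>h x\<bar>) y"
        by (simp only: integral_mult_right_zero primitive_def)
      then show "(\<integral>x. norm (case_prod P (y, x)) \<partial>unit_leb) = \<bar>q y\<bar> * Tf (\<lambda>x. \<bar>h x\<bar>) y"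
        by (simp add: Tf_def)
    qed
    show "integrable unit_leb (\<lambda>y. \<integral>x. norm (case_prod P (y, x)) \<partial>unit_leb)"
      unfolding eq by (rule square_integrable_mult[OF square_integrable_abs[OF q] Tf_square_integrable[OF ha]])
    show "AE y in unit_leb. integrable unit_leb (\<lambda>x. case_prod P (y, x))"
      unfolding prod.case Px by (intro AE_I2 integrable_mult_right primitive_integrable h)
  qed
  have "(\<integral>x. Tsf q x * h x \<partial>unit_leb) = (\<integral>x. \<integral>y. P y x \<partial>unit_leb \<partial>unit_leb)"
  proof (rule Bochner_Integration.integral_cong[OF refl])
    fix x
    have "(\<lambda>y. P y x) = (\<lambda>y. (indicator {x<..} y * (wt y * q y)) * h x)"
      by (rule ext) (simp add: P_def less_kernel_def indicator_def)
    then show "Tsf q x * h x = (\<integral>y. P y x \<partial>unit_leb)"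
      by (simp only: integral_mult_left_zero Tsf_def)
  qed
  also have "\<dots> = (\<integral>y. \<integral>x. P y x \<partial>unit_leb \<partial>unit_leb)"
    by (rule unit_leb_pair.Fubini_integral[OF int])
  also have "\<dots> = (\<integral>y. q y * Tf h y \<partial>unit_leb)"
    unfolding Px integral_mult_right_zero Tf_def primitive_def by (simp only: mult_ac)
  finally show ?thesis .
qed

definition T :: "L2 \<Rightarrow> L2" where "T u = abs_L2 (Tf (rep_L2 u))"

definition Ts :: "L2 \<Rightarrow> L2" where "Ts u = abs_L2 (Tsf (rep_L2 u))"

lemma Tf_cong_AE:
  assumes f: "square_integrable f" and g: "square_integrable g" and eq: "AE x in unit_leb. f x = g x"
  shows "Tf f = Tf g"
proof -
  have "primitive f y = primitive g y" for y
    unfolding primitive_def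
  proof (rule integral_cong_AE)
    show "AE x in unit_leb. indicator {..<y} x * f x = indicator {..<y} x * g x"
      using eq by eventually_elim simp
  qed (use primitive_integrable[OF f] primitive_integrable[OF g] in \<open>auto intro: borel_measurable_integrable\<close>)
  then show ?thesis by (intro ext) (simp add: Tf_def)
qed

lemma Tsf_cong_AE:
  assumes f: "square_integrable f" and g: "square_integrable g" and eq: "AE x in unit_leb. f x = g x"
  shows "Tsf f = Tsf g"
proof (rule ext)
  fix x
  have m: "(\<lambda>y. indicator {x<..} y * (wt y * q y)) \<in> borel_measurable unit_leb" if "square_integrable q" for q
    by (intro borel_measurable_times wq_measurable[OF that] borel_measurable_unit_leb[of "indicator {x<..}"]
       powr_unit_measurable) (use that in \<open>auto simp: square_integrable_def\<close>)
  show "Tsf f x = Tsf g x" unfolding Tsf_def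
  proof (rule integral_cong_AE[OF m[OF f] m[OF g]])
    show "AE y in unit_leb. indicator {x<..} y * (wt y * f y) = indicator {x<..} y * (wt y * g y)"
      using eq by eventually_elim simp
  qed
qed

lemma T_abs: "square_integrable f \<Longrightarrow> T (abs_L2 f) = abs_L2 (Tf f)"
  unfolding T_def using Tf_cong_AE[OF square_integrable_rep _ rep_abs_L2_AE] by metis

lemma Ts_abs: "square_integrable f \<Longrightarrow> Ts (abs_L2 f) = abs_L2 (Tsf f)"
  unfolding Ts_def using Tsf_cong_AE[OF square_integrable_rep _ rep_abs_L2_AE] by metis

lemma Ts_T_adjoint: "inner (Ts q) h = inner q (T h)"
proof -
  obtain q' h' where *: "square_integrable q'" "q = abs_L2 q'" "square_integrable h'" "h = abs_L2 h'"
    by (metis abs_L2_cases)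
  then show ?thesis
    using Tsf_adjoint[of q' h'] by (simp add: T_abs Ts_abs inner_abs_L2 Tsf_square_integrable Tf_square_integrable)
qed

lemma T_Ts_adjoint: "inner (T h) q = inner h (Ts q)"
  using Ts_T_adjoint[of q h] by (simp add: inner_commute)

lemma linear_of_adjoint:
  fixes P Q :: "L2 \<Rightarrow> L2"
  assumes adj: "\<And>u v. inner (P u) v = inner u (Q v)"
  shows "linear P"
proof (rule linearI)
  have eqI: "u = v" if "\<And>w :: L2. inner u w = inner v w" for u v
    using that[of "u - v"] inner_eq_zero_iff[of "u - v"] by (simp add: inner_diff_left del: inner_eq_zero_iff)
  show "P (x + y) = P x + P y" for x y by (rule eqI) (simp add: adj inner_add_left)
  show "P (c *\<^sub>R x) = c *\<^sub>R P x" for c x by (rule eqI) (simp add: adj)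
qed

lemma T_linear: "linear T" by (rule linear_of_adjoint[OF T_Ts_adjoint])

lemma Ts_linear: "linear Ts" by (rule linear_of_adjoint[OF Ts_T_adjoint])

lemma T_norm: "norm (T u) \<le> sqrt (1 / (2 - \<beta>)) * norm u"
proof -
  obtain f where f: "square_integrable f" "u = abs_L2 f" by (rule abs_L2_cases)
  show ?thesis using Tf_norm[OF f(1)] by (simp add: f T_abs)
qed

lemma Ts_norm: "norm (Ts u) \<le> sqrt (1 / (2 - \<beta>)) * norm u"
proof (cases "Ts u = 0")
  case False
  have "norm (Ts u) * norm (Ts u) = inner u (T (Ts u))"
    using Ts_T_adjoint[of u "Ts u"] by (simp add: dot_square_norm power2_eq_square)
  also have "\<dots> \<le> norm u * norm (T (Ts u))" by (rule norm_cauchy_schwarz)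
  also have "\<dots> \<le> norm u * (sqrt (1 / (2 - \<beta>)) * norm (Ts u))" by (intro mult_left_mono T_norm) simp
  finally have "norm (Ts u) * norm (Ts u) \<le> (sqrt (1 / (2 - \<beta>)) * norm u) * norm (Ts u)"
    by (simp only: mult_ac)
  then show ?thesis by (rule mult_right_le_imp_le) (use False in simp)
qed (use \<beta>2 in simp)

end

section \<open>Weak derivatives and absolute continuity\<close>

lemma test_functionD:
  assumes "test_function \<psi> \<psi>'"
  shows "(\<psi> has_real_derivative \<psi>' x) (at x)" "continuous_on A \<psi>'" "continuous_on A \<psi>" "x \<le> 0 \<Longrightarrow> \<psi> x = 0" "1 \<le> x \<Longrightarrow> \<psi> x = 0"
proof -
  show d: "(\<psi> has_real_derivative \<psi>' x) (at x)" for x using assms by (auto simp: test_function_def)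
  show "continuous_on A \<psi>'" using assms by (auto simp: test_function_def intro: continuous_on_subset)
  show "continuous_on A \<psi>" by (intro continuous_at_imp_continuous_on ballI DERIV_isCont[OF d])
  obtain K where "K \<subseteq> {0<..<1}" "\<forall>x. x \<notin> K \<longrightarrow> \<psi> x = 0" using assms by (auto simp: test_function_def)
  then show "x \<le> 0 \<Longrightarrow> \<psi> x = 0" "1 \<le> x \<Longrightarrow> \<psi> x = 0" by force+
qed

lemma square_integrable_local:
  assumes v: "square_integrable v" and K: "K \<subseteq> {0<..<1}" "compact K"
  shows "set_integrable lebesgue K v"
proof -
  have "integrable unit_leb v" by (rule square_integrable_integrable[OF v])
  then have "set_integrable lebesgue {0<..<1} v"
    by (subst (asm) integrable_restrict_space) (simp_all add: set_integrable_def)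
  then show ?thesis
    by (rule set_integrable_subset) (use K fmeasurableD[OF lmeasurable_compact[OF K(2)]] in auto)
qed

lemma weak_derivative_test_integrable:
  assumes g: "has_weak_derivative v g" and t: "test_function \<psi> \<psi>'"
  shows "integrable unit_leb (\<lambda>x. g x * \<psi> x)"
proof -
  obtain K where K: "K \<subseteq> {0<..<1}" "compact K" "\<forall>x. x \<notin> K \<longrightarrow> \<psi> x = 0" using t by (auto simp: test_function_def)
  have i: "integrable lebesgue (\<lambda>x. indicator K x *\<^sub>R g x)"
    using g K by (simp add: has_weak_derivative_def set_integrable_def)
  have "bounded (\<psi> ` {0..1})"
    by (intro compact_imp_bounded compact_continuous_image test_functionD(3)[OF t]) auto
  then obtain C where C: "\<And>x. x \<in> {0..1} \<Longrightarrow> \<bar>\<psi> x\<bar> \<le> C"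
    unfolding bounded_iff real_norm_def by (meson image_eqI)
  have "integrable lebesgue (\<lambda>x. \<psi> x * (indicator K x *\<^sub>R g x))"
  proof (rule Bochner_Integration.integrable_bound)
    show "integrable lebesgue (\<lambda>x. C * (indicator K x *\<^sub>R g x))" by (rule integrable_mult_right[OF i])
    have "\<psi> \<in> borel_measurable lebesgue"
      by (intro measurable_completion) (simp add: borel_measurable_continuous_onI test_functionD(3)[OF t])
    then show "(\<lambda>x. \<psi> x * (indicator K x *\<^sub>R g x)) \<in> borel_measurable lebesgue"
      by (intro borel_measurable_times borel_measurable_integrable[OF i])
    show "AE x in lebesgue. norm (\<psi> x * (indicator K x *\<^sub>R g x)) \<le> norm (C * (indicator K x *\<^sub>R g x))"
    proof (rule AE_I2)
      fix x
      show "norm (\<psi> x * (indicator K x *\<^sub>R g x)) \<le> norm (C * (indicator K x *\<^sub>R g x))"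
      proof (cases "x \<in> K")
        case True
        then have "\<bar>\<psi> x\<bar> \<le> \<bar>C\<bar>" using C[of x] K(1) by fastforce
        then show ?thesis by (simp add: abs_mult mult_right_mono)
      qed simp
    qed
  qed
  moreover have "(\<lambda>x. indicator {0<..<1} x *\<^sub>R (g x * \<psi> x)) = (\<lambda>x. \<psi> x * (indicator K x *\<^sub>R g x))"
    by (rule ext) (use K in \<open>auto simp: indicator_def\<close>)
  ultimately show ?thesis by (subst integrable_restrict_space) (simp_all only:, simp)
qed

lemma weak_derivative_test:
  assumes "has_weak_derivative v g" "test_function \<psi> \<psi>'"
  shows "(\<integral>x. v x * \<psi>' x \<partial>unit_leb) = - (\<integral>x. g x * \<psi> x \<partial>unit_leb)"
  using assms unfolding has_weak_derivative_def test_function_def by blast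

lemma cutoff_bounds: "0 \<le> cutoff n x" "0 < x \<Longrightarrow> x < 1 \<Longrightarrow> cutoff n x \<le> 1" "cutoff n x \<noteq> 0 \<Longrightarrow> 0 < x \<Longrightarrow> 1 / real (Suc n) < x"
proof -
  show "0 \<le> cutoff n x" by (simp add: cutoff_def)
  show "cutoff n x \<le> 1" if x: "0 < x" "x < 1"
  proof -
    have "x * (1 - x) \<le> 1 * 1" using x by (intro mult_mono) auto
    moreover have "0 \<le> 1 / real (Suc n)" by simp
    ultimately have "max 0 (x * (1 - x) - 1 / real (Suc n)) \<le> 1" by linarith
    then show ?thesis unfolding cutoff_def by (intro power_le_one) auto
  qed
  assume "cutoff n x \<noteq> 0" "0 < x"
  then have "1 / real (Suc n) < x * (1 - x)" by (auto simp: cutoff_def max_def split: if_splits)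
  also have "\<dots> \<le> x * 1" using \<open>0 < x\<close> by (intro mult_left_mono) auto
  finally show "1 / real (Suc n) < x" by simp
qed

lemma cutoff_measurable: "cutoff n \<in> borel_measurable unit_leb"
  unfolding cutoff_def by (intro continuous_unit_leb_measurable continuous_intros)

text \<open>
  Test functions determine the weak derivative almost everywhere.  After multiplication by a cutoff the weight
  \<open>x\<^bsup>-\<beta>/2\<^esup>\<close> is bounded, so the difference of two weak derivatives becomes square integrable.
\<close>

lemma has_wgrad_unique:
  assumes "has_wgrad \<beta> v q1" "has_wgrad \<beta> v q2"
  shows "q1 = q2"
proof -
  obtain g1 where g1: "has_weak_derivative (rep_L2 v) g1" "square_integrable (\<lambda>x. x powr (\<beta> / 2) * g1 x)"
    "q1 = abs_L2 (\<lambda>x. x powr (\<beta> / 2) * g1 x)" using assms(1) by (auto simp: has_wgrad_def)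
  obtain g2 where g2: "has_weak_derivative (rep_L2 v) g2" "square_integrable (\<lambda>x. x powr (\<beta> / 2) * g2 x)"
    "q2 = abs_L2 (\<lambda>x. x powr (\<beta> / 2) * g2 x)" using assms(2) by (auto simp: has_wgrad_def)
  let ?f = "\<lambda>x. g1 x - g2 x"
  have si: "square_integrable (\<lambda>x. x powr (\<beta> / 2) * ?f x)"
    using square_integrable_diff[OF g1(2) g2(2)] by (simp add: right_diff_distrib)
  have "AE x in unit_leb. ?f x = 0"
  proof (rule test_functions_separate)
    fix n
    let ?c = "\<lambda>x. cutoff n x * x powr (- \<beta> / 2)"
    have "square_integrable (\<lambda>x. ?c x * (x powr (\<beta> / 2) * ?f x))"
    proof (rule square_integrable_mult_bounded[OF si])
      show "?c \<in> borel_measurable unit_leb"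
        by (intro borel_measurable_times cutoff_measurable borel_measurable_unit_leb) simp
      fix x :: real assume x: "0 < x" "x < 1"
      have pb: "x powr (- \<beta> / 2) \<le> max 1 ((1 / real (Suc n)) powr (- \<beta> / 2))" if "cutoff n x \<noteq> 0"
      proof (cases "0 \<le> \<beta>")
        case True
        then have "x powr (- \<beta> / 2) \<le> (1 / real (Suc n)) powr (- \<beta> / 2)"
          using cutoff_bounds(3)[OF that x(1)] by (intro powr_mono2') auto
        then show ?thesis by simp
      next
        case False
        then have "x powr (- \<beta> / 2) \<le> 1" using x by (intro powr_le1) auto
        then show ?thesis by simp
      qed
      have "cutoff n x * x powr (- \<beta> / 2) \<le> 1 * max 1 ((1 / real (Suc n)) powr (- \<beta> / 2))"
      proof (cases "cutoff n x = 0")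
        case False
        show ?thesis by (rule mult_mono[OF cutoff_bounds(2)[OF x] pb[OF False]]) simp_all
      qed simp
      then show "\<bar>?c x\<bar> \<le> max 1 ((1 / real (Suc n)) powr (- \<beta> / 2))"
        using cutoff_bounds(1)[of n x] by simp
    qed
    then show "square_integrable (\<lambda>x. cutoff n x * ?f x)"
    proof (rule square_integrable_bound)
      have m1: "(\<lambda>x. x powr (- \<beta> / 2)) \<in> borel_measurable unit_leb" by (rule borel_measurable_unit_leb) simp
      have m2: "(\<lambda>x. x powr (\<beta> / 2) * ?f x) \<in> borel_measurable unit_leb" using si by (simp only: square_integrable_def)
      have c: "x powr (- \<beta> / 2) * (x powr (\<beta> / 2) * z) = z" if "0 < x" for x z :: real
      proof -
        have "x powr (- \<beta> / 2) * x powr (\<beta> / 2) = 1" using that by (simp flip: powr_add)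
        then show ?thesis by (simp only: mult.assoc[symmetric] mult_1_left)
      qed
      show "(\<lambda>x. cutoff n x * ?f x) \<in> borel_measurable unit_leb"
        by (rule measurable_cong[THEN iffD1, OF _ borel_measurable_times[OF cutoff_measurable borel_measurable_times[OF m1 m2]]])
           (simp only: c space_unit_leb greaterThanLessThan_iff)
      fix x :: real assume "0 < x" "x < 1"
      then have "?c x * (x powr (\<beta> / 2) * ?f x) = cutoff n x * ?f x"
        by (simp only: mult.assoc c)
      then show "\<bar>cutoff n x * ?f x\<bar> \<le> \<bar>?c x * (x powr (\<beta> / 2) * ?f x)\<bar>" by (simp only: order_refl)
    qed
  next
    fix \<psi> \<psi>' assume t: "test_function \<psi> \<psi>'"
    have "(\<integral>x. ?f x * \<psi> x \<partial>unit_leb) = (\<integral>x. g1 x * \<psi> x \<partial>unit_leb) - (\<integral>x. g2 x * \<psi> x \<partial>unit_leb)"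
      unfolding left_diff_distrib
      by (intro Bochner_Integration.integral_diff weak_derivative_test_integrable[OF _ t]) (rule g1(1) g2(1))+
    then show "(\<integral>x. ?f x * \<psi> x \<partial>unit_leb) = 0"
      using weak_derivative_test[OF g1(1) t] weak_derivative_test[OF g2(1) t] by simp
  qed
  then have "AE x in unit_leb. x powr (\<beta> / 2) * g1 x = x powr (\<beta> / 2) * g2 x"
    by eventually_elim simp
  then show ?thesis using abs_L2_eq_iff[OF g1(2) g2(2)] g1(3) g2(3) by simp
qed

lemma wgrad_eqI: "has_wgrad \<beta> v q \<Longrightarrow> wgrad \<beta> v = q"
  unfolding wgrad_def using has_wgrad_unique by blast

lemma rep_L2_diff_AE: "AE x in unit_leb. rep_L2 (u - v) x = rep_L2 u x - rep_L2 v x"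
proof -
  have "u - v = abs_L2 (\<lambda>x. rep_L2 u x - rep_L2 v x)"
    using abs_L2_diff[OF square_integrable_rep square_integrable_rep, of u v] by simp
  then show ?thesis
    using rep_abs_L2_AE[OF square_integrable_diff[OF square_integrable_rep square_integrable_rep], of u v] by simp
qed

lemma has_wgrad_diff:
  assumes "has_wgrad \<beta> u q" "has_wgrad \<beta> v r"
  shows "has_wgrad \<beta> (u - v) (q - r)"
proof -
  obtain g1 where g1: "has_weak_derivative (rep_L2 u) g1" "square_integrable (\<lambda>x. x powr (\<beta> / 2) * g1 x)"
    "q = abs_L2 (\<lambda>x. x powr (\<beta> / 2) * g1 x)" using assms(1) by (auto simp: has_wgrad_def)
  obtain g2 where g2: "has_weak_derivative (rep_L2 v) g2" "square_integrable (\<lambda>x. x powr (\<beta> / 2) * g2 x)"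
    "r = abs_L2 (\<lambda>x. x powr (\<beta> / 2) * g2 x)" using assms(2) by (auto simp: has_wgrad_def)
  have w: "has_weak_derivative (rep_L2 (u - v)) (\<lambda>x. g1 x - g2 x)"
    unfolding has_weak_derivative_def
  proof (intro conjI allI impI)
    fix K :: "real set" assume K: "K \<subseteq> {0<..<1}" "compact K"
    show "set_integrable lebesgue K (rep_L2 (u - v))"
      by (rule square_integrable_local[OF square_integrable_rep K])
    show "set_integrable lebesgue K (\<lambda>x. g1 x - g2 x)"
      using g1(1) g2(1) K by (intro set_integral_diff) (auto simp: has_weak_derivative_def)
  next
    fix \<psi> \<psi>' :: "real \<Rightarrow> real"
    assume "(\<forall>x. (\<psi> has_real_derivative \<psi>' x) (at x)) \<and> continuous_on UNIV \<psi>' \<and>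
             (\<exists>K\<subseteq>{0<..<1}. compact K \<and> (\<forall>x. x \<notin> K \<longrightarrow> \<psi> x = 0))"
    then have t: "test_function \<psi> \<psi>'" by (simp add: test_function_def)
    have psi: "square_integrable \<psi>'" by (intro square_integrable_continuous test_functionD(2)[OF t])
    have psm: "\<psi>' \<in> borel_measurable unit_leb" using psi by (simp add: square_integrable_def)
    have rm: "rep_L2 w \<in> borel_measurable unit_leb" for w
      using square_integrable_rep[of w] by (simp add: square_integrable_def)
    have "(\<integral>x. rep_L2 (u - v) x * \<psi>' x \<partial>unit_leb) = (\<integral>x. rep_L2 u x * \<psi>' x - rep_L2 v x * \<psi>' x \<partial>unit_leb)"
    proof (rule integral_cong_AE)
      show "AE x in unit_leb. rep_L2 (u - v) x * \<psi>' x = rep_L2 u x * \<psi>' x - rep_L2 v x * \<psi>' x"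
        using rep_L2_diff_AE[of u v] by eventually_elim (simp add: left_diff_distrib)
    qed (intro borel_measurable_times borel_measurable_diff rm psm)+
    also have "\<dots> = (\<integral>x. rep_L2 u x * \<psi>' x \<partial>unit_leb) - (\<integral>x. rep_L2 v x * \<psi>' x \<partial>unit_leb)"
      by (intro Bochner_Integration.integral_diff square_integrable_mult square_integrable_rep psi)
    also have "\<dots> = - ((\<integral>x. g1 x * \<psi> x \<partial>unit_leb) - (\<integral>x. g2 x * \<psi> x \<partial>unit_leb))"
      using weak_derivative_test[OF g1(1) t] weak_derivative_test[OF g2(1) t] by simp
    also have "(\<integral>x. g1 x * \<psi> x \<partial>unit_leb) - (\<integral>x. g2 x * \<psi> x \<partial>unit_leb) = (\<integral>x. (g1 x - g2 x) * \<psi> x \<partial>unit_leb)"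
      unfolding left_diff_distrib
      by (intro Bochner_Integration.integral_diff[symmetric] weak_derivative_test_integrable[OF _ t]) (rule g1(1) g2(1))+
    finally show "(\<integral>x. rep_L2 (u - v) x * \<psi>' x \<partial>unit_leb) = - (\<integral>x. (g1 x - g2 x) * \<psi> x \<partial>unit_leb)" .
  qed
  have eq: "(\<lambda>x. x powr (\<beta> / 2) * (g1 x - g2 x)) = (\<lambda>x. x powr (\<beta> / 2) * g1 x - x powr (\<beta> / 2) * g2 x)"
    by (rule ext) (rule right_diff_distrib)
  show ?thesis unfolding has_wgrad_def
  proof (intro exI conjI)
    show "has_weak_derivative (rep_L2 (u - v)) (\<lambda>x. g1 x - g2 x)" by (rule w)
    show "square_integrable (\<lambda>x. x powr (\<beta> / 2) * (g1 x - g2 x))"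
      unfolding eq by (rule square_integrable_diff[OF g1(2) g2(2)])
    show "q - r = abs_L2 (\<lambda>x. x powr (\<beta> / 2) * (g1 x - g2 x))"
      unfolding eq g1(3) g2(3) by (rule abs_L2_diff[OF g1(2) g2(2)])
  qed
qed

lemma lipschitz_absolutely_continuous:
  fixes f :: "real \<Rightarrow> real"
  assumes L: "\<And>x y. x \<in> {a..b} \<Longrightarrow> y \<in> {a..b} \<Longrightarrow> \<bar>f y - f x\<bar> \<le> L * \<bar>y - x\<bar>" and L0: "0 \<le> L"
  shows "absolutely_continuous_on a b f"
  unfolding absolutely_continuous_on_def
proof (intro allI impI)
  fix e :: real assume e: "0 < e"
  show "\<exists>d>0. \<forall>P :: (real \<times> real) set. finite P \<and> (\<forall>(x, y)\<in>P. a \<le> x \<and> x < y \<and> y \<le> b) \<and>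
        disjoint_family_on (\<lambda>(x, y). {x<..<y}) P \<and> (\<Sum>(x, y)\<in>P. y - x) < d
        \<longrightarrow> (\<Sum>(x, y)\<in>P. \<bar>f y - f x\<bar>) < e"
  proof (intro exI[of _ "e / (L + 1)"] conjI allI impI)
    show "0 < e / (L + 1)" using e L0 by simp
    fix P :: "(real \<times> real) set"
    assume P: "finite P \<and> (\<forall>(x, y)\<in>P. a \<le> x \<and> x < y \<and> y \<le> b) \<and>
        disjoint_family_on (\<lambda>(x, y). {x<..<y}) P \<and> (\<Sum>(x, y)\<in>P. y - x) < e / (L + 1)"
    have "(\<Sum>(x, y)\<in>P. \<bar>f y - f x\<bar>) \<le> (\<Sum>p\<in>P. L * (case p of (x, y) \<Rightarrow> y - x))"
    proof (rule sum_mono)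
      fix p assume "p \<in> P"
      with P have "a \<le> fst p \<and> fst p < snd p \<and> snd p \<le> b" by (auto simp: split_beta)
      then show "(case p of (x, y) \<Rightarrow> \<bar>f y - f x\<bar>) \<le> L * (case p of (x, y) \<Rightarrow> y - x)"
        using L[of "fst p" "snd p"] by (simp add: split_beta)
    qed
    also have "\<dots> = L * (\<Sum>(x, y)\<in>P. y - x)" by (simp add: sum_distrib_left)
    also have "\<dots> \<le> L * (e / (L + 1))" using P L0 by (intro mult_left_mono) auto
    also have "\<dots> < e" using e L0 by (simp add: field_simps)
    finally show "(\<Sum>(x, y)\<in>P. \<bar>f y - f x\<bar>) < e" .
  qed
qed

lemma absolutely_continuous_imp_continuous:
  assumes ac: "absolutely_continuous_on a b f"
  shows "continuous_on {a..b} f"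
  unfolding continuous_on_iff
proof (intro ballI allI impI)
  fix x e :: real assume x: "x \<in> {a..b}" and e: "0 < e"
  from ac e obtain d where d: "0 < d" and H: "\<And>P :: (real \<times> real) set. \<lbrakk>finite P; \<forall>(x, y)\<in>P. a \<le> x \<and> x < y \<and> y \<le> b;
        disjoint_family_on (\<lambda>(x, y). {x<..<y}) P; (\<Sum>(x, y)\<in>P. y - x) < d\<rbrakk>
        \<Longrightarrow> (\<Sum>(x, y)\<in>P. \<bar>f y - f x\<bar>) < e"
    unfolding absolutely_continuous_on_def by meson
  have *: "\<bar>f z - f y\<bar> < e" if "a \<le> y" "y < z" "z \<le> b" "z - y < d" for y z
    using H[of "{(y, z)}"] that by (simp add: disjoint_family_on_def)
  show "\<exists>d>0. \<forall>x'\<in>{a..b}. dist x' x < d \<longrightarrow> dist (f x') (f x) < e"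
  proof (intro exI[of _ d] conjI ballI impI d)
    fix y assume y: "y \<in> {a..b}" "dist y x < d"
    show "dist (f y) (f x) < e"
      using *[of x y] *[of y x] x y e by (cases x y rule: linorder_cases) (auto simp: dist_real_def abs_minus_commute)
  qed
qed

section \<open>The inverse of the elliptic operator\<close>

lemma FTC_real_interior:
  fixes F f :: "real \<Rightarrow> real"
  assumes "a \<le> b" "continuous_on {a..b} F" "\<And>x. a < x \<Longrightarrow> x < b \<Longrightarrow> (F has_real_derivative f x) (at x)"
  shows "(f has_integral (F b - F a)) {a..b}"
proof (rule fundamental_theorem_of_calculus_interior[OF assms(1,2)])
  fix x assume "x \<in> {a<..<b}"
  then have "(F has_real_derivative f x) (at x)" by (intro assms(3)) auto
  then show "(F has_vector_derivative f x) (at x)" by (simp only: has_real_derivative_iff_has_vector_derivative)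
qed

context degenerate_elliptic
begin

text \<open>
  \<open>T\<^sup>* T\<close> is the inverse of \<open>A\<close>: the first factor integrates \<open>A v\<close> from \<open>0\<close> and yields minus the weighted
  flux, from which the second one recovers \<open>v\<close> by integrating from \<open>1\<close>.
\<close>

definition A_inv :: "L2 \<Rightarrow> L2" where "A_inv u = Ts (T u)"

lemma A_inv_linear: "linear A_inv"
  using linear_compose[OF T_linear Ts_linear] by (simp add: A_inv_def[abs_def] o_def)

lemma A_inv_inner: "inner (A_inv u) v = inner (T u) (T v)"
  by (simp add: A_inv_def Ts_T_adjoint)

lemma A_inv_sym: "inner (A_inv u) v = inner u (A_inv v)"
  by (metis A_inv_inner inner_commute)

lemma A_inv_norm: "norm (A_inv u) \<le> 1 / (2 - \<beta>) * norm u"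
proof -
  let ?c = "sqrt (1 / (2 - \<beta>))"
  have "norm (A_inv u) \<le> ?c * norm (T u)" unfolding A_inv_def by (rule Ts_norm)
  also have "\<dots> \<le> ?c * (?c * norm u)" using \<beta>2 by (intro mult_left_mono T_norm) simp
  also have "\<dots> = 1 / (2 - \<beta>) * norm u"
    using \<beta>2 real_sqrt_mult_self[of "1 / (2 - \<beta>)"] by (simp add: mult.assoc[symmetric])
  finally show ?thesis .
qed

lemma primitive_test_function:
  assumes t: "test_function \<psi> \<psi>'" and y: "0 < y" "y < 1"
  shows "primitive \<psi>' y = \<psi> y"
proof -
  have 1: "(\<psi>' has_integral (\<psi> y - \<psi> 0)) {0..y}"
    by (rule FTC_real_interior[OF _ test_functionD(3)[OF t] test_functionD(1)[OF t]]) (use y in simp)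
  show ?thesis unfolding primitive_def
    by (subst unit_leb_integral_of_continuous(2)[OF 1 test_functionD(2)[OF t]])
       (use y test_functionD(4)[OF t, of 0] in \<open>auto simp: indicator_def\<close>)
qed

text \<open>
  Testing against \<open>\<psi>'\<close> moves \<open>T\<^sup>*\<close> to the other side, and \<open>T \<psi>' = y\<^bsup>-\<beta>/2\<^esup> \<psi>\<close> by the fundamental theorem.
\<close>

lemma weak_derivative_Ts:
  assumes q: "square_integrable q"
  shows "has_weak_derivative (rep_L2 (abs_L2 (Tsf q))) (\<lambda>y. - (wt y * q y))"
  unfolding has_weak_derivative_def
proof (intro conjI allI impI)
  fix K :: "real set" assume K: "K \<subseteq> {0<..<1}" "compact K"
  show "set_integrable lebesgue K (rep_L2 (abs_L2 (Tsf q)))"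
    by (rule square_integrable_local[OF square_integrable_rep K])
  have "\<exists>k>0. \<forall>y\<in>K. k \<le> y"
  proof (cases "K = {}")
    case False
    then obtain k where k: "k \<in> K" "\<forall>y\<in>K. k \<le> y" using compact_attains_inf[OF K(2)] by blast
    have "0 < k" using subsetD[OF K(1) k(1)] by simp
    with k(2) show ?thesis by blast
  next
    case True then show ?thesis by (intro exI[of _ 1]) simp
  qed
  then obtain k where k: "0 < k" "\<And>y. y \<in> K \<Longrightarrow> k \<le> y" by blast
  have Ks: "K \<in> sets borel" using K(2) by (rule borel_compact)
  have "square_integrable (\<lambda>y. (indicator K y * wt y) * q y)"
  proof (rule square_integrable_mult_bounded[OF q])
    have "indicator K \<in> borel_measurable unit_leb"
      by (intro borel_measurable_unit_leb borel_measurable_indicator Ks)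
    then show "(\<lambda>y. indicator K y * wt y) \<in> borel_measurable unit_leb"
      by (rule borel_measurable_times[OF _ powr_unit_measurable])
    fix y :: real assume "0 < y" "y < 1"
    show "\<bar>indicator K y * wt y\<bar> \<le> wt k"
    proof (cases "y \<in> K")
      case True
      then show ?thesis using k \<beta>1 by (auto intro!: powr_mono2')
    qed simp
  qed
  from square_integrable_local[OF this K] have "set_integrable lebesgue K (\<lambda>y. - ((indicator K y * wt y) * q y))"
    unfolding set_integrable_def using integrable_minus by fastforce
  then show "set_integrable lebesgue K (\<lambda>y. - (wt y * q y))"
    by (rule set_integrable_cong[THEN iffD1, rotated 3]) auto
next
  fix \<psi> \<psi>' :: "real \<Rightarrow> real"
  assume "(\<forall>x. (\<psi> has_real_derivative \<psi>' x) (at x)) \<and> continuous_on UNIV \<psi>' \<and>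
             (\<exists>K\<subseteq>{0<..<1}. compact K \<and> (\<forall>x. x \<notin> K \<longrightarrow> \<psi> x = 0))"
  then have t: "test_function \<psi> \<psi>'" by (simp add: test_function_def)
  have psi: "square_integrable \<psi>'" by (intro square_integrable_continuous test_functionD(2)[OF t])
  note Tsi = Tsf_square_integrable[OF q]
  have "(\<integral>x. rep_L2 (abs_L2 (Tsf q)) x * \<psi>' x \<partial>unit_leb) = inner (abs_L2 (rep_L2 (abs_L2 (Tsf q)))) (abs_L2 \<psi>')"
    by (rule inner_abs_L2[OF square_integrable_rep psi, symmetric])
  also have "\<dots> = (\<integral>x. Tsf q x * \<psi>' x \<partial>unit_leb)"
    by (simp add: inner_abs_L2[OF Tsi psi])
  also have "\<dots> = (\<integral>y. q y * Tf \<psi>' y \<partial>unit_leb)" by (rule Tsf_adjoint[OF q psi])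
  also have "\<dots> = (\<integral>y. - (- (wt y * q y) * \<psi> y) \<partial>unit_leb)"
    by (intro Bochner_Integration.integral_cong refl) (simp add: Tf_def primitive_test_function[OF t])
  finally show "(\<integral>x. rep_L2 (abs_L2 (Tsf q)) x * \<psi>' x \<partial>unit_leb) = - (\<integral>y. - (wt y * q y) * \<psi> y \<partial>unit_leb)"
    by (simp only: integral_minus)
qed

lemma has_wgrad_Ts: "has_wgrad \<beta> (Ts q) (- q)"
proof -
  obtain q' where q': "square_integrable q'" "q = abs_L2 q'" by (rule abs_L2_cases)
  have pt: "x powr (\<beta> / 2) * - (wt x * q' x) = - q' x" if "0 < x" for x
  proof -
    have "x powr (\<beta> / 2) * wt x = 1" using that by (simp flip: powr_add)
    then have "x powr (\<beta> / 2) * (wt x * q' x) = q' x" by (simp only: mult.assoc[symmetric] mult_1_left)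
    then show ?thesis by (simp only: mult_minus_right)
  qed
  have si: "square_integrable (\<lambda>x. x powr (\<beta> / 2) * - (wt x * q' x))"
  proof (rule square_integrable_bound[OF square_integrable_uminus[OF q'(1)]])
    show "(\<lambda>x. x powr (\<beta> / 2) * - (wt x * q' x)) \<in> borel_measurable unit_leb"
      by (rule borel_measurable_times[OF powr_unit_measurable borel_measurable_uminus[OF wq_measurable[OF q'(1)]]])
  qed (simp only: pt order_refl)
  show ?thesis unfolding has_wgrad_def
  proof (intro exI conjI)
    show "has_weak_derivative (rep_L2 (Ts q)) (\<lambda>y. - (wt y * q' y))"
      unfolding q'(2) Ts_abs[OF q'(1)] by (rule weak_derivative_Ts[OF q'(1)])
    show "- q = abs_L2 (\<lambda>x. x powr (\<beta> / 2) * - (wt x * q' x))"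
      unfolding q'(2) abs_L2_uminus[OF q'(1)] abs_L2_eq_iff[OF square_integrable_uminus[OF q'(1)] si]
      by (rule AE_unit_lebI) (simp only: pt)
  qed (rule si)
qed

lemma has_wgrad_A_inv: "has_wgrad \<beta> (A_inv u) (- T u)"
  unfolding A_inv_def by (rule has_wgrad_Ts)

text \<open>
  If \<open>T u = 0\<close>, then \<open>u\<close> is orthogonal to the range of \<open>T\<^sup>*\<close>.  That range contains all test functions: a test function is
  \<open>T\<^sup>*\<close> of its negative weighted derivative.
\<close>

lemma A_inv_inj:
  assumes "A_inv u = 0" shows "u = 0"
proof -
  have "inner (T u) (T u) = 0" using A_inv_inner[of u u] assms by simp
  then have Tu: "T u = 0" by simp
  let ?f = "rep_L2 u"
  have "AE x in unit_leb. ?f x = 0"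
  proof (rule test_functions_separate)
    show "square_integrable (\<lambda>x. cutoff n x * ?f x)" for n
    proof (rule square_integrable_mult_bounded[OF square_integrable_rep cutoff_measurable])
      fix x :: real assume "0 < x" "x < 1"
      then show "\<bar>cutoff n x\<bar> \<le> 1" using cutoff_bounds(1)[of n x] cutoff_bounds(2)[of x n] by simp
    qed
    fix \<psi> \<psi>' assume t: "test_function \<psi> \<psi>'"
    have psi: "square_integrable \<psi>" by (intro square_integrable_continuous test_functionD(3)[OF t])
    let ?q = "\<lambda>y. - (y powr (\<beta> / 2) * \<psi>' y)"
    have q: "square_integrable ?q"
    proof (rule square_integrable_continuous)
      show "continuous_on {0..1} ?q"
        using \<beta>1 by (intro continuous_on_minus continuous_on_mult continuous_on_powr' continuous_on_id continuous_on_const test_functionD(2)[OF t]) auto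
    qed
    have eq: "Tsf ?q x = \<psi> x" if x: "0 < x" "x < 1" for x
    proof -
      have "((\<lambda>y. - \<psi>' y) has_integral (- \<psi> 1 - (- \<psi> x))) {x..1}"
        by (rule FTC_real_interior[OF _ continuous_on_minus[OF test_functionD(3)[OF t]] DERIV_minus[OF test_functionD(1)[OF t]]]) (use x in simp)
      then have 1: "((\<lambda>y. - \<psi>' y) has_integral \<psi> x) {x..1}" using test_functionD(5)[OF t, of 1] by simp
      have w: "wt y * ?q y = - \<psi>' y" if "0 < y" for y
      proof -
        have "wt y * y powr (\<beta> / 2) = 1" using that by (simp flip: powr_add)
        then have "wt y * (y powr (\<beta> / 2) * \<psi>' y) = \<psi>' y" by (simp only: mult.assoc[symmetric] mult_1_left)
        then show ?thesis by (simp only: mult_minus_right)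
      qed
      show ?thesis unfolding Tsf_def
        by (rule unit_leb_integral_of_continuous(2)[OF 1])
           (use x w in \<open>auto intro!: continuous_on_minus test_functionD(2)[OF t] simp: indicator_def\<close>)
    qed
    then have "Ts (abs_L2 ?q) = abs_L2 \<psi>"
      unfolding Ts_abs[OF q] abs_L2_eq_iff[OF Tsf_square_integrable[OF q] psi] by (intro AE_unit_lebI)
    then have "inner u (abs_L2 \<psi>) = 0"
      using T_Ts_adjoint[of u "abs_L2 ?q"] Tu by simp
    then show "(\<integral>x. ?f x * \<psi> x \<partial>unit_leb) = 0"
      using inner_abs_L2[OF square_integrable_rep psi, of u] by simp
  qed
  then have "abs_L2 ?f = abs_L2 (\<lambda>x. 0)"
    using abs_L2_eq_iff[OF square_integrable_rep square_integrable_zero] by blast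
  then show ?thesis by (simp add: abs_L2_zero)
qed

section \<open>The initial domain and the Friedrichs extension\<close>

text \<open>
  Otherwise \<open>v' \<ge> c x\<^sup>-\<^sup>\<beta>\<close> near \<open>0\<close>, and since \<open>\<beta> > 1\<close> the function \<open>v\<close> would be unbounded there.
\<close>

lemma no_positive_flux_at_0:
  assumes v: "continuous_on {0..1} v" and w: "continuous_on {0..1} w"
    and d: "\<And>x. 0 < x \<Longrightarrow> x < 1 \<Longrightarrow> (v has_real_derivative v' x) (at x)"
    and wv: "\<And>x. 0 < x \<Longrightarrow> x < 1 \<Longrightarrow> w x = x powr \<beta> * v' x"
  shows "w 0 \<le> 0"
proof (rule ccontr)
  assume "\<not> w 0 \<le> 0"
  then have w0: "0 < w 0" by simp
  define c where "c = w 0 / 2"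
  have c: "0 < c" using w0 by (simp add: c_def)
  from w have "\<exists>d>0. \<forall>x\<in>{0..1}. dist x 0 < d \<longrightarrow> dist (w x) (w 0) < c"
    unfolding continuous_on_iff using c by (auto dest!: bspec[of _ _ 0])
  then obtain e where e: "0 < e" "\<And>x. x \<in> {0..1} \<Longrightarrow> dist x 0 < e \<Longrightarrow> dist (w x) (w 0) < c" by blast
  define \<delta> where "\<delta> = min (1/2) (e / 2)"
  have \<delta>: "0 < \<delta>" "\<delta> < 1" "\<delta> < e" using e(1) by (auto simp: \<delta>_def)
  have wc: "c \<le> w x" if "0 < x" "x \<le> \<delta>" for x
  proof -
    have "\<bar>w x - w 0\<bar> < c" using e(2)[of x] that \<delta> by (simp add: dist_real_def)
    then show ?thesis unfolding c_def by linarith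
  qed
  have "bounded (v ` {0..1})" by (intro compact_imp_bounded compact_continuous_image v) auto
  then obtain C where C: "\<And>x. x \<in> {0..1} \<Longrightarrow> \<bar>v x\<bar> \<le> C"
    unfolding bounded_iff real_norm_def by (meson image_eqI)
  \<comment> \<open>\<open>v\<close> minus a primitive of \<open>c x\<^sup>-\<^sup>\<beta>\<close>, hence nondecreasing near \<open>0\<close>\<close>
  define H where "H x = v x - c * (- (x powr (1 - \<beta>)) / (\<beta> - 1))" for x
  have H: "H x \<le> H \<delta>" if x: "0 < x" "x \<le> \<delta>" for x
  proof (rule DERIV_nonneg_imp_nondecreasing[OF x(2)])
    fix y assume y: "x \<le> y" "y \<le> \<delta>"
    have "((\<lambda>y. y powr (1 - \<beta>)) has_real_derivative (1 - \<beta>) * y powr (1 - \<beta> - 1)) (at y)"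
      using y x by (intro has_real_derivative_powr) auto
    then have "((\<lambda>y. c * (- (y powr (1 - \<beta>)) / (\<beta> - 1))) has_real_derivative c * (- ((1 - \<beta>) * y powr (1 - \<beta> - 1)) / (\<beta> - 1))) (at y)"
      by (intro DERIV_cmult DERIV_cdivide DERIV_minus)
    moreover have "- ((1 - \<beta>) * z) / (\<beta> - 1) = z" for z
      using \<beta>1 by (simp add: divide_eq_eq algebra_simps)
    moreover have "1 - \<beta> - 1 = - \<beta>" by simp
    ultimately have "((\<lambda>y. c * (- (y powr (1 - \<beta>)) / (\<beta> - 1))) has_real_derivative c * y powr (- \<beta>)) (at y)"
      by (simp only:)
    then have "(H has_real_derivative v' y - c * y powr (- \<beta>)) (at y)"
      unfolding H_def using y x \<delta> by (intro DERIV_diff d) auto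
    moreover have "0 \<le> v' y - c * y powr (- \<beta>)"
    proof -
      have yp: "y powr (- \<beta>) * y powr \<beta> = 1" using y x by (simp flip: powr_add)
      have "y powr (- \<beta>) * c \<le> y powr (- \<beta>) * w y" using wc[of y] x y by (intro mult_left_mono) auto
      also have "\<dots> = (y powr (- \<beta>) * y powr \<beta>) * v' y" using wv[of y] x y \<delta> by simp
      also have "\<dots> = v' y" by (simp only: yp mult_1_left)
      finally show ?thesis by (simp only: mult.commute[of c] diff_ge_0_iff_ge)
    qed
    ultimately show "\<exists>z. (H has_real_derivative z) (at y) \<and> 0 \<le> z" by blast
  qed
  have le: "x powr (1 - \<beta>) \<le> (\<beta> - 1) / c * (H \<delta> + C)" if x: "0 < x" "x \<le> \<delta>" for x
  proof -
    have "c * (x powr (1 - \<beta>) / (\<beta> - 1)) \<le> H \<delta> + C"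
      using H[OF x] C[of x] x \<delta> unfolding H_def[of x] by simp
    then show ?thesis using c \<beta>1 by (simp add: field_simps)
  qed
  define Y where "Y = max 1 ((\<beta> - 1) / c * (H \<delta> + C) + 1)"
  \<comment> \<open>a point so close to \<open>0\<close> that \<open>x powr (1 - \<beta>)\<close> exceeds the bound \<open>le\<close>\<close>
  define x where "x = min \<delta> (Y powr (1 / (1 - \<beta>)))"
  have Y: "0 < Y" by (simp add: Y_def)
  have x: "0 < x" "x \<le> \<delta>" using \<delta> Y by (auto simp: x_def)
  have "Y = (Y powr (1 / (1 - \<beta>))) powr (1 - \<beta>)" using Y \<beta>1 by (simp add: powr_powr)
  also have "\<dots> \<le> x powr (1 - \<beta>)" using x \<beta>1 by (intro powr_mono2') (auto simp: x_def)
  finally show False using le[OF x] by (simp add: Y_def)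
qed

text \<open>
  The flux vanishes at \<open>0\<close> by \<open>no_positive_flux_at_0\<close>, applied to \<open>v\<close> and to \<open>- v\<close>; therefore it is the primitive
  from \<open>0\<close> of \<open>z\<close>.  Together with \<open>v 1 = 0\<close> this determines \<open>v\<close> as \<open>A_inv h\<close>.
\<close>

lemma A_init_subset_graph:
  assumes "(u, h) \<in> A_init \<beta>" shows "u = A_inv h"
proof -
  obtain v z v' w where u: "u = abs_L2 v" and h: "h = abs_L2 (\<lambda>x. - z x)" and vc: "continuous_on {0..1} v"
    and H: "\<forall>x\<in>{0<..<1}. (v has_real_derivative v' x) (at x) \<and> w x = x powr \<beta> * v' x \<and> (w has_real_derivative z x) (at x)"
    and wc: "continuous_on {0..1} w" and ac: "absolutely_continuous_on 0 1 z"
    and zsi: "square_integrable (\<lambda>x. - z x)" and v1: "v 1 = 0"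
    using assms unfolding A_init_def by blast
  have d: "(v has_real_derivative v' x) (at x)" "w x = x powr \<beta> * v' x" "(w has_real_derivative z x) (at x)" if "0 < x" "x < 1" for x
    using H that by auto
  have zc: "continuous_on {0..1} z" by (rule absolutely_continuous_imp_continuous[OF ac])
  have vsi: "square_integrable v" by (rule square_integrable_continuous[OF vc])
  have w0: "w 0 = 0"
  proof (rule antisym)
    show "w 0 \<le> 0" by (rule no_positive_flux_at_0[OF vc wc d(1,2)])
    have "- w 0 \<le> 0"
    proof (rule no_positive_flux_at_0[of "\<lambda>x. - v x" "\<lambda>x. - w x" "\<lambda>x. - v' x"])
      show "continuous_on {0..1} (\<lambda>x. - v x)" "continuous_on {0..1} (\<lambda>x. - w x)"
        by (intro continuous_on_minus vc wc)+
    qed (use d in \<open>auto intro!: DERIV_minus\<close>)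
    then show "0 \<le> w 0" by simp
  qed
  have prim: "primitive (\<lambda>x. - z x) y = - w y" if y: "0 < y" "y < 1" for y
  proof -
    have "((\<lambda>x. - z x) has_integral (- w y - (- w 0))) {0..y}"
    proof (rule FTC_real_interior)
      show "continuous_on {0..y} (\<lambda>x. - w x)"
        using y by (intro continuous_on_minus continuous_on_subset[OF wc]) auto
      fix x assume "0 < x" "x < y"
      then show "((\<lambda>x. - w x) has_real_derivative - z x) (at x)"
        using d(3)[of x] y by (intro DERIV_minus) simp
    qed (use y in simp)
    then have 1: "((\<lambda>x. - z x) has_integral (- w y)) {0..y}" by (simp add: w0)
    have "continuous_on {0..y} (\<lambda>x. - z x)" using y by (intro continuous_on_minus continuous_on_subset[OF zc]) auto
    show ?thesis unfolding primitive_def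
      by (rule unit_leb_integral_of_continuous(2)[OF 1 \<open>continuous_on {0..y} (\<lambda>x. - z x)\<close>])
         (use y in \<open>auto simp: indicator_def\<close>)
  qed
  have "Tsf (Tf (\<lambda>x. - z x)) x = v x" if x: "0 < x" "x < 1" for x
  proof -
    have 1: "((\<lambda>y. - v' y) has_integral (- v 1 - (- v x))) {x..1}"
    proof (rule FTC_real_interior)
      show "continuous_on {x..1} (\<lambda>x. - v x)"
        using x by (intro continuous_on_minus continuous_on_subset[OF vc]) auto
      fix y assume "x < y" "y < 1"
      then show "((\<lambda>x. - v x) has_real_derivative - v' y) (at y)"
        using d(1)[of y] x by (intro DERIV_minus) simp
    qed (use x in simp)
    have vw: "v' y = y powr (- \<beta>) * w y" if y: "0 < y" "y < 1" for y
    proof -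
      have "y powr (- \<beta>) * y powr \<beta> = 1" using y by (simp flip: powr_add)
      then show ?thesis unfolding d(2)[OF y] by (simp only: mult.assoc[symmetric] mult_1_left)
    qed
    have 2: "((\<lambda>y. - (y powr (- \<beta>) * w y)) has_integral v x) {x..1}"
    proof (rule has_integral_spike_finite[where S = "{1}"])
      show "((\<lambda>y. - v' y) has_integral v x) {x..1}" using 1 v1 by simp
      fix y assume "y \<in> {x..1} - {1}"
      then show "- (y powr (- \<beta>) * w y) = - v' y" using vw[of y] x by auto
    qed simp
    have c: "continuous_on {x..1} (\<lambda>y. - (y powr (- \<beta>) * w y))"
      using x by (intro continuous_on_minus continuous_on_mult continuous_on_powr continuous_on_id continuous_on_const continuous_on_subset[OF wc]) auto
    have pw: "wt y * Tf (\<lambda>x. - z x) y = - (y powr (- \<beta>) * w y)" if y: "0 < y" "y < 1" for y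
    proof -
      have "wt y * wt y = y powr (- \<beta>)" using y by (simp flip: powr_add)
      then show ?thesis unfolding Tf_def prim[OF y] by (simp add: mult.assoc[symmetric])
    qed
    show ?thesis unfolding Tsf_def
      by (rule unit_leb_integral_of_continuous(2)[OF 2 c]) (use x pw in \<open>auto simp: indicator_def\<close>)
  qed
  then have "abs_L2 (Tsf (Tf (\<lambda>x. - z x))) = abs_L2 v"
    unfolding abs_L2_eq_iff[OF Tsf_square_integrable[OF Tf_square_integrable[OF zsi]] vsi] by (intro AE_unit_lebI)
  then show ?thesis
    by (simp add: u h A_inv_def T_abs[OF zsi] Ts_abs[OF Tf_square_integrable[OF zsi]])
qed

lemma poly_lipschitz:
  obtains L where "0 \<le> L" "\<And>x y. x \<in> {0..1} \<Longrightarrow> y \<in> {0..1} \<Longrightarrow> \<bar>poly p y - poly p x\<bar> \<le> L * \<bar>y - (x :: real)\<bar>"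
proof -
  have "bounded (poly (pderiv p) ` {0..1})" by (intro compact_imp_bounded compact_continuous_image continuous_intros) auto
  then obtain L where L: "\<And>x. x \<in> {0..1} \<Longrightarrow> \<bar>poly (pderiv p) x\<bar> \<le> L"
    unfolding bounded_iff real_norm_def by (meson image_eqI)
  have lt: "\<bar>poly p y - poly p x\<bar> \<le> L * \<bar>y - x\<bar>" if xy: "x \<in> {0..1}" "y \<in> {0..1}" "x < y" for x y
  proof -
    obtain \<xi> where "x < \<xi>" "\<xi> < y" "poly p y - poly p x = (y - x) * poly (pderiv p) \<xi>"
      using poly_MVT[OF xy(3), of p] by blast
    then show ?thesis using L[of \<xi>] xy by (simp add: abs_mult mult.commute mult_right_mono)
  qed
  show ?thesis
  proof (rule that[of L])
    show "0 \<le> L" using L[of 0] by auto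
    fix x y :: real assume "x \<in> {0..1}" "y \<in> {0..1}"
    then show "\<bar>poly p y - poly p x\<bar> \<le> L * \<bar>y - x\<bar>"
      using lt[of x y] lt[of y x] by (cases x y rule: linorder_cases) (auto simp: abs_minus_commute)
  qed
qed

text \<open>
  For a polynomial right-hand side the solution is an explicit combination of powers; \<open>A_init_subset_graph\<close> then
  identifies it with \<open>A_inv\<close>.
\<close>

lemma poly_in_A_init: "(A_inv (abs_L2 (poly p)), abs_L2 (poly p)) \<in> A_init \<beta>"
proof -
  define k where "k i = coeff p i / (real i + 1)" for i
  define v where "v x = (\<Sum>i\<le>degree p. k i * ((1 - x powr (real i + 2 - \<beta>)) / (real i + 2 - \<beta>)))" for x
  define v' where "v' x = (\<Sum>i\<le>degree p. k i * (- (x powr (real i + 1 - \<beta>))))" for x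
  define w where "w x = (\<Sum>i\<le>degree p. k i * (- (x ^ Suc i)))" for x
  define z where "z x = - poly p x" for x
  have e: "0 < real i + 2 - \<beta>" for i using \<beta>2 by (simp add: add_nonneg_pos)
  have vc: "continuous_on {0..1} v"
    unfolding v_def
  proof (intro continuous_on_sum continuous_on_mult continuous_on_divide continuous_on_diff continuous_on_const continuous_on_powr' continuous_on_id)
    show "\<forall>x\<in>{0..1}. 0 \<le> x \<and> (x = 0 \<longrightarrow> 0 < real i + 2 - \<beta>)" for i using e by auto
    show "\<forall>x\<in>{0..1}. real i + 2 - \<beta> \<noteq> 0" for i using e[of i] by auto
  qed
  have dv: "(v has_real_derivative v' x) (at x)" if x: "0 < x" for x
    unfolding v_def v'_def
  proof (intro DERIV_sum DERIV_cmult)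
    fix i
    have "((\<lambda>y. y powr (real i + 2 - \<beta>)) has_real_derivative (real i + 2 - \<beta>) * x powr (real i + 2 - \<beta> - 1)) (at x)"
      using x by (rule has_real_derivative_powr)
    from DERIV_cdivide[OF DERIV_diff[OF DERIV_const this], of 1 "real i + 2 - \<beta>"]
    show "((\<lambda>y. (1 - y powr (real i + 2 - \<beta>)) / (real i + 2 - \<beta>)) has_real_derivative - (x powr (real i + 1 - \<beta>))) (at x)"
    proof (rule DERIV_cong)
      have "(0 - (real i + 2 - \<beta>) * c) / (real i + 2 - \<beta>) = - c" for c
        using e[of i] by (simp add: field_simps)
      moreover have "real i + 2 - \<beta> - 1 = real i + 1 - \<beta>" by simp
      ultimately show "(0 - (real i + 2 - \<beta>) * x powr (real i + 2 - \<beta> - 1)) / (real i + 2 - \<beta>) = - (x powr (real i + 1 - \<beta>))"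
        by (simp only:)
    qed
  qed
  have wv: "w x = x powr \<beta> * v' x" if x: "0 < x" for x
  proof -
    have "x powr \<beta> * x powr (real i + 1 - \<beta>) = x ^ Suc i" for i
      using x powr_realpow[of x "Suc i"] by (simp add: add.commute flip: powr_add)
    then have "x powr \<beta> * (k i * - (x powr (real i + 1 - \<beta>))) = k i * - (x ^ Suc i)" for i
      by (metis mult.left_commute mult_minus_right)
    then show ?thesis unfolding w_def v'_def sum_distrib_left by (intro sum.cong refl) (simp only:)
  qed
  have dw: "(w has_real_derivative z x) (at x)" for x
  proof -
    have "(w has_real_derivative (\<Sum>i\<le>degree p. k i * (- (real (Suc i) * x ^ i)))) (at x)"
      unfolding w_def
    proof (intro DERIV_sum DERIV_cmult DERIV_minus)
      show "((\<lambda>x. x ^ Suc i) has_real_derivative real (Suc i) * x ^ i) (at x)" for i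
        by (rule DERIV_cong[OF DERIV_pow]) simp
    qed
    moreover have "(\<Sum>i\<le>degree p. k i * (- (real (Suc i) * x ^ i))) = z x"
      unfolding z_def poly_altdef sum_negf[symmetric]
    proof (intro sum.cong refl)
      fix i
      have "k i * real (Suc i) = coeff p i" by (simp add: k_def add.commute)
      then show "k i * (- (real (Suc i) * x ^ i)) = - (coeff p i * x ^ i)"
        by (metis mult.assoc mult_minus_right)
    qed
    ultimately show ?thesis by simp
  qed
  have wc: "continuous_on {0..1} w" by (intro continuous_at_imp_continuous_on ballI DERIV_isCont[OF dw])
  have zeq: "(\<lambda>x. - z x) = poly p" by (rule ext) (simp add: z_def)
  obtain L where L: "0 \<le> L" "\<And>x y. x \<in> {0..1} \<Longrightarrow> y \<in> {0..1} \<Longrightarrow> \<bar>poly p y - poly p x\<bar> \<le> L * \<bar>y - (x :: real)\<bar>"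
    using poly_lipschitz by blast
  have ac: "absolutely_continuous_on 0 1 z"
    by (rule lipschitz_absolutely_continuous[OF _ L(1)]) (use L(2) in \<open>auto simp: z_def abs_minus_commute\<close>)
  have "(abs_L2 v, abs_L2 (\<lambda>x. - z x)) \<in> A_init \<beta>"
    unfolding A_init_def mem_Collect_eq
  proof (rule exI[of _ v], rule exI[of _ z], intro conjI refl)
    show "\<exists>v' w. (\<forall>x\<in>{0<..<1}. (v has_real_derivative v' x) (at x) \<and> w x = x powr \<beta> * v' x \<and> (w has_real_derivative z x) (at x)) \<and> continuous_on {0..1} w"
      using dv wv dw wc by (intro exI[of _ v'] exI[of _ w]) auto
    show "square_integrable (\<lambda>x. - z x)" unfolding zeq by (intro square_integrable_continuous continuous_intros)
    show "v 1 = 0" by (simp add: v_def)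
  qed (rule vc ac)+
  then have *: "(abs_L2 v, abs_L2 (poly p)) \<in> A_init \<beta>" by (simp only: zeq)
  from A_init_subset_graph[OF this] * show ?thesis by simp
qed

lemma polynomial_sequence:
  obtains p where "(\<lambda>n. abs_L2 (poly (p n))) \<longlonglongrightarrow> g"
proof -
  have "\<exists>p. norm (g - abs_L2 (poly p)) < 1 / real (Suc n)" for n by (rule polynomials_dense_L2) simp
  then obtain p where p: "\<And>n. norm (g - abs_L2 (poly (p n))) < 1 / real (Suc n)" by metis
  have "(\<lambda>n. g - abs_L2 (poly (p n))) \<longlonglongrightarrow> 0"
  proof (rule Lim_null_comparison)
    show "\<forall>\<^sub>F n in sequentially. norm (g - abs_L2 (poly (p n))) \<le> 1 / real (Suc n)"
      using p by (intro always_eventually allI less_imp_le)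
    show "(\<lambda>n. 1 / real (Suc n)) \<longlonglongrightarrow> 0" by (rule LIMSEQ_Suc[OF lim_1_over_n])
  qed
  from tendsto_diff[OF tendsto_const[of g] this] show ?thesis by (intro that[of p]) simp
qed

lemma A_inv_bounded_linear: "bounded_linear A_inv"
  unfolding bounded_linear_def bounded_linear_axioms_def
proof (intro conjI exI allI)
  show "norm (A_inv x) \<le> norm x * (1 / (2 - \<beta>))" for x
    using A_inv_norm[of x] by (simp only: mult.commute)
qed (rule A_inv_linear)

text \<open>
  Forwards, an element of the adjoint is tested against the pairs \<open>(A_inv p, p)\<close> with polynomials \<open>p\<close>, which are
  dense.  Backwards, polynomials that tend to \<open>g\<close> give a sequence in the initial domain that is Cauchy in the
  energy norm, since \<open>(h, A_inv h)\<close> is bounded by a multiple of the square of the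
  norm of \<open>h\<close>.
\<close>

lemma friedrichs_eq_graph: "(u, g) \<in> friedrichs (A_init \<beta>) \<longleftrightarrow> u = A_inv g"
proof
  assume "(u, g) \<in> friedrichs (A_init \<beta>)"
  then have *: "inner u h = inner g v" if "(v, h) \<in> A_init \<beta>" for v h
    using that unfolding friedrichs_def by blast
  have "inner (u - A_inv g) (abs_L2 (poly p)) = 0" for p
    using *[OF poly_in_A_init[of p]] by (simp add: inner_diff_left A_inv_sym)
  moreover obtain p where "(\<lambda>n. abs_L2 (poly (p n))) \<longlonglongrightarrow> u - A_inv g" by (rule polynomial_sequence)
  then have "(\<lambda>n. inner (u - A_inv g) (abs_L2 (poly (p n)))) \<longlonglongrightarrow> inner (u - A_inv g) (u - A_inv g)"
    by (intro tendsto_intros)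
  ultimately have "inner (u - A_inv g) (u - A_inv g) = 0" by (simp add: LIMSEQ_const_iff)
  then show "u = A_inv g" by simp
next
  assume u: "u = A_inv g"
  obtain p where p: "(\<lambda>n. abs_L2 (poly (p n))) \<longlonglongrightarrow> g" by (rule polynomial_sequence)
  let ?Y = "\<lambda>n. abs_L2 (poly (p n))"
  have "u \<in> energy_space (A_init \<beta>)"
    unfolding energy_space_def mem_Collect_eq
  proof (rule exI[of _ "\<lambda>n. A_inv (?Y n)"], rule exI[of _ ?Y], intro conjI allI impI)
    show "(A_inv (?Y n), ?Y n) \<in> A_init \<beta>" for n by (rule poly_in_A_init)
    show "(\<lambda>n. A_inv (?Y n)) \<longlonglongrightarrow> u" unfolding u by (rule bounded_linear.tendsto[OF A_inv_bounded_linear p])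
    fix e :: real assume e: "0 < e"
    \<comment> \<open>chosen such that \<open>d\<^sup>2\<close> times the bound \<open>1 / (2 - \<beta>)\<close> of \<open>A_inv\<close> is \<open>e\<close>\<close>
    define d where "d = sqrt (e * (2 - \<beta>))"
    have d: "0 < d" "d * d = e * (2 - \<beta>)" using e \<beta>2 by (auto simp: d_def)
    have "Cauchy ?Y" using p by (rule LIMSEQ_imp_Cauchy)
    then obtain N where N: "\<And>m n. m \<ge> N \<Longrightarrow> n \<ge> N \<Longrightarrow> norm (?Y m - ?Y n) < d"
      using d(1) unfolding Cauchy_def dist_norm by meson
    show "\<exists>N. \<forall>m\<ge>N. \<forall>n\<ge>N. inner (?Y m - ?Y n) (A_inv (?Y m) - A_inv (?Y n)) < e"
    proof (intro exI allI impI)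
      fix m n assume mn: "N \<le> m" "N \<le> n"
      let ?D = "?Y m - ?Y n"
      have "inner ?D (A_inv (?Y m) - A_inv (?Y n)) = inner ?D (A_inv ?D)" by (simp add: linear_diff[OF A_inv_linear])
      also have "\<dots> \<le> norm ?D * norm (A_inv ?D)" by (rule norm_cauchy_schwarz)
      also have "\<dots> \<le> norm ?D * (1 / (2 - \<beta>) * norm ?D)" by (intro mult_left_mono A_inv_norm) simp
      also have "\<dots> = (norm ?D * norm ?D) / (2 - \<beta>)" by simp
      also have "\<dots> < (d * d) / (2 - \<beta>)"
        using N[OF mn] d(1) \<beta>2 by (intro divide_strict_right_mono mult_strict_mono) auto
      also have "\<dots> = e" using \<beta>2 by (simp add: d(2))
      finally show "inner ?D (A_inv (?Y m) - A_inv (?Y n)) < e" .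
    qed
  qed
  moreover have "inner u h = inner g v" if "(v, h) \<in> A_init \<beta>" for v h
    using A_init_subset_graph[OF that] by (simp add: u A_inv_sym)
  ultimately show "(u, g) \<in> friedrichs (A_init \<beta>)" unfolding friedrichs_def by blast
qed

section \<open>The weighted Sobolev space\<close>

lemma wgrad_A_inv: "wgrad \<beta> (A_inv g) = - T g"
  by (rule wgrad_eqI[OF has_wgrad_A_inv])

lemma Wnorm_A_inv: "Wnorm \<beta> (A_inv g) \<le> (1 / (2 - \<beta>) + sqrt (1 / (2 - \<beta>))) * norm g"
proof -
  have "Wnorm \<beta> (A_inv g) \<le> norm (A_inv g) + norm (T g)"
    unfolding Wnorm_def wgrad_A_inv using sqrt_sum_squares_le_sum[of "norm (A_inv g)" "norm (T g)"] by simp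
  also have "\<dots> \<le> 1 / (2 - \<beta>) * norm g + sqrt (1 / (2 - \<beta>)) * norm g"
    by (intro add_mono A_inv_norm T_norm)
  finally show ?thesis by (simp add: distrib_right)
qed

lemma Wnorm_nonneg: "0 \<le> Wnorm \<beta> v"
  by (simp add: Wnorm_def)

lemma tendsto_Wnorm_A_inv:
  assumes "(g \<longlongrightarrow> l) F"
  shows "((\<lambda>x. Wnorm \<beta> (A_inv (g x) - A_inv l)) \<longlongrightarrow> 0) F"
proof (rule Lim_null_comparison)
  let ?C = "1 / (2 - \<beta>) + sqrt (1 / (2 - \<beta>))"
  show "\<forall>\<^sub>F x in F. norm (Wnorm \<beta> (A_inv (g x) - A_inv l)) \<le> ?C * norm (g x - l)"
    using Wnorm_A_inv Wnorm_nonneg by (simp flip: linear_diff[OF A_inv_linear])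
  have "((\<lambda>x. ?C * norm (g x - l)) \<longlongrightarrow> ?C * norm (l - l)) F" by (intro tendsto_intros assms)
  then show "((\<lambda>x. ?C * norm (g x - l)) \<longlongrightarrow> 0) F" by simp
qed

lemma A_inv_in_Wspace: "A_inv g \<in> Wspace \<beta>"
proof -
  obtain p where p: "(\<lambda>n. abs_L2 (poly (p n))) \<longlonglongrightarrow> g" by (rule polynomial_sequence)
  have "A_inv (abs_L2 (poly (p n))) \<in> Domain (A_init \<beta>)" for n
    using poly_in_A_init[of "p n"] by (rule DomainI)
  then show ?thesis
    unfolding Wspace_def mem_Collect_eq
    using has_wgrad_A_inv[of g] tendsto_Wnorm_A_inv[OF p] by (intro conjI exI[of _ "- T g"] exI[of _ "\<lambda>n. A_inv (abs_L2 (poly (p n)))"] allI)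
qed

text \<open>
  On the range of \<open>A_inv\<close> this is \<open>(T g, T h) = (g, A_inv h)\<close>.  Elements of the Sobolev space are limits of such
  functions in the Sobolev norm, and both sides are continuous in that norm.
\<close>

lemma wgrad_inner:
  assumes \<omega>: "\<omega> \<in> Wspace \<beta>"
  shows "inner (wgrad \<beta> (A_inv g)) (wgrad \<beta> \<omega>) = inner g \<omega>"
proof -
  from \<omega> obtain q X where q: "has_wgrad \<beta> \<omega> q" and X: "\<And>n. X n \<in> Domain (A_init \<beta>)"
    and lim: "(\<lambda>n. Wnorm \<beta> (X n - \<omega>)) \<longlonglongrightarrow> 0" by (auto simp: Wspace_def)
  have "\<exists>h. X n = A_inv h" for n using X[of n] A_init_subset_graph by (auto elim: DomainE)
  then obtain h where h: "\<And>n. X n = A_inv (h n)" by metis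
  have g: "wgrad \<beta> (X n - \<omega>) = - T (h n) - q" for n
    unfolding h by (rule wgrad_eqI[OF has_wgrad_diff[OF has_wgrad_A_inv q]])
  have n1: "norm (X n - \<omega>) \<le> Wnorm \<beta> (X n - \<omega>)" and n2: "norm (- T (h n) - q) \<le> Wnorm \<beta> (X n - \<omega>)" for n
    unfolding Wnorm_def g by (auto intro!: real_le_rsqrt)
  have "(\<lambda>n. X n - \<omega>) \<longlonglongrightarrow> 0" by (rule Lim_null_comparison[OF always_eventually lim]) (use n1 in auto)
  then have l1: "X \<longlonglongrightarrow> \<omega>" by (simp add: LIM_zero_iff)
  have "(\<lambda>n. - T (h n) - q) \<longlonglongrightarrow> 0" by (rule Lim_null_comparison[OF always_eventually lim]) (use n2 in auto)
  then have l2: "(\<lambda>n. - T (h n)) \<longlonglongrightarrow> q" by (simp add: LIM_zero_iff)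
  have "(\<lambda>n. inner (- T g) (- T (h n))) \<longlonglongrightarrow> inner (- T g) q" by (intro tendsto_intros l2)
  moreover have "inner (- T g) (- T (h n)) = inner g (X n)" for n
    using A_inv_inner[of g "h n"] A_inv_sym[of g "h n"] by (simp add: h)
  ultimately have "(\<lambda>n. inner g (X n)) \<longlonglongrightarrow> inner (- T g) q" by simp
  moreover have "(\<lambda>n. inner g (X n)) \<longlonglongrightarrow> inner g \<omega>" by (intro tendsto_intros l1)
  ultimately have "inner (- T g) q = inner g \<omega>" by (rule LIMSEQ_unique)
  then show ?thesis by (simp add: wgrad_A_inv wgrad_eqI[OF q])
qed

end

section \<open>The change of time\<close>

text \<open>
  The time \<open>t\<close> is cut off below at \<open>a\<close>, so that the clock is continuous on the whole line.
\<close>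

definition clock :: "real \<Rightarrow> real \<Rightarrow> real \<Rightarrow> real" where
  "clock p a t = (max a t powr p - a powr p) / p"

definition unclock :: "real \<Rightarrow> real \<Rightarrow> real \<Rightarrow> real" where
  "unclock p a s = (p * max 0 s + a powr p) powr (1 / p)"

context
  fixes p a :: real
  assumes p: "0 < p" and a: "0 \<le> a"
begin

lemma clock_continuous: "continuous_on A (clock p a)"
  unfolding clock_def using p a
  by (intro continuous_on_divide continuous_on_diff continuous_on_powr' continuous_on_max continuous_on_id continuous_on_const) auto

lemma unclock_continuous: "continuous_on A (unclock p a)"
  unfolding unclock_def using p a
  by (intro continuous_on_powr' continuous_on_add continuous_on_mult continuous_on_max continuous_on_id continuous_on_const) (auto intro!: add_nonneg_nonneg)

lemma clock_a [simp]: "clock p a a = 0"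
  by (simp add: clock_def)

lemma clock_less: "a \<le> s \<Longrightarrow> s < t \<Longrightarrow> clock p a s < clock p a t"
  using p a by (auto simp: clock_def divide_strict_right_mono powr_less_mono2)

lemma clock_nonneg: "0 \<le> clock p a t"
  using p a by (auto simp: clock_def powr_mono2)

lemma unclock_clock: "a \<le> t \<Longrightarrow> unclock p a (clock p a t) = t"
  using p a clock_nonneg[of t] by (simp add: unclock_def) (simp add: clock_def powr_powr)

lemma unclock_ge: "a \<le> unclock p a s"
proof -
  have "a = (a powr p) powr (1 / p)" using p a by (simp add: powr_powr)
  also have "\<dots> \<le> unclock p a s" unfolding unclock_def using p by (intro powr_mono2) auto
  finally show ?thesis .
qed

lemma clock_unclock: "0 \<le> s \<Longrightarrow> clock p a (unclock p a s) = s"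
  using unclock_ge[of s] p a by (simp add: clock_def max_absorb2) (simp add: unclock_def powr_powr)

lemma unclock_powr: "0 \<le> s \<Longrightarrow> unclock p a s powr x = (p * s + a powr p) powr (x / p)"
  using p by (simp add: unclock_def powr_powr)

lemma clock_powr: "a \<le> t \<Longrightarrow> p * clock p a t + a powr p = t powr p"
  using p by (simp add: clock_def max_absorb2)

lemma clock_pos: "a < t \<Longrightarrow> 0 < clock p a t"
  using clock_less[of a t] by simp

lemma clock_le: "a \<le> s \<Longrightarrow> s \<le> t \<Longrightarrow> clock p a s \<le> clock p a t"
  using clock_less[of s t] by (cases "s = t") auto

lemma clock_deriv:
  assumes t: "a < t"
  shows "(clock p a has_real_derivative t powr (p - 1)) (at t)"
proof -
  have "((\<lambda>t. t powr p) has_real_derivative p * t powr (p - 1)) (at t)"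
    using t a by (intro has_real_derivative_powr) auto
  from DERIV_cdivide[OF DERIV_diff[OF this DERIV_const], of "a powr p" p]
  have d: "((\<lambda>t. (t powr p - a powr p) / p) has_real_derivative t powr (p - 1)) (at t)" using p by simp
  show ?thesis
    by (rule has_field_derivative_transform_within_open[OF d, of "{a<..}"]) (use t in \<open>auto simp: clock_def max_absorb2\<close>)
qed

lemma unclock_deriv:
  assumes s: "0 < s"
  shows "(unclock p a has_real_derivative unclock p a s powr (1 - p)) (at s)"
proof -
  have pos: "0 < p * s + a powr p" using s p by (simp add: add_pos_nonneg)
  have l: "((\<lambda>s. p * s + a powr p) has_real_derivative p) (at s)" by (auto intro!: derivative_eq_intros)
  have "((\<lambda>x. x powr (1 / p)) has_real_derivative (1 / p) * (p * s + a powr p) powr (1 / p - 1)) (at (p * s + a powr p))"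
    by (rule has_real_derivative_powr[OF pos])
  from DERIV_chain2[OF this l]
  have "((\<lambda>s. (p * s + a powr p) powr (1 / p)) has_real_derivative (p * s + a powr p) powr (1 / p - 1)) (at s)"
    using p by simp
  moreover have "(1 - p) / p = 1 / p - 1" using p by (simp add: field_simps)
  ultimately have d: "((\<lambda>s. (p * s + a powr p) powr (1 / p)) has_real_derivative unclock p a s powr (1 - p)) (at s)"
    using s unclock_powr[of s "1 - p"] by simp
  show ?thesis
    by (rule has_field_derivative_transform_within_open[OF d, of "{0<..}"]) (use s in \<open>auto simp: unclock_def\<close>)
qed

lemma clock_image: assumes t: "a < t" shows "clock p a ` {a<..<t} = {0<..<clock p a t}"
proof (intro equalityI subsetI)
  fix s assume s: "s \<in> {0<..<clock p a t}"
  have "unclock p a s \<in> {a<..<t}"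
  proof -
    have "a \<noteq> unclock p a s" using clock_unclock[of s] s clock_a by (metis greaterThanLessThan_iff less_imp_le less_irrefl)
    moreover have "\<not> t \<le> unclock p a s" using clock_le[of t "unclock p a s"] clock_unclock[of s] s t by auto
    ultimately show ?thesis using unclock_ge[of s] by auto
  qed
  moreover have "s = clock p a (unclock p a s)" using clock_unclock[of s] s by simp
  ultimately show "s \<in> clock p a ` {a<..<t}" by blast
qed (use clock_less clock_pos in \<open>auto simp: less_imp_le\<close>)

lemma clock_inj: "inj_on (clock p a) {a<..<t}"
  by (rule inj_on_inverseI[of _ "unclock p a"]) (auto simp: unclock_clock)

text \<open>
  The substitution is made on the open interval, because for \<open>a = 0\<close> and \<open>p < 1\<close> the derivative of the clock
  is unbounded at the left end point.
\<close>

lemma clock_change_of_variables: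
  fixes h :: "real \<Rightarrow> real"
  assumes t: "a < t" and hm: "h \<in> borel_measurable borel" and hi: "set_integrable lborel {0..clock p a t} h"
  shows "(LBINT \<tau>:{a..t}. \<tau> powr (p - 1) * h (clock p a \<tau>)) = (LBINT s:{0..clock p a t}. h s)"
proof -
  let ?C = "clock p a t" and ?k = "\<lambda>\<tau>. \<tau> powr (p - 1) * h (clock p a \<tau>)"
  have hi': "set_integrable lborel {0<..<?C} h" by (rule set_integrable_subset[OF hi]) auto
  have ha: "h absolutely_integrable_on {0<..<?C}"
    using hi' hm unfolding set_integrable_def by (subst integrable_completion) auto
  have cm: "clock p a \<in> borel_measurable borel" by (rule borel_measurable_continuous_onI[OF clock_continuous])
  have km: "?k \<in> borel_measurable borel"
    by (intro borel_measurable_times measurable_compose[OF cm hm] powr_real_measurable borel_measurable_const) simp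
  have *: "(\<lambda>\<tau>. \<bar>\<tau> powr (p - 1)\<bar> * h (clock p a \<tau>)) absolutely_integrable_on {a<..<t} \<and>
      integral {a<..<t} (\<lambda>\<tau>. \<bar>\<tau> powr (p - 1)\<bar> * h (clock p a \<tau>)) = integral {0<..<?C} h"
    by (rule iffD2[OF has_absolute_integral_change_of_variables_1'[OF _ _ clock_inj]])
       (use ha clock_image[OF t] in \<open>auto intro!: has_field_derivative_at_within[OF clock_deriv]\<close>)
  then have ka: "?k absolutely_integrable_on {a<..<t}" and ki: "integral {a<..<t} ?k = integral {0<..<?C} h"
    by simp_all
  have kl: "set_integrable lborel {a<..<t} ?k"
    using ka km unfolding set_integrable_def by (subst (asm) integrable_completion) auto
  have Icc: "(LBINT x:{r..s}. g x) = (LBINT x:{r<..<s}. g x)" if "g \<in> borel_measurable borel" for g :: "real \<Rightarrow> real" and r s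
  proof (rule set_integral_cong_set)
    show "AE x in lborel. (x \<in> {r<..<s}) = (x \<in> {r..s})"
      using AE_lborel_singleton[of r] AE_lborel_singleton[of s] by eventually_elim auto
  qed (use that in \<open>auto simp: set_borel_measurable_def\<close>)
  show ?thesis
    unfolding Icc[OF km] Icc[OF hm] set_borel_integral_eq_integral(2)[OF kl] set_borel_integral_eq_integral(2)[OF hi'] by (rule ki)
qed

text \<open>
  Here \<open>t\<^sup>p - \<tau>\<^sup>p\<close> is \<open>p\<close> times the difference of the clock readings, and \<open>p \<tau>\<^bsup>p-1\<^esup>\<close> is \<open>p\<close> times the derivative
  of the clock.
\<close>

lemma EK_integral_eq_rl:
  assumes \<alpha>: "0 < \<alpha>" "\<alpha> < 1" and t: "a < t" and gt: "continuous_on UNIV gt"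
    and g: "\<And>\<tau>. a \<le> \<tau> \<Longrightarrow> \<tau> \<le> t \<Longrightarrow> g \<tau> = gt (clock p a \<tau>)"
  shows "EK_integral p a 0 (1 - \<alpha>) g t = t powr (- p * (1 - \<alpha>)) * p powr (1 - \<alpha>) * rl (1 - \<alpha>) gt (clock p a t)"
proof -
  let ?C = "clock p a t"
  let ?h = "\<lambda>s. (?C - s) powr (1 - \<alpha> - 1) * gt s"
  have gm: "gt \<in> borel_measurable borel" using gt by (rule borel_measurable_continuous_onI)
  have C: "0 < ?C" by (rule clock_pos[OF t])
  obtain D where D: "\<And>t. 0 \<le> t \<Longrightarrow> t \<le> ?C \<Longrightarrow> \<bar>gt t\<bar> \<le> D"
    by (rule continuous_bounded_Icc[OF continuous_on_subset[OF gt]]) blast+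
  have hi: "set_integrable lborel {0..?C} ?h"
    by (rule abel_integrand_integrable[where C = D]) (use \<alpha> C gm D in auto)
  have hm: "?h \<in> borel_measurable borel"
    using gm by (intro borel_measurable_times powr_real_measurable borel_measurable_diff borel_measurable_const) simp_all
  have "(LBINT \<tau>:{a..t}. (t powr p - \<tau> powr p) powr (1 - \<alpha> - 1) * \<tau> powr (p * 0) * g \<tau> * (p * \<tau> powr (p - 1)))
      = (LBINT \<tau>:{a..t}. p powr (1 - \<alpha>) * (\<tau> powr (p - 1) * ?h (clock p a \<tau>)))"
  proof (rule set_lebesgue_integral_cong)
    show "\<forall>\<tau>. \<tau> \<in> {a..t} \<longrightarrow> (t powr p - \<tau> powr p) powr (1 - \<alpha> - 1) * \<tau> powr (p * 0) * g \<tau> * (p * \<tau> powr (p - 1))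
      = p powr (1 - \<alpha>) * (\<tau> powr (p - 1) * ?h (clock p a \<tau>))"
    proof (intro allI impI)
      fix \<tau> assume \<tau>: "\<tau> \<in> {a..t}"
      show "(t powr p - \<tau> powr p) powr (1 - \<alpha> - 1) * \<tau> powr (p * 0) * g \<tau> * (p * \<tau> powr (p - 1))
        = p powr (1 - \<alpha>) * (\<tau> powr (p - 1) * ?h (clock p a \<tau>))"
      proof (cases "\<tau> = 0")
        case False
        have e: "t powr p - \<tau> powr p = p * (?C - clock p a \<tau>)"
          using clock_powr[of t] clock_powr[of \<tau>] \<tau> t unfolding right_diff_distrib by auto
        have "p powr (1 - \<alpha> - 1) * p = p powr (1 - \<alpha>)"
          using p powr_mult_base[of p "1 - \<alpha> - 1"] by (simp add: mult.commute)
        moreover have "(p * (?C - clock p a \<tau>)) powr (1 - \<alpha> - 1) = p powr (1 - \<alpha> - 1) * (?C - clock p a \<tau>) powr (1 - \<alpha> - 1)"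
          by (rule powr_mult)
        ultimately show ?thesis unfolding e using False g[of \<tau>] \<tau> by (simp add: mult_ac)
      qed simp
    qed
  qed simp
  also have "\<dots> = p powr (1 - \<alpha>) * (LBINT s:{0..?C}. ?h s)"
    by (simp only: set_integral_mult_right clock_change_of_variables[OF t hm hi])
  finally show ?thesis unfolding EK_integral_def rl_def by simp
qed

end

lemma has_derivative_transform_on:
  assumes "x \<in> S" "(f has_real_derivative d) (at x within S)" "\<And>y. y \<in> S \<Longrightarrow> g y = f y"
  shows "(g has_real_derivative d) (at x within S)"
  by (rule has_field_derivative_transform_within[OF assms(2) zero_less_one assms(1)]) (simp add: assms(3))

lemma rl_const:
  assumes "0 < a" "0 \<le> s" shows "rl a (\<lambda>t. k) s = k * s powr a / Gamma (a + 1)"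
proof -
  have "rl a (\<lambda>t. k * 1) s = k * rl a (\<lambda>t. 1) s" by (rule rl_cmult)
  also have "rl a (\<lambda>t. 1) s = s powr a / Gamma (a + 1)"
    using abel_kernel_set_integral(2)[OF assms] assms by (simp add: rl_def Gamma_plus1_pos)
  finally show ?thesis by simp
qed

text \<open>
  The Abel integral of a constant is a power of \<open>s\<close>; its derivative is the singular term that the regularized
  derivative subtracts.
\<close>

lemma rl_subtract_const_deriv_iff:
  assumes \<alpha>: "0 < \<alpha>" "\<alpha> < 1" and gt: "continuous_on UNIV gt" and s: "s \<in> {0<..L}"
  shows "(rl (1 - \<alpha>) (\<lambda>r. gt r - k) has_real_derivative d) (at s within {0<..L}) \<longleftrightarrow>
    (rl (1 - \<alpha>) gt has_real_derivative d + k * s powr (- \<alpha>) / Gamma (1 - \<alpha>)) (at s within {0<..L})"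
proof -
  have G: "Gamma (1 - \<alpha> + 1) = (1 - \<alpha>) * Gamma (1 - \<alpha>)"
    by (rule Gamma_plus1_pos) (use \<alpha> in simp)
  let ?k = "\<lambda>s. k * s powr (1 - \<alpha>) / Gamma (1 - \<alpha> + 1)"
  have "((\<lambda>s. s powr (1 - \<alpha>)) has_real_derivative (1 - \<alpha>) * s powr (1 - \<alpha> - 1)) (at s)"
    using s by (intro has_real_derivative_powr) auto
  from DERIV_cdivide[OF DERIV_cmult[OF this]]
  have "(?k has_real_derivative k * ((1 - \<alpha>) * s powr (1 - \<alpha> - 1)) / Gamma (1 - \<alpha> + 1)) (at s)" .
  moreover have "k * ((1 - \<alpha>) * s powr (1 - \<alpha> - 1)) / Gamma (1 - \<alpha> + 1) = k * s powr (- \<alpha>) / Gamma (1 - \<alpha>)"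
    unfolding G using \<alpha> by simp
  ultimately have dk: "(?k has_real_derivative k * s powr (- \<alpha>) / Gamma (1 - \<alpha>)) (at s within {0<..L})"
    using has_field_derivative_at_within by metis
  have eq: "rl (1 - \<alpha>) (\<lambda>r. gt r - k) r = rl (1 - \<alpha>) gt r - ?k r" if r: "0 \<le> r" for r
  proof -
    have int: "set_integrable lborel {0..r} (\<lambda>t. (r - t) powr (1 - \<alpha> - 1) * g t)" if g: "continuous_on UNIV g" for g
    proof -
      obtain D where "\<And>t. 0 \<le> t \<Longrightarrow> t \<le> r \<Longrightarrow> \<bar>g t\<bar> \<le> D"
        by (rule continuous_bounded_Icc[OF continuous_on_subset[OF g subset_UNIV]]) blast
      then show ?thesis using g \<alpha> r
        by (intro abel_integrand_integrable[where C = D] borel_measurable_continuous_onI) auto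
    qed
    show ?thesis using rl_diff[OF int[OF gt] int[OF continuous_on_const]] rl_const[of "1 - \<alpha>" r k] \<alpha> r by simp
  qed
  show ?thesis
  proof
    assume "(rl (1 - \<alpha>) (\<lambda>r. gt r - k) has_real_derivative d) (at s within {0<..L})"
    from DERIV_add[OF this dk]
    show "(rl (1 - \<alpha>) gt has_real_derivative d + k * s powr (- \<alpha>) / Gamma (1 - \<alpha>)) (at s within {0<..L})"
      by (rule has_derivative_transform_on[OF s]) (simp add: eq)
  next
    assume "(rl (1 - \<alpha>) gt has_real_derivative d + k * s powr (- \<alpha>) / Gamma (1 - \<alpha>)) (at s within {0<..L})"
    from DERIV_diff[OF this dk]
    have "((\<lambda>r. rl (1 - \<alpha>) gt r - ?k r) has_real_derivative d) (at s within {0<..L})" by simp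
    then show "(rl (1 - \<alpha>) (\<lambda>r. gt r - k) has_real_derivative d) (at s within {0<..L})"
      by (rule has_derivative_transform_on[OF s]) (simp add: eq)
  qed
qed

text \<open>
  The Erdelyi--Kober integral is \<open>w t \<cdot> J (c t)\<close> with \<open>J = rl (1 - \<alpha>) gt\<close> and the power \<open>w\<close> of lemma
  \<open>EK_integral_eq_rl\<close>.  In \<open>1 - \<alpha> + (t/p) d/dt\<close> the term without derivative cancels against the derivative of \<open>w\<close>,
  and a multiple of \<open>J'\<close> remains.  For the converse, \<open>J\<close> is recovered by composing with the inverse of the
  clock.
\<close>

lemma caputo_hyper_bessel_iff_rl:
  assumes \<alpha>: "0 < \<alpha>" "\<alpha> < 1" and \<theta>: "\<theta> < 1" and a: "0 \<le> a" and t: "t \<in> {a<..T}"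
    and gt: "continuous_on UNIV gt"
    and g: "\<And>\<tau>. a \<le> \<tau> \<Longrightarrow> \<tau> \<le> T \<Longrightarrow> g \<tau> = gt (clock (1 - \<theta>) a \<tau>)"
  shows "has_caputo_hyper_bessel_derivative \<theta> \<alpha> a T g d t \<longleftrightarrow>
    (rl (1 - \<alpha>) (\<lambda>r. gt r - gt 0) has_real_derivative d)
      (at (clock (1 - \<theta>) a t) within {0<..clock (1 - \<theta>) a T})"
proof -
  define p where "p = 1 - \<theta>"
  have p: "0 < p" using \<theta> by (simp add: p_def)
  let ?c = "clock p a" and ?u = "unclock p a"
  let ?J = "rl (1 - \<alpha>) gt" and ?E = "EK_integral p a 0 (1 - \<alpha>) g"
  have aT: "a < T" and t0: "0 < t" and at: "a < t" "t \<le> T" using t a by auto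
  define w where "w t = t powr (- p * (1 - \<alpha>)) * p powr (1 - \<alpha>)" for t
  \<comment> \<open>the reciprocal of \<open>w\<close> as a function of the clock reading (fact \<open>wv\<close>)\<close>
  define v where "v s = (p * s + a powr p) powr (1 - \<alpha>) * p powr (\<alpha> - 1)" for s
  have g': "g \<tau> = gt (?c \<tau>)" if "a \<le> \<tau>" "\<tau> \<le> T" for \<tau> using g[OF that] by (simp add: p_def)
  have E: "?E r = ?J (?c r) * w r" if r: "r \<in> {a<..T}" for r
    using EK_integral_eq_rl[OF p a \<alpha> _ gt, of r g] g' r by (simp add: w_def)
  have wv: "w r * v (?c r) = 1" if r: "a < r" for r
  proof -
    have "r powr (- p * (1 - \<alpha>)) * (r powr p) powr (1 - \<alpha>) = 1" using r a by (simp add: powr_powr flip: powr_add)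
    moreover have "p powr (1 - \<alpha>) * p powr (\<alpha> - 1) = 1" using p by (simp flip: powr_add)
    ultimately have "(r powr (- p * (1 - \<alpha>)) * (r powr p) powr (1 - \<alpha>)) * (p powr (1 - \<alpha>) * p powr (\<alpha> - 1)) = 1" by simp
    then show ?thesis using clock_powr[OF p a, of r] r by (simp add: w_def v_def mult_ac)
  qed
  have cs: "?c t \<in> {0<..?c T}" using clock_pos[OF p a at(1)] clock_le[OF p a _ at(2)] at by simp
  have uc: "?u (?c t) = t" using unclock_clock[OF p a, of t] at by simp
  have u_in: "?u s \<in> {a<..T}" if s: "s \<in> {0<..?c T}" for s
  proof -
    have "a \<noteq> ?u s" using clock_unclock[OF p a, of s] s clock_a[OF p a] by (metis greaterThanAtMost_iff less_imp_le less_irrefl)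
    moreover have "\<not> T < ?u s" using clock_less[OF p a, of T "?u s"] clock_unclock[OF p a, of s] s aT by auto
    ultimately show ?thesis using unclock_ge[OF p a, of s] by auto
  qed
  have c_in: "?c r \<in> {0<..?c T}" if r: "r \<in> {a<..T}" for r
    using clock_pos[OF p a, of r] clock_le[OF p a, of r T] r by auto
  \<comment> \<open>the factor in front of the Erdelyi--Kober derivative\<close>
  define m where "m = p powr \<alpha> * t powr (- p * \<alpha>)"
  have m1: "m * (t / p) = t powr (1 - p) * v (?c t)"
  proof -
    have "v (?c t) = t powr (p * (1 - \<alpha>)) * p powr (\<alpha> - 1)"
      using clock_powr[OF p a, of t] at by (simp add: v_def powr_powr)
    moreover have "t powr (1 - p) * t powr (p * (1 - \<alpha>)) = t powr (1 + - p * \<alpha>)"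
      by (simp add: algebra_simps flip: powr_add)
    moreover have "t powr (1 + - p * \<alpha>) = t * t powr (- p * \<alpha>)"
      by (rule powr_mult_base[symmetric]) (use t0 in simp)
    moreover have "p powr (\<alpha> - 1) = p powr \<alpha> / p" using p by (simp add: powr_diff)
    ultimately show ?thesis unfolding m_def by (simp add: mult_ac)
  qed
  have v': "(v has_real_derivative m * (1 - \<alpha>)) (at (?c t))"
  proof -
    have pos: "0 < p * ?c t + a powr p" using clock_powr[OF p a, of t] at t0 by simp
    have l: "((\<lambda>s. p * s + a powr p) has_real_derivative p) (at (?c t))" by (auto intro!: derivative_eq_intros)
    from DERIV_chain2[OF has_real_derivative_powr[OF pos, where r = "1 - \<alpha>"] l]
    have "((\<lambda>s. (p * s + a powr p) powr (1 - \<alpha>)) has_real_derivative (1 - \<alpha>) * (t powr p) powr (1 - \<alpha> - 1) * p) (at (?c t))"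
      using clock_powr[OF p a, of t] at by simp
    from DERIV_cmult_right[OF this, of "p powr (\<alpha> - 1)"]
    have 1: "(v has_real_derivative (1 - \<alpha>) * (t powr p) powr (1 - \<alpha> - 1) * p * p powr (\<alpha> - 1)) (at (?c t))"
      unfolding v_def .
    have 3: "(t powr p) powr (1 - \<alpha> - 1) = t powr (- p * \<alpha>)" by (simp add: powr_powr)
    have 2: "p * p powr (\<alpha> - 1) = p powr \<alpha>" using p by (simp add: powr_diff)
    have "(1 - \<alpha>) * (t powr p) powr (1 - \<alpha> - 1) * p * p powr (\<alpha> - 1) = (1 - \<alpha>) * t powr (- p * \<alpha>) * (p * p powr (\<alpha> - 1))"
      by (simp only: 3 mult.assoc)
    also have "\<dots> = m * (1 - \<alpha>)" unfolding 2 m_def by simp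
    finally have eq: "(1 - \<alpha>) * (t powr p) powr (1 - \<alpha> - 1) * p * p powr (\<alpha> - 1) = m * (1 - \<alpha>)" .
    show ?thesis using 1 unfolding eq .
  qed
  have w': "(w has_real_derivative - (w t * w t * (m * (1 - \<alpha>)) * t powr (p - 1))) (at t)"
  proof -
    have c': "(?c has_real_derivative t powr (p - 1)) (at t)" by (rule clock_deriv[OF p a at(1)])
    have vn: "v (?c t) \<noteq> 0" using wv[OF at(1)] by auto
    have "((\<lambda>r. inverse (v (?c r))) has_real_derivative - (inverse (v (?c t)) * (m * (1 - \<alpha>) * t powr (p - 1)) * inverse (v (?c t)))) (at t)"
      by (rule DERIV_inverse'[OF DERIV_chain2[OF v' c'] vn])
    moreover have iv: "inverse (v (?c r)) = w r" if "a < r" for r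
      using wv[OF that] by (metis inverse_unique mult.commute)
    ultimately have "((\<lambda>r. inverse (v (?c r))) has_real_derivative - (w t * w t * (m * (1 - \<alpha>)) * t powr (p - 1))) (at t)"
      using at by (simp add: mult_ac)
    then show ?thesis
      by (rule has_field_derivative_transform_within_open[of _ _ _ "{a<..}"]) (use at iv in auto)
  qed
  have tt: "t powr (p - 1) * t powr (1 - p) = 1" using t0 by (simp flip: powr_add)
  have forward: "(?J has_real_derivative m * X) (at (?c t) within {0<..?c T})"
    if D: "(?E has_real_derivative D) (at t within {a<..T})" and X: "X = (1 - \<alpha>) * ?E t + t / p * D" for D X
  proof -
    have u': "(?u has_real_derivative t powr (1 - p)) (at (?c t) within {0<..?c T})"
      using has_field_derivative_at_within[OF unclock_deriv[OF p a, of "?c t"]] cs by (simp add: uc)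
    have "(?E has_real_derivative D) (at (?u (?c t)) within ?u ` {0<..?c T})"
      unfolding uc by (rule DERIV_subset[OF D]) (use u_in in auto)
    from DERIV_mult[OF DERIV_image_chain[OF this u'] has_field_derivative_at_within[OF v']]
    have "((\<lambda>s. ?E (?u s) * v s) has_real_derivative D * t powr (1 - p) * v (?c t) + m * (1 - \<alpha>) * ?E t) (at (?c t) within {0<..?c T})"
      by (simp add: o_def uc)
    moreover have "D * t powr (1 - p) * v (?c t) + m * (1 - \<alpha>) * ?E t = m * X"
      unfolding X distrib_left mult.assoc[symmetric] m1[symmetric]
      using m1 by (simp add: mult_ac)
    ultimately have "((\<lambda>s. ?E (?u s) * v s) has_real_derivative m * X) (at (?c t) within {0<..?c T})" by simp
    then show ?thesis
    proof (rule has_derivative_transform_on[OF cs])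
      fix s assume s: "s \<in> {0<..?c T}"
      then show "?J s = ?E (?u s) * v s"
        using E[OF u_in[OF s]] wv[of "?u s"] u_in[OF s] clock_unclock[OF p a, of s] by simp
    qed
  qed
  have backward: "\<exists>D. (?E has_real_derivative D) (at t within {a<..T}) \<and> m * ((1 - \<alpha>) * ?E t + t / p * D) = X"
    if J: "(?J has_real_derivative X) (at (?c t) within {0<..?c T})" for X
  proof (intro exI conjI)
    have c': "(?c has_real_derivative t powr (p - 1)) (at t within {a<..T})"
      by (rule has_field_derivative_at_within[OF clock_deriv[OF p a at(1)]])
    have "(?J has_real_derivative X) (at (?c t) within ?c ` {a<..T})"
      by (rule DERIV_subset[OF J]) (use c_in in auto)
    from DERIV_mult[OF DERIV_image_chain[OF this c'] has_field_derivative_at_within[OF w']]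
    have "((\<lambda>r. ?J (?c r) * w r) has_real_derivative X * t powr (p - 1) * w t + - (w t * w t * (m * (1 - \<alpha>)) * t powr (p - 1)) * ?J (?c t)) (at t within {a<..T})"
      by (simp only: o_def)
    then show "(?E has_real_derivative X * t powr (p - 1) * w t + - (w t * w t * (m * (1 - \<alpha>)) * t powr (p - 1)) * ?J (?c t)) (at t within {a<..T})"
      by (rule has_derivative_transform_on[OF t]) (use E in simp)
    let ?e = "t powr (p - 1)" and ?e' = "t powr (1 - p)" and ?v = "v (?c t)" and ?w = "w t" and ?j = "?J (?c t)"
    have "m * ((1 - \<alpha>) * ?E t + t / p * (X * ?e * ?w + - (?w * ?w * (m * (1 - \<alpha>)) * ?e) * ?j))
      = m * (1 - \<alpha>) * (?j * ?w) + (m * (t / p)) * (X * ?e * ?w + - (?w * ?w * (m * (1 - \<alpha>)) * ?e) * ?j)"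
      unfolding E[OF t] by (simp only: distrib_left mult.assoc)
    also have "\<dots> = m * (1 - \<alpha>) * (?j * ?w) + (?e' * ?v) * (X * ?e * ?w + - (?w * ?w * (m * (1 - \<alpha>)) * ?e) * ?j)"
      by (simp only: m1)
    also have "\<dots> = m * (1 - \<alpha>) * (?j * ?w) + (?e * ?e') * (?w * ?v) * (X - ?w * (m * (1 - \<alpha>)) * ?j)"
      by (simp add: algebra_simps)
    also have "\<dots> = X" using wv[OF at(1)] tt by (simp add: algebra_simps)
    finally show "m * ((1 - \<alpha>) * ?E t + t / p * (X * ?e * ?w + - (?w * ?w * (m * (1 - \<alpha>)) * ?e) * ?j)) = X" .
  qed
  have k: "p powr \<alpha> * g a * (t powr p - a powr p) powr (- \<alpha>) / Gamma (1 - \<alpha>) = gt 0 * ?c t powr (- \<alpha>) / Gamma (1 - \<alpha>)"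
  proof -
    have "t powr p - a powr p = p * ?c t" using clock_powr[OF p a, of t] at by simp
    then have "p powr \<alpha> * (t powr p - a powr p) powr (- \<alpha>) = p powr \<alpha> * p powr (- \<alpha>) * ?c t powr (- \<alpha>)"
      by (simp add: powr_mult)
    also have "\<dots> = ?c t powr (- \<alpha>)" using p by (simp flip: powr_add)
    finally have 1: "p powr \<alpha> * (t powr p - a powr p) powr (- \<alpha>) = ?c t powr (- \<alpha>)" .
    have "g a = gt 0" using g'[of a] aT clock_a[OF p a] by simp
    then have "p powr \<alpha> * g a * (t powr p - a powr p) powr (- \<alpha>) = gt 0 * (p powr \<alpha> * (t powr p - a powr p) powr (- \<alpha>))" by simp
    then show ?thesis by (simp only: 1)
  qed
  have "has_caputo_hyper_bessel_derivative \<theta> \<alpha> a T g d t \<longleftrightarrow>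
    (\<exists>X. (\<exists>D. (?E has_real_derivative D) (at t within {a<..T}) \<and> X = (1 - \<alpha>) * ?E t + t / p * D) \<and>
       d = m * X - gt 0 * ?c t powr (- \<alpha>) / Gamma (1 - \<alpha>))"
    unfolding has_caputo_hyper_bessel_derivative_def has_EK_derivative_def Let_def p_def[symmetric] k m_def ..
  also have "\<dots> \<longleftrightarrow> (?J has_real_derivative d + gt 0 * ?c t powr (- \<alpha>) / Gamma (1 - \<alpha>)) (at (?c t) within {0<..?c T})"
    (is "?L \<longleftrightarrow> ?R")
  proof
    assume ?L
    then obtain X D where D: "(?E has_real_derivative D) (at t within {a<..T})" "X = (1 - \<alpha>) * ?E t + t / p * D"
      and d: "d = m * X - gt 0 * ?c t powr (- \<alpha>) / Gamma (1 - \<alpha>)" by blast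
    have "m * X = d + gt 0 * ?c t powr (- \<alpha>) / Gamma (1 - \<alpha>)" using d by linarith
    then show ?R using forward[OF D] by (simp only:)
  next
    assume ?R
    from backward[OF this] obtain D where D: "(?E has_real_derivative D) (at t within {a<..T})"
      and eq: "m * ((1 - \<alpha>) * ?E t + t / p * D) = d + gt 0 * ?c t powr (- \<alpha>) / Gamma (1 - \<alpha>)" by blast
    then have "d = m * ((1 - \<alpha>) * ?E t + t / p * D) - gt 0 * ?c t powr (- \<alpha>) / Gamma (1 - \<alpha>)" by linarith
    with D show ?L by blast
  qed
  also have "\<dots> \<longleftrightarrow> (rl (1 - \<alpha>) (\<lambda>r. gt r - gt 0) has_real_derivative d) (at (?c t) within {0<..?c T})"
    by (rule rl_subtract_const_deriv_iff[OF \<alpha> gt cs, symmetric])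
  finally show ?thesis unfolding p_def .
qed


text \<open>
  A function of time, read off at clock time; beyond \<open>T\<close> it is continued by its last value.
\<close>

definition on_clock :: "real \<Rightarrow> real \<Rightarrow> real \<Rightarrow> (real \<Rightarrow> 'b) \<Rightarrow> real \<Rightarrow> 'b" where
  "on_clock p a T u s = u (min T (unclock p a s))"

context
  fixes p a T :: real
  assumes p: "0 < p" and a: "0 \<le> a" and aT: "a < T"
begin

lemma on_clock_range: "min T (unclock p a s) \<in> {a..T}"
  using unclock_ge[OF p a, of s] aT by auto

lemma on_clock_clock: "t \<in> {a..T} \<Longrightarrow> on_clock p a T u (clock p a t) = u t"
  using unclock_clock[OF p a, of t] by (simp add: on_clock_def)

lemma on_clock_0: "on_clock p a T u 0 = u a"
  using on_clock_clock[of a u] clock_a[OF p a] aT by simp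

lemma on_clock_continuous:
  assumes "continuous_on {a..T} (u :: real \<Rightarrow> 'b::topological_space)" shows "continuous_on A (on_clock p a T u)"
  unfolding on_clock_def
  by (rule continuous_on_compose2[OF assms continuous_on_min[OF continuous_on_const unclock_continuous[OF p a]]])
     (use on_clock_range in blast)

lemma clock_obtain:
  assumes "s \<in> {0<..clock p a T}"
  obtains t where "t \<in> {a<..T}" "clock p a t = s"
proof (rule that[of "unclock p a s"])
  show eq: "clock p a (unclock p a s) = s" using clock_unclock[OF p a, of s] assms by simp
  have "a \<noteq> unclock p a s" using eq assms clock_a[OF p a] by auto
  moreover have "\<not> T < unclock p a s" using clock_less[OF p a, of T "unclock p a s"] eq assms aT by auto
  ultimately show "unclock p a s \<in> {a<..T}" using unclock_ge[OF p a, of s] by auto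
qed

end

section \<open>Weak solutions\<close>

context degenerate_elliptic
begin

text \<open>
  The factor \<open>2 - \<beta>\<close> normalizes \<open>A_inv\<close> to a contraction.
\<close>

lemma fractional_resolvent_A_inv:
  assumes \<alpha>: "0 < \<alpha>" "\<alpha> < 1"
  shows "fractional_resolvent (\<lambda>u. (2 - \<beta>) *\<^sub>R A_inv u) (1 / (2 - \<beta>)) \<alpha>"
proof (rule fractional_resolvent.intro[OF positive_contraction.intro fractional_resolvent_axioms.intro])
  have b: "0 < 2 - \<beta>" using \<beta>2 by simp
  show "linear (\<lambda>u. (2 - \<beta>) *\<^sub>R A_inv u)" by (rule linear_compose_scale_right[OF A_inv_linear])
  fix x y :: L2
  show "inner ((2 - \<beta>) *\<^sub>R A_inv x) y = inner x ((2 - \<beta>) *\<^sub>R A_inv y)" by (simp add: A_inv_sym)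
  show "0 \<le> inner ((2 - \<beta>) *\<^sub>R A_inv x) x" using b by (simp add: A_inv_inner)
  have "norm ((2 - \<beta>) *\<^sub>R A_inv x) = (2 - \<beta>) * norm (A_inv x)" using b by simp
  also have "\<dots> \<le> (2 - \<beta>) * (1 / (2 - \<beta>) * norm x)" using b by (intro mult_left_mono A_inv_norm) simp
  also have "\<dots> = norm x" using b by simp
  finally show "norm ((2 - \<beta>) *\<^sub>R A_inv x) \<le> norm x" .
  show "0 < 1 / (2 - \<beta>)" using b by simp
  show "0 < \<alpha>" "\<alpha> < 1" by (rule \<alpha>)+
  show "x = 0" if "(2 - \<beta>) *\<^sub>R A_inv x = 0" using that b A_inv_inj[of x] by simp
qed

lemma weak_solution_exists:
  fixes a T :: real
  assumes \<alpha>: "0 < \<alpha>" "\<alpha> < 1" and \<theta>: "\<theta> < 1" and a: "0 \<le> a" and aT: "a < T" and f: "C1_on {a..T} f"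
  shows "\<exists>u. weak_solution \<alpha> \<theta> \<beta> a T \<phi> f u"
proof -
  interpret fr: fractional_resolvent "\<lambda>u. (2 - \<beta>) *\<^sub>R A_inv u" "1 / (2 - \<beta>)" \<alpha>
    by (rule fractional_resolvent_A_inv[OF \<alpha>])
  have RB: "fr.R x = A_inv x" for x using \<beta>2 by (simp add: fr.R_def)
  have p: "0 < 1 - \<theta>" using \<theta> by simp
  define c where "c = clock (1 - \<theta>) a"
  obtain f' where f': "\<And>t. t \<in> {a..T} \<Longrightarrow> (f has_vector_derivative f' t) (at t within {a..T})"
    and f'c: "continuous_on {a..T} f'" using f unfolding C1_on_def by blast
  have fc: "continuous_on {a..T} f"
    unfolding continuous_on_eq_continuous_within using f' has_vector_derivative_continuous by blast
  have cc: "continuous_on A c" for A unfolding c_def by (rule clock_continuous[OF p a])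
  have cmono: "c s < c t" if "s \<in> {a..T}" "t \<in> {a..T}" "s < t" for s t
    unfolding c_def using that by (intro clock_less[OF p a]) auto
  have c0: "c a = 0" unfolding c_def by (rule clock_a[OF p a])
  have cpos: "0 < c t" if "a < t" for t unfolding c_def by (rule clock_pos[OF p a that])
  have cle: "c t \<in> {0<..c T}" if "t \<in> {a<..T}" for t
    using cpos[of t] clock_le[OF p a, of t T] that by (simp add: c_def)
  define F where "F = on_clock (1 - \<theta>) a T f"
  have Fc: "continuous_on UNIV F" unfolding F_def by (rule on_clock_continuous[OF p a aT fc])
  have Ff: "F (c t) = f t" if "t \<in> {a..T}" for t unfolding F_def c_def by (rule on_clock_clock[OF p a aT that])
  note data = aT f' f'c cc cmono c0 Fc Ff
  define U where "U = fr.U a T f f' c \<phi>"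
  define AU where "AU = fr.AU a T f f' c \<phi>"
  have U_cont: "continuous_on A U" for A unfolding U_def by (rule fr.U_continuous[OF data])
  have AU_cont: "continuous_on {0<..} AU" unfolding AU_def by (rule fr.AU_continuous[OF data])
  have U0: "U 0 = \<phi>" unfolding U_def by (rule fr.U_0[OF data])
  have U_eq: "U s = A_inv (AU s)" if "0 < s" for s
    unfolding U_def AU_def using fr.R_AU[OF data that, of \<phi>] by (simp only: RB)
  have eqn: "(rl (1 - \<alpha>) (\<lambda>r. inner (U r - \<phi>) \<eta>) has_real_derivative inner (F s - AU s) \<eta>) (at s within {0<..c T})"
    if "s \<in> {0<..c T}" for s \<eta>
    unfolding U_def AU_def by (rule fr.U_equation[OF data that])
  define u where "u t = U (c t)" for t
  define Au where "Au t = AU (c t)" for t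
  have u_A_inv: "u t = A_inv (Au t)" if "a < t" for t unfolding u_def Au_def by (rule U_eq[OF cpos[OF that]])
  have u_cont: "continuous_on A u" for A
    unfolding u_def by (rule continuous_on_compose2[OF U_cont[of UNIV] cc]) simp
  have Au_cont: "continuous_on {a<..T} Au"
    unfolding Au_def by (rule continuous_on_compose2[OF AU_cont cc]) (use cpos in auto)
  have "W_continuous_on \<beta> {a<..T} u"
    unfolding W_continuous_on_def
  proof (intro ballI conjI)
    fix t assume t: "t \<in> {a<..T}"
    show "u t \<in> Wspace \<beta>" using t by (simp add: u_A_inv A_inv_in_Wspace)
    have "(Au \<longlongrightarrow> Au t) (at t within {a<..T})" using Au_cont t by (simp add: continuous_on_def)
    from tendsto_Wnorm_A_inv[OF this]
    show "((\<lambda>s. Wnorm \<beta> (u s - u t)) \<longlongrightarrow> 0) (at t within {a<..T})"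
    proof (rule Lim_transform_eventually)
      show "\<forall>\<^sub>F s in at t within {a<..T}. Wnorm \<beta> (A_inv (Au s) - A_inv (Au t)) = Wnorm \<beta> (u s - u t)"
        using t by (simp add: eventually_at_filter u_A_inv)
    qed
  qed
  moreover have "\<forall>t\<in>{a<..T}. (u t, Au t) \<in> friedrichs (A_init \<beta>)"
    by (simp add: friedrichs_eq_graph u_A_inv)
  moreover have "\<exists>d. has_caputo_hyper_bessel_derivative \<theta> \<alpha> a T (\<lambda>s. inner (u s) \<omega>) d t \<and>
        d + inner (wgrad \<beta> (u t)) (wgrad \<beta> \<omega>) = inner (f t) \<omega>" if \<omega>: "\<omega> \<in> Wspace \<beta>" and t: "t \<in> {a<..T}" for \<omega> t
  proof (intro exI conjI)
    have "(rl (1 - \<alpha>) (\<lambda>r. inner (U r) \<omega> - inner (U 0) \<omega>) has_real_derivative inner (f t - Au t) \<omega>) (at (c t) within {0<..c T})"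
      using eqn[OF cle[OF t], of \<omega>] Ff[of t] t by (simp add: U0 Au_def inner_diff_left)
    then show "has_caputo_hyper_bessel_derivative \<theta> \<alpha> a T (\<lambda>s. inner (u s) \<omega>) (inner (f t - Au t) \<omega>) t"
      unfolding c_def
      by (subst caputo_hyper_bessel_iff_rl[OF \<alpha> \<theta> a t, of "\<lambda>s. inner (U s) \<omega>"])
         (auto intro!: continuous_on_inner U_cont continuous_on_const simp: u_def c_def)
    show "inner (f t - Au t) \<omega> + inner (wgrad \<beta> (u t)) (wgrad \<beta> \<omega>) = inner (f t) \<omega>"
      using t by (simp add: u_A_inv wgrad_inner[OF \<omega>] inner_diff_left)
  qed
  moreover have "(u \<longlongrightarrow> \<phi>) (at_right a)"
  proof -
    have "(u \<longlongrightarrow> u a) (at a within {a..T})" using u_cont[of "{a..T}"] aT by (simp add: continuous_on_def)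
    then show ?thesis using aT by (simp add: at_within_Icc_at_right u_def c0 U0)
  qed
  ultimately have "weak_solution \<alpha> \<theta> \<beta> a T \<phi> f u"
    unfolding weak_solution_def using u_cont Au_cont by blast
  then show ?thesis by blast
qed

lemma weak_solution_initial:
  fixes a T :: real
  assumes "a < T" "weak_solution \<alpha> \<theta> \<beta> a T \<phi> f u"
  shows "u a = \<phi>"
proof -
  have c: "continuous_on {a..T} u" and l: "(u \<longlongrightarrow> \<phi>) (at_right a)" using assms(2) by (auto simp: weak_solution_def)
  have "(u \<longlongrightarrow> u a) (at a within {a..T})" using c assms(1) by (simp add: continuous_on_def)
  then have "(u \<longlongrightarrow> u a) (at_right a)" using assms(1) by (simp add: at_within_Icc_at_right)
  from tendsto_unique[OF _ this l] show ?thesis by simp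
qed

text \<open>
  Test functions in the range of \<open>A_inv\<close> turn the bilinear form into the inner product with \<open>u\<close> itself, so no
  regularity of \<open>u\<close> enters the abstract equation.
\<close>

lemma weak_solution_rl:
  fixes a T :: real
  assumes \<alpha>: "0 < \<alpha>" "\<alpha> < 1" and \<theta>: "\<theta> < 1" and a: "0 \<le> a" and aT: "a < T"
    and u: "weak_solution \<alpha> \<theta> \<beta> a T \<phi> f u" and s: "s \<in> {0<..clock (1 - \<theta>) a T}"
  shows "(rl (1 - \<alpha>) (\<lambda>r. inner (on_clock (1 - \<theta>) a T u r) (A_inv \<eta>) - inner \<phi> (A_inv \<eta>)) has_real_derivative
      inner (on_clock (1 - \<theta>) a T f s) (A_inv \<eta>) - inner (on_clock (1 - \<theta>) a T u s) \<eta>)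
      (at s within {0<..clock (1 - \<theta>) a T})"
proof -
  have p: "0 < 1 - \<theta>" using \<theta> by simp
  note cl = p a aT
  obtain t where t: "t \<in> {a<..T}" "clock (1 - \<theta>) a t = s" by (rule clock_obtain[OF cl s])
  have uc: "continuous_on {a..T} u" and W: "u t \<in> Wspace \<beta>"
    using u t(1) by (auto simp: weak_solution_def W_continuous_on_def)
  obtain d where d: "has_caputo_hyper_bessel_derivative \<theta> \<alpha> a T (\<lambda>s. inner (u s) (A_inv \<eta>)) d t"
    and eq: "d + inner (wgrad \<beta> (u t)) (wgrad \<beta> (A_inv \<eta>)) = inner (f t) (A_inv \<eta>)"
    using u t(1) A_inv_in_Wspace[of \<eta>] unfolding weak_solution_def by blast
  have "inner (wgrad \<beta> (u t)) (wgrad \<beta> (A_inv \<eta>)) = inner (u t) \<eta>"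
    using wgrad_inner[OF W, of \<eta>] by (simp add: inner_commute)
  then have deq: "d = inner (on_clock (1 - \<theta>) a T f s) (A_inv \<eta>) - inner (on_clock (1 - \<theta>) a T u s) \<eta>"
    using eq t on_clock_clock[OF cl, of t u] on_clock_clock[OF cl, of t f] by simp
  have gc: "continuous_on UNIV (\<lambda>r. inner (on_clock (1 - \<theta>) a T u r) (A_inv \<eta>))"
    by (intro continuous_on_inner continuous_on_const on_clock_continuous[OF cl uc])
  have "(rl (1 - \<alpha>) (\<lambda>r. inner (on_clock (1 - \<theta>) a T u r) (A_inv \<eta>) - inner (on_clock (1 - \<theta>) a T u 0) (A_inv \<eta>)) has_real_derivative d)
      (at (clock (1 - \<theta>) a t) within {0<..clock (1 - \<theta>) a T})"
    by (rule iffD1[OF caputo_hyper_bessel_iff_rl[OF \<alpha> \<theta> a t(1) gc] d]) (simp add: on_clock_clock[OF cl])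
  then show ?thesis by (simp only: t(2) deq on_clock_0[OF cl] weak_solution_initial[OF aT u])
qed

lemma weak_solution_unique:
  fixes a T :: real
  assumes \<alpha>: "0 < \<alpha>" "\<alpha> < 1" and \<theta>: "\<theta> < 1" and a: "0 \<le> a" and aT: "a < T"
    and u: "weak_solution \<alpha> \<theta> \<beta> a T \<phi> f u" and v: "weak_solution \<alpha> \<theta> \<beta> a T \<phi> f v" and t: "t \<in> {a..T}"
  shows "v t = u t"
proof -
  interpret fr: fractional_resolvent "\<lambda>u. (2 - \<beta>) *\<^sub>R A_inv u" "1 / (2 - \<beta>)" \<alpha>
    by (rule fractional_resolvent_A_inv[OF \<alpha>])
  have RB: "fr.R x = A_inv x" for x using \<beta>2 by (simp add: fr.R_def)
  have p: "0 < 1 - \<theta>" using \<theta> by simp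
  note cl = p a aT
  let ?u = "on_clock (1 - \<theta>) a T u" and ?v = "on_clock (1 - \<theta>) a T v"
  let ?L = "clock (1 - \<theta>) a T"
  have uc: "continuous_on A ?u" and vc: "continuous_on A ?v" for A
    using u v by (auto intro!: on_clock_continuous[OF cl] simp: weak_solution_def)
  have int: "set_integrable lborel {0..r} (\<lambda>t. (r - t) powr (1 - \<alpha> - 1) * g t)" if g: "continuous_on UNIV g" and r: "0 \<le> r" for g r
  proof -
    obtain D where "\<And>t. 0 \<le> t \<Longrightarrow> t \<le> r \<Longrightarrow> \<bar>g t\<bar> \<le> D"
      by (rule continuous_bounded_Icc[OF continuous_on_subset[OF g subset_UNIV]]) blast
    then show ?thesis using g \<alpha> r
      by (intro abel_integrand_integrable[where C = D] borel_measurable_continuous_onI) auto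
  qed
  have "?v (clock (1 - \<theta>) a t) - ?u (clock (1 - \<theta>) a t) = 0"
  proof (rule fr.homogeneous_solution_zero[where w = "\<lambda>s. ?v s - ?u s" and L = ?L])
    show "0 < ?L" by (rule clock_pos[OF p a aT])
    show "continuous_on {0..?L} (\<lambda>s. ?v s - ?u s)" by (intro continuous_on_diff uc vc)
    show "clock (1 - \<theta>) a t \<in> {0..?L}" using clock_nonneg[OF p a] clock_le[OF p a, of t T] t by simp
    fix \<eta> s assume s: "s \<in> {0<..?L}"
    let ?g = "\<lambda>w r. inner (w r) (A_inv \<eta>) - inner \<phi> (A_inv \<eta>)"
    have gc: "continuous_on UNIV (?g ?u)" "continuous_on UNIV (?g ?v)"
      by (intro continuous_on_diff continuous_on_inner continuous_on_const uc vc)+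
    have "((\<lambda>r. rl (1 - \<alpha>) (?g ?v) r - rl (1 - \<alpha>) (?g ?u) r) has_real_derivative
       (inner (on_clock (1 - \<theta>) a T f s) (A_inv \<eta>) - inner (?v s) \<eta>) - (inner (on_clock (1 - \<theta>) a T f s) (A_inv \<eta>) - inner (?u s) \<eta>))
      (at s within {0<..?L})"
      by (rule DERIV_diff[OF weak_solution_rl[OF \<alpha> \<theta> a aT v s] weak_solution_rl[OF \<alpha> \<theta> a aT u s]])
    moreover have "(inner (on_clock (1 - \<theta>) a T f s) (A_inv \<eta>) - inner (?v s) \<eta>) - (inner (on_clock (1 - \<theta>) a T f s) (A_inv \<eta>) - inner (?u s) \<eta>)
      = - inner (?v s - ?u s) \<eta>" by (simp add: inner_diff_left)
    ultimately have D: "((\<lambda>r. rl (1 - \<alpha>) (?g ?v) r - rl (1 - \<alpha>) (?g ?u) r) has_real_derivative - inner (?v s - ?u s) \<eta>)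
      (at s within {0<..?L})" by (simp only:)
    show "(rl (1 - \<alpha>) (\<lambda>r. inner (?v r - ?u r) (fr.R \<eta>)) has_real_derivative - inner (?v s - ?u s) \<eta>) (at s within {0<..?L})"
    proof (rule has_derivative_transform_on[OF s D])
      fix r assume "r \<in> {0<..?L}"
      then have r: "0 \<le> r" by simp
      have "rl (1 - \<alpha>) (\<lambda>r. inner (?v r - ?u r) (fr.R \<eta>)) r = rl (1 - \<alpha>) (\<lambda>r. ?g ?v r - ?g ?u r) r"
        by (rule rl_cong) (simp add: RB inner_diff_left)
      also have "\<dots> = rl (1 - \<alpha>) (?g ?v) r - rl (1 - \<alpha>) (?g ?u) r" by (rule rl_diff[OF int[OF gc(2) r] int[OF gc(1) r]])
      finally show "rl (1 - \<alpha>) (\<lambda>r. inner (?v r - ?u r) (fr.R \<eta>)) r = rl (1 - \<alpha>) (?g ?v) r - rl (1 - \<alpha>) (?g ?u) r" .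
    qed
  qed
  then show ?thesis using t by (simp add: on_clock_clock[OF cl])
qed

end

theorem theorem7p4:
  fixes \<alpha> \<theta> \<beta> a T :: real
    and \<phi> :: L2
    and f :: "real \<Rightarrow> L2"
  assumes "0 < \<alpha>" and "\<alpha> < 1" and "\<theta> < 1" and "0 \<le> a" and "a < T"
    and "1 < \<beta>" and "\<beta> < 2"
    and "C1_on {a..T} f"
  shows "\<exists>u. weak_solution \<alpha> \<theta> \<beta> a T \<phi> f u \<and>
             (\<forall>v. weak_solution \<alpha> \<theta> \<beta> a T \<phi> f v \<longrightarrow> (\<forall>t\<in>{a..T}. v t = u t))"
proof -
  interpret de: degenerate_elliptic \<beta> by unfold_locales (use assms in auto)
  obtain u where u: "weak_solution \<alpha> \<theta> \<beta> a T \<phi> f u"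
    using de.weak_solution_exists[OF assms(1-5,8)] by blast
  have "v t = u t" if "weak_solution \<alpha> \<theta> \<beta> a T \<phi> f v" "t \<in> {a..T}" for v t
    by (rule de.weak_solution_unique[OF assms(1-5) u that])
  with u show ?thesis by blast
qed

end
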